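(* Let $p\in(1,\infty)$ and $g\in L^1_{\rm loc}(\Omega)$. Then $\|g\|_{\mathcal H_p(\Omega,V)}<\infty$ if and only if the Hardy-type inequality $$\int_\Omega |g||\phi|^p\,dx\le C\,Q_{p,A,V}(\phi)\qquad\forall \phi\in W^{1,p}(\Omega)\cap C_c(\Omega)$$ holds for some $C>0$. Moreover, let $\mathcal B_g(\Omega,V)$ be the best constant in this inequality; then $$\|g\|_{\mathcal H_p(\Omega,V)}\le \mathcal B_g(\Omega,V)\le C_H\|g\|_{\mathcal H_p(\Omega,V)},$$ where $C_H$ is independent of $g$. Furthermore, $\|g\|_{\mathcal B(\Omega,V)}:=\mathcal B_g(\Omega,V)$ is an equivalent norm on $\mathcal H_p(\Omega,V)$. In particular, up to the equivalence relation of norms, the norm $\|\cdot\|_{\mathcal H_p(\Omega,V)}$ is independent of the positive solution ${\bf u}$ used to define it.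
   Context: Setting: $\Omega\subset\mathbb R^N$ is a domain, $p\in(1,\infty)$, and $A=(a_{ij})\in L^\infty_{\rm loc}(\Omega;\mathbb R^{N\times N})$ is a symmetric, locally uniformly positive definite matrix; $|\xi|_A^2:=\sum_{i,j=1}^N a_{ij}(x)\xi_i\xi_j$. The potential $V$ is real valued with $V\in\mathcal M^q_{\rm loc}(p;\Omega)$, and $$Q_{p,A,V}(\phi):=\int_\Omega\big[|\nabla\phi|_A^p+V|\phi|^p\big]dx,\qquad \phi\in W^{1,p}(\Omega)\cap C_c(\Omega).$$ Standing assumption: $Q_{p,A,V}\ge 0$ on $W^{1,p}(\Omega)\cap C_c(\Omega)$. Morrey spaces: $\mathcal M^q_{\rm loc}(\Omega)$ ($q\in[1,\infty]$) is the set of measurable real valued $f$ with $\sup\{r^{-N/q'}\int_{\omega\cap B_r(y)}|f|dx: y\in\omega,\ 0<r<\mathrm{diam}(\omega)\}<\infty$ for every open $\omega\Subset\Omega$, where $q'$ is the Hölder conjugate exponent of $q$. Then $\mathcal M^q_{\rm loc}(p;\Omega)$ is: $\mathcal M^q_{\rm loc}(\Omega)$ with $q>N/p$ if $p<N$; $L^1_{\rm loc}(\Omega)$ if $p>N$; and, if $p=N$, the set of $f$ such that for some $q>N$ and every open $\omega\Subset\Omega$, $\sup\{[\log(\mathrm{diam}(\omega)/r)]^{q/N'}\int_{\omega\cap B_r(y)}|f|dx: y\in\omega,\ 0<r<\mathrm{diam}(\omega)\}<\infty$, $N'=N/(N-1)$. Hardy-weights: $\mathcal H_p(\Omega,V)$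 is the set of $g\in L^1_{\rm loc}(\Omega)$ for which the Hardy-type inequality of the claim holds for some $C>0$. Capacity: for a positive function ${\bf u}\in W^{1,p}_{\rm loc}(\Omega)\cap C(\Omega)$ and a compact set $F\Subset\Omega$, $$\mathrm{Cap}_{\bf u}(F,\Omega):=\inf\{Q_{p,A,V}(\phi): \phi\in W^{1,p}(\Omega)\cap C_c(\Omega),\ \phi\ge{\bf u}\text{ on }F\}.$$ Norm: let ${\bf u}\in W^{1,p}_{\rm loc}(\Omega)\cap C(\Omega)$ be a positive (weak) solution of $-\mathrm{div}(|\nabla u|_A^{p-2}A\nabla u)+V|u|^{p-2}u=0$ in $\Omega$. Then $$\|g\|_{\mathcal H_p(\Omega,V)}:=\sup\left\{\frac{\int_F|g||{\bf u}|^p\,dx}{\mathrm{Cap}_{\bf u}(F,\Omega)}\ :\ F\Subset\Omega\text{ is a compact set such that }\mathrm{Cap}_{\bf u}(F,\Omega)\neq0\right\}.$$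
   Formalization: If every compact set has Cap_u(F,Ω)=0 (e.g. Ω=R^N, V=0, A=I, p≥N, u=1), the supremum defining the norm of g is empty and the claim fails; in that case only, the norm is taken to be 0 if g=0 a.e. and ∞ otherwise. *)

theory Defs
  imports "HOL-Analysis.Analysis"
begin

text \<open>
  Functions on an open set \<open>\<Omega>\<close> of \<open>real^'n\<close> are total functions whose values outside \<open>\<Omega>\<close> are
  irrelevant. Elements of Lebesgue and Sobolev spaces are represented by concrete functions;
  equality almost everywhere is stated explicitly where it matters.
\<close>

section \<open>Lebesgue and Morrey spaces\<close>

definition Lp_space :: "real \<Rightarrow> (real^'n) set \<Rightarrow> (real^'n \<Rightarrow> real) set" where
  "Lp_space p S = {f \<in> borel_measurable (lebesgue_on S).
     set_integrable lebesgue S (\<lambda>x. \<bar>f x\<bar> powr p)}"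

definition Lp_loc :: "real \<Rightarrow> (real^'n) set \<Rightarrow> (real^'n \<Rightarrow> real) set" where
  "Lp_loc p \<Omega> = {f. \<forall>K. compact K \<and> K \<subseteq> \<Omega> \<longrightarrow> f \<in> Lp_space p K}"

definition L1_loc :: "(real^'n) set \<Rightarrow> (real^'n \<Rightarrow> real) set" where
  "L1_loc \<Omega> = {f. \<forall>K. compact K \<and> K \<subseteq> \<Omega> \<longrightarrow> set_integrable lebesgue K f}"

definition compactly_inside :: "(real^'n) set \<Rightarrow> (real^'n) set \<Rightarrow> bool" where
  "compactly_inside \<omega> \<Omega> \<longleftrightarrow> compact (closure \<omega>) \<and> closure \<omega> \<subseteq> \<Omega>"

text \<open>
  The exponent \<open>- N / q'\<close> is written as \<open>- N * (1 - 1/q)\<close>, where \<open>1/q = 0\<close> for \<open>q = \<infinity>\<close>.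
\<close>

definition morrey_loc :: "ereal \<Rightarrow> (real^'n) set \<Rightarrow> (real^'n \<Rightarrow> real) set" where
  "morrey_loc q \<Omega> = {f \<in> borel_measurable (lebesgue_on \<Omega>).
     \<forall>\<omega>. open \<omega> \<and> compactly_inside \<omega> \<Omega> \<longrightarrow>
       (SUP (y, r) \<in> {(y, r). y \<in> \<omega> \<and> 0 < r \<and> r < diameter \<omega>}.
          ennreal (r powr (- real CARD('n) * (1 - real_of_ereal (1 / q)))) *
          (\<integral>\<^sup>+x\<in>\<omega> \<inter> ball y r. ennreal \<bar>f x\<bar> \<partial>lebesgue)) < \<infinity>}"

text \<open>
  The borderline case \<open>p = N\<close>. Only \<open>N \<ge> 2\<close> is relevant, since \<open>p > 1\<close>.
\<close>

definition morrey_log_loc :: "real \<Rightarrow> (real^'n) set \<Rightarrow> (real^'n \<Rightarrow> real) set" where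
  "morrey_log_loc q \<Omega> = {f \<in> borel_measurable (lebesgue_on \<Omega>).
     \<forall>\<omega>. open \<omega> \<and> compactly_inside \<omega> \<Omega> \<longrightarrow>
       (SUP (y, r) \<in> {(y, r). y \<in> \<omega> \<and> 0 < r \<and> r < diameter \<omega>}.
          ennreal (ln (diameter \<omega> / r) powr
            (q / (real CARD('n) / (real CARD('n) - 1)))) *
          (\<integral>\<^sup>+x\<in>\<omega> \<inter> ball y r. ennreal \<bar>f x\<bar> \<partial>lebesgue)) < \<infinity>}"

definition morrey_p_loc :: "ereal \<Rightarrow> real \<Rightarrow> (real^'n) set \<Rightarrow> (real^'n \<Rightarrow> real) set" where
  "morrey_p_loc q p \<Omega> =
     (if p < real CARD('n) then {f \<in> morrey_loc q \<Omega>. q > ereal (real CARD('n) / p)}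
      else if p = real CARD('n) then (\<Union>s\<in>{real CARD('n)<..}. morrey_log_loc s \<Omega>)
      else L1_loc \<Omega>)"

section \<open>Test functions, weak gradients and Sobolev spaces\<close>

definition compact_support_in :: "(real^'n) set \<Rightarrow> (real^'n \<Rightarrow> real) \<Rightarrow> bool" where
  "compact_support_in \<Omega> f \<longleftrightarrow> (\<exists>K. compact K \<and> K \<subseteq> \<Omega> \<and> (\<forall>x\<in>\<Omega> - K. f x = 0))"

definition Cc :: "(real^'n) set \<Rightarrow> (real^'n \<Rightarrow> real) set" where
  "Cc \<Omega> = {f. continuous_on \<Omega> f \<and> compact_support_in \<Omega> f}"

definition classical_grad :: "(real^'n \<Rightarrow> real) \<Rightarrow> real^'n \<Rightarrow> real^'n" where
  "classical_grad f x = (\<chi> i. frechet_derivative f (at x) (axis i 1))"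

primrec Ck_on :: "nat \<Rightarrow> (real^'n) set \<Rightarrow> (real^'n \<Rightarrow> real) \<Rightarrow> bool" where
  "Ck_on 0 \<Omega> f \<longleftrightarrow> continuous_on \<Omega> f"
| "Ck_on (Suc k) \<Omega> f \<longleftrightarrow>
     (\<forall>x\<in>\<Omega>. f differentiable (at x)) \<and> (\<forall>i. Ck_on k \<Omega> (\<lambda>x. classical_grad f x $ i))"

definition test_functions :: "(real^'n) set \<Rightarrow> (real^'n \<Rightarrow> real) set" where
  "test_functions \<Omega> = {f. (\<forall>k. Ck_on k \<Omega> f) \<and> compact_support_in \<Omega> f}"

definition is_weak_grad ::
    "(real^'n) set \<Rightarrow> (real^'n \<Rightarrow> real) \<Rightarrow> (real^'n \<Rightarrow> real^'n) \<Rightarrow> bool" where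
  "is_weak_grad \<Omega> u G \<longleftrightarrow> u \<in> L1_loc \<Omega> \<and> (\<forall>i. (\<lambda>x. G x $ i) \<in> L1_loc \<Omega>) \<and>
     (\<forall>\<phi>\<in>test_functions \<Omega>. \<forall>i.
        (LINT x:\<Omega>|lebesgue. u x * classical_grad \<phi> x $ i) =
        - (LINT x:\<Omega>|lebesgue. G x $ i * \<phi> x))"

text \<open>The weak gradient is unique up to null sets; an arbitrary representative is chosen.\<close>

definition weak_grad :: "(real^'n) set \<Rightarrow> (real^'n \<Rightarrow> real) \<Rightarrow> real^'n \<Rightarrow> real^'n" where
  "weak_grad \<Omega> u = (SOME G. is_weak_grad \<Omega> u G)"

definition W1p :: "real \<Rightarrow> (real^'n) set \<Rightarrow> (real^'n \<Rightarrow> real) set" where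
  "W1p p \<Omega> = {u \<in> Lp_space p \<Omega>.
     \<exists>G. is_weak_grad \<Omega> u G \<and> (\<forall>i. (\<lambda>x. G x $ i) \<in> Lp_space p \<Omega>)}"

definition W1p_loc :: "real \<Rightarrow> (real^'n) set \<Rightarrow> (real^'n \<Rightarrow> real) set" where
  "W1p_loc p \<Omega> = {u \<in> Lp_loc p \<Omega>.
     \<exists>G. is_weak_grad \<Omega> u G \<and> (\<forall>i. (\<lambda>x. G x $ i) \<in> Lp_loc p \<Omega>)}"

section \<open>The energy functional\<close>

definition Linf_loc_matrix :: "(real^'n) set \<Rightarrow> (real^'n \<Rightarrow> real^'n^'n) \<Rightarrow> bool" where
  "Linf_loc_matrix \<Omega> A \<longleftrightarrow> A \<in> borel_measurable (lebesgue_on \<Omega>) \<and>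
     (\<forall>K. compact K \<and> K \<subseteq> \<Omega> \<longrightarrow> (\<exists>M. AE x\<in>K in lebesgue. \<forall>i j. \<bar>A x $ i $ j\<bar> \<le> M))"

definition symmetric_matrix_on :: "(real^'n) set \<Rightarrow> (real^'n \<Rightarrow> real^'n^'n) \<Rightarrow> bool" where
  "symmetric_matrix_on \<Omega> A \<longleftrightarrow> (AE x\<in>\<Omega> in lebesgue. transpose (A x) = A x)"

definition quad_form :: "real^'n^'n \<Rightarrow> real^'n \<Rightarrow> real" where
  "quad_form M \<xi> = (\<Sum>i\<in>UNIV. \<Sum>j\<in>UNIV. M $ i $ j * \<xi> $ i * \<xi> $ j)"

definition loc_unif_pos_def :: "(real^'n) set \<Rightarrow> (real^'n \<Rightarrow> real^'n^'n) \<Rightarrow> bool" where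
  "loc_unif_pos_def \<Omega> A \<longleftrightarrow> (\<forall>K. compact K \<and> K \<subseteq> \<Omega> \<longrightarrow>
     (\<exists>\<theta>>0. AE x\<in>K in lebesgue. \<forall>\<xi>. \<theta> * (norm \<xi>)\<^sup>2 \<le> quad_form (A x) \<xi>))"

definition norm_mat :: "real^'n^'n \<Rightarrow> real^'n \<Rightarrow> real" where
  "norm_mat M \<xi> = sqrt (quad_form M \<xi>)"

definition Q_energy ::
    "real \<Rightarrow> (real^'n \<Rightarrow> real^'n^'n) \<Rightarrow> (real^'n \<Rightarrow> real) \<Rightarrow> (real^'n) set \<Rightarrow>
     (real^'n \<Rightarrow> real) \<Rightarrow> real" where
  "Q_energy p A V \<Omega> \<phi> = (LINT x:\<Omega>|lebesgue.
     norm_mat (A x) (weak_grad \<Omega> \<phi> x) powr p + V x * \<bar>\<phi> x\<bar> powr p)"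

text \<open>
  For \<open>p < 2\<close> the flux is read as \<open>0\<close> where the gradient vanishes, in agreement with
  \<open>0 powr (p - 2) = 0\<close>.
\<close>

definition positive_solution ::
    "real \<Rightarrow> (real^'n \<Rightarrow> real^'n^'n) \<Rightarrow> (real^'n \<Rightarrow> real) \<Rightarrow> (real^'n) set \<Rightarrow>
     (real^'n \<Rightarrow> real) \<Rightarrow> bool" where
  "positive_solution p A V \<Omega> u \<longleftrightarrow>
     u \<in> W1p_loc p \<Omega> \<and> continuous_on \<Omega> u \<and> (\<forall>x\<in>\<Omega>. u x > 0) \<and>
     (\<forall>\<phi>\<in>test_functions \<Omega>. (LINT x:\<Omega>|lebesgue.
        norm_mat (A x) (weak_grad \<Omega> u x) powr (p - 2) *
          ((A x *v weak_grad \<Omega> u x) \<bullet> classical_grad \<phi> x) +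
        V x * \<bar>u x\<bar> powr (p - 2) * u x * \<phi> x) = 0)"

section \<open>Hardy-weights, capacity and norms\<close>

definition hardy_inequality ::
    "real \<Rightarrow> (real^'n \<Rightarrow> real^'n^'n) \<Rightarrow> (real^'n \<Rightarrow> real) \<Rightarrow> (real^'n) set \<Rightarrow>
     (real^'n \<Rightarrow> real) \<Rightarrow> real \<Rightarrow> bool" where
  "hardy_inequality p A V \<Omega> g C \<longleftrightarrow> (\<forall>\<phi>\<in>W1p p \<Omega> \<inter> Cc \<Omega>.
     (LINT x:\<Omega>|lebesgue. \<bar>g x\<bar> * \<bar>\<phi> x\<bar> powr p) \<le> C * Q_energy p A V \<Omega> \<phi>)"

definition hardy_weights ::
    "real \<Rightarrow> (real^'n \<Rightarrow> real^'n^'n) \<Rightarrow> (real^'n \<Rightarrow> real) \<Rightarrow> (real^'n) set \<Rightarrow>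
     (real^'n \<Rightarrow> real) set" where
  "hardy_weights p A V \<Omega> = {g \<in> L1_loc \<Omega>. \<exists>C>0. hardy_inequality p A V \<Omega> g C}"

definition best_constant ::
    "real \<Rightarrow> (real^'n \<Rightarrow> real^'n^'n) \<Rightarrow> (real^'n \<Rightarrow> real) \<Rightarrow> (real^'n) set \<Rightarrow>
     (real^'n \<Rightarrow> real) \<Rightarrow> ereal" where
  "best_constant p A V \<Omega> g = (INF C\<in>{C. C > 0 \<and> hardy_inequality p A V \<Omega> g C}. ereal C)"

definition capacity ::
    "real \<Rightarrow> (real^'n \<Rightarrow> real^'n^'n) \<Rightarrow> (real^'n \<Rightarrow> real) \<Rightarrow> (real^'n) set \<Rightarrow>
     (real^'n \<Rightarrow> real) \<Rightarrow> (real^'n) set \<Rightarrow> ereal" where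
  "capacity p A V \<Omega> u F =
     (INF \<phi>\<in>{\<phi> \<in> W1p p \<Omega> \<inter> Cc \<Omega>. \<forall>x\<in>F. u x \<le> \<phi> x}. ereal (Q_energy p A V \<Omega> \<phi>))"

definition positive_cap_compacts ::
    "real \<Rightarrow> (real^'n \<Rightarrow> real^'n^'n) \<Rightarrow> (real^'n \<Rightarrow> real) \<Rightarrow> (real^'n) set \<Rightarrow>
     (real^'n \<Rightarrow> real) \<Rightarrow> (real^'n) set set" where
  "positive_cap_compacts p A V \<Omega> u =
     {F. compact F \<and> F \<subseteq> \<Omega> \<and> capacity p A V \<Omega> u F \<noteq> 0}"

text \<open>
  If \<open>Q\<close> is critical (for instance the \<open>p\<close>-Laplacian on the whole space with \<open>p \<ge> N\<close>), every
  compact set has capacity \<open>0\<close> and the supremum defining the norm ranges over the empty family.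
  The value \<open>0\<close> would then make every weight have finite norm, although the zero weight is the
  only Hardy-weight. In this degenerate case the norm is \<open>0\<close> for the zero weight and \<open>\<infinity>\<close>
  otherwise; this is also what the quotients give with \<open>0/0 = 0\<close> and \<open>c/0 = \<infinity>\<close> for \<open>c > 0\<close>.
\<close>

definition hardy_norm ::
    "real \<Rightarrow> (real^'n \<Rightarrow> real^'n^'n) \<Rightarrow> (real^'n \<Rightarrow> real) \<Rightarrow> (real^'n) set \<Rightarrow>
     (real^'n \<Rightarrow> real) \<Rightarrow> (real^'n \<Rightarrow> real) \<Rightarrow> ereal" where
  "hardy_norm p A V \<Omega> u g =
     (if positive_cap_compacts p A V \<Omega> u = {}
      then (if AE x\<in>\<Omega> in lebesgue. g x = 0 then 0 else \<infinity>)
      else (SUP F\<in>positive_cap_compacts p A V \<Omega> u.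
              ereal (LINT x:F|lebesgue. \<bar>g x\<bar> * \<bar>u x\<bar> powr p) / capacity p A V \<Omega> u F))"

text \<open>
  \<open>X\<close>, modulo equality almost everywhere on \<open>\<Omega>\<close>, is a real vector space normed by \<open>n\<close>.
\<close>

definition ae_norm_on ::
    "(real^'n) set \<Rightarrow> (real^'n \<Rightarrow> real) set \<Rightarrow> ((real^'n \<Rightarrow> real) \<Rightarrow> ereal) \<Rightarrow> bool" where
  "ae_norm_on \<Omega> X n \<longleftrightarrow>
     (\<lambda>x. 0) \<in> X \<and>
     (\<forall>f\<in>X. \<forall>g\<in>X. (\<lambda>x. f x + g x) \<in> X \<and> n (\<lambda>x. f x + g x) \<le> n f + n g) \<and>
     (\<forall>c. \<forall>g\<in>X. (\<lambda>x. c * g x) \<in> X \<and> n (\<lambda>x. c * g x) = ereal \<bar>c\<bar> * n g) \<and>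
     (\<forall>f\<in>X. \<forall>g. (AE x\<in>\<Omega> in lebesgue. f x = g x) \<longrightarrow> g \<in> X \<and> n g = n f) \<and>
     (\<forall>g\<in>X. 0 \<le> n g \<and> n g < \<infinity> \<and> (n g = 0 \<longleftrightarrow> (AE x\<in>\<Omega> in lebesgue. g x = 0)))"

definition equivalent_norms_on ::
    "(real^'n \<Rightarrow> real) set \<Rightarrow> ((real^'n \<Rightarrow> real) \<Rightarrow> ereal) \<Rightarrow>
     ((real^'n \<Rightarrow> real) \<Rightarrow> ereal) \<Rightarrow> bool" where
  "equivalent_norms_on X n m \<longleftrightarrow>
     (\<exists>c>0. \<exists>d>0. \<forall>g\<in>X. ereal c * n g \<le> m g \<and> m g \<le> ereal d * n g)"

end

theory Submission
  imports Defs "HOL-Real_Asymp.Real_Asymp"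
begin

text \<open>
  Write \<open>\<phi> = u w\<close>. Testing the equation of \<open>u\<close> with \<open>\<bar>w\<bar>\<^sup>p u\<close> gives the ground state representation
  \<open>Q(u w) = \<integral> R(w \<nabla>u, u \<nabla>w)\<close>, where \<open>R(x, y) = \<bar>x + y\<bar>\<^sup>p - \<bar>x\<bar>\<^sup>p - p \<bar>x\<bar>\<^sup>p\<^sup>-\<^sup>2 x \<sqdot> y\<close> (norms induced by
  \<open>A\<close>) is nonnegative and, up to constants, monotone under rescaling of its arguments. With a smooth truncation
  \<open>T\<close>, equal to 1 outside \<open>(-1, 1)\<close> and quadratic near 0, the energies of \<open>2\<^sup>k u T(2\<^sup>-\<^sup>k w)\<close> therefore sum up to at
  most a constant times \<open>Q(u w)\<close>, pointwise by a geometric series; \<open>u T(2\<^sup>-\<^sup>k w)\<close> competes for the capacity of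
  compact subsets of \<open>{\<bar>w\<bar> \<ge> 2\<^sup>k}\<close>, and Maz'ya's dyadic summation turns the capacity bounds into the Hardy inequality.

  Compact sets of zero capacity are excluded from the supremum, so they must carry no mass of \<open>g\<close>. If such a set is
  not Lebesgue null, there are \<open>w\<^sub>n\<close>, at least 1 on it, with \<open>Q(u w\<^sub>n) \<longlonglongrightarrow> 0\<close>; truncated at height 1, \<open>w\<^sub>n\<close> tends to
  the constant 1 locally in \<open>L\<^sup>1\<close>, because \<open>\<Omega>\<close> is connected. With a cut-off function \<open>\<zeta>\<close>, the functions
  \<open>w\<^sub>n + \<zeta> (1 - w\<^sub>n)\<close> then show that every compact set has zero capacity. Then no
  compact set enters the supremum, and finiteness of the norm means \<open>g = 0\<close> by convention.
\<close>

section \<open>The remainder of the power of a norm\<close>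

text \<open>Maz'ya's classical argument cuts between two levels and uses that the energy is an
  integral of a power of the gradient, so that disjoint strips add up. Here the density depends on
  \<open>w\<close> as well as on its gradient and, for \<open>p \<noteq> 2\<close>, changes its
  growth from \<open>|x|^(p-2) |y|^2\<close> to \<open>|y|^p\<close> where \<open>|y|\<close>
  becomes comparable to \<open>|x|\<close>. Replacing \<open>w\<close> by \<open>T(w)\<close>
  multiplies the first slot by \<open>T(w) / w\<close> and the second by \<open>T'(w)\<close>.
  Homogeneity removes the factor \<open>T(w) / w\<close> and leaves the second slot dilated by
  \<open>w T'(w) / T(w)\<close>. This ratio has to stay nonnegative and bounded, which a sharp cut
  such as \<open>max 0 (w - l)\<close> violates near its threshold. So the truncation vanishes at 0
  only: being quadratic there, it keeps the ratio below 2, while \<open>T(w) / w\<close> still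
  decays fast enough for a geometric series. The constants of the pointwise inequalities depend on
  \<open>p\<close> alone, because two vectors with the form of \<open>A\<close> embed isometrically
  in the complex plane; this makes the final constant independent of \<open>g\<close>.\<close>

definition bregman :: "real \<Rightarrow> 'a::real_inner \<Rightarrow> 'a \<Rightarrow> real" where
  "bregman p x y = norm (x + y) powr p - norm x powr p - p * norm x powr (p - 2) * (x \<bullet> y)"

lemma powr_between:
  fixes q s :: real
  assumes "1/4 \<le> q" "q \<le> 4"
  shows "4 powr (-\<bar>s\<bar>) \<le> q powr s" "q powr s \<le> 4 powr \<bar>s\<bar>"
proof -
  have q: "q > 0" using assms by simp
  have "ln (1/4) \<le> ln q" using assms q by (subst ln_le_cancel_iff) auto
  then have l1: "- ln 4 \<le> ln q" by (simp add: ln_div)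
  have l2: "ln q \<le> ln 4" using assms q by simp
  have *: "\<bar>ln q\<bar> \<le> ln 4" using l1 l2 by linarith
  then have "\<bar>s * ln q\<bar> \<le> \<bar>s\<bar> * ln 4" by (simp add: abs_mult mult_left_mono)
  then have "- (\<bar>s\<bar> * ln 4) \<le> s * ln q" "s * ln q \<le> \<bar>s\<bar> * ln 4" by linarith+
  then show "4 powr (-\<bar>s\<bar>) \<le> q powr s" "q powr s \<le> 4 powr \<bar>s\<bar>"
    using q by (auto simp: powr_def)
qed

text \<open>This is \<open>|x + y|^p\<close> expanded around \<open>x\<close>, with
  \<open>r = p/2\<close>, \<open>\<alpha> = x \<bullet> y / |x|^2\<close> and
  \<open>\<beta> = |y|^2 / |x|^2\<close>. Then \<open>\<alpha>\<^sup>2 \<le> \<beta>\<close> is the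
  Cauchy-Schwarz inequality, \<open>\<beta> \<le> 1/4\<close> means \<open>2 |y| \<le> |x|\<close>,
  and \<open>1/2 < r\<close> is \<open>p > 1\<close>.\<close>

lemma bregman_near_scalar:
  fixes r :: real
  assumes r: "1/2 < r"
  shows "\<exists>c1>0. \<exists>c2>0. \<forall>\<alpha> \<beta>. \<alpha>\<^sup>2 \<le> \<beta> \<and> \<beta> \<le> 1/4 \<longrightarrow>
     c1 * \<beta> \<le> (1 + 2*\<alpha> + \<beta>) powr r - 1 - 2*r*\<alpha> \<and> (1 + 2*\<alpha> + \<beta>) powr r - 1 - 2*r*\<alpha> \<le> c2 * \<beta>"
proof -
  \<comment> \<open>\<open>1\<close> and \<open>2*r-1 = p - 1\<close> are the transversal and radial
    eigenvalues of the Hessian of \<open>|.|^p\<close>, up to the factor \<open>p |.|^(p-2)\<close>;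
    which of them is smaller depends on \<open>p\<close>.\<close>
  define m where "m = min 1 (2*r-1)"
  define M where "M = max 1 (2*r-1)"
  define d where "d = 4 powr \<bar>r-1\<bar>"
  have m: "m > 0" "M > 0" and d: "d > 0" using r by (auto simp: m_def M_def d_def)
  have di: "4 powr (-\<bar>r-1\<bar>) = 1/d" by (simp add: d_def powr_minus divide_inverse)
  have main: "r * m / d * \<beta> \<le> (1 + 2*\<alpha> + \<beta>) powr r - 1 - 2*r*\<alpha> \<and>
     (1 + 2*\<alpha> + \<beta>) powr r - 1 - 2*r*\<alpha> \<le> r * M * d * \<beta>"
    if ab: "\<alpha>\<^sup>2 \<le> \<beta>" "\<beta> \<le> 1/4" for \<alpha> \<beta> :: real
  proof -
    have b0: "0 \<le> \<beta>" using ab by (meson order_trans zero_le_power2)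
    define b where "b = sqrt \<beta>"
    have b: "0 \<le> b" "b \<le> 1/2" "b\<^sup>2 = \<beta>" 
      using b0 ab real_sqrt_le_mono[of \<beta> "1/4"] by (auto simp: b_def real_sqrt_divide)
    have ab': "\<bar>\<alpha>\<bar> \<le> b" unfolding b_def using ab by (simp add: real_le_rsqrt)
    \<comment> \<open>\<open>q t\<close> is \<open>|x + t y|^2 / |x|^2\<close>. It lies between
      \<open>(1 - b t)^2\<close> and \<open>(1 + b t)^2\<close>, so its powers are bounded on both
      sides.\<close>
    define q where "q t = 1 + 2*\<alpha>*t + \<beta>*t\<^sup>2" for t
    have qb: "1/4 \<le> q t \<and> q t \<le> 4" if "0 \<le> t" "t \<le> 1" for t
    proof -
      have bt: "0 \<le> b*t" "b*t \<le> 1/2" using b that mult_mono[of b "1/2" t 1] by auto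
      have at: "\<bar>\<alpha>*t\<bar> \<le> b*t" using ab' that by (simp add: abs_mult mult_right_mono)
      have "(1/2)\<^sup>2 \<le> (1-b*t)\<^sup>2" using bt by (intro power_mono) auto
      moreover have "(1+b*t)\<^sup>2 \<le> (3/2)\<^sup>2" using bt by (intro power_mono) auto
      moreover have "(1-b*t)\<^sup>2 = 1 - 2*(b*t) + \<beta>*t\<^sup>2" "(1+b*t)\<^sup>2 = 1 + 2*(b*t) + \<beta>*t\<^sup>2"
        using b by (auto simp: power2_eq_square algebra_simps)
      moreover have "(1/2::real)\<^sup>2 = 1/4" "(3/2::real)\<^sup>2 = 9/4" by (auto simp: power2_eq_square)
      moreover have "- (b*t) \<le> \<alpha>*t" "\<alpha>*t \<le> b*t" using at by linarith+
      moreover have "q t = 1 + 2*(\<alpha>*t) + \<beta>*t\<^sup>2" by (simp add: q_def)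
      ultimately show ?thesis by linarith
    qed
    define f1 where "f1 t = r * q t powr (r-1) * (2*\<alpha> + 2*\<beta>*t)" for t
    define f2 where "f2 t = 2 * r * q t powr (r-2) * (\<beta> * q t + 2*(r-1)*(\<alpha>+\<beta>*t)\<^sup>2)" for t
    define diff where "diff n = (if n = 0 then (\<lambda>t. q t powr r) else if n = 1 then f1 else f2)" for n :: nat
    have d1: "DERIV (\<lambda>t. q t powr r) t :> f1 t" if t: "0 \<le> t" "t \<le> 1" for t
    proof -
      have "q t > 0" using qb[OF t] by auto
      then show ?thesis unfolding q_def f1_def
        by (auto intro!: derivative_eq_intros simp: power2_eq_square powr_diff field_simps)
    qed
    have d2: "DERIV f1 t :> f2 t" if t: "0 \<le> t" "t \<le> 1" for t
    proof -
      have qp: "q t > 0" using qb[OF t] by auto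
      have e: "q t powr (r-1) = q t powr (r-2) * q t" using qp by (simp add: powr_diff power2_eq_square)
      have e2: "q t powr (r-1-1) = q t powr (r-2)" by simp
      have dq: "DERIV q t :> 2*\<alpha>+2*\<beta>*t" unfolding q_def
        by (auto intro!: derivative_eq_intros)
      have dqp: "DERIV (\<lambda>t. q t powr (r-1)) t :> (r-1) * q t powr (r-1-1) * (2*\<alpha>+2*\<beta>*t)"
        using DERIV_fun_powr[OF dq qp, of "r-1"] by simp
      have "DERIV f1 t :> r * ((r-1) * q t powr (r-1-1) * (2*\<alpha>+2*\<beta>*t)) * (2*\<alpha> + 2*\<beta>*t) + r * q t powr (r-1) * (2*\<beta>)"
        unfolding f1_def by (rule derivative_eq_intros dqp refl | simp)+
      also have "r * ((r-1) * q t powr (r-1-1) * (2*\<alpha>+2*\<beta>*t)) * (2*\<alpha> + 2*\<beta>*t) + r * q t powr (r-1) * (2*\<beta>) = f2 t"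
        unfolding f2_def e e2 by (simp add: power2_eq_square algebra_simps)
      finally show ?thesis .
    qed
    have "\<exists>t>0. t < 1 \<and> q 1 powr r = (\<Sum>k<2. diff k 0 / fact k * 1 ^ k) + diff 2 t / fact 2 * 1 ^ 2"
    proof (rule Maclaurin)
      show "\<forall>n t. n < 2 \<and> 0 \<le> t \<and> t \<le> 1 \<longrightarrow> DERIV (diff n) t :> diff (Suc n) t"
        using d1 d2 by (auto simp: diff_def less_2_cases_iff)
    qed (auto simp: diff_def)
    then obtain t where t: "0 < t" "t < 1" and e: "q 1 powr r = 1 + 2*r*\<alpha> + f2 t / 2"
      by (auto simp: diff_def numeral_2_eq_2 q_def f1_def)
    have qt: "1/4 \<le> q t" "q t \<le> 4" and qp: "0 < q t" using qb[of t] t by auto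
    \<comment> \<open>Cauchy-Schwarz for \<open>x + t y\<close> and \<open>y\<close>.\<close>
    have k: "(\<alpha>+\<beta>*t)\<^sup>2 \<le> \<beta> * q t"
    proof -
      have "\<beta> * q t - (\<alpha>+\<beta>*t)\<^sup>2 = \<beta> - \<alpha>\<^sup>2" by (simp add: q_def power2_eq_square algebra_simps)
      then show ?thesis using ab by simp
    qed
    have br: "m * (\<beta> * q t) \<le> \<beta> * q t + 2*(r-1)*(\<alpha>+\<beta>*t)\<^sup>2 \<and> \<beta> * q t + 2*(r-1)*(\<alpha>+\<beta>*t)\<^sup>2 \<le> M * (\<beta> * q t)"
    proof (cases "r \<ge> 1")
      case True
      then have "m = 1" "M = 2*r-1" by (auto simp: m_def M_def)
      moreover have "2*(r-1)*(\<alpha>+\<beta>*t)\<^sup>2 \<le> 2*(r-1)*(\<beta>*q t)" using k True by (intro mult_left_mono) auto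
      moreover have "0 \<le> 2*(r-1)*(\<alpha>+\<beta>*t)\<^sup>2" using True by simp
      moreover have "(2*r-1) * (\<beta> * q t) = \<beta> * q t + 2*(r-1)*(\<beta>*q t)" by (simp add: algebra_simps)
      ultimately show ?thesis by simp
    next
      case False
      then have "m = 2*r-1" "M = 1" by (auto simp: m_def M_def)
      moreover have "2*(r-1)*(\<alpha>+\<beta>*t)\<^sup>2 \<ge> 2*(r-1)*(\<beta>*q t)" using k False by (intro mult_left_mono_neg) auto
      moreover have "0 \<ge> 2*(r-1)*(\<alpha>+\<beta>*t)\<^sup>2" using False by (simp add: mult_nonpos_nonneg)
      moreover have "(2*r-1) * (\<beta> * q t) = \<beta> * q t + 2*(r-1)*(\<beta>*q t)" by (simp add: algebra_simps)
      ultimately show ?thesis by simp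
    qed
    have f2e: "f2 t / 2 = r * q t powr (r-2) * (\<beta> * q t + 2*(r-1)*(\<alpha>+\<beta>*t)\<^sup>2)" by (simp add: f2_def)
    have e3: "q t powr (r-2) * q t = q t powr (r-1)" using qp by (simp add: powr_diff power2_eq_square)
    have pb: "1/d \<le> q t powr (r-1)" "q t powr (r-1) \<le> d"
      using powr_between[OF qt, of "r-1"] by (auto simp: di[symmetric]) (simp add: d_def)
    have "r * m / d * \<beta> = (r * m * \<beta>) * (1/d)" by simp
    also have "\<dots> \<le> (r*m*\<beta>) * q t powr (r-1)" using pb b0 m r by (intro mult_left_mono) auto
    also have "\<dots> = r * q t powr (r-2) * (m * (\<beta> * q t))" using e3[symmetric] by simp
    also have "\<dots> \<le> f2 t / 2" unfolding f2e using br r by (intro mult_left_mono) auto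
    finally have lo: "r * m / d * \<beta> \<le> f2 t / 2" .
    have "f2 t / 2 \<le> r * q t powr (r-2) * (M * (\<beta> * q t))" unfolding f2e using br r by (intro mult_left_mono) auto
    also have "\<dots> = (r*M*\<beta>) * q t powr (r-1)" using e3[symmetric] by simp
    also have "\<dots> \<le> (r*M*\<beta>) * d" using pb b0 m r by (intro mult_left_mono) auto
    finally have hi: "f2 t / 2 \<le> r * M * d * \<beta>" by (simp add: mult_ac)
    have q1: "q 1 = 1 + 2*\<alpha> + \<beta>" by (simp add: q_def)
    show ?thesis using lo hi e unfolding q1 by simp
  qed
  show ?thesis
    by (rule exI[of _ "r * m / d"], rule conjI, use m d r in simp, rule exI[of _ "r * M * d"])
       (use main m d r in auto)
qed

section \<open>Homogeneity, sign and convexity of the remainder\<close>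

lemma bregman_scaleR: "bregman p (s *\<^sub>R x) (s *\<^sub>R y) = \<bar>s\<bar> powr p * bregman p x y"
proof (cases "s = 0")
  case False
  have "norm (s *\<^sub>R x + s *\<^sub>R y) = \<bar>s\<bar> * norm (x + y)" by (simp flip: scaleR_right_distrib)
  moreover have "\<bar>s\<bar> powr p = \<bar>s\<bar> powr (p-2) * s\<^sup>2"
    using False by (simp add: powr_diff)
  ultimately show ?thesis using False
    by (simp add: bregman_def powr_mult algebra_simps power2_eq_square)
qed (simp add: bregman_def)

lemma bregman_zero [simp]: "bregman p x 0 = 0"
  by (simp add: bregman_def)

lemma bregman_zero_left: "bregman p 0 y = norm y powr p"
  by (simp add: bregman_def)

text \<open>Written with \<open>x + y\<close> in place of \<open>y\<close>, the linear term is at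
  most \<open>p |x|^(p-1) |x + y|\<close>, and Young's inequality bounds this by
  \<open>(p - 1) |x|^p + |x + y|^p\<close>.\<close>

lemma bregman_nonneg:
  assumes p: "1 < p"
  shows "0 \<le> bregman p x y"
proof -
  define s where "s = norm x"
  define t where "t = norm (x + y)"
  have e: "x \<bullet> y = x \<bullet> (x + y) - s\<^sup>2" by (simp add: s_def inner_add_right power2_norm_eq_inner)
  have st: "0 \<le> s" "0 \<le> t" by (auto simp: s_def t_def)
  show ?thesis
  proof (cases "s = 0")
    case True
    then show ?thesis by (simp add: bregman_def s_def)
  next
    case False
    then have s: "s > 0" using st by simp
    have "x \<bullet> (x + y) \<le> s * t" unfolding s_def t_def by (rule norm_cauchy_schwarz)
    then have "p * s powr (p-2) * (x \<bullet> (x+y)) \<le> p * s powr (p-2) * (s * t)"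
      using p by (intro mult_left_mono) auto
    also have "\<dots> = p * (s powr (p-1) * t)" using s by (simp add: powr_diff power2_eq_square)
    also have "\<dots> \<le> (p-1) * s powr p + t powr p"
    proof -
      have "s powr (p-1) * t \<le> (s powr (p-1)) powr (p/(p-1)) / (p/(p-1)) + t powr p / p"
        using p st by (intro Youngs_inequality) (auto simp: field_simps)
      also have "\<dots> = (p-1)/p * s powr p + t powr p / p" using p by (simp add: powr_powr)
      finally have "p * (s powr (p-1) * t) \<le> p * ((p-1)/p * s powr p + t powr p / p)"
        using p by (intro mult_left_mono) auto
      then show ?thesis using p by (simp add: distrib_left)
    qed
    finally have "p * s powr (p-2) * (x \<bullet> (x+y)) \<le> (p-1) * s powr p + t powr p" .
    moreover have "s powr (p-2) * s\<^sup>2 = s powr p" using s by (simp add: powr_diff)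
    ultimately show ?thesis unfolding bregman_def e s_def[symmetric] t_def[symmetric]
      by (simp add: algebra_simps)
  qed
qed

text \<open>When an endpoint vanishes, the claim reduces to \<open>t powr p \<le> t\<close>.\<close>

lemma powr_convex_ineq:
  fixes a b t p :: real
  assumes "1 < p" "0 \<le> a" "0 \<le> b" "0 < t" "t < 1"
  shows "((1-t) * a + t * b) powr p \<le> (1-t) * a powr p + t * b powr p"
proof -
  have small: "s powr p \<le> s" if "0 < s" "s < 1" for s
    using powr_mono'[of 1 p s] that assms by auto
  consider "a = 0" | "b = 0" | "a > 0" "b > 0" using assms by linarith
  then show ?thesis
  proof cases
    case 3
    then show ?thesis using convex_onD[OF powr_convex[of p], of t a b] assms by auto
  qed (use assms small[of t] small[of "1-t"] in \<open>auto simp: powr_mult intro!: mult_right_mono\<close>)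
qed

lemma convex_on_norm_powr_line:
  fixes x y :: "'a::real_inner"
  assumes p: "1 < p"
  shows "convex_on UNIV (\<lambda>t. norm (x + t *\<^sub>R y) powr p)"
proof (rule convex_onI)
  fix t a b :: real assume t: "0 < t" "t < 1"
  have "x + ((1-t) *\<^sub>R a + t *\<^sub>R b) *\<^sub>R y = (1-t) *\<^sub>R (x + a *\<^sub>R y) + t *\<^sub>R (x + b *\<^sub>R y)"
    by (simp add: algebra_simps)
  then have "norm (x + ((1-t) *\<^sub>R a + t *\<^sub>R b) *\<^sub>R y) \<le> (1-t) * norm (x + a *\<^sub>R y) + t * norm (x + b *\<^sub>R y)"
    using t by (metis norm_triangle_ineq norm_scaleR abs_of_nonneg diff_ge_0_iff_ge less_eq_real_def)
  then have "norm (x + ((1-t) *\<^sub>R a + t *\<^sub>R b) *\<^sub>R y) powr p \<le> ((1-t) * norm (x + a *\<^sub>R y) + t * norm (x + b *\<^sub>R y)) powr p"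
    using p by (intro powr_mono2) auto
  also have "\<dots> \<le> (1-t) * norm (x + a *\<^sub>R y) powr p + t * norm (x + b *\<^sub>R y) powr p"
    by (rule powr_convex_ineq) (use p t in auto)
  finally show "norm (x + ((1-t) *\<^sub>R a + t *\<^sub>R b) *\<^sub>R y) powr p \<le> (1-t) * norm (x + a *\<^sub>R y) powr p + t * norm (x + b *\<^sub>R y) powr p" .
qed auto

text \<open>The inner product term is linear in \<open>t\<close>, so only the convexity of
  \<open>t \<mapsto> |x + t y|^p\<close> enters. This carries lower bounds known for short vectors
  out to longer ones on the same ray.\<close>

lemma bregman_ray:
  fixes x y :: "'a::real_inner"
  assumes p: "1 < p" and t: "0 \<le> t" "t \<le> 1"
  shows "bregman p x (t *\<^sub>R y) \<le> t * bregman p x y"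
proof -
  have "norm (x + t *\<^sub>R y) powr p \<le> (1-t) * norm x powr p + t * norm (x + y) powr p"
    using convex_onD[OF convex_on_norm_powr_line[OF p, of x y], of t 0 1] t by auto
  then show ?thesis by (simp add: bregman_def algebra_simps)
qed

text \<open>For \<open>2 |y| \<le> |x|\<close> the segment from \<open>x\<close> to
  \<open>x + y\<close> keeps away from 0, so the second order Taylor term of \<open>|.|^p\<close>
  has the size \<open>|x|^(p-2) |y|^2\<close> along all of it.\<close>

lemma bregman_near:
  assumes p: "1 < p"
  shows "\<exists>c1>0. \<exists>c2>0. \<forall>x y :: 'a::real_inner. 2 * norm y \<le> norm x \<longrightarrow>
     c1 * norm x powr (p-2) * (norm y)\<^sup>2 \<le> bregman p x y \<and> bregman p x y \<le> c2 * norm x powr (p-2) * (norm y)\<^sup>2"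
proof -
  obtain c1 c2 where c: "c1 > 0" "c2 > 0" and
    *: "\<And>\<alpha> \<beta>. \<alpha>\<^sup>2 \<le> \<beta> \<Longrightarrow> \<beta> \<le> 1/4 \<Longrightarrow>
     c1 * \<beta> \<le> (1 + 2*\<alpha> + \<beta>) powr (p/2) - 1 - 2*(p/2)*\<alpha> \<and> (1 + 2*\<alpha> + \<beta>) powr (p/2) - 1 - 2*(p/2)*\<alpha> \<le> c2 * \<beta>"
    using bregman_near_scalar[of "p/2"] p by auto
  have "c1 * norm x powr (p-2) * (norm y)\<^sup>2 \<le> bregman p x y \<and> bregman p x y \<le> c2 * norm x powr (p-2) * (norm y)\<^sup>2"
    if xy: "2 * norm y \<le> norm x" for x y :: 'a
  proof (cases "x = 0")
    case True
    then show ?thesis using xy by simp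
  next
    case False
    define N where "N = norm x"
    have N: "N > 0" using False by (simp add: N_def)
    define \<alpha> where "\<alpha> = (x \<bullet> y) / N\<^sup>2"
    define \<beta> where "\<beta> = (norm y)\<^sup>2 / N\<^sup>2"
    have "(x \<bullet> y)\<^sup>2 \<le> N\<^sup>2 * (norm y)\<^sup>2"
      unfolding N_def using Cauchy_Schwarz_ineq[of x y] by (simp add: power2_norm_eq_inner)
    then have a: "\<alpha>\<^sup>2 \<le> \<beta>" unfolding \<alpha>_def \<beta>_def using N
      by (simp add: power_divide divide_simps power2_eq_square mult_ac)
    have "(2 * norm y)\<^sup>2 \<le> N\<^sup>2" unfolding N_def using xy by (intro power_mono) auto
    then have b: "\<beta> \<le> 1/4" unfolding \<beta>_def using N by (simp add: power_mult_distrib divide_simps)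
    have n2: "(norm (x + y))\<^sup>2 = N\<^sup>2 * (1 + 2*\<alpha> + \<beta>)"
    proof -
      have "(norm (x + y))\<^sup>2 = N\<^sup>2 + 2 * (x \<bullet> y) + (norm y)\<^sup>2"
        by (simp add: N_def power2_norm_eq_inner inner_add_left inner_add_right inner_commute)
      then show ?thesis using N by (simp add: \<alpha>_def \<beta>_def field_simps)
    qed
    then have pos: "0 \<le> 1 + 2*\<alpha> + \<beta>" using N
      by (metis zero_le_power2 zero_le_mult_iff not_less zero_less_power)
    have pw: "norm z powr p = ((norm z)\<^sup>2) powr (p/2)" for z :: 'a
    proof -
      have "(norm z)\<^sup>2 = norm z powr 2" by simp
      then show ?thesis by (simp only: powr_powr) simp
    qed
    have e1: "norm (x + y) powr p = N powr p * (1 + 2*\<alpha> + \<beta>) powr (p/2)"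
      unfolding pw[of "x+y"] n2 using pos N by (simp add: powr_mult pw[of x, folded N_def])
    have Np: "N powr p = N powr (p-2) * N\<^sup>2" using N by (simp add: powr_diff)
    have e2: "p * N powr (p-2) * (x \<bullet> y) = N powr p * (2*(p/2)*\<alpha>)"
      unfolding \<alpha>_def Np using N by (simp add: field_simps)
    have e3: "bregman p x y = N powr p * ((1 + 2*\<alpha> + \<beta>) powr (p/2) - 1 - 2*(p/2)*\<alpha>)"
      unfolding bregman_def e1 N_def[symmetric] e2 by (simp add: right_diff_distrib)
    have e4: "N powr (p-2) * (norm y)\<^sup>2 = N powr p * \<beta>" unfolding Np \<beta>_def using N by simp
    have "c1 * N powr (p-2) * (norm y)\<^sup>2 = N powr p * (c1*\<beta>)" "c2 * N powr (p-2) * (norm y)\<^sup>2 = N powr p * (c2*\<beta>)"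
      using e4 by (auto simp: mult.assoc)
    then show ?thesis unfolding e3 N_def[symmetric] using *[OF a b]
      by (simp only:) (intro conjI mult_left_mono; simp)
  qed
  then show ?thesis using c by blast
qed

text \<open>With \<open>|x| \<le> |y| / k\<close> the first and the last term are bounded by
  multiples of \<open>|y|^p\<close>; the term \<open>- |x|^p\<close> is dropped.\<close>

lemma bregman_upper_far:
  fixes x y :: "'a::real_inner"
  assumes p: "1 < p" and k: "0 < k" "k * norm x \<le> norm y"
  shows "bregman p x y \<le> ((1 + 1/k) powr p + p * (1/k) powr (p-1)) * norm y powr p"
proof -
  have x: "norm x \<le> norm y / k" using k by (simp add: field_simps)
  have "norm (x + y) \<le> (1 + 1/k) * norm y" using x norm_triangle_ineq[of x y] by (simp add: algebra_simps)
  then have "norm (x+y) powr p \<le> ((1+1/k) * norm y) powr p" using p by (intro powr_mono2) auto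
  also have "\<dots> = (1+1/k) powr p * norm y powr p" using k by (simp add: powr_mult)
  finally have 1: "norm (x+y) powr p \<le> (1+1/k) powr p * norm y powr p" .
  have 2: "- (p * norm x powr (p-2) * (x \<bullet> y)) \<le> p * (1/k) powr (p-1) * norm y powr p"
  proof (cases "x = 0")
    case False
    have "- (x \<bullet> y) \<le> norm x * norm y" using Cauchy_Schwarz_ineq2[of x y] by (simp add: abs_le_iff)
    then have "p * norm x powr (p-2) * - (x \<bullet> y) \<le> p * norm x powr (p-2) * (norm x * norm y)"
      using p by (intro mult_left_mono) auto
    also have "\<dots> = p * norm x powr (p-1) * norm y" using False by (simp add: powr_diff power2_eq_square)
    also have "\<dots> \<le> p * (norm y / k) powr (p-1) * norm y"
      using p x by (intro mult_left_mono mult_right_mono powr_mono2) auto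
    also have "\<dots> = p * (1/k) powr (p-1) * norm y powr p"
    proof (cases "y = 0")
      case False
      have "norm y / k = (1/k) * norm y" by simp
      then have "(norm y / k) powr (p-1) * norm y = (1/k) powr (p-1) * (norm y powr (p-1) * norm y)"
        using k by (simp only: powr_mult) 
      also have "norm y powr (p-1) * norm y = norm y powr p" using False by (simp add: powr_diff)
      finally show ?thesis by simp
    qed simp
    finally show ?thesis by simp
  qed (use p in simp)
  show ?thesis using 1 2 by (simp add: bregman_def distrib_right) (smt (verit) powr_ge_zero)
qed

text \<open>Two regimes: if \<open>x\<close> is very short compared with \<open>y\<close>, the
  remainder is close to \<open>|y|^p\<close>; otherwise \<open>y\<close> is shortened along its ray
  until the quadratic bound applies.\<close>

lemma bregman_lower_far:
  assumes p: "1 < p" and k: "0 < k" "k \<le> 1/2"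
  shows "\<exists>c>0. \<forall>x y :: 'a::real_inner. k * norm x \<le> norm y \<longrightarrow> c * norm y powr p \<le> bregman p x y"
proof -
  obtain c1 where c1: "c1 > 0" and
    near: "\<And>x y::'a. 2 * norm y \<le> norm x \<Longrightarrow> c1 * norm x powr (p-2) * (norm y)\<^sup>2 \<le> bregman p x y"
    using bregman_near[OF p, where 'a='a] by auto
  \<comment> \<open>For \<open>|x| = e |y|\<close> this expression bounds the remainder divided by
    \<open>|y|^p\<close> from below; by \<open>p > 1\<close> it tends to 1, so at least half of
    \<open>|y|^p\<close> survives for small \<open>e\<close>.\<close>
  have "((\<lambda>e. (1-e) powr p - e powr p - p * e powr (p-1)) \<longlongrightarrow> 1) (at_right (0::real))"
    using p by real_asymp
  then have "eventually (\<lambda>e. (1-e) powr p - e powr p - p * e powr (p-1) > 1/2) (at_right (0::real))"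
    by (rule order_tendstoD) simp
  then obtain b where b: "b > 0" "\<And>e. 0 < e \<Longrightarrow> e < b \<Longrightarrow> (1-e) powr p - e powr p - p * e powr (p-1) > 1/2"
    by (auto simp: eventually_at_right_field)
  define e0 where "e0 = min (b/2) (1/2)"
  have e0: "0 < e0" "e0 < b" "e0 \<le> 1/2" using b by (auto simp: e0_def)
  define c where "c = min (1/2) (c1 * k * e0 powr (p-1))"
  have c: "c > 0" "c \<le> 1/2" "c \<le> c1 * k * e0 powr (p-1)" using c1 k e0 by (auto simp: c_def)
  have "c * norm y powr p \<le> bregman p x y" if xy: "k * norm x \<le> norm y" for x y :: 'a
  proof (cases "y = 0")
    case False
    define n where "n = norm y"
    have n: "n > 0" using False by (simp add: n_def)
    show ?thesis
    proof (cases "norm x \<le> e0 * n")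
      case True
      show ?thesis
      proof (cases "x = 0")
        case True
        then show ?thesis using c by (simp add: bregman_zero_left mult_left_le_one_le)
      next
        case x0: False
        define e where "e = norm x / n"
        have e: "0 < e" "e \<le> e0" using True n x0 by (auto simp: e_def field_simps)
        have nx: "norm x = e * n" using n by (simp add: e_def)
        have "(1-e) * n \<le> norm (x + y)" using norm_triangle_ineq2[of y "-x"] 
          by (simp add: left_diff_distrib nx n_def add.commute)
        then have "((1-e)*n) powr p \<le> norm (x+y) powr p" using e e0 n p by (intro powr_mono2) auto
        then have 1: "(1-e) powr p * n powr p \<le> norm (x+y) powr p" using e e0 n by (simp add: powr_mult)
        have 2: "p * norm x powr (p-2) * (x \<bullet> y) \<le> p * e powr (p-1) * n powr p"
        proof -
          have "p * norm x powr (p-2) * (x \<bullet> y) \<le> p * norm x powr (p-2) * (norm x * norm y)"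
            using p norm_cauchy_schwarz by (intro mult_left_mono) auto
          also have "\<dots> = p * (norm x powr (p-1) * n)" using x0 by (simp add: powr_diff power2_eq_square n_def)
          also have "norm x powr (p-1) * n = e powr (p-1) * n powr p" using e n unfolding nx
            by (simp add: powr_mult powr_diff)
          finally show ?thesis by simp
        qed
        have 3: "norm x powr p = e powr p * n powr p" unfolding nx using e n by (simp add: powr_mult)
        have "c * n powr p \<le> ((1-e) powr p - e powr p - p * e powr (p-1)) * n powr p"
          using b(2)[of e] e e0 c by (intro mult_right_mono) auto
        also have "\<dots> \<le> bregman p x y" using 1 2 3 by (simp add: bregman_def left_diff_distrib)
        finally show ?thesis by (simp add: n_def)
      qed
    next
      case False
      define N where "N = norm x"
      have N: "N > 0" "e0 * n < N" using False e0 n by (auto simp: N_def)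
      \<comment> \<open>\<open>t\<close> shortens \<open>y\<close> to the length
        \<open>k |x|\<close>, where the quadratic bound applies because \<open>k \<le> 1/2\<close>;
        the ray inequality gives back a factor \<open>1/t\<close>.\<close>
      define t where "t = k * N / n"
      have t: "0 < t" "t \<le> 1" using k N n xy by (auto simp: t_def N_def n_def)
      have nt: "norm (t *\<^sub>R y) = k * N" using k N n by (simp add: t_def n_def)
      have "c1 * N powr (p-2) * (k*N)\<^sup>2 \<le> bregman p x (t *\<^sub>R y)"
        using near[of "t *\<^sub>R y" x] nt k N by (simp add: N_def)
      also have "\<dots> \<le> t * bregman p x y" by (rule bregman_ray[OF p]) (use t in auto)
      finally have "c1 * N powr (p-2) * (k*N)\<^sup>2 / t \<le> bregman p x y" using t by (simp add: field_simps)
      also have "c1 * N powr (p-2) * (k*N)\<^sup>2 / t = c1 * k * N powr (p-1) * n"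
        using k N n by (simp add: t_def powr_diff power2_eq_square field_simps)
      finally have 1: "c1 * k * N powr (p-1) * n \<le> bregman p x y" .
      have "c * n powr p \<le> (c1 * k * e0 powr (p-1)) * n powr p" using c by (intro mult_right_mono) auto
      also have "\<dots> = c1 * k * (e0 * n) powr (p-1) * n" using e0 n by (simp add: powr_mult powr_diff)
      also have "\<dots> \<le> c1 * k * N powr (p-1) * n" using N n k c1 p e0
        by (intro mult_right_mono mult_left_mono powr_mono2) auto
      finally show ?thesis using 1 by (simp add: n_def)
    qed
  qed simp
  then show ?thesis using c by blast
qed

text \<open>The range up to 2 is the one produced by the truncation. Only \<open>t = 2\<close> needs
  work: if \<open>4 |y| \<le> |x|\<close>, both \<open>y\<close> and \<open>2 y\<close> are in the
  quadratic regime, otherwise both are in the regime of \<open>|y|^p\<close>. Smaller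
  \<open>t\<close> follow by convexity on the ray of \<open>2 y\<close>.\<close>

lemma bregman_dilate:
  assumes p: "1 < p"
  shows "\<exists>C>0. \<forall>x y :: 'a::real_inner. \<forall>t. 0 \<le> t \<and> t \<le> 2 \<longrightarrow> bregman p x (t *\<^sub>R y) \<le> C * bregman p x y"
proof -
  obtain c1 c2 where c1: "c1 > 0" "c2 > 0" and
    near: "\<And>x y::'a. 2 * norm y \<le> norm x \<Longrightarrow> c1 * norm x powr (p-2) * (norm y)\<^sup>2 \<le> bregman p x y"
    "\<And>x y::'a. 2 * norm y \<le> norm x \<Longrightarrow> bregman p x y \<le> c2 * norm x powr (p-2) * (norm y)\<^sup>2"
    using bregman_near[OF p, where 'a='a] by blast
  obtain c where c: "c > 0" and far: "\<And>x y::'a. 1/4 * norm x \<le> norm y \<Longrightarrow> c * norm y powr p \<le> bregman p x y"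
    using bregman_lower_far[OF p, of "1/4", where 'a='a] by auto
  define D where "D = ((1 + 1/(1/4)) powr p + p * (1/(1/4)) powr (p-1)) * 2 powr p"
  have D: "D \<ge> 0" using p by (simp add: D_def)
  define C where "C = max (4*c2/c1) (D/c) + 1"
  have C: "C > 0" "4*c2/c1 \<le> C" "D/c \<le> C" using c c1 D 
  proof -
    have "0 \<le> D/c" using D c by simp
    then show "C > 0" "4*c2/c1 \<le> C" "D/c \<le> C" unfolding C_def by linarith+
  qed
  have two: "bregman p x (2 *\<^sub>R y) \<le> C * bregman p x y" for x y :: 'a
  proof (cases "4 * norm y \<le> norm x")
    case True
    have "bregman p x (2 *\<^sub>R y) \<le> c2 * norm x powr (p-2) * (norm (2 *\<^sub>R y))\<^sup>2"
      using True by (intro near) auto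
    also have "\<dots> = (4*c2/c1) * (c1 * norm x powr (p-2) * (norm y)\<^sup>2)" using c1 by (simp add: power_mult_distrib)
    also have "\<dots> \<le> (4*c2/c1) * bregman p x y" using True c1 by (intro mult_left_mono near) (auto, smt (verit) norm_ge_zero)
    also have "\<dots> \<le> C * bregman p x y" using C bregman_nonneg[OF p] by (intro mult_right_mono) auto
    finally show ?thesis .
  next
    case False
    have "bregman p x (2 *\<^sub>R y) \<le> ((1 + 1/(1/4)) powr p + p * (1/(1/4)) powr (p-1)) * norm (2 *\<^sub>R y) powr p"
      using False by (intro bregman_upper_far[OF p]) (auto, smt (verit) norm_ge_zero)
    also have "\<dots> = D/c * (c * norm y powr p)" using c by (simp add: D_def powr_mult)
    also have "\<dots> \<le> D/c * bregman p x y" using False c D by (intro mult_left_mono far) auto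
    also have "\<dots> \<le> C * bregman p x y" using C bregman_nonneg[OF p] by (intro mult_right_mono) auto
    finally show ?thesis .
  qed
  have "bregman p x (t *\<^sub>R y) \<le> C * bregman p x y" if t: "0 \<le> t" "t \<le> 2" for x y :: 'a and t
  proof -
    have "bregman p x ((t/2) *\<^sub>R (2 *\<^sub>R y)) \<le> (t/2) * bregman p x (2 *\<^sub>R y)"
      by (rule bregman_ray[OF p]) (use t in auto)
    also have "\<dots> \<le> 1 * bregman p x (2 *\<^sub>R y)" using t bregman_nonneg[OF p] by (intro mult_right_mono) auto
    finally show ?thesis using two[of x y] by simp
  qed
  then show ?thesis using C by blast
qed

text \<open>For \<open>p < 2\<close> and \<open>|y|\<close> much smaller than \<open>|x|\<close> the
  remainder is far below \<open>|y|^p\<close>; an arbitrarily small share of \<open>|x|^p\<close>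
  compensates. The threshold \<open>k\<close> splits off the region where
  \<open>|y|^p \<le> d |x|^p\<close> holds anyway.\<close>

lemma norm_powr_le_bregman:
  assumes p: "1 < p" and d: "0 < d"
  shows "\<exists>C>0. \<forall>x y :: 'a::real_inner. norm y powr p \<le> d * norm x powr p + C * bregman p x y"
proof -
  define k where "k = min (1/2) (d powr (1/p))"
  have k: "0 < k" "k \<le> 1/2" "k \<le> d powr (1/p)" using d by (auto simp: k_def)
  obtain c where c: "c > 0" and far: "\<And>x y::'a. k * norm x \<le> norm y \<Longrightarrow> c * norm y powr p \<le> bregman p x y"
    using bregman_lower_far[OF p k(1,2), where 'a='a] by auto
  have kp: "k powr p \<le> d"
  proof -
    have "k powr p \<le> (d powr (1/p)) powr p" using k p by (intro powr_mono2) auto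
    then show ?thesis using p d by (simp add: powr_powr)
  qed
  have "norm y powr p \<le> d * norm x powr p + 1/c * bregman p x y" for x y :: 'a
  proof (cases "k * norm x \<le> norm y")
    case True
    then have "norm y powr p \<le> 1/c * bregman p x y" using far[OF True] c by (simp add: field_simps)
    moreover have "0 \<le> d * norm x powr p" using d by simp
    ultimately show ?thesis by linarith
  next
    case False
    then have "norm y powr p \<le> (k * norm x) powr p" using p by (intro powr_mono2) auto
    also have "\<dots> = k powr p * norm x powr p" using k by (simp add: powr_mult)
    also have "\<dots> \<le> d * norm x powr p" using kp by (intro mult_right_mono) auto
    moreover have "0 \<le> 1/c * bregman p x y" using c bregman_nonneg[OF p, of x y] by simp
    ultimately show ?thesis by linarith
  qed
  then show ?thesis using c by (intro exI[of _ "1/c"]) auto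
qed

text \<open>The converse comparison; here the share of \<open>|x|^p\<close> is what
  \<open>p > 2\<close> requires, since \<open>|x|^(p-2) |y|^2\<close> then exceeds every multiple of
  \<open>|y|^p\<close> for short \<open>y\<close>.\<close>

lemma bregman_le_norm_powr:
  assumes p: "1 < p" and d: "0 < d"
  shows "\<exists>C>0. \<forall>x y :: 'a::real_inner. bregman p x y \<le> d * norm x powr p + C * norm y powr p"
proof -
  obtain c2 where c2: "c2 > 0" and
    near: "\<And>x y::'a. 2 * norm y \<le> norm x \<Longrightarrow> bregman p x y \<le> c2 * norm x powr (p-2) * (norm y)\<^sup>2"
    using bregman_near[OF p, where 'a='a] by blast
  define k where "k = min (1/2) (sqrt (d/c2))"
  have k: "0 < k" "k \<le> 1/2" "k \<le> sqrt (d/c2)" using d c2 by (auto simp: k_def)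
  have k2: "c2 * k\<^sup>2 \<le> d"
  proof -
    have "k\<^sup>2 \<le> (sqrt (d/c2))\<^sup>2" using k by (intro power_mono) auto
    then show ?thesis using d c2 by (simp add: field_simps)
  qed
  define C where "C = (1 + 1/k) powr p + p * (1/k) powr (p-1)"
  have C: "C > 0" using k p unfolding C_def by (intro add_pos_nonneg) (auto simp: add_nonneg_eq_0_iff)
  have "bregman p x y \<le> d * norm x powr p + C * norm y powr p" for x y :: 'a
  proof (cases "k * norm x \<le> norm y")
    case True
    have "bregman p x y \<le> C * norm y powr p" unfolding C_def by (rule bregman_upper_far[OF p k(1) True])
    moreover have "0 \<le> d * norm x powr p" using d by simp
    ultimately show ?thesis by linarith
  next
    case False
    then have y: "norm y \<le> k * norm x" by simp
    have x0: "x \<noteq> 0" using False by auto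
    have "k * norm x \<le> 1/2 * norm x" using k by (intro mult_right_mono) auto
    then have "bregman p x y \<le> c2 * norm x powr (p-2) * (norm y)\<^sup>2" using y by (intro near) auto
    also have "\<dots> \<le> c2 * norm x powr (p-2) * (k * norm x)\<^sup>2" using y c2 by (intro mult_left_mono power_mono) auto
    also have "\<dots> = (c2 * k\<^sup>2) * norm x powr p" using x0 by (simp add: powr_diff power_mult_distrib)
    also have "\<dots> \<le> d * norm x powr p" using k2 by (intro mult_right_mono) auto
    also have "\<dots> \<le> d * norm x powr p + C * norm y powr p" using C by simp
    finally show ?thesis .
  qed
  then show ?thesis using C by blast
qed

section \<open>Smooth functions\<close>

lemma classical_grad_eq:
  assumes "(f has_derivative D) (at x)"
  shows "classical_grad f x $ i = D (axis i 1)"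
  using frechet_derivative_at[OF assms] by (simp add: classical_grad_def)

lemma has_derivative_classical_grad:
  fixes f :: "real^'n \<Rightarrow> real"
  assumes "f differentiable (at x)"
  shows "(f has_derivative (\<lambda>h. classical_grad f x \<bullet> h)) (at x)"
proof -
  obtain D where D: "(f has_derivative D) (at x)" using assms by (auto simp: differentiable_def)
  then interpret bounded_linear D by (rule has_derivative_bounded_linear)
  have "D = (\<lambda>h. classical_grad f x \<bullet> h)"
  proof
    fix h
    have "D h = D (\<Sum>i\<in>UNIV. (h $ i) *\<^sub>R axis i 1)"
      by (simp add: basis_expansion flip: scalar_mult_eq_scaleR)
    also have "\<dots> = (\<Sum>i\<in>UNIV. h $ i * D (axis i 1))" by (simp add: sum scaleR)
    also have "\<dots> = classical_grad f x \<bullet> h"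
      using classical_grad_eq[OF D] by (simp add: inner_vec_def mult.commute)
    finally show "D h = classical_grad f x \<bullet> h" .
  qed
  then show ?thesis using D by simp
qed

lemma has_derivative_cong_open:
  assumes "open S" "x \<in> S" "\<And>y. y \<in> S \<Longrightarrow> f y = g y"
  shows "(f has_derivative D) (at x) \<longleftrightarrow> (g has_derivative D) (at x)"
  using has_derivative_transform_within_open[OF _ assms(1,2)] assms(3) by metis

lemma classical_grad_cong_open:
  fixes f g :: "real^'n \<Rightarrow> real"
  assumes "open S" "x \<in> S" "\<And>y. y \<in> S \<Longrightarrow> f y = g y"
  shows "classical_grad f x = classical_grad g x"
  using has_derivative_cong_open[OF assms] by (simp add: classical_grad_def frechet_derivative_def)

text \<open>\<open>Ck_on\<close> recurses through the gradient of a total function. On an open set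
  this gradient sees nearby values only, so gradient formulas that are valid only on
  \<open>S\<close> may be substituted inside the recursion.\<close>

lemma Ck_on_cong:
  fixes f g :: "real^'n \<Rightarrow> real"
  assumes "open S" "\<And>y. y \<in> S \<Longrightarrow> f y = g y"
  shows "Ck_on k S f \<longleftrightarrow> Ck_on k S g"
  using assms(2)
proof (induction k arbitrary: f g)
  case 0
  then show ?case by (auto cong: continuous_on_cong)
next
  case (Suc k)
  have "\<And>i. Ck_on k S (\<lambda>x. classical_grad f x $ i) = Ck_on k S (\<lambda>x. classical_grad g x $ i)"
    using classical_grad_cong_open[OF assms(1) _ Suc.prems] by (intro Suc.IH) auto
  moreover have "(\<forall>x\<in>S. f differentiable (at x)) = (\<forall>x\<in>S. g differentiable (at x))"
    using has_derivative_cong_open[OF assms(1) _ Suc.prems] by (auto simp: differentiable_def)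
  ultimately show ?case by simp
qed

lemma Ck_on_continuous:
  assumes "Ck_on k S f"
  shows "continuous_on S f"
proof (cases k)
  case (Suc n)
  then have "\<forall>x\<in>S. f differentiable (at x)" using assms by auto
  then show ?thesis
    by (intro continuous_at_imp_continuous_on) (auto intro: differentiable_imp_continuous_within)
qed (use assms in auto)

lemma Ck_on_Suc_imp: "Ck_on (Suc k) S f \<Longrightarrow> Ck_on k S f"
proof (induction k arbitrary: f)
  case 0
  then show ?case using Ck_on_continuous[OF 0] by simp
next
  case (Suc k)
  have "\<forall>x\<in>S. f differentiable (at x)" "\<And>i. Ck_on (Suc k) S (\<lambda>x. classical_grad f x $ i)"
    using Suc.prems by auto
  then show ?case using Suc.IH by auto
qed

lemma Ck_on_subset: "Ck_on k S f \<Longrightarrow> T \<subseteq> S \<Longrightarrow> Ck_on k T f"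
  by (induction k arbitrary: f) (auto intro: continuous_on_subset)

lemma Ck_on_const [simp]:
  fixes S :: "(real^'n) set"
  shows "open S \<Longrightarrow> Ck_on k S (\<lambda>x. c)"
proof (induction k arbitrary: c)
  case (Suc k)
  have "classical_grad (\<lambda>x. c) x $ i = 0" for x :: "real^'n" and i
    using classical_grad_eq[of "\<lambda>x. c" "\<lambda>_. 0" x i] by simp
  then show ?case using Suc by simp
qed simp

lemma Ck_on_add:
  assumes S: "open S" and "Ck_on k S f" "Ck_on k S g"
  shows "Ck_on k S (\<lambda>x. f x + g x)"
  using assms(2,3)
proof (induction k arbitrary: f g)
  case 0
  then show ?case by (auto intro: continuous_on_add)
next
  case (Suc k)
  have e: "classical_grad f x $ i + classical_grad g x $ i = classical_grad (\<lambda>x. f x + g x) x $ i" if "x \<in> S" for x i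
    using classical_grad_eq[OF has_derivative_add[OF has_derivative_classical_grad[of f x] has_derivative_classical_grad[of g x]], of i]
      Suc.prems that by (simp add: inner_axis)
  have "Ck_on k S (\<lambda>x. classical_grad f x $ i + classical_grad g x $ i)" for i
    using Suc by auto
  note H = this
  have "Ck_on k S (\<lambda>x. classical_grad (\<lambda>x. f x + g x) x $ i)" for i
    by (rule iffD1[OF Ck_on_cong[OF S] H]) (rule e)
  then show ?case using Suc.prems by auto
qed

lemma Ck_on_mult:
  assumes S: "open S" and "Ck_on k S f" "Ck_on k S g"
  shows "Ck_on k S (\<lambda>x. f x * g x)"
  using assms(2,3)
proof (induction k arbitrary: f g)
  case 0
  then show ?case by (auto intro: continuous_on_mult)
next
  case (Suc k)
  have e: "f x * classical_grad g x $ i + classical_grad f x $ i * g x = classical_grad (\<lambda>x. f x * g x) x $ i" if "x \<in> S" for x i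
    using classical_grad_eq[OF has_derivative_mult[OF has_derivative_classical_grad[of f x] has_derivative_classical_grad[of g x]], of i]
      Suc.prems that by (simp add: inner_axis)
  have "Ck_on k S (\<lambda>x. f x * classical_grad g x $ i + classical_grad f x $ i * g x)" for i
    using Suc Ck_on_Suc_imp[OF Suc.prems(1)] Ck_on_Suc_imp[OF Suc.prems(2)]
    by (intro Ck_on_add[OF S]) auto
  note H = this
  have "Ck_on k S (\<lambda>x. classical_grad (\<lambda>x. f x * g x) x $ i)" for i
    by (rule iffD1[OF Ck_on_cong[OF S] H]) (rule e)
  then show ?case using Suc.prems by auto
qed

lemma Ck_on_nth:
  fixes S :: "(real^'n) set"
  shows "open S \<Longrightarrow> Ck_on k S (\<lambda>x. x $ j)"
proof (cases k)
  case (Suc n)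
  assume S: "open S"
  have D: "((\<lambda>x. x $ j) has_derivative (\<lambda>h. h $ j)) (at x)" for x :: "real^'n"
    by (rule bounded_linear_imp_has_derivative) (rule bounded_linear_vec_nth)
  have "classical_grad (\<lambda>x. x $ j) x $ i = axis i 1 $ j" for x :: "real^'n" and i
    by (rule classical_grad_eq[OF D])
  then show ?thesis using D S Suc by (auto simp: differentiable_def)
qed (auto intro: continuous_intros)

text \<open>The family \<open>exp (-1/t) / t\<^sup>m\<close> is closed, up to linear combinations, under differentiation.\<close>

definition exp_inv :: "nat \<Rightarrow> real \<Rightarrow> real" where
  "exp_inv m t = (if t > 0 then exp (- 1 / t) / t ^ m else 0)"

lemma exp_inv_tendsto_0: "(exp_inv m \<longlongrightarrow> 0) (at_right 0)"
proof -
  have "((\<lambda>t. inverse t ^ m / exp (inverse t)) \<longlongrightarrow> 0) (at_right (0::real))"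
    by (rule filterlim_compose[OF tendsto_power_div_exp_0 filterlim_inverse_at_top_right])
  moreover have "\<forall>\<^sub>F t in at_right 0. inverse t ^ m / exp (inverse t) = exp_inv m t"
    by (auto simp: eventually_at_right_field exp_inv_def exp_minus field_simps intro!: exI[of _ 1])
  ultimately show ?thesis by (rule Lim_transform_eventually)
qed

lemma exp_inv_deriv: "(exp_inv m has_real_derivative (exp_inv (m+2) t - real m * exp_inv (m+1) t)) (at t)"
proof -
  consider "t > 0" | "t < 0" | "t = 0" by linarith
  then show ?thesis
  proof cases
    case 1
    have "((\<lambda>t. exp (- 1 / t) / t ^ m) has_real_derivative (exp_inv (m+2) t - real m * exp_inv (m+1) t)) (at t)"
    proof -
      have d1: "((\<lambda>t. t ^ m) has_real_derivative real m * t ^ (m - 1)) (at t)" using DERIV_pow[of m t] by simp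
      have d2: "((\<lambda>t. exp (- 1 / t)) has_real_derivative exp (- 1 / t) / t\<^sup>2) (at t)"
        using 1 by (auto intro!: derivative_eq_intros simp: power2_eq_square)
      have "((\<lambda>t. exp (- 1 / t) / t ^ m) has_real_derivative
          (exp (- 1 / t) / t\<^sup>2 * t ^ m - exp (- 1 / t) * (real m * t ^ (m - 1))) / (t ^ m * t ^ m)) (at t)"
        by (rule DERIV_divide[OF d2 d1]) (use 1 in simp)
      moreover have "(exp (- 1 / t) / t\<^sup>2 * t ^ m - exp (- 1 / t) * (real m * t ^ (m - 1))) / (t ^ m * t ^ m)
          = exp_inv (m+2) t - real m * exp_inv (m+1) t"
      proof (cases m)
        case (Suc n)
        show ?thesis using 1 unfolding exp_inv_def Suc by (simp add: divide_simps power2_eq_square) (simp add: algebra_simps)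
      qed (use 1 in \<open>simp add: exp_inv_def power2_eq_square\<close>)
      ultimately show ?thesis by simp
    qed
    then show ?thesis
      by (rule has_field_derivative_transform_within_open[of _ _ _ "{0<..}"]) (use 1 in \<open>auto simp: exp_inv_def\<close>)
  next
    case 2
    have "((\<lambda>t. 0) has_real_derivative (exp_inv (m+2) t - real m * exp_inv (m+1) t)) (at t)"
      using 2 by (auto simp: exp_inv_def)
    then show ?thesis
      by (rule has_field_derivative_transform_within_open[of _ _ _ "{..<0}"]) (use 2 in \<open>auto simp: exp_inv_def\<close>)
  next
    case 3
    \<comment> \<open>The right difference quotient at 0 is \<open>exp_inv (m+1)\<close>, which
      tends to 0, and the left one vanishes; so the differentiation rule also holds where the two
      branches meet.\<close>
    have "((\<lambda>y. (exp_inv m y - exp_inv m 0) / (y - 0)) \<longlongrightarrow> 0) (at 0)"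
    proof (rule filterlim_split_at)
      show "((\<lambda>y. (exp_inv m y - exp_inv m 0) / (y - 0)) \<longlongrightarrow> 0) (at_left 0)"
        by (rule tendsto_eventually) (auto simp: eventually_at_left_field exp_inv_def intro!: exI[of _ "-1"])
      have "\<forall>\<^sub>F y in at_right 0. exp_inv (m+1) y = (exp_inv m y - exp_inv m 0) / (y - 0)"
        by (auto simp: eventually_at_right_field exp_inv_def field_simps intro!: exI[of _ "1"])
      then show "((\<lambda>y. (exp_inv m y - exp_inv m 0) / (y - 0)) \<longlongrightarrow> 0) (at_right 0)"
        by (rule Lim_transform_eventually[OF exp_inv_tendsto_0])
    qed
    then show ?thesis using 3 by (simp add: has_field_derivative_iff exp_inv_def)
  qed
qed

text \<open>The polynomial \<open>c - x \<bullet> x\<close> avoids the norm, which is not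
  differentiable at 0. For \<open>c = e\<^sup>2\<close> the composition lives in the ball of radius
  \<open>e\<close>.\<close>

lemma exp_inv_ball_deriv:
  fixes x :: "real^'n"
  shows "((\<lambda>x. exp_inv m (c - x \<bullet> x)) has_derivative
    (\<lambda>h. (exp_inv (m+2) (c - x \<bullet> x) - real m * exp_inv (m+1) (c - x \<bullet> x)) * (- 2 * (x \<bullet> h)))) (at x)"
proof -
  have "((\<lambda>x::real^'n. c - x \<bullet> x) has_derivative (\<lambda>h. - 2 * (x \<bullet> h))) (at x)"
    by (auto intro!: derivative_eq_intros simp: inner_commute)
  from has_derivative_compose[OF this, of "exp_inv m", OF exp_inv_deriv[unfolded has_field_derivative_def]]
  show ?thesis by simp
qed

text \<open>\<open>m\<close> stays arbitrary in the induction because differentiation raises it: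
  each partial derivative combines two members of the family and multiplies by a coordinate.\<close>

lemma exp_inv_ball_Ck: "Ck_on k UNIV (\<lambda>x::real^'n. exp_inv m (c - x \<bullet> x))"
proof (induction k arbitrary: m)
  case 0
  have "continuous (at x) (\<lambda>x::real^'n. exp_inv m (c - x \<bullet> x))" for x
    using exp_inv_ball_deriv has_derivative_continuous by blast
  then show ?case by (auto intro: continuous_at_imp_continuous_on)
next
  case (Suc k)
  have e: "classical_grad (\<lambda>x::real^'n. exp_inv m (c - x \<bullet> x)) x $ i
     = (exp_inv (m+2) (c - x \<bullet> x) + (- real m) * exp_inv (m+1) (c - x \<bullet> x)) * ((- 2) * x $ i)" for x i
    by (subst classical_grad_eq[OF exp_inv_ball_deriv]) (simp add: inner_axis)
  have "Ck_on k UNIV (\<lambda>x::real^'n. classical_grad (\<lambda>x. exp_inv m (c - x \<bullet> x)) x $ i)" for i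
    unfolding e by (intro Ck_on_mult Ck_on_add Suc Ck_on_const Ck_on_nth open_UNIV)
  moreover have "(\<lambda>x::real^'n. exp_inv m (c - x \<bullet> x)) differentiable (at x)" for x
    using exp_inv_ball_deriv differentiable_def by blast
  ultimately show ?case by simp
qed

section \<open>Continuous functions with compact support\<close>

lemma Cc_UNIV_D:
  assumes "k \<in> Cc UNIV"
  shows "continuous_on UNIV k" and "\<exists>R>0. \<forall>x. norm x > R \<longrightarrow> k x = 0"
proof -
  show "continuous_on UNIV k" using assms by (simp add: Cc_def)
  obtain K where K: "compact K" "\<And>x. x \<notin> K \<Longrightarrow> k x = 0" using assms by (auto simp: Cc_def compact_support_in_def)
  obtain R where "R > 0" "\<And>x. x \<in> K \<Longrightarrow> norm x \<le> R" using compact_imp_bounded[OF K(1)] bounded_pos by blast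
  then show "\<exists>R>0. \<forall>x. norm x > R \<longrightarrow> k x = 0" using K(2) by (meson not_le)
qed

lemma Cc_UNIV_I:
  assumes "continuous_on UNIV k" "\<And>x. norm x > R \<Longrightarrow> k x = 0"
  shows "k \<in> Cc UNIV"
  using assms by (auto simp: Cc_def compact_support_in_def intro!: exI[of _ "cball 0 R"])

lemma Cc_UNIV_uniformly_continuous:
  assumes "k \<in> Cc (UNIV :: (real^'n) set)" "e > 0"
  shows "\<exists>d>0. \<forall>x y. dist x y < d \<longrightarrow> \<bar>k x - k y\<bar> < e"
proof -
  obtain R where R: "R > 0" "\<And>x. norm x > R \<Longrightarrow> k x = 0" using Cc_UNIV_D[OF assms(1)] by auto
  have "uniformly_continuous_on (cball 0 (R+1)) k"
    using Cc_UNIV_D(1)[OF assms(1)] by (intro compact_uniformly_continuous) (auto intro: continuous_on_subset)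
  then obtain d where d: "d > 0" "\<And>x y. norm x \<le> R+1 \<Longrightarrow> norm y \<le> R+1 \<Longrightarrow> dist y x < d \<Longrightarrow> dist (k y) (k x) < e"
    using assms(2) by (auto simp: uniformly_continuous_on_def dest!: spec[of _ e])
  have "\<bar>k x - k y\<bar> < e" if xy: "dist x y < min d 1" for x y
  proof (cases "norm x \<le> R+1 \<and> norm y \<le> R+1")
    case True
    then show ?thesis using d(2)[of y x] xy by (auto simp: dist_real_def)
  next
    case False
    have "norm x \<le> norm y + dist x y" "norm y \<le> norm x + dist x y"
      using norm_triangle_ineq2[of x y] norm_triangle_ineq2[of y x] by (auto simp: dist_norm norm_minus_commute)
    then have "norm x > R" "norm y > R" using False xy by auto
    then show ?thesis using R assms(2) by simp
  qed
  then show ?thesis using d(1) by (intro exI[of _ "min d 1"]) auto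
qed

lemma Cc_UNIV_bounded:
  assumes "k \<in> Cc (UNIV :: (real^'n) set)"
  shows "\<exists>B>0. \<forall>x. \<bar>k x\<bar> \<le> B"
proof -
  obtain R where R: "R > 0" "\<And>x. norm x > R \<Longrightarrow> k x = 0" using Cc_UNIV_D[OF assms(1)] by auto
  have "compact (k ` cball 0 R)"
    using Cc_UNIV_D(1)[OF assms(1)] by (intro compact_continuous_image) (auto intro: continuous_on_subset)
  then obtain B where "B > 0" "\<And>x. norm x \<le> R \<Longrightarrow> \<bar>k x\<bar> \<le> B"
    using compact_imp_bounded[of "k ` cball 0 R"] unfolding bounded_pos by auto
  then show ?thesis using R(2) by (metis abs_0 linorder_le_less_linear order_less_imp_le)
qed

lemma continuous_imp_measurable_lebesgue:
  fixes f :: "real^'n \<Rightarrow> real"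
  assumes "continuous_on UNIV f"
  shows "f \<in> borel_measurable lebesgue" "f \<in> borel_measurable lborel"
  using borel_measurable_continuous_onI[OF assms] by (auto intro: measurable_completion)

lemma integrable_lebesgue_bounded_support:
  fixes f :: "real^'n \<Rightarrow> real"
  assumes "f \<in> borel_measurable lebesgue" "\<And>x. \<bar>f x\<bar> \<le> B" "\<And>x. x \<notin> K \<Longrightarrow> f x = 0" "bounded K"
  shows "integrable lebesgue f"
proof -
  obtain R where R: "K \<subseteq> cball 0 R" using assms(4) unfolding bounded_iff subset_iff by auto
  have "integrable lebesgue (\<lambda>x::real^'n. indicator (cball 0 R) x *\<^sub>R B :: real)"
    using lmeasurable_cball[of "0::real^'n" R] by (intro integrable_scaleR_left integrable_real_indicator) (auto simp: fmeasurable_def)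
  then show ?thesis
  proof (rule Bochner_Integration.integrable_bound)
    show "AE x in lebesgue. norm (f x) \<le> norm (indicator (cball 0 R) x *\<^sub>R B)"
    proof (rule AE_I2)
      fix x
      show "norm (f x) \<le> norm (indicator (cball 0 R) x *\<^sub>R B)"
        using assms(2)[of x] assms(3)[of x] subsetD[OF R, of x] by (cases "x \<in> cball 0 R") (auto split: if_splits)
    qed
  qed (use assms in auto)
qed

lemma Cc_UNIV_integrable:
  assumes "k \<in> Cc (UNIV :: (real^'n) set)"
  shows "integrable lebesgue k" "integrable lborel k"
proof -
  obtain B where B: "\<And>x. \<bar>k x\<bar> \<le> B" using Cc_UNIV_bounded[OF assms] by auto
  obtain K where K: "compact K" "\<And>x. x \<notin> K \<Longrightarrow> k x = 0" using assms by (auto simp: Cc_def compact_support_in_def)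
  show 1: "integrable lebesgue k"
    by (rule integrable_lebesgue_bounded_support[OF _ B K(2)])
       (use K Cc_UNIV_D(1)[OF assms] in \<open>auto intro: continuous_imp_measurable_lebesgue compact_imp_bounded\<close>)
  then show "integrable lborel k"
    using integrable_completion[of k lborel] continuous_imp_measurable_lebesgue(2)[OF Cc_UNIV_D(1)[OF assms]] by simp
qed

text \<open>\<open>\<bar>c\<bar> = 1\<close> covers translations as well as the reflection
  \<open>y \<mapsto> x - y\<close> in a convolution.\<close>

lemma integral_lborel_affine:
  fixes f :: "real^'n \<Rightarrow> real"
  assumes f: "f \<in> borel_measurable borel" and c: "\<bar>c\<bar> = 1"
  shows "(\<integral>x. f (t + c *\<^sub>R x) \<partial>lborel) = (\<integral>x. f x \<partial>lborel)"
    and "integrable lborel (\<lambda>x. f (t + c *\<^sub>R x)) \<longleftrightarrow> integrable lborel f"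
proof -
  have e: "lborel = distr lborel borel (\<lambda>x::real^'n. t + c *\<^sub>R x)"
    using lborel_affine[of c t] c by (auto simp: density_1)
  have m: "(\<lambda>x::real^'n. t + c *\<^sub>R x) \<in> measurable lborel borel"
    by (auto intro!: borel_measurable_continuous_onI continuous_intros)
  show "(\<integral>x. f (t + c *\<^sub>R x) \<partial>lborel) = (\<integral>x. f x \<partial>lborel)"
    by (subst (2) e) (rule integral_distr[OF m f, symmetric])
  show "integrable lborel (\<lambda>x. f (t + c *\<^sub>R x)) \<longleftrightarrow> integrable lborel f"
    by (subst (2) e) (rule integrable_distr_eq[OF m f, symmetric])
qed

lemma integral_lebesgue_affine_continuous:
  fixes f :: "real^'n \<Rightarrow> real"
  assumes "continuous_on UNIV f" "\<bar>c\<bar> = 1"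
  shows "(\<integral>x. f (t + c *\<^sub>R x) \<partial>lebesgue) = (\<integral>x. f x \<partial>lebesgue)"
proof -
  have "continuous_on UNIV (\<lambda>x. f (t + c *\<^sub>R x))"
    by (rule continuous_on_compose2[OF assms(1)]) (auto intro!: continuous_intros)
  then show ?thesis
    using integral_lborel_affine(1)[OF _ assms(2), of f t] borel_measurable_continuous_onI[OF assms(1)]
    by (simp add: integral_completion continuous_imp_measurable_lebesgue assms(1) borel_measurable_continuous_onI)
qed

section \<open>Convolution\<close>

definition conv :: "(real^'n \<Rightarrow> real) \<Rightarrow> (real^'n \<Rightarrow> real) \<Rightarrow> real^'n \<Rightarrow> real" where
  "conv k f x = (\<integral>y. k (x - y) * f y \<partial>lebesgue)"

lemma continuous_on_reflect:
  fixes k :: "real^'n \<Rightarrow> real"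
  assumes "continuous_on UNIV k"
  shows "continuous_on UNIV (\<lambda>y. k (x - y))"
  by (rule continuous_on_compose2[OF assms]) (auto intro!: continuous_intros)

lemma integrable_bounded_mult:
  fixes f g :: "real^'n \<Rightarrow> real"
  assumes "integrable lebesgue f" "g \<in> borel_measurable lebesgue" "\<And>x. \<bar>g x\<bar> \<le> B"
  shows "integrable lebesgue (\<lambda>x. g x * f x)"
proof (rule Bochner_Integration.integrable_bound[where f = "\<lambda>x. B * f x"])
  have "B \<ge> 0" using assms(3)[of 0] by linarith
  then show "AE x in lebesgue. norm (g x * f x) \<le> norm (B * f x)"
    using assms(3) by (auto simp: abs_mult intro!: mult_right_mono)
qed (use assms in auto)

lemma conv_integrable:
  assumes "k \<in> Cc UNIV" "integrable lebesgue f"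
  shows "integrable lebesgue (\<lambda>y. k (x - y) * f y)"
proof -
  obtain B where "\<And>x. \<bar>k x\<bar> \<le> B" using Cc_UNIV_bounded[OF assms(1)] by auto
  then show ?thesis using assms
    by (intro integrable_bounded_mult[where B = B] continuous_imp_measurable_lebesgue continuous_on_reflect Cc_UNIV_D) auto
qed

lemma conv_abs_le:
  assumes "k \<in> Cc UNIV" "integrable lebesgue f" "\<And>x. 0 \<le> k x"
  shows "\<bar>conv k f x\<bar> \<le> conv k (\<lambda>x. \<bar>f x\<bar>) x"
proof -
  have "\<bar>conv k f x\<bar> \<le> (\<integral>y. \<bar>k (x - y) * f y\<bar> \<partial>lebesgue)"
    unfolding conv_def by (rule integral_abs_bound)
  then show ?thesis using assms(3) by (simp add: conv_def abs_mult)
qed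

lemma conv_diff:
  assumes "k \<in> Cc UNIV" "integrable lebesgue f" "integrable lebesgue g"
  shows "conv k (\<lambda>x. f x - g x) x = conv k f x - conv k g x"
  unfolding conv_def using conv_integrable[OF assms(1,2)] conv_integrable[OF assms(1,3)]
  by (simp add: right_diff_distrib)

lemma conv_mono:
  assumes "k \<in> Cc UNIV" "integrable lebesgue f" "integrable lebesgue g" "\<And>x. 0 \<le> k x" "\<And>x. f x \<le> g x"
  shows "conv k f x \<le> conv k g x"
  unfolding conv_def using assms
  by (intro integral_mono conv_integrable mult_left_mono) auto

lemma Cc_reflect:
  assumes "k \<in> Cc (UNIV :: (real^'n) set)"
  shows "(\<lambda>y. k (x - y)) \<in> Cc UNIV"
proof -
  obtain R where R: "R > 0" "\<And>x. norm x > R \<Longrightarrow> k x = 0" using Cc_UNIV_D[OF assms(1)] by auto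
  have "k (x - y) = 0" if "norm y > R + norm x" for y
    using R(2)[of "x - y"] that norm_triangle_ineq2[of y x] by (simp add: norm_minus_commute)
  then show ?thesis
    by (intro Cc_UNIV_I[of _ "R + norm x"] continuous_on_reflect Cc_UNIV_D[OF assms]) auto
qed

text \<open>Fubini, carried out for the Borel measure with a Borel representative \<open>f'\<close>
  of \<open>f\<close>, because \<open>(y, x) \<mapsto> k (x - y) * f' y\<close> has to be measurable
  on the product.\<close>

lemma integral_conv:
  fixes f :: "real^'n \<Rightarrow> real"
  assumes k: "k \<in> Cc UNIV" and f: "integrable lebesgue f"
  shows "integrable lebesgue (conv k f)"
    and "(\<integral>x. conv k f x \<partial>lebesgue) = (\<integral>x. k x \<partial>lebesgue) * (\<integral>x. f x \<partial>lebesgue)"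
proof -
  obtain f' where f': "f' \<in> borel_measurable lborel" and ae: "AE x in lborel. f x = f' x"
    using completion_ex_borel_measurable_real[OF borel_measurable_integrable[OF f]] by auto
  have ae': "AE x in lebesgue. f x = f' x" using ae by (rule AE_completion)
  have kc: "continuous_on UNIV k" using Cc_UNIV_D[OF k] by simp
  have kb: "k \<in> borel_measurable borel" by (rule borel_measurable_continuous_onI[OF kc])
  have f'i: "integrable lebesgue f'"
    using f ae' f' by (subst integrable_cong_AE[of _ _ f]) (auto intro: measurable_completion)
  then have f'l: "integrable lborel f'" using f' by (simp add: integrable_completion)
  have If: "(\<integral>x. f x \<partial>lebesgue) = (\<integral>x. f' x \<partial>lborel)"
    using ae' f f' f'i by (subst integral_cong_AE[where g = f']) (auto simp: integral_completion)
  have Ik: "(\<integral>x. k x \<partial>lebesgue) = (\<integral>x. k x \<partial>lborel)"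
    using kb by (simp add: integral_completion)
  have mk: "(\<lambda>y. k (x - y)) \<in> borel_measurable borel" for x
    by (rule borel_measurable_continuous_onI[OF continuous_on_reflect[OF kc]])
  have c: "conv k f x = (\<integral>y. k (x - y) * f' y \<partial>lborel)" for x
  proof -
    have "conv k f x = (\<integral>y. k (x - y) * f' y \<partial>lebesgue)"
      unfolding conv_def
      using ae' borel_measurable_integrable[OF f] borel_measurable_integrable[OF f'i] continuous_imp_measurable_lebesgue(1)[OF continuous_on_reflect[OF kc]]
      by (intro integral_cong_AE borel_measurable_times) auto
    then show ?thesis using mk f' by (simp add: integral_completion)
  qed
  have mF: "(\<lambda>(y, x). k (x - y) * f' y) \<in> borel_measurable (lborel \<Otimes>\<^sub>M lborel)"
  proof -
    have "(\<lambda>z::(real^'n) \<times> (real^'n). snd z - fst z) \<in> borel_measurable (lborel \<Otimes>\<^sub>M lborel)"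
      by (intro borel_measurable_diff) auto
    from measurable_compose[OF this kb] have "(\<lambda>z. k (snd z - fst z)) \<in> borel_measurable (lborel \<Otimes>\<^sub>M lborel)" .
    moreover have "(\<lambda>z. f' (fst z)) \<in> borel_measurable (lborel \<Otimes>\<^sub>M (lborel :: (real^'n) measure))"
      using f' by (intro measurable_compose[OF measurable_fst]) auto
    ultimately show ?thesis unfolding split_beta by (rule borel_measurable_times)
  qed
  have tr: "(\<integral>x. g (x - y) \<partial>lborel) = (\<integral>x. g x \<partial>lborel)" "integrable lborel (\<lambda>x. g (x - y)) \<longleftrightarrow> integrable lborel g"
    if "g \<in> borel_measurable borel" for y :: "real^'n" and g :: "real^'n \<Rightarrow> real"
    using integral_lborel_affine[OF that, of 1 "-y"] by simp_all
  have kl: "integrable lborel k" by (rule Cc_UNIV_integrable[OF k])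
  have int: "integrable (lborel \<Otimes>\<^sub>M lborel) (\<lambda>(y, x). k (x - y) * f' y)"
  proof (rule lborel_pair.Fubini_integrable[OF mF])
    have e: "(\<integral>x. norm (case (y, x) of (y, x) \<Rightarrow> k (x - y) * f' y) \<partial>lborel) = (\<integral>x. \<bar>k x\<bar> \<partial>lborel) * \<bar>f' y\<bar>" for y
      using tr(1)[of "\<lambda>x. \<bar>k x\<bar>" y] kb by (simp add: abs_mult)
    show "integrable lborel (\<lambda>y. \<integral>x. norm (case (y, x) of (y, x) \<Rightarrow> k (x - y) * f' y) \<partial>lborel)"
      unfolding e using f'l by simp
    show "AE y in lborel. integrable lborel (\<lambda>x. case (y, x) of (y, x) \<Rightarrow> k (x - y) * f' y)"
      using tr(2)[OF kb] kl by auto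
  qed
  have 1: "integrable lborel (conv k f)"
    using lborel_pair.integrable_snd[OF int] unfolding c by simp
  then show "integrable lebesgue (conv k f)" by (simp add: integrable_completion)
  have "(\<integral>x. conv k f x \<partial>lebesgue) = (\<integral>x. conv k f x \<partial>lborel)"
    using 1 by (simp add: integral_completion)
  also have "\<dots> = (\<integral>y. (\<integral>x. k (x - y) * f' y \<partial>lborel) \<partial>lborel)"
    unfolding c using lborel_pair.Fubini_integral[OF int] by simp
  also have "\<dots> = (\<integral>x. k x \<partial>lborel) * (\<integral>x. f' x \<partial>lborel)"
    using tr(1)[OF kb] by simp
  finally show "(\<integral>x. conv k f x \<partial>lebesgue) = (\<integral>x. k x \<partial>lebesgue) * (\<integral>x. f x \<partial>lebesgue)"
    using If Ik by simp
qed

text \<open>The reflected kernel has integral 1, so \<open>conv k f x - c\<close> is an average of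
  \<open>f - c\<close> over the ball of radius \<open>e\<close>. Bounds, supports and pointwise
  limits of mollifications are instances of this one estimate.\<close>

lemma conv_local:
  assumes k: "k \<in> Cc UNIV" and f: "integrable lebesgue f" and pos: "\<And>x. 0 \<le> k x"
    and one: "(\<integral>x. k x \<partial>lebesgue) = 1" and supp: "\<And>x. e \<le> norm x \<Longrightarrow> k x = 0"
    and near: "\<And>y. dist y x < e \<Longrightarrow> \<bar>f y - c\<bar> \<le> d"
  shows "\<bar>conv k f x - c\<bar> \<le> d"
proof -
  have kr: "(\<lambda>y. k (x - y)) \<in> Cc UNIV" by (rule Cc_reflect[OF k])
  have 1: "(\<integral>y. k (x - y) \<partial>lebesgue) = 1"
    using integral_lebesgue_affine_continuous[OF Cc_UNIV_D(1)[OF k], of "-1" x] one by simp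
  have i: "integrable lebesgue (\<lambda>y. k (x - y))" using Cc_UNIV_integrable[OF kr] by simp
  have "conv k f x - c = (\<integral>y. k (x - y) * f y \<partial>lebesgue) - (\<integral>y. k (x - y) * c \<partial>lebesgue)"
    using 1 by (simp add: conv_def)
  also have "\<dots> = (\<integral>y. k (x - y) * f y - k (x - y) * c \<partial>lebesgue)"
    by (rule Bochner_Integration.integral_diff[OF conv_integrable[OF k f] integrable_mult_left[OF i], symmetric])
  finally have e: "conv k f x - c = (\<integral>y. k (x - y) * (f y - c) \<partial>lebesgue)" by (simp add: right_diff_distrib)
  have "\<bar>k (x - y) * (f y - c)\<bar> \<le> k (x - y) * d" for y
  proof (cases "dist y x < e")
    case True
    then show ?thesis using near[OF True] pos by (simp add: abs_mult mult_left_mono)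
  next
    case False
    then have "k (x - y) = 0" using supp[of "x - y"] by (simp add: dist_norm norm_minus_commute)
    then show ?thesis by simp
  qed
  note le = this
  have "integrable lebesgue (\<lambda>y. k (x - y) * f y - k (x - y) * c)"
    by (rule Bochner_Integration.integrable_diff[OF conv_integrable[OF k f] integrable_mult_left[OF i]])
  then have "integrable lebesgue (\<lambda>y. k (x - y) * (f y - c))" by (simp add: right_diff_distrib)
  then have "\<bar>conv k f x - c\<bar> \<le> (\<integral>y. k (x - y) * d \<partial>lebesgue)"
    unfolding e using i le by (intro order_trans[OF integral_abs_bound] integral_mono integrable_abs) auto
  then show ?thesis using 1 by simp
qed

lemma test_functions_UNIV_D:
  assumes "k \<in> test_functions UNIV"
  shows "k \<in> Cc UNIV" "k differentiable (at x)" "(\<lambda>x. classical_grad k x $ i) \<in> test_functions UNIV"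
proof -
  have C: "\<And>j. Ck_on j UNIV k" using assms by (simp add: test_functions_def)
  from C[of 0] assms show "k \<in> Cc UNIV" by (simp add: test_functions_def Cc_def)
  from C[of 1] show "k differentiable (at x)" by simp
  have "Ck_on j UNIV (\<lambda>x. classical_grad k x $ i)" for j using C[of "Suc j"] by simp
  moreover have "compact_support_in UNIV (\<lambda>x. classical_grad k x $ i)"
  proof -
    obtain K where K: "compact K" "\<And>x. x \<notin> K \<Longrightarrow> k x = 0" using assms by (auto simp: test_functions_def compact_support_in_def)
    have "classical_grad k x $ i = 0" if "x \<notin> K" for x
    proof -
      have "classical_grad k x = classical_grad (\<lambda>_. 0) x"
        using K that by (intro classical_grad_cong_open[of "-K"]) (auto intro: compact_imp_closed)
      then show ?thesis using classical_grad_eq[of "\<lambda>_. 0" "\<lambda>_. 0" x i] by simp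
    qed
    then show ?thesis using K by (auto simp: compact_support_in_def)
  qed
  ultimately show "(\<lambda>x. classical_grad k x $ i) \<in> test_functions UNIV" by (simp add: test_functions_def)
qed

text \<open>Compact support makes the gradient uniformly continuous, so the linearisation error is
  uniform in the base point. This is what lets a derivative pass under the integral of a
  convolution.\<close>

lemma test_functions_uniform_linearization:
  fixes k :: "real^'n \<Rightarrow> real"
  assumes k: "k \<in> test_functions UNIV" and e: "e > 0"
  shows "\<exists>d>0. \<forall>z h. norm h < d \<longrightarrow> \<bar>k (z + h) - k z - classical_grad k z \<bullet> h\<bar> \<le> e * norm h"
proof -
  define n where "n = real CARD('n)"
  have n: "n > 0" by (simp add: n_def)
  have "\<exists>d>0. \<forall>x y. dist x y < d \<longrightarrow> \<bar>classical_grad k x $ i - classical_grad k y $ i\<bar> < e / n" for i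
    using Cc_UNIV_uniformly_continuous[OF test_functions_UNIV_D(1)[OF test_functions_UNIV_D(3)[OF k]], of "e/n" i] e n by auto
  then obtain d where d: "\<And>i. d i > 0" "\<And>i x y. dist x y < d i \<Longrightarrow> \<bar>classical_grad k x $ i - classical_grad k y $ i\<bar> < e / n"
    by metis
  define D where "D = Min (range d)"
  have D: "D > 0" "\<And>i. D \<le> d i" using d(1) by (auto simp: D_def)
  have "\<bar>k (z + h) - k z - classical_grad k z \<bullet> h\<bar> \<le> e * norm h" if h: "norm h < D" for z h
  proof -
    have "norm (k (z + h) - k z - (classical_grad k z \<bullet> ((z + h) - z))) \<le> norm ((z + h) - z) * e"
    proof (rule differentiable_bound_linearization[where S = "ball z D" and f' = "\<lambda>x h. classical_grad k x \<bullet> h"])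
      show "z + t *\<^sub>R (z + h - z) \<in> ball z D" if "t \<in> {0..1}" for t
      proof -
        have "norm (t *\<^sub>R h) \<le> norm h" using that by (simp add: mult_left_le_one_le)
        then show ?thesis using h by (simp add: dist_norm)
      qed
      show "(k has_derivative (\<lambda>h. classical_grad k x \<bullet> h)) (at x within ball z D)" for x
        using has_derivative_classical_grad[OF test_functions_UNIV_D(2)[OF k]] has_derivative_at_withinI by blast
      show "onorm ((\<lambda>h. classical_grad k x \<bullet> h) - (\<lambda>h. classical_grad k z \<bullet> h)) \<le> e" if x: "x \<in> ball z D" for x
      proof (rule onorm_bound)
        fix v :: "real^'n"
        have "norm (((\<lambda>h. classical_grad k x \<bullet> h) - (\<lambda>h. classical_grad k z \<bullet> h)) v)
          = \<bar>(classical_grad k x - classical_grad k z) \<bullet> v\<bar>" by (simp add: inner_diff_left)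
        also have "\<dots> \<le> norm (classical_grad k x - classical_grad k z) * norm v" by (rule Cauchy_Schwarz_ineq2)
        also have "norm (classical_grad k x - classical_grad k z) \<le> (\<Sum>i\<in>UNIV. \<bar>(classical_grad k x - classical_grad k z) $ i\<bar>)"
          by (rule norm_le_l1_cart)
        also have "\<dots> \<le> (\<Sum>i\<in>(UNIV::'n set). e / n)"
          using d(2)[of x z] x D(2) by (intro sum_mono) (auto simp: dist_commute less_le_trans less_imp_le)
        also have "\<dots> = e" using n by (simp add: n_def)
        finally show "norm (((\<lambda>h. classical_grad k x \<bullet> h) - (\<lambda>h. classical_grad k z \<bullet> h)) v) \<le> e * norm v"
          by (simp add: mult_right_mono)
      qed (use e in simp)
    qed (use D in simp)
    then show ?thesis by (simp add: mult.commute)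
  qed
  then show ?thesis using D(1) by blast
qed

lemma conv_has_derivative:
  fixes f k :: "real^'n \<Rightarrow> real"
  assumes k: "k \<in> test_functions UNIV" and f: "integrable lebesgue f"
  shows "(conv k f has_derivative (\<lambda>h. \<Sum>i\<in>UNIV. conv (\<lambda>x. classical_grad k x $ i) f x * h $ i)) (at x)"
proof -
  have kc: "k \<in> Cc UNIV" by (rule test_functions_UNIV_D[OF k])
  have gc: "(\<lambda>x. classical_grad k x $ i) \<in> Cc UNIV" for i
    by (intro test_functions_UNIV_D(1) test_functions_UNIV_D(3)[OF k])
  define L where "L h = (\<Sum>i\<in>UNIV. conv (\<lambda>x. classical_grad k x $ i) f x * h $ i)" for h
  have Lint: "integrable lebesgue (\<lambda>y. (classical_grad k (x - y) \<bullet> h) * f y)"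
     "L h = (\<integral>y. (classical_grad k (x - y) \<bullet> h) * f y \<partial>lebesgue)" for h
  proof -
    have "(classical_grad k (x - y) \<bullet> h) * f y = (\<Sum>i\<in>UNIV. (classical_grad k (x - y) $ i * f y) * h $ i)" for y
      by (simp add: inner_vec_def sum_distrib_right sum_distrib_left mult_ac)
    moreover have "integrable lebesgue (\<lambda>y. (classical_grad k (x - y) $ i * f y) * h $ i)" for i
      by (rule integrable_mult_left[OF conv_integrable[OF gc f]])
    ultimately show "integrable lebesgue (\<lambda>y. (classical_grad k (x - y) \<bullet> h) * f y)"
      "L h = (\<integral>y. (classical_grad k (x - y) \<bullet> h) * f y \<partial>lebesgue)"
      by (simp_all add: L_def conv_def)
  qed
  have "(conv k f has_derivative L) (at x)"
    unfolding has_derivative_at_alt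
  proof (intro conjI allI impI)
    show "bounded_linear L" unfolding L_def
      by (intro bounded_linear_sum bounded_linear_const_mult bounded_linear_vec_nth)
    fix e :: real assume e: "e > 0"
    \<comment> \<open>The summand 1 keeps \<open>M\<close> positive when \<open>f\<close> vanishes
      almost everywhere.\<close>
    define M where "M = (\<integral>y. \<bar>f y\<bar> \<partial>lebesgue) + 1"
    have M: "M > 0" by (simp add: M_def add_nonneg_pos)
    obtain d where d: "d > 0" "\<And>z h. norm h < d \<Longrightarrow> \<bar>k (z + h) - k z - classical_grad k z \<bullet> h\<bar> \<le> e / M * norm h"
      using test_functions_uniform_linearization[OF k, of "e/M"] e M by auto
    have "norm (conv k f y - conv k f x - L (y - x)) \<le> e * norm (y - x)" if y: "norm (y - x) < d" for y
    proof -
      define h where "h = y - x"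
      have i1: "integrable lebesgue (\<lambda>z. k (y - z) * f z - k (x - z) * f z)"
        by (rule Bochner_Integration.integrable_diff[OF conv_integrable[OF kc f] conv_integrable[OF kc f]])
      have "conv k f y - conv k f x = (\<integral>z. k (y - z) * f z - k (x - z) * f z \<partial>lebesgue)"
        unfolding conv_def by (rule Bochner_Integration.integral_diff[OF conv_integrable[OF kc f] conv_integrable[OF kc f], symmetric])
      then have "conv k f y - conv k f x - L h = (\<integral>z. (k (y - z) * f z - k (x - z) * f z) - (classical_grad k (x - z) \<bullet> h) * f z \<partial>lebesgue)"
        unfolding Lint(2) using Bochner_Integration.integral_diff[OF i1 Lint(1)] by simp
      also have "\<dots> = (\<integral>z. (k ((x - z) + h) - k (x - z) - classical_grad k (x - z) \<bullet> h) * f z \<partial>lebesgue)"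
        by (intro Bochner_Integration.integral_cong) (auto simp: h_def algebra_simps)
      finally have e1: "conv k f y - conv k f x - L h = (\<integral>z. (k ((x - z) + h) - k (x - z) - classical_grad k (x - z) \<bullet> h) * f z \<partial>lebesgue)" (is "_ = integral\<^sup>L _ ?g") .
      have gi: "integrable lebesgue ?g"
      proof -
        have "?g = (\<lambda>z. (k (y - z) * f z - k (x - z) * f z) - (classical_grad k (x - z) \<bullet> h) * f z)"
          by (auto simp: h_def algebra_simps)
        then show ?thesis using Bochner_Integration.integrable_diff[OF i1 Lint(1)[of h]] by simp
      qed
      have "\<bar>integral\<^sup>L lebesgue ?g\<bar> \<le> (\<integral>z. e / M * norm h * \<bar>f z\<bar> \<partial>lebesgue)"
      proof (rule order_trans[OF integral_abs_bound integral_mono])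
        show "integrable lebesgue (\<lambda>z. \<bar>?g z\<bar>)" using gi by (rule integrable_abs)
        show "integrable lebesgue (\<lambda>z. e / M * norm h * \<bar>f z\<bar>)" using f by simp
        show "\<bar>?g z\<bar> \<le> e / M * norm h * \<bar>f z\<bar>" for z
          unfolding abs_mult using d(2)[of h "x - z"] y by (intro mult_right_mono) (auto simp: h_def)
      qed
      also have "\<dots> = e / M * norm h * (M - 1)" by (simp add: M_def)
      also have "\<dots> \<le> e / M * norm h * M" using e M by (intro mult_left_mono) auto
      also have "\<dots> = e * norm h" using M by simp
      finally show ?thesis unfolding e1[unfolded h_def] by (simp add: h_def)
    qed
    then show "\<exists>d>0. \<forall>y. norm (y - x) < d \<longrightarrow> norm (conv k f y - conv k f x - L (y - x)) \<le> e * norm (y - x)"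
      using d(1) by blast
  qed
  then show ?thesis unfolding L_def .
qed

lemma classical_grad_conv:
  assumes "k \<in> test_functions UNIV" "integrable lebesgue f"
  shows "classical_grad (conv k f) x $ i = conv (\<lambda>x. classical_grad k x $ i) f x"
  using classical_grad_eq[OF conv_has_derivative[OF assms], of x i] by (simp add: axis_def if_distrib cong: if_cong)

text \<open>Every derivative falls on the kernel, and the partial derivatives of a test function are
  test functions; hence the induction over arbitrary kernels.\<close>

lemma Ck_on_conv:
  assumes "k \<in> test_functions UNIV" "integrable lebesgue f"
  shows "Ck_on j UNIV (conv k f)"
  using assms(1)
proof (induction j arbitrary: k)
  case 0
  have "continuous (at x) (conv k f)" for x
    using conv_has_derivative[OF 0 assms(2)] has_derivative_continuous by blast
  then show ?case by (auto intro: continuous_at_imp_continuous_on)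
next
  case (Suc j)
  have "conv k f differentiable (at x)" for x
    using conv_has_derivative[OF Suc.prems assms(2)] differentiable_def by blast
  moreover have "Ck_on j UNIV (\<lambda>x. classical_grad (conv k f) x $ i)" for i
    unfolding classical_grad_conv[OF Suc.prems assms(2)]
    by (rule Suc.IH[OF test_functions_UNIV_D(3)[OF Suc.prems]])
  ultimately show ?case by simp
qed

section \<open>Mollifiers\<close>

text \<open>The standard mollifier: the bump \<open>exp (- 1 / (e\<^sup>2 - |x|\<^sup>2))\<close> of
  the ball of radius \<open>e\<close>, normalised to integral 1.\<close>

definition moll :: "real \<Rightarrow> real^'n \<Rightarrow> real" where
  "moll e x = exp_inv 0 (e\<^sup>2 - x \<bullet> x) / (\<integral>y. exp_inv 0 (e\<^sup>2 - y \<bullet> y) \<partial>(lebesgue :: (real^'n) measure))"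

definition mollify :: "real \<Rightarrow> (real^'n \<Rightarrow> real) \<Rightarrow> real^'n \<Rightarrow> real" where
  "mollify e = conv (moll e)"

lemma integrable_indicator_cball: "integrable lebesgue (\<lambda>x::real^'n. indicator (cball a r) x * (c::real))"
  using lmeasurable_cball[of a r]
  by (intro integrable_mult_left integrable_real_indicator) (auto simp: fmeasurable_def)

lemma exp_inv_ball_zero:
  fixes x :: "real^'n"
  assumes "0 \<le> e" "e \<le> norm x" shows "exp_inv m (e\<^sup>2 - x \<bullet> x) = 0"
proof -
  have "e\<^sup>2 \<le> (norm x)\<^sup>2" using assms by (intro power_mono) auto
  then show ?thesis by (simp add: exp_inv_def power2_norm_eq_inner)
qed

lemma exp_inv_ball_Cc:
  assumes "0 < e" shows "(\<lambda>x::real^'n. exp_inv 0 (e\<^sup>2 - x \<bullet> x)) \<in> Cc UNIV"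
  by (rule Cc_UNIV_I[of _ e]) (use exp_inv_ball_Ck[of 0 0 "e\<^sup>2"] assms in \<open>auto intro: exp_inv_ball_zero\<close>)

lemma exp_inv_ball_integral_pos:
  assumes e: "0 < e" shows "(\<integral>y. exp_inv 0 (e\<^sup>2 - y \<bullet> y) \<partial>(lebesgue :: (real^'n) measure)) > 0"
proof -
  define c where "c = exp_inv 0 (e\<^sup>2 - (e/2)\<^sup>2)"
  have e2: "(e/2)\<^sup>2 < e\<^sup>2" using e by (simp add: power_divide)
  then have c: "c > 0" by (simp add: c_def exp_inv_def)
  have "c * measure lebesgue (ball (0::real^'n) (e/2)) = (\<integral>y. indicator (ball 0 (e/2)) y * c \<partial>(lebesgue :: (real^'n) measure))"
    by simp
  also have "\<dots> \<le> (\<integral>y. exp_inv 0 (e\<^sup>2 - y \<bullet> y) \<partial>(lebesgue :: (real^'n) measure))"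
  proof (rule integral_mono)
    show "integrable lebesgue (\<lambda>y::real^'n. indicator (ball 0 (e/2)) y * c)"
      using lmeasurable_ball[of "0::real^'n" "e/2"]
      by (intro integrable_mult_left integrable_real_indicator) (auto simp: fmeasurable_def)
    show "integrable lebesgue (\<lambda>y::real^'n. exp_inv 0 (e\<^sup>2 - y \<bullet> y))"
      by (rule Cc_UNIV_integrable[OF exp_inv_ball_Cc[OF e]])
    fix y :: "real^'n"
    show "indicator (ball 0 (e/2)) y * c \<le> exp_inv 0 (e\<^sup>2 - y \<bullet> y)"
    proof (cases "norm y < e/2")
      case True
      then have "(norm y)\<^sup>2 \<le> (e/2)\<^sup>2" by (intro power_mono) auto
      then have "e\<^sup>2 - (e/2)\<^sup>2 \<le> e\<^sup>2 - y \<bullet> y" by (simp add: power2_norm_eq_inner)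
      then have "c \<le> exp_inv 0 (e\<^sup>2 - y \<bullet> y)" unfolding c_def using e2
        by (simp add: exp_inv_def frac_le)
      then show ?thesis using True by simp
    qed (simp add: exp_inv_def)
  qed
  finally have "c * measure lebesgue (ball (0::real^'n) (e/2)) \<le> (\<integral>y. exp_inv 0 (e\<^sup>2 - y \<bullet> y) \<partial>(lebesgue :: (real^'n) measure))" .
  moreover have "c * measure lebesgue (ball (0::real^'n) (e/2)) > 0"
    using c content_ball_pos[of "e/2" "0::real^'n"] e by simp
  ultimately show ?thesis by linarith
qed

lemma moll_nonneg: "0 < e \<Longrightarrow> 0 \<le> moll e x"
  unfolding moll_def using exp_inv_ball_integral_pos[of e] by (simp add: exp_inv_def)

lemma moll_zero: "0 < e \<Longrightarrow> e \<le> norm x \<Longrightarrow> moll e x = 0"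
  unfolding moll_def using exp_inv_ball_zero[of e x 0] by simp

lemma moll_integral:
  assumes "0 < e" shows "(\<integral>x. moll e x \<partial>(lebesgue :: (real^'n) measure)) = 1"
  unfolding moll_def using exp_inv_ball_integral_pos[OF assms, where 'n='n] by simp

lemma moll_test:
  assumes "0 < e" shows "(moll e :: real^'n \<Rightarrow> real) \<in> test_functions UNIV"
proof -
  have "Ck_on k UNIV (moll e :: real^'n \<Rightarrow> real)" for k
    using Ck_on_mult[OF open_UNIV exp_inv_ball_Ck[where 'n='n and c = "e\<^sup>2" and m = 0] Ck_on_const[OF open_UNIV],
        of k "1 / (\<integral>y. exp_inv 0 (e\<^sup>2 - y \<bullet> y) \<partial>(lebesgue :: (real^'n) measure))"]
    by (simp add: moll_def[abs_def])
  then show ?thesis using assms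
    by (auto simp: test_functions_def compact_support_in_def intro!: exI[of _ "cball 0 e"] moll_zero)
qed

lemma moll_Cc: "0 < e \<Longrightarrow> moll e \<in> Cc UNIV"
  by (rule test_functions_UNIV_D(1)[OF moll_test])

lemma moll_grad_zero:
  fixes x :: "real^'n"
  assumes "0 < e" "e \<le> norm x" shows "classical_grad (moll e) x $ i = 0"
proof -
  define c where "c = (\<integral>y. exp_inv 0 (e\<^sup>2 - y \<bullet> y) \<partial>(lebesgue :: (real^'n) measure))"
  have "(moll e has_derivative (\<lambda>h. ((exp_inv 2 (e\<^sup>2 - x \<bullet> x)) * (- 2 * (x \<bullet> h))) / c)) (at x)"
    using has_derivative_divide'[OF exp_inv_ball_deriv[of 0 "e\<^sup>2" x] has_derivative_const, of c]
      exp_inv_ball_integral_pos[OF assms(1), where 'n='n]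
    unfolding moll_def[abs_def] c_def[symmetric] by (simp add: numeral_2_eq_2)
  from classical_grad_eq[OF this, of i] show ?thesis
    using exp_inv_ball_zero[of e x 2] assms by simp
qed

lemma mollify_local:
  assumes "0 < e" "integrable lebesgue f" "\<And>y. dist y x < e \<Longrightarrow> \<bar>f y - c\<bar> \<le> d"
  shows "\<bar>mollify e f x - c\<bar> \<le> d"
  unfolding mollify_def
  by (rule conv_local[OF moll_Cc]) (use assms moll_nonneg moll_integral moll_zero in auto)

text \<open>Being in \<open>[a, b]\<close> means being within half its length of the
  midpoint.\<close>

lemma mollify_local_bounds:
  assumes "0 < e" "integrable lebesgue f" "\<And>y. dist y x < e \<Longrightarrow> a \<le> f y \<and> f y \<le> b"
  shows "a \<le> mollify e f x" "mollify e f x \<le> b"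
proof -
  have "\<bar>mollify e f x - (a+b)/2\<bar> \<le> (b-a)/2"
  proof (rule mollify_local[OF assms(1,2)])
    show "\<bar>f y - (a + b) / 2\<bar> \<le> (b - a) / 2" if "dist y x < e" for y
      using assms(3)[OF that] unfolding abs_le_iff by (auto simp: field_simps)
  qed
  then show "a \<le> mollify e f x" "mollify e f x \<le> b" unfolding abs_le_iff by (auto simp: field_simps)
qed

lemma mollify_cong_local:
  assumes "0 < e" "\<And>y. dist y x < e \<Longrightarrow> f y = g y"
  shows "mollify e f x = mollify e g x"
  unfolding mollify_def conv_def
proof (rule Bochner_Integration.integral_cong)
  fix y
  show "moll e (x - y) * f y = moll e (x - y) * g y"
    using assms(2)[of y] moll_zero[OF assms(1), of "x - y"] by (cases "dist y x < e") (auto simp: dist_norm norm_minus_commute)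
qed simp

lemma integral_mollify:
  assumes "0 < e" "integrable lebesgue f"
  shows "integrable lebesgue (mollify e f)" "(\<integral>x. mollify e f x \<partial>lebesgue) = (\<integral>x. f x \<partial>lebesgue)"
  using integral_conv[OF moll_Cc[OF assms(1)] assms(2)] moll_integral[OF assms(1)] by (auto simp: mollify_def)

lemma mollify_diff:
  assumes "0 < e" "integrable lebesgue f" "integrable lebesgue g"
  shows "mollify e (\<lambda>x. f x - g x) x = mollify e f x - mollify e g x"
  unfolding mollify_def by (rule conv_diff[OF moll_Cc]) (use assms in auto)

lemma mollify_abs_le:
  assumes "0 < e" "integrable lebesgue f"
  shows "\<bar>mollify e f x\<bar> \<le> mollify e (\<lambda>x. \<bar>f x\<bar>) x"
  unfolding mollify_def by (rule conv_abs_le[OF moll_Cc]) (use assms moll_nonneg in auto)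

lemma mollify_mono:
  assumes "0 < e" "integrable lebesgue f" "integrable lebesgue g" "\<And>x. f x \<le> g x"
  shows "mollify e f x \<le> mollify e g x"
  unfolding mollify_def by (rule conv_mono[OF moll_Cc]) (use assms moll_nonneg in auto)

lemma mollify_Ck: "0 < e \<Longrightarrow> integrable lebesgue f \<Longrightarrow> Ck_on j UNIV (mollify e f)"
  unfolding mollify_def by (rule Ck_on_conv[OF moll_test])

lemma mollify_continuous: "0 < e \<Longrightarrow> integrable lebesgue f \<Longrightarrow> continuous_on UNIV (mollify e f)"
  using mollify_Ck[of e f 0] by simp

lemma mollify_differentiable: "0 < e \<Longrightarrow> integrable lebesgue f \<Longrightarrow> mollify e f differentiable (at x)"
  using mollify_Ck[of e f 1] by simp

section \<open>Density of continuous functions and convergence of mollifications\<close>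

lemma integral_lebesgue_tendsto:
  fixes f :: "real^'n \<Rightarrow> real"
  assumes f: "f \<in> borel_measurable lebesgue" and s: "\<And>i. s i \<in> borel_measurable lebesgue"
    and w: "integrable lebesgue w" and lim: "AE x in lebesgue. (\<lambda>i. s i x) \<longlonglongrightarrow> f x"
    and bd: "\<And>i x. \<bar>s i x - f x\<bar> \<le> w x"
  shows "(\<lambda>i. \<integral>x. \<bar>s i x - f x\<bar> \<partial>lebesgue) \<longlonglongrightarrow> 0"
proof -
  have "(\<lambda>i. \<integral>x. \<bar>s i x - f x\<bar> \<partial>lebesgue) \<longlonglongrightarrow> (\<integral>x. 0 \<partial>(lebesgue :: (real^'n) measure))"
  proof (rule integral_dominated_convergence[where w = w])
    show "AE x in lebesgue. (\<lambda>i. \<bar>s i x - f x\<bar>) \<longlonglongrightarrow> 0"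
      using lim by eventually_elim (auto intro: tendsto_rabs_zero simp: LIM_zero_iff)
  qed (use f s w bd in auto)
  then show ?thesis by simp
qed

text \<open>First \<open>f\<close> is truncated in height and radius; the truncated function is then
  approximated by continuous functions whose bounds and supports are forced to match it.\<close>

lemma integrable_L1_dense:
  fixes f :: "real^'n \<Rightarrow> real"
  assumes f: "integrable lebesgue f" and e: "e > 0"
  shows "\<exists>g\<in>Cc UNIV. (\<integral>x. \<bar>f x - g x\<bar> \<partial>lebesgue) < e"
proof -
  define t where "t k x = (if norm x \<le> real k then max (- real k) (min (real k) (f x)) else 0)" for k x
  have fm: "f \<in> borel_measurable lebesgue" using f by auto
  have tm: "t k \<in> borel_measurable lebesgue" for k
  proof -
    have "t k = (\<lambda>x. indicator (cball 0 (real k)) x * max (- real k) (min (real k) (f x)))"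
      by (auto simp: t_def)
    then show ?thesis using fm
      by (auto intro!: borel_measurable_times borel_measurable_indicator borel_measurable_max borel_measurable_min)
  qed
  have "(\<lambda>k. \<integral>x. \<bar>t k x - f x\<bar> \<partial>lebesgue) \<longlonglongrightarrow> 0"
  proof (rule integral_lebesgue_tendsto[OF fm tm, of "\<lambda>x. \<bar>f x\<bar>"])
    show "AE x in lebesgue. (\<lambda>i. t i x) \<longlonglongrightarrow> f x"
    proof (rule AE_I2)
      fix x
      obtain N where N: "max (norm x) \<bar>f x\<bar> \<le> real N" using real_arch_simple by blast
      have "t i x = f x" if "i \<ge> N" for i
      proof -
        have "real N \<le> real i" using that by simp
        then show ?thesis using N by (auto simp: t_def)
      qed
      then show "(\<lambda>i. t i x) \<longlonglongrightarrow> f x" by (intro tendsto_eventually eventually_sequentiallyI)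
    qed
    show "\<bar>t i x - f x\<bar> \<le> \<bar>f x\<bar>" for i x by (auto simp: t_def)
  qed (use f in auto)
  then have "\<forall>\<^sub>F k in sequentially. (\<integral>x. \<bar>t k x - f x\<bar> \<partial>lebesgue) < e/2"
    by (rule order_tendstoD) (use e in simp)
  then obtain k where k: "(\<integral>x. \<bar>t k x - f x\<bar> \<partial>lebesgue) < e/2" by (auto simp: eventually_sequentially)
  have ti: "integrable lebesgue (t k)"
    by (rule integrable_lebesgue_bounded_support[OF tm, of k "real k" "cball 0 (real k)"]) (auto simp: t_def)
  \<comment> \<open>A Lebesgue measurable function is an almost everywhere limit of continuous
    functions.\<close>
  obtain N g where N: "negligible N" and g: "\<And>n. continuous_on UNIV (g n)" and
    gl: "\<And>x. x \<notin> N \<Longrightarrow> (\<lambda>n. g n x) \<longlonglongrightarrow> t k x"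
    using lebesgue_measurable_imp_measurable_on[OF tm, of UNIV k] unfolding measurable_on_def by auto
  define \<zeta> where "\<zeta> x = max 0 (min 1 (real k + 1 - norm x))" for x :: "real^'n"
  \<comment> \<open>Clipping and the cut-off \<open>\<zeta>\<close> make the convergence dominated.
    They do not change the limit \<open>t k\<close>, which is bounded by \<open>k\<close> and
    vanishes outside the ball of radius \<open>k\<close>, where \<open>\<zeta> = 1\<close>.\<close>
  define h where "h n x = max (- real k) (min (real k) (g n x)) * \<zeta> x" for n x
  have hc: "continuous_on UNIV (h n)" for n unfolding h_def \<zeta>_def by (intro continuous_intros g)
  have hC: "h n \<in> Cc UNIV" for n
    by (rule Cc_UNIV_I[OF hc, of "real k + 1"]) (auto simp: h_def \<zeta>_def)
  have "(\<lambda>n. \<integral>x. \<bar>h n x - t k x\<bar> \<partial>lebesgue) \<longlonglongrightarrow> 0"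
  proof (rule integral_lebesgue_tendsto[OF tm, of _ "\<lambda>x. indicator (cball 0 (real k + 1)) x * (2 * real k)"])
    show "h n \<in> borel_measurable lebesgue" for n by (rule continuous_imp_measurable_lebesgue[OF hc])
    show "integrable lebesgue (\<lambda>x::real^'n. indicator (cball 0 (real k + 1)) x * (2 * real k))"
      by (rule integrable_indicator_cball)
    have "AE x in lebesgue. x \<notin> N" using N by (simp add: AE_not_in negligible_iff_null_sets)
    then show "AE x in lebesgue. (\<lambda>i. h i x) \<longlonglongrightarrow> t k x"
    proof eventually_elim
      case (elim x)
      have "(\<lambda>i. h i x) \<longlonglongrightarrow> max (- real k) (min (real k) (t k x)) * \<zeta> x"
        unfolding h_def by (intro tendsto_intros gl elim)
      moreover have "max (- real k) (min (real k) (t k x)) * \<zeta> x = t k x" by (auto simp: t_def \<zeta>_def)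
      ultimately show ?case by simp
    qed
    fix i and x :: "real^'n"
    have "\<bar>h i x\<bar> \<le> real k * 1" unfolding h_def abs_mult by (intro mult_mono) (auto simp: \<zeta>_def)
    moreover have "\<bar>t k x\<bar> \<le> real k" by (auto simp: t_def)
    moreover have "norm x > real k + 1 \<Longrightarrow> h i x = 0 \<and> t k x = 0" by (auto simp: h_def t_def \<zeta>_def)
    ultimately show "\<bar>h i x - t k x\<bar> \<le> indicator (cball 0 (real k + 1)) x * (2 * real k)"
      by (cases "norm x \<le> real k + 1") auto
  qed
  then have "\<forall>\<^sub>F n in sequentially. (\<integral>x. \<bar>h n x - t k x\<bar> \<partial>lebesgue) < e/2"
    by (rule order_tendstoD) (use e in simp)
  then obtain n where n: "(\<integral>x. \<bar>h n x - t k x\<bar> \<partial>lebesgue) < e/2" by (auto simp: eventually_sequentially)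
  have hi: "integrable lebesgue (h n)" by (rule Cc_UNIV_integrable[OF hC])
  have "(\<integral>x. \<bar>f x - h n x\<bar> \<partial>lebesgue) \<le> (\<integral>x. \<bar>t k x - f x\<bar> + \<bar>h n x - t k x\<bar> \<partial>lebesgue)"
    using f ti hi by (intro integral_mono) auto
  also have "\<dots> < e" using k n f ti hi by simp
  finally show ?thesis using hC by blast
qed

text \<open>The scales of all mollifications that pass to a limit; a sequence, since dominated
  convergence is applied along it.\<close>

definition eps :: "nat \<Rightarrow> real" where "eps n = inverse (real (Suc n))"

lemma eps_pos [simp]: "0 < eps n" by (simp add: eps_def)

lemma eps_tendsto: "eps \<longlonglongrightarrow> 0"
  unfolding eps_def[abs_def] by (rule LIMSEQ_inverse_real_of_nat)

lemma eventually_eps_less: "0 < e \<Longrightarrow> \<forall>\<^sub>F n in sequentially. eps n < e"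
  using order_tendstoD(2)[OF eps_tendsto] .

lemma mollify_L1_le:
  assumes "0 < e" "integrable lebesgue f"
  shows "(\<integral>x. \<bar>mollify e f x\<bar> \<partial>lebesgue) \<le> (\<integral>x. \<bar>f x\<bar> \<partial>lebesgue)"
proof -
  have "(\<integral>x. \<bar>mollify e f x\<bar> \<partial>lebesgue) \<le> (\<integral>x. mollify e (\<lambda>x. \<bar>f x\<bar>) x \<partial>lebesgue)"
    using assms integral_mollify[OF assms] integral_mollify[of e "\<lambda>x. \<bar>f x\<bar>"] mollify_abs_le[OF assms]
    by (intro integral_mono) auto
  then show ?thesis using integral_mollify[of e "\<lambda>x. \<bar>f x\<bar>"] assms by simp
qed

text \<open>Density and contraction: the difference \<open>f - g\<close> costs \<open>r/3\<close>
  twice. For \<open>g\<close> uniform continuity suffices, because at scales below 1 both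
  \<open>g\<close> and its mollification vanish outside the ball of radius
  \<open>R+1\<close>.\<close>

lemma mollify_L1_tendsto:
  fixes f :: "real^'n \<Rightarrow> real"
  assumes f: "integrable lebesgue f"
  shows "(\<lambda>n. \<integral>x. \<bar>mollify (eps n) f x - f x\<bar> \<partial>lebesgue) \<longlonglongrightarrow> 0"
proof (rule LIMSEQ_I)
  fix r :: real assume r: "r > 0"
  obtain g where g: "g \<in> Cc UNIV" and fg: "(\<integral>x. \<bar>f x - g x\<bar> \<partial>lebesgue) < r/3"
    using integrable_L1_dense[OF f, of "r/3"] r by auto
  have gi: "integrable lebesgue g" by (rule Cc_UNIV_integrable[OF g])
  obtain R where R: "R > 0" "\<And>x. norm x > R \<Longrightarrow> g x = 0" using Cc_UNIV_D[OF g] by auto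
  define m where "m = measure lebesgue (cball (0::real^'n) (R+1))"
  have m: "m \<ge> 0" by (simp add: m_def)
  define d where "d = r / 3 / (m + 1)"
  have d: "d > 0" "d * m < r/3" using r m by (auto simp: d_def field_simps)
  obtain s where s: "s > 0" "\<And>x y. dist x y < s \<Longrightarrow> \<bar>g x - g y\<bar> < d"
    using Cc_UNIV_uniformly_continuous[OF g d(1)] by auto
  have "\<forall>\<^sub>F n in sequentially. eps n < min s 1" by (rule eventually_eps_less) (use s in auto)
  then have "\<forall>\<^sub>F n in sequentially. (\<integral>x. \<bar>mollify (eps n) f x - f x\<bar> \<partial>lebesgue) < r"
  proof eventually_elim
    case (elim n)
    have b: "\<bar>mollify (eps n) g x - g x\<bar> \<le> indicator (cball 0 (R+1)) x * d" for x
    proof (cases "norm x \<le> R + 1")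
      case True
      have "\<bar>mollify (eps n) g x - g x\<bar> \<le> d"
        using s(2) elim by (intro mollify_local[OF eps_pos gi]) (auto intro: less_imp_le)
      then show ?thesis using True by simp
    next
      case False
      have "\<bar>mollify (eps n) g x - 0\<bar> \<le> 0"
      proof (rule mollify_local[OF eps_pos gi])
        fix y assume "dist y x < eps n"
        then have "norm y > R" using False elim norm_triangle_ineq2[of x y] by (simp add: dist_norm norm_minus_commute)
        then show "\<bar>g y - 0\<bar> \<le> 0" using R by simp
      qed
      then show ?thesis using False R by simp
    qed
    have fgi: "integrable lebesgue (\<lambda>x. f x - g x)" using f gi by simp
    have "(\<integral>x. \<bar>mollify (eps n) f x - f x\<bar> \<partial>lebesgue)
      \<le> (\<integral>x. \<bar>mollify (eps n) (\<lambda>x. f x - g x) x\<bar> + indicator (cball 0 (R+1)) x * d + \<bar>f x - g x\<bar> \<partial>lebesgue)"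
    proof (rule integral_mono)
      show "integrable lebesgue (\<lambda>x. \<bar>mollify (eps n) f x - f x\<bar>)" using f integral_mollify[OF eps_pos f, of n] by simp
      have "integrable lebesgue (\<lambda>x::real^'n. indicator (cball 0 (R+1)) x * d)"
        by (rule integrable_indicator_cball)
      then show "integrable lebesgue (\<lambda>x. \<bar>mollify (eps n) (\<lambda>x. f x - g x) x\<bar> + indicator (cball 0 (R+1)) x * d + \<bar>f x - g x\<bar>)"
        using fgi integral_mollify[OF eps_pos fgi, of n] by simp
      show "\<bar>mollify (eps n) f x - f x\<bar> \<le> \<bar>mollify (eps n) (\<lambda>x. f x - g x) x\<bar> + indicator (cball 0 (R+1)) x * d + \<bar>f x - g x\<bar>" for x
        using b[of x] mollify_diff[OF eps_pos f gi, of n x] by linarith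
    qed
    also have "\<dots> = (\<integral>x. \<bar>mollify (eps n) (\<lambda>x. f x - g x) x\<bar> \<partial>lebesgue) + m * d + (\<integral>x. \<bar>f x - g x\<bar> \<partial>lebesgue)"
    proof -
      have "integrable lebesgue (\<lambda>x::real^'n. indicator (cball 0 (R+1)) x * d)"
        by (rule integrable_indicator_cball)
      then show ?thesis using fgi integral_mollify[OF eps_pos fgi, of n] by (simp add: m_def)
    qed
    also have "\<dots> < r" using mollify_L1_le[OF eps_pos fgi, of n] fg d(2) by (simp add: mult.commute)
    finally show ?case .
  qed
  then show "\<exists>no. \<forall>n\<ge>no. norm ((\<integral>x. \<bar>mollify (eps n) f x - f x\<bar> \<partial>lebesgue) - 0) < r"
    by (auto simp: eventually_sequentially)
qed

lemma mollify_tendsto: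
  assumes f: "integrable lebesgue f" and c: "isCont f x"
  shows "(\<lambda>n. mollify (eps n) f x) \<longlonglongrightarrow> f x"
proof (rule LIMSEQ_I)
  fix r :: real assume r: "r > 0"
  obtain d where d: "d > 0" "\<And>y. dist y x < d \<Longrightarrow> \<bar>f y - f x\<bar> < r/2"
    using c r unfolding continuous_at_eps_delta by (metis dist_norm real_norm_def half_gt_zero)
  have "\<forall>\<^sub>F n in sequentially. norm (mollify (eps n) f x - f x) < r"
    using eventually_eps_less[OF d(1)]
  proof eventually_elim
    case (elim n)
    have "\<bar>mollify (eps n) f x - f x\<bar> \<le> r/2"
      using d(2) elim by (intro mollify_local[OF eps_pos f]) (auto intro: less_imp_le)
    then show ?case using r by simp
  qed
  then show "\<exists>no. \<forall>n\<ge>no. norm (mollify (eps n) f x - f x) < r" by (simp add: eventually_sequentially)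
qed

section \<open>Weak gradients\<close>

text \<open>Room for mollification: at scales below \<open>d\<close> a mollification at a point of
  \<open>K\<close> only reads values inside \<open>K1\<close>.\<close>

lemma compact_neighbourhood:
  fixes \<Omega> :: "(real^'n) set"
  assumes "open \<Omega>" "compact K" "K \<subseteq> \<Omega>"
  obtains d K1 where "d > 0" "compact K1" "K1 \<subseteq> \<Omega>" "\<And>x. x \<in> K \<Longrightarrow> cball x d \<subseteq> K1" "K \<subseteq> K1"
proof -
  obtain e where e: "e > 0" "(\<Union>x\<in>K. ball x e) \<subseteq> \<Omega>"
    by (rule compact_subset_open_imp_ball_epsilon_subset[OF assms(2,1,3)])
  define K1 where "K1 = {x + y | x y. x \<in> K \<and> y \<in> cball 0 (e/2)}"
  have K1c: "compact K1" unfolding K1_def by (rule compact_sums[OF assms(2) compact_cball])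
  have c: "cball x (e/2) \<subseteq> K1" if "x \<in> K" for x
  proof
    fix y assume "y \<in> cball x (e/2)"
    then have "y = x + (y - x)" "y - x \<in> cball 0 (e/2)" by (auto simp: dist_norm norm_minus_commute)
    then show "y \<in> K1" unfolding K1_def mem_Collect_eq using that by blast
  qed
  have K1O: "K1 \<subseteq> \<Omega>"
  proof
    fix z assume "z \<in> K1"
    then obtain x y where z: "z = x + y" "x \<in> K" "norm y \<le> e/2" by (auto simp: K1_def)
    then have "z \<in> ball x e" using e by (auto simp: dist_norm)
    then show "z \<in> \<Omega>" using e(2) z(2) by blast
  qed
  have KK1: "K \<subseteq> K1"
  proof
    fix x assume "x \<in> K"
    then show "x \<in> K1" using subsetD[OF c, of x x] e(1) by simp
  qed
  show ?thesis by (rule that[OF _ K1c K1O c KK1]) (use e(1) in simp)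
qed

lemma L1_loc_integrable:
  assumes "f \<in> L1_loc \<Omega>" "compact K" "K \<subseteq> \<Omega>"
  shows "integrable lebesgue (\<lambda>x. indicat_real K x * f x)"
proof -
  have "\<forall>K. compact K \<and> K \<subseteq> \<Omega> \<longrightarrow> set_integrable lebesgue K f" using assms(1) unfolding L1_loc_def mem_Collect_eq .
  then have "set_integrable lebesgue K f" using assms(2,3) by blast
  then show ?thesis unfolding set_integrable_def real_scaleR_def .
qed

lemma L1_loc_subset: "f \<in> L1_loc \<Omega> \<Longrightarrow> S \<subseteq> \<Omega> \<Longrightarrow> f \<in> L1_loc S"
  unfolding L1_loc_def mem_Collect_eq by (meson order_trans)

lemma compact_sets_lebesgue: "compact K \<Longrightarrow> (K :: (real^'n) set) \<in> sets lebesgue"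
  by (rule fmeasurableD[OF lmeasurable_compact])

lemma continuous_on_indicator_measurable:
  fixes f :: "real^'n \<Rightarrow> real"
  assumes "compact K" "continuous_on K f"
  shows "(\<lambda>x. indicat_real K x * f x) \<in> borel_measurable lebesgue"
proof -
  have "f \<in> borel_measurable (lebesgue_on K)"
    by (rule continuous_imp_measurable_on_sets_lebesgue[OF assms(2) compact_sets_lebesgue[OF assms(1)]])
  moreover have "K \<in> sets lebesgue" by (rule compact_sets_lebesgue[OF assms(1)])
  ultimately show ?thesis
    using borel_measurable_restrict_space_iff[of K lebesgue f] by simp
qed

lemma continuous_on_compact_bounded:
  fixes f :: "'a::topological_space \<Rightarrow> real"
  assumes "compact K" "continuous_on K f"
  obtains B where "B > 0" "\<And>x. x \<in> K \<Longrightarrow> \<bar>f x\<bar> \<le> B"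
proof -
  have "bounded (f ` K)" using compact_continuous_image[OF assms(2,1)] by (rule compact_imp_bounded)
  then show ?thesis using that unfolding bounded_pos by auto
qed

lemma L1_loc_mult_integrable:
  fixes f g :: "real^'n \<Rightarrow> real"
  assumes "f \<in> L1_loc \<Omega>" "compact K" "K \<subseteq> \<Omega>" "continuous_on K g"
  shows "integrable lebesgue (\<lambda>x. indicat_real K x * (g x * f x))"
proof -
  obtain B where B: "B > 0" "\<And>x. x \<in> K \<Longrightarrow> \<bar>g x\<bar> \<le> B" using continuous_on_compact_bounded[OF assms(2,4)] by auto
  have "integrable lebesgue (\<lambda>x. (indicat_real K x * g x) * (indicat_real K x * f x))"
  proof (rule integrable_bounded_mult[OF L1_loc_integrable[OF assms(1-3)] continuous_on_indicator_measurable[OF assms(2,4)]])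
    show "\<bar>indicat_real K x * g x\<bar> \<le> B" for x using B by (cases "x \<in> K") auto
  qed
  moreover have "(\<lambda>x. (indicat_real K x * g x) * (indicat_real K x * f x)) = (\<lambda>x. indicat_real K x * (g x * f x))"
    by (auto simp: indicator_def)
  ultimately show ?thesis by simp
qed

lemma L1_loc_mult:
  assumes "f \<in> L1_loc \<Omega>" "continuous_on \<Omega> g"
  shows "(\<lambda>x. g x * f x) \<in> L1_loc \<Omega>"
  using L1_loc_mult_integrable[OF assms(1) _ _ continuous_on_subset[OF assms(2)]]
  by (auto simp: L1_loc_def set_integrable_def)

lemma L1_loc_const: "(\<lambda>x. c) \<in> L1_loc \<Omega>"
proof -
  have "integrable lebesgue (\<lambda>x. indicat_real K x *\<^sub>R c)" if "compact K" for K :: "(real^'n) set"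
    using lmeasurable_compact[OF that] by (intro integrable_scaleR_left integrable_real_indicator) (auto simp: fmeasurable_def)
  then show ?thesis by (auto simp: L1_loc_def set_integrable_def)
qed

lemma L1_loc_continuous: "continuous_on \<Omega> g \<Longrightarrow> g \<in> L1_loc \<Omega>"
  using L1_loc_mult[OF L1_loc_const[of 1]] by simp

lemma L1_loc_add: "f \<in> L1_loc \<Omega> \<Longrightarrow> g \<in> L1_loc \<Omega> \<Longrightarrow> (\<lambda>x. f x + g x) \<in> L1_loc \<Omega>"
  by (auto simp: L1_loc_def intro: set_integral_add)

lemma L1_loc_cmult: "f \<in> L1_loc \<Omega> \<Longrightarrow> (\<lambda>x. c * f x) \<in> L1_loc \<Omega>"
  by (rule L1_loc_mult) auto

lemma set_integral_support:
  fixes f :: "real^'n \<Rightarrow> real"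
  assumes "K \<subseteq> \<Omega>" "\<And>x. x \<in> \<Omega> - K \<Longrightarrow> f x = 0"
  shows "(LINT x:\<Omega>|lebesgue. f x) = (\<integral>x. indicat_real K x * f x \<partial>lebesgue)"
    "set_integrable lebesgue \<Omega> f \<longleftrightarrow> integrable lebesgue (\<lambda>x. indicat_real K x * f x)"
proof -
  have "(\<lambda>x. indicat_real \<Omega> x *\<^sub>R f x) = (\<lambda>x. indicat_real K x * f x)"
  proof
    fix x show "indicat_real \<Omega> x *\<^sub>R f x = indicat_real K x * f x"
      using assms(2)[of x] subsetD[OF assms(1), of x] by (cases "x \<in> K"; cases "x \<in> \<Omega>") auto
  qed
  then show "(LINT x:\<Omega>|lebesgue. f x) = (\<integral>x. indicat_real K x * f x \<partial>lebesgue)"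
    "set_integrable lebesgue \<Omega> f \<longleftrightarrow> integrable lebesgue (\<lambda>x. indicat_real K x * f x)"
    by (simp_all add: set_lebesgue_integral_def set_integrable_def)
qed

lemma L1_loc_set_integrable:
  assumes "f \<in> L1_loc \<Omega>" "continuous_on \<Omega> g" "compact K" "K \<subseteq> \<Omega>" "\<And>x. x \<in> \<Omega> - K \<Longrightarrow> g x = 0"
  shows "set_integrable lebesgue \<Omega> (\<lambda>x. f x * g x)"
  using L1_loc_mult_integrable[OF assms(1,3,4) continuous_on_subset[OF assms(2,4)]] assms(4,5)
  by (subst set_integral_support(2)[of K]) (auto simp: mult_ac)

lemma test_functions_D:
  assumes "\<phi> \<in> test_functions \<Omega>"
  shows "continuous_on \<Omega> \<phi>" "\<And>x. x \<in> \<Omega> \<Longrightarrow> \<phi> differentiable (at x)"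
    "\<And>i. continuous_on \<Omega> (\<lambda>x. classical_grad \<phi> x $ i)"
proof -
  have "Ck_on 1 \<Omega> \<phi>" "Ck_on 0 \<Omega> \<phi>" using assms by (simp_all add: test_functions_def del: Ck_on.simps)
  then show "continuous_on \<Omega> \<phi>" "\<And>x. x \<in> \<Omega> \<Longrightarrow> \<phi> differentiable (at x)"
    "\<And>i. continuous_on \<Omega> (\<lambda>x. classical_grad \<phi> x $ i)" by auto
qed

lemma classical_grad_zero_outside:
  fixes \<phi> :: "real^'n \<Rightarrow> real"
  assumes "open \<Omega>" "compact K" "\<And>x. x \<in> \<Omega> - K \<Longrightarrow> \<phi> x = 0" "x \<in> \<Omega> - K"
  shows "classical_grad \<phi> x = 0"
proof -
  have "open (\<Omega> - K)" using assms by (auto intro: open_Diff compact_imp_closed)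
  then have "classical_grad \<phi> x = classical_grad (\<lambda>_. 0) x"
    using assms by (intro classical_grad_cong_open[of "\<Omega> - K"]) auto
  then show ?thesis using classical_grad_eq[of "\<lambda>_. 0" "\<lambda>_. 0" x] by (simp add: vec_eq_iff)
qed

lemma test_functions_support:
  assumes "\<phi> \<in> test_functions \<Omega>" "open \<Omega>"
  obtains K where "compact K" "K \<subseteq> \<Omega>" "\<And>x. x \<in> \<Omega> - K \<Longrightarrow> \<phi> x = 0" "\<And>x. x \<in> \<Omega> - K \<Longrightarrow> classical_grad \<phi> x = 0"
proof -
  obtain K where K: "compact K" "K \<subseteq> \<Omega>" "\<And>x. x \<in> \<Omega> - K \<Longrightarrow> \<phi> x = 0"
    using assms by (auto simp: test_functions_def compact_support_in_def)
  show ?thesis by (rule that[OF K classical_grad_zero_outside[OF assms(2) K(1) K(3)]])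
qed

section \<open>Weak gradients through mollification\<close>

lemma is_weak_grad_L1: "is_weak_grad \<Omega> u G \<Longrightarrow> u \<in> L1_loc \<Omega>" "is_weak_grad \<Omega> u G \<Longrightarrow> (\<lambda>x. G x $ i) \<in> L1_loc \<Omega>"
  by (auto simp: is_weak_grad_def)

text \<open>The value of a mollification at \<open>x\<close> is a pairing with this function, so the
  definition of a weak gradient can be tested with it. Reflection produces the sign that cancels the
  one of integration by parts.\<close>

lemma reflect_test:
  fixes \<Omega> :: "(real^'n) set"
  assumes "open \<Omega>" "e > 0" "cball x e \<subseteq> \<Omega>"
  shows "(\<lambda>y. moll e (x - y)) \<in> test_functions \<Omega>"
    and "classical_grad (\<lambda>y. moll e (x - y)) y $ i = - classical_grad (moll e) (x - y) $ i"
proof -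
  have D: "((\<lambda>y. k (x - y)) has_derivative (\<lambda>h. - (classical_grad k (x - y) \<bullet> h))) (at y)"
    if "k \<in> test_functions UNIV" for k :: "real^'n \<Rightarrow> real" and y
  proof -
    have "((\<lambda>y. x - y) has_derivative (\<lambda>h. - h)) (at y)" by (auto intro!: derivative_eq_intros)
    from has_derivative_compose[OF this has_derivative_classical_grad[OF test_functions_UNIV_D(2)[OF that]]]
    show ?thesis by simp
  qed
  have g: "classical_grad (\<lambda>y. k (x - y)) y $ i = - classical_grad k (x - y) $ i"
    if "k \<in> test_functions UNIV" for k :: "real^'n \<Rightarrow> real" and y i
    using classical_grad_eq[OF D[OF that]] by (simp add: inner_axis)
  show "classical_grad (\<lambda>y. moll e (x - y)) y $ i = - classical_grad (moll e) (x - y) $ i"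
    by (rule g[OF moll_test[OF assms(2)]])
  have "Ck_on j UNIV (\<lambda>y. k (x - y))" if "k \<in> test_functions UNIV" for k :: "real^'n \<Rightarrow> real" and j
    using that
  proof (induction j arbitrary: k)
    case 0
    then show ?case using continuous_on_reflect[OF Cc_UNIV_D(1)[OF test_functions_UNIV_D(1)]] by simp
  next
    case (Suc j)
    have "Ck_on j UNIV (\<lambda>y. (-1) * classical_grad k (x - y) $ i)" for i
      by (intro Ck_on_mult open_UNIV Ck_on_const Suc.IH[OF test_functions_UNIV_D(3)[OF Suc.prems]])
    then have "Ck_on j UNIV (\<lambda>y. classical_grad (\<lambda>y. k (x - y)) y $ i)" for i
      unfolding g[OF Suc.prems] by simp
    moreover have "(\<lambda>y. k (x - y)) differentiable (at y)" for y using D[OF Suc.prems] differentiable_def by blast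
    ultimately show ?case by simp
  qed
  from this[OF moll_test[OF assms(2)]] have "Ck_on j \<Omega> (\<lambda>y. moll e (x - y))" for j
    by (rule Ck_on_subset) simp
  moreover have "moll e (x - y) = 0" if "y \<notin> cball x e" for y
    using that assms by (intro moll_zero) (auto simp: dist_norm)
  ultimately show "(\<lambda>y. moll e (x - y)) \<in> test_functions \<Omega>"
    using assms by (auto simp: test_functions_def compact_support_in_def intro!: exI[of _ "cball x e"])
qed

lemma norm_ge_of_cball_subset:
  assumes "cball x e \<subseteq> K" "y \<notin> K"
  shows "e \<le> norm (x - y)"
proof (rule ccontr)
  assume "\<not> e \<le> norm (x - y)"
  then have "y \<in> cball x e" by (simp add: dist_norm)
  then show False using assms by blast
qed

text \<open>The indicator of \<open>K\<close> makes the mollification globally smooth, yet it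
  contributes no boundary term at \<open>x\<close>: the kernel centred at \<open>x\<close> vanishes
  off \<open>K\<close> because \<open>cball x e \<subseteq> K\<close>.\<close>

lemma mollify_weak_grad:
  assumes \<Omega>: "open \<Omega>" and u: "is_weak_grad \<Omega> u G" and K: "compact K" "K \<subseteq> \<Omega>" and e: "e > 0" "cball x e \<subseteq> K"
  shows "classical_grad (mollify e (\<lambda>y. indicat_real K y * u y)) x $ i = mollify e (\<lambda>y. indicat_real K y * G y $ i) x"
proof -
  have "classical_grad (mollify e (\<lambda>y. indicat_real K y * u y)) x $ i
     = (\<integral>y. classical_grad (moll e) (x - y) $ i * (indicat_real K y * u y) \<partial>lebesgue)"
    unfolding mollify_def
    by (subst classical_grad_conv[OF moll_test[OF e(1)] L1_loc_integrable[OF is_weak_grad_L1(1)[OF u] K]]) (simp add: conv_def)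
  also have "\<dots> = (\<integral>y. indicat_real K y * - (u y * classical_grad (\<lambda>y. moll e (x - y)) y $ i) \<partial>lebesgue)"
    using reflect_test(2)[OF \<Omega> e(1)] e K by (intro Bochner_Integration.integral_cong) auto
  also have "\<dots> = - (\<integral>y. indicat_real K y * (u y * classical_grad (\<lambda>y. moll e (x - y)) y $ i) \<partial>lebesgue)"
    by simp
  also have "\<dots> = - (LINT y:\<Omega>|lebesgue. u y * classical_grad (\<lambda>y. moll e (x - y)) y $ i)"
  proof (subst set_integral_support(1)[OF K(2)])
    fix y assume "y \<in> \<Omega> - K"
    then have "e \<le> norm (x - y)" using norm_ge_of_cball_subset[OF e(2)] by blast
    then show "u y * classical_grad (\<lambda>y. moll e (x - y)) y $ i = 0"
      using reflect_test(2)[OF \<Omega> e(1), of x y i] e K moll_grad_zero[OF e(1), of "x - y" i] by auto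
  qed simp
  also have "\<dots> = (LINT y:\<Omega>|lebesgue. G y $ i * moll e (x - y))"
    using u reflect_test(1)[OF \<Omega> e(1), of x] e K unfolding is_weak_grad_def by auto
  also have "\<dots> = (\<integral>y. indicat_real K y * (G y $ i * moll e (x - y)) \<partial>lebesgue)"
  proof (subst set_integral_support(1)[OF K(2)])
    fix y assume "y \<in> \<Omega> - K"
    then have "e \<le> norm (x - y)" using norm_ge_of_cball_subset[OF e(2)] by blast
    then show "G y $ i * moll e (x - y) = 0" using moll_zero[OF e(1), of "x - y"] by simp
  qed simp
  also have "\<dots> = mollify e (\<lambda>y. indicat_real K y * G y $ i) x"
    unfolding mollify_def conv_def by (intro Bochner_Integration.integral_cong) auto
  finally show ?thesis .
qed

text \<open>A locally negligible set is negligible. The exceptional set is not known to be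
  measurable, so the argument goes through \<open>negligible\<close> rather than through countable
  unions of null sets.\<close>

lemma AE_local:
  fixes \<Omega> :: "(real^'n) set"
  assumes loc: "\<And>x. x \<in> \<Omega> \<Longrightarrow> \<exists>r>0. AE y in lebesgue. y \<in> ball x r \<longrightarrow> P y"
  shows "AE x\<in>\<Omega> in lebesgue. P x"
proof -
  define S where "S = {x\<in>\<Omega>. \<not> P x}"
  have "\<exists>U. openin (top_of_set S) U \<and> x \<in> U \<and> negligible U" if x: "x \<in> S" for x
  proof -
    have "x \<in> \<Omega>" using x by (simp add: S_def)
    from loc[OF this] obtain r where r: "r > 0" and ae: "AE y in lebesgue. y \<in> ball x r \<longrightarrow> P y" by blast
    from AE_E[OF ae] obtain N where N: "{y \<in> space lebesgue. \<not> (y \<in> ball x r \<longrightarrow> P y)} \<subseteq> N" "emeasure lebesgue N = 0" "N \<in> sets lebesgue" .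
    have "negligible N" unfolding negligible_iff_null_sets by (rule null_setsI[OF N(2,3)])
    then have "negligible (S \<inter> ball x r)"
      by (rule negligible_subset) (use N(1) in \<open>auto simp: S_def\<close>)
    moreover have "openin (top_of_set S) (S \<inter> ball x r)" by (rule openin_open_Int[OF open_ball])
    ultimately show ?thesis using x r by (intro exI[of _ "S \<inter> ball x r"]) simp
  qed
  then have "negligible S" by (subst locally_negligible_alt) (rule ballI)
  then have "AE x in lebesgue. x \<notin> S" unfolding negligible_iff_null_sets by (rule AE_not_in)
  then show ?thesis by (rule AE_mp) (simp add: S_def)
qed

text \<open>On the half ball the mollifications at scales below \<open>r/2\<close> vanish, so the
  integral of \<open>\<bar>F\<bar>\<close> over it is at most that of
  \<open>\<bar>mollify (eps n) F - F\<bar>\<close>, which tends to 0.\<close>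

lemma AE_zero_of_mollify_zero:
  fixes f :: "real^'n \<Rightarrow> real"
  assumes f: "f \<in> L1_loc \<Omega>"
    and loc: "\<And>x. x \<in> \<Omega> \<Longrightarrow> \<exists>r>0. cball x r \<subseteq> \<Omega> \<and>
      (\<forall>y e. 0 < e \<and> cball y e \<subseteq> cball x r \<longrightarrow> mollify e (\<lambda>z. indicat_real (cball x r) z * f z) y = 0)"
  shows "AE x\<in>\<Omega> in lebesgue. f x = 0"
proof (rule AE_local)
  fix x assume "x \<in> \<Omega>"
  then obtain r where r: "r > 0" "cball x r \<subseteq> \<Omega>" and
    z: "\<And>y e. 0 < e \<Longrightarrow> cball y e \<subseteq> cball x r \<Longrightarrow> mollify e (\<lambda>z. indicat_real (cball x r) z * f z) y = 0"
    using loc by blast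
  define F where "F z = indicat_real (cball x r) z * f z" for z
  have F: "integrable lebesgue F" unfolding F_def by (rule L1_loc_integrable[OF f _ r(2)]) simp
  have Bi: "integrable lebesgue (\<lambda>z. \<bar>indicat_real (ball x (r/2)) z * F z\<bar>)"
    using F by (intro integrable_abs integrable_bounded_mult[where B = 1] borel_measurable_indicator) auto
  have "(\<integral>z. \<bar>indicat_real (ball x (r/2)) z * F z\<bar> \<partial>lebesgue) \<le> 0"
  proof (rule LIMSEQ_le_const[OF mollify_L1_tendsto[OF F]])
    have "\<forall>\<^sub>F n in sequentially. eps n < r/2" by (rule eventually_eps_less) (use r in simp)
    then have "\<forall>\<^sub>F n in sequentially. (\<integral>z. \<bar>indicat_real (ball x (r/2)) z * F z\<bar> \<partial>lebesgue) \<le> (\<integral>x. \<bar>mollify (eps n) F x - F x\<bar> \<partial>lebesgue)"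
    proof eventually_elim
      case (elim n)
      show ?case
      proof (rule integral_mono[OF Bi])
        show "integrable lebesgue (\<lambda>x. \<bar>mollify (eps n) F x - F x\<bar>)"
          using F integral_mollify[OF eps_pos F, of n] by simp
        fix y
        show "\<bar>indicat_real (ball x (r/2)) y * F y\<bar> \<le> \<bar>mollify (eps n) F y - F y\<bar>"
        proof (cases "y \<in> ball x (r/2)")
          case True
          have "cball y (eps n) \<subseteq> cball x r"
          proof
            fix w assume "w \<in> cball y (eps n)"
            then show "w \<in> cball x r" using True elim dist_triangle[of x w y] by auto
          qed
          then have "mollify (eps n) F y = 0" using z[OF eps_pos] unfolding F_def[abs_def] by blast
          then show ?thesis using True by simp
        qed simp
      qed
    qed
    then show "\<exists>N. \<forall>n\<ge>N. (\<integral>z. \<bar>indicat_real (ball x (r/2)) z * F z\<bar> \<partial>lebesgue) \<le> (\<integral>x. \<bar>mollify (eps n) F x - F x\<bar> \<partial>lebesgue)"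
      by (simp add: eventually_sequentially)
  qed
  then have "(\<integral>z. \<bar>indicat_real (ball x (r/2)) z * F z\<bar> \<partial>lebesgue) = 0"
    by (intro antisym integral_nonneg_AE) auto
  then have "AE z in lebesgue. \<bar>indicat_real (ball x (r/2)) z * F z\<bar> = 0"
    using integral_nonneg_eq_0_iff_AE[OF Bi] by simp
  then have "AE z in lebesgue. z \<in> ball x (r/2) \<longrightarrow> f z = 0"
  proof eventually_elim
    case (elim z)
    have "dist x z \<le> r" if "dist x z < r/2" using that zero_le_dist[of x z] by linarith
    then show ?case using elim by (auto simp: F_def)
  qed
  then show "\<exists>r>0. AE y in lebesgue. y \<in> ball x r \<longrightarrow> f y = 0" using r(1) by (intro exI[of _ "r/2"]) auto
qed

lemma AE_all_finite: "(\<And>i::'n::finite. AE x\<in>\<Omega> in M. P i x) \<Longrightarrow> AE x\<in>\<Omega> in M. \<forall>i. P i x"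
  using AE_finite_all[of "UNIV :: 'n set" "\<lambda>x i. x \<in> \<Omega> \<longrightarrow> P i x" "ae_filter M"] by auto

text \<open>Both gradients mollify to the same classical gradient, that of the mollified
  \<open>u\<close>.\<close>

lemma weak_grad_unique:
  assumes \<Omega>: "open \<Omega>" and G: "is_weak_grad \<Omega> u G" and H: "is_weak_grad \<Omega> u H"
  shows "AE x\<in>\<Omega> in lebesgue. G x = H x"
proof -
  have "AE x\<in>\<Omega> in lebesgue. G x $ i - H x $ i = 0" for i
  proof (rule AE_zero_of_mollify_zero)
    show "(\<lambda>x. G x $ i - H x $ i) \<in> L1_loc \<Omega>"
      using L1_loc_add[OF is_weak_grad_L1(2)[OF G] L1_loc_cmult[OF is_weak_grad_L1(2)[OF H], of "-1"]] by simp
    fix x assume "x \<in> \<Omega>"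
    then obtain r where r: "r > 0" "cball x r \<subseteq> \<Omega>" using \<Omega> open_contains_cball by blast
    have "mollify e (\<lambda>z. indicat_real (cball x r) z * (G z $ i - H z $ i)) y = 0" if "0 < e" "cball y e \<subseteq> cball x r" for y e
    proof -
      have "mollify e (\<lambda>z. indicat_real (cball x r) z * (G z $ i - H z $ i)) y
         = mollify e (\<lambda>z. indicat_real (cball x r) z * G z $ i) y - mollify e (\<lambda>z. indicat_real (cball x r) z * H z $ i) y"
        using mollify_diff[OF that(1) L1_loc_integrable[OF is_weak_grad_L1(2)[OF G] compact_cball r(2)]
          L1_loc_integrable[OF is_weak_grad_L1(2)[OF H] compact_cball r(2)]] by (simp add: right_diff_distrib)
      then show ?thesis
        using mollify_weak_grad[OF \<Omega> G compact_cball r(2) that, of i] mollify_weak_grad[OF \<Omega> H compact_cball r(2) that, of i] by simp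
    qed
    then show "\<exists>r>0. cball x r \<subseteq> \<Omega> \<and> (\<forall>y e. 0 < e \<and> cball y e \<subseteq> cball x r \<longrightarrow>
         mollify e (\<lambda>z. indicat_real (cball x r) z * (G z $ i - H z $ i)) y = 0)" using r by blast
  qed
  then have "AE x\<in>\<Omega> in lebesgue. \<forall>i. G x $ i - H x $ i = 0" by (rule AE_all_finite)
  then show ?thesis by eventually_elim (auto simp: vec_eq_iff)
qed

text \<open>Near a point off \<open>K\<close> the mollified \<open>u\<close> is identically 0, and
  so is its gradient, the mollified \<open>G\<close>.\<close>

lemma weak_grad_zero_outside:
  assumes \<Omega>: "open \<Omega>" and G: "is_weak_grad \<Omega> u G" and K: "compact K" "\<And>x. x \<in> \<Omega> - K \<Longrightarrow> u x = 0"
  shows "AE x\<in>\<Omega> - K in lebesgue. G x = 0"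
proof -
  have "AE x\<in>\<Omega> - K in lebesgue. G x $ i = 0" for i
  proof (rule AE_zero_of_mollify_zero)
    show "(\<lambda>x. G x $ i) \<in> L1_loc (\<Omega> - K)"
      using L1_loc_subset[OF is_weak_grad_L1(2)[OF G]] by blast
    fix x assume "x \<in> \<Omega> - K"
    moreover have o: "open (\<Omega> - K)" using \<Omega> K by (auto intro: open_Diff compact_imp_closed)
    ultimately obtain r where r: "r > 0" "cball x r \<subseteq> \<Omega> - K" using open_contains_cball by blast
    then have r': "cball x r \<subseteq> \<Omega>" by blast
    have z: "(\<lambda>y. indicat_real (cball x r) y * u y) = (\<lambda>y. 0)"
    proof
      fix y show "indicat_real (cball x r) y * u y = 0"
        using subsetD[OF r(2), of y] K(2)[of y] by (cases "y \<in> cball x r") auto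
    qed
    have "mollify e (\<lambda>z. indicat_real (cball x r) z * (G z $ i)) y = 0" if "0 < e" "cball y e \<subseteq> cball x r" for y e
    proof -
      have "mollify e (\<lambda>z. indicat_real (cball x r) z * (G z $ i)) y = classical_grad (mollify e (\<lambda>y. 0)) y $ i"
        using mollify_weak_grad[OF \<Omega> G compact_cball r' that, of i] unfolding z by simp
      also have "mollify e (\<lambda>y. 0) = (\<lambda>y. 0 :: real)" by (auto simp: mollify_def conv_def)
      finally show ?thesis using classical_grad_eq[of "\<lambda>_. 0" "\<lambda>_. 0" y i] by simp
    qed
    then show "\<exists>r>0. cball x r \<subseteq> \<Omega> - K \<and> (\<forall>y e. 0 < e \<and> cball y e \<subseteq> cball x r \<longrightarrow>
         mollify e (\<lambda>z. indicat_real (cball x r) z * (G z $ i)) y = 0)" using r by blast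
  qed
  then have "AE x\<in>\<Omega> - K in lebesgue. \<forall>i. G x $ i = 0" by (rule AE_all_finite)
  then show ?thesis by eventually_elim (auto simp: vec_eq_iff)
qed

text \<open>Difference quotients have integral 0 by translation invariance, and the mean value
  theorem bounds them by \<open>B\<close>; dominated convergence passes to the derivative.\<close>

lemma integral_partial_derivative_zero:
  fixes h :: "real^'n \<Rightarrow> real"
  assumes d: "\<And>x. h differentiable (at x)" and B: "\<And>x. \<bar>classical_grad h x $ i\<bar> \<le> B"
    and K: "bounded K" "\<And>x. x \<notin> K \<Longrightarrow> h x = 0"
  shows "(\<integral>x. classical_grad h x $ i \<partial>lebesgue) = 0"
proof -
  define e where "e = (axis i 1 :: real^'n)"
  have ne: "norm e = 1" by (simp add: e_def)
  obtain R where R: "\<And>x. norm x > R \<Longrightarrow> h x = 0" proof -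
    obtain a where "\<And>x. x \<in> K \<Longrightarrow> norm x \<le> a" using K(1) unfolding bounded_iff by auto
    then show ?thesis using that[of a] K(2) by force
  qed
  have hc: "continuous_on UNIV h"
    using d by (intro continuous_at_imp_continuous_on) (auto intro: differentiable_imp_continuous_within)
  have line: "((\<lambda>t. h (x + t *\<^sub>R e)) has_real_derivative (classical_grad h (x + t *\<^sub>R e) $ i)) (at t)" for x t
  proof -
    have "((\<lambda>t. x + t *\<^sub>R e) has_derivative (\<lambda>s. s *\<^sub>R e)) (at t)" by (auto intro!: derivative_eq_intros)
    from has_derivative_compose[OF this has_derivative_classical_grad[OF d]]
    show ?thesis by (simp add: has_field_derivative_def e_def inner_axis mult.commute[of _ "classical_grad h _ $ i"])
  qed
  define q where "q n x = (h (x + eps n *\<^sub>R e) - h x) / eps n" for n x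
  have hs: "continuous_on UNIV (\<lambda>x::real^'n. h (x + c *\<^sub>R e))" for c
    by (rule continuous_on_compose2[OF hc]) (auto intro!: continuous_intros)
  have hC: "h \<in> Cc UNIV" by (rule Cc_UNIV_I[OF hc R])
  have hsC: "(\<lambda>x::real^'n. h (x + c *\<^sub>R e)) \<in> Cc UNIV" for c
  proof (rule Cc_UNIV_I[OF hs, of "R + \<bar>c\<bar>"])
    fix x :: "real^'n" assume "norm x > R + \<bar>c\<bar>"
    then have "norm (x + c *\<^sub>R e) > R" using norm_triangle_ineq2[of x "- (c *\<^sub>R e)"] ne by simp
    then show "h (x + c *\<^sub>R e) = 0" by (rule R)
  qed
  have q0: "(\<integral>x. q n x \<partial>lebesgue) = 0" for n
  proof -
    have "(\<integral>x. h (x + eps n *\<^sub>R e) \<partial>lebesgue) = (\<integral>x. h x \<partial>lebesgue)"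
      using integral_lebesgue_affine_continuous[OF hc, of 1 "eps n *\<^sub>R e"] by (simp add: add.commute)
    then show ?thesis unfolding q_def
      using Cc_UNIV_integrable(1)[OF hC] Cc_UNIV_integrable(1)[OF hsC[of "eps n"]] by simp
  qed
  have "(\<lambda>n. \<integral>x. q n x \<partial>lebesgue) \<longlonglongrightarrow> (\<integral>x. classical_grad h x $ i \<partial>lebesgue)"
  proof (rule integral_dominated_convergence)
    have lim: "(\<lambda>n. q n x) \<longlonglongrightarrow> classical_grad h x $ i" for x
    proof -
      have "((\<lambda>t. (h (x + t *\<^sub>R e) - h (x + 0 *\<^sub>R e)) / (t - 0)) \<longlongrightarrow> classical_grad h (x + 0 *\<^sub>R e) $ i) (at 0)"
        using line[of x 0] unfolding has_field_derivative_iff .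
      moreover have "filterlim eps (at 0) sequentially"
        using eps_tendsto by (simp add: filterlim_at less_imp_neq[OF eps_pos, symmetric])
      ultimately have "((\<lambda>n. (h (x + eps n *\<^sub>R e) - h (x + 0 *\<^sub>R e)) / (eps n - 0)) \<longlongrightarrow> classical_grad h (x + 0 *\<^sub>R e) $ i) sequentially"
        by (rule filterlim_compose)
      then show ?thesis by (simp add: q_def)
    qed
    show qm: "q n \<in> borel_measurable lebesgue" for n
      unfolding q_def by (intro borel_measurable_divide borel_measurable_diff continuous_imp_measurable_lebesgue hs hc) simp
    show "(\<lambda>x. classical_grad h x $ i) \<in> borel_measurable lebesgue"
      by (rule borel_measurable_LIMSEQ_real[OF lim qm])
    show "integrable lebesgue (\<lambda>x::real^'n. indicator (cball 0 (R+1)) x * B)" by (rule integrable_indicator_cball)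
    show "AE x in lebesgue. (\<lambda>n. q n x) \<longlonglongrightarrow> classical_grad h x $ i" using lim by simp
    show "AE x in lebesgue. norm (q n x) \<le> indicator (cball 0 (R+1)) x * B" for n
    proof (rule AE_I2)
      fix x :: "real^'n"
      have e1: "eps n \<le> 1" by (simp add: eps_def field_simps)
      show "norm (q n x) \<le> indicator (cball 0 (R+1)) x * B"
      proof (cases "norm x \<le> R + 1")
        case True
        obtain t where "0 < t" "t < eps n" "h (x + eps n *\<^sub>R e) - h (x + 0 *\<^sub>R e) = (eps n - 0) * classical_grad h (x + t *\<^sub>R e) $ i"
          using MVT2[of 0 "eps n" "\<lambda>t. h (x + t *\<^sub>R e)" "\<lambda>t. classical_grad h (x + t *\<^sub>R e) $ i"] line by auto
        then have "q n x = classical_grad h (x + t *\<^sub>R e) $ i" using eps_pos[of n] by (simp add: q_def)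
        then show ?thesis using B True by simp
      next
        case False
        have "norm (x + eps n *\<^sub>R e) > R" using False norm_triangle_ineq2[of x "- (eps n *\<^sub>R e)"] ne e1 eps_pos[of n] by simp
        then show ?thesis using False R by (simp add: q_def)
      qed
    qed
  qed
  then show ?thesis using q0 by (simp add: LIMSEQ_const_iff)
qed

lemma is_weak_gradI:
  assumes "u \<in> L1_loc \<Omega>" "\<And>i. (\<lambda>x. G x $ i) \<in> L1_loc \<Omega>"
    "\<And>\<phi> i. \<phi> \<in> test_functions \<Omega> \<Longrightarrow>
        (LINT x:\<Omega>|lebesgue. u x * classical_grad \<phi> x $ i) = - (LINT x:\<Omega>|lebesgue. G x $ i * \<phi> x)"
  shows "is_weak_grad \<Omega> u G"
  unfolding is_weak_grad_def by (intro conjI allI ballI assms)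

text \<open>The product, extended by 0, is differentiable everywhere with bounded partial
  derivative: by the product rule on \<open>K\<close>, and off \<open>K\<close> because it vanishes
  on an open set. Regularity of \<open>f\<close> is asked for at points of \<open>K\<close> only,
  which suits compositions whose inner values are controlled only there.\<close>

lemma integral_by_parts_test:
  fixes f \<phi> :: "real^'n \<Rightarrow> real"
  assumes \<Omega>: "open \<Omega>" and \<phi>: "\<phi> \<in> test_functions \<Omega>" and K: "compact K" "K \<subseteq> \<Omega>" "\<And>x. x \<in> \<Omega> - K \<Longrightarrow> \<phi> x = 0"
    and f: "\<And>x. x \<in> K \<Longrightarrow> f differentiable (at x)" "continuous_on K (\<lambda>x. classical_grad f x $ i)"
  shows "(\<integral>x. indicat_real K x * (f x * classical_grad \<phi> x $ i) \<partial>lebesgue)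
    = - (\<integral>x. indicat_real K x * (classical_grad f x $ i * \<phi> x) \<partial>lebesgue)"
proof -
  have fc: "continuous_on K f"
    using f(1) by (intro continuous_at_imp_continuous_on) (auto intro: differentiable_imp_continuous_within)
  have \<phi>c: "continuous_on K \<phi>" "continuous_on K (\<lambda>x. classical_grad \<phi> x $ i)"
    by (rule continuous_on_subset[OF test_functions_D(1)[OF \<phi>] K(2)], rule continuous_on_subset[OF test_functions_D(3)[OF \<phi>] K(2)])
  define h where "h y = (if y \<in> \<Omega> then f y * \<phi> y else 0)" for y
  have zero: "h y = 0" if "y \<notin> K" for y using that K by (auto simp: h_def)
  have D: "(h has_derivative (\<lambda>v. f x * (classical_grad \<phi> x \<bullet> v) + (classical_grad f x \<bullet> v) * \<phi> x)) (at x)" if x: "x \<in> K" for x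
  proof -
    have "x \<in> \<Omega>" using x K by blast
    have "((\<lambda>y. f y * \<phi> y) has_derivative (\<lambda>v. f x * (classical_grad \<phi> x \<bullet> v) + (classical_grad f x \<bullet> v) * \<phi> x)) (at x)"
      by (rule has_derivative_mult[OF has_derivative_classical_grad[OF f(1)[OF x]] has_derivative_classical_grad[OF test_functions_D(2)[OF \<phi> \<open>x \<in> \<Omega>\<close>]]])
    then show ?thesis
      by (subst has_derivative_cong_open[OF \<Omega> \<open>x \<in> \<Omega>\<close>, of h "\<lambda>y. f y * \<phi> y"]) (simp_all add: h_def)
  qed
  have D0: "(h has_derivative (\<lambda>v. 0)) (at x)" if x: "x \<notin> K" for x
    by (subst has_derivative_cong_open[of "-K" x h "\<lambda>_. 0"])
       (use x K zero in \<open>auto intro: compact_imp_closed open_Compl\<close>)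
  have g: "classical_grad h x $ i = indicat_real K x * (f x * classical_grad \<phi> x $ i) + indicat_real K x * (classical_grad f x $ i * \<phi> x)" for x
    using classical_grad_eq[OF D, of x i] classical_grad_eq[OF D0, of x i] by (cases "x \<in> K") (auto simp: inner_axis)
  have c: "continuous_on K (\<lambda>x. f x * classical_grad \<phi> x $ i + classical_grad f x $ i * \<phi> x)"
    by (intro continuous_intros fc \<phi>c f(2))
  obtain B where B: "B > 0" "\<And>x. x \<in> K \<Longrightarrow> \<bar>f x * classical_grad \<phi> x $ i + classical_grad f x $ i * \<phi> x\<bar> \<le> B"
    using continuous_on_compact_bounded[OF K(1) c] by auto
  have "(\<integral>x. classical_grad h x $ i \<partial>lebesgue) = 0"
  proof (rule integral_partial_derivative_zero[where B = B and K = K])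
    show "h differentiable (at x)" for x
      using D[of x] D0[of x] unfolding differentiable_def by blast
    show "\<bar>classical_grad h x $ i\<bar> \<le> B" for x
      unfolding g using B by (cases "x \<in> K") auto
  qed (use K compact_imp_bounded zero in auto)
  moreover have "integrable lebesgue (\<lambda>x. indicat_real K x * (f x * classical_grad \<phi> x $ i))"
    using L1_loc_mult_integrable[OF L1_loc_const[of 1 UNIV] K(1), of "\<lambda>x. f x * classical_grad \<phi> x $ i"] continuous_on_mult[OF fc \<phi>c(2)] by simp
  moreover have "integrable lebesgue (\<lambda>x. indicat_real K x * (classical_grad f x $ i * \<phi> x))"
    using L1_loc_mult_integrable[OF L1_loc_const[of 1 UNIV] K(1), of "\<lambda>x. classical_grad f x $ i * \<phi> x"] continuous_on_mult[OF f(2) \<phi>c(1)] by simp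
  ultimately show ?thesis unfolding g by simp
qed

lemma is_weak_grad_classical:
  fixes f :: "real^'n \<Rightarrow> real"
  assumes \<Omega>: "open \<Omega>" and f: "\<And>x. x \<in> \<Omega> \<Longrightarrow> f differentiable (at x)" "\<And>i. continuous_on \<Omega> (\<lambda>x. classical_grad f x $ i)"
  shows "is_weak_grad \<Omega> f (classical_grad f)"
proof -
  have fc: "continuous_on \<Omega> f"
    using f(1) by (intro continuous_at_imp_continuous_on) (auto intro: differentiable_imp_continuous_within)
  have "(LINT x:\<Omega>|lebesgue. f x * classical_grad \<phi> x $ i) = - (LINT x:\<Omega>|lebesgue. classical_grad f x $ i * \<phi> x)"
    if \<phi>: "\<phi> \<in> test_functions \<Omega>" for \<phi> i
  proof -
    obtain K where K: "compact K" "K \<subseteq> \<Omega>" "\<And>x. x \<in> \<Omega> - K \<Longrightarrow> \<phi> x = 0" "\<And>x. x \<in> \<Omega> - K \<Longrightarrow> classical_grad \<phi> x = 0"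
      by (fact test_functions_support[OF \<phi> \<Omega>])
    show ?thesis
      using integral_by_parts_test[OF \<Omega> \<phi> K(1-3), of f i] f K continuous_on_subset[OF f(2) K(2)]
      by (subst (1 2) set_integral_support(1)[OF K(2)]) auto
  qed
  then show ?thesis by (intro is_weak_gradI L1_loc_continuous f fc)
qed

section \<open>Chain rule and product rule for weak gradients\<close>

lemma interval_range_bounds:
  fixes u :: "'a::topological_space \<Rightarrow> real"
  assumes "compact K" "K \<noteq> {}" "continuous_on K u" "u ` K \<subseteq> I" "convex I"
  obtains a b where "{a..b} \<subseteq> I" "\<And>x. x \<in> K \<Longrightarrow> a \<le> u x \<and> u x \<le> b"
proof -
  obtain x0 where x0: "x0 \<in> K" "\<And>x. x \<in> K \<Longrightarrow> u x0 \<le> u x" using continuous_attains_inf[OF assms(1-3)] by blast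
  obtain x1 where x1: "x1 \<in> K" "\<And>x. x \<in> K \<Longrightarrow> u x \<le> u x1" using continuous_attains_sup[OF assms(1-3)] by blast
  have "closed_segment (u x0) (u x1) \<subseteq> I"
    using assms(4,5) x0(1) x1(1) by (intro closed_segment_subset) auto
  moreover have "u x0 \<le> u x1" using x0 x1 by blast
  ultimately have "{u x0..u x1} \<subseteq> I" by (simp add: closed_segment_eq_real_ivl)
  then show ?thesis using that x0 x1 by blast
qed

text \<open>Mollify \<open>u\<close>, apply the classical chain rule and pass to the limit. Averages
  of values in \<open>{a..b}\<close> stay in \<open>{a..b}\<close>, so \<open>F\<close> is evaluated
  inside \<open>I\<close> only. Continuity of \<open>u\<close> gives pointwise convergence of the
  values; the gradients converge in \<open>L^1\<close>.\<close>

lemma is_weak_grad_chain: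
  fixes u :: "real^'n \<Rightarrow> real" and F F' :: "real \<Rightarrow> real"
  assumes \<Omega>: "open \<Omega>" and u: "is_weak_grad \<Omega> u G" "continuous_on \<Omega> u"
    and I: "open I" "convex I" "\<And>x. x \<in> \<Omega> \<Longrightarrow> u x \<in> I"
    and F: "\<And>s. s \<in> I \<Longrightarrow> (F has_real_derivative F' s) (at s)" "continuous_on I F'"
  shows "is_weak_grad \<Omega> (\<lambda>x. F (u x)) (\<lambda>x. F' (u x) *\<^sub>R G x)"
proof -
  have Fc: "continuous_on I F" using F(1) by (intro continuous_at_imp_continuous_on) (auto intro: DERIV_isCont)
  have Fu: "continuous_on \<Omega> (\<lambda>x. F (u x))" and F'u: "continuous_on \<Omega> (\<lambda>x. F' (u x))"
    using I by (auto intro!: continuous_on_compose2[OF Fc u(2)] continuous_on_compose2[OF F(2) u(2)])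
  have GL: "(\<lambda>x. (F' (u x) *\<^sub>R G x) $ i) \<in> L1_loc \<Omega>" for i
    using L1_loc_mult[OF is_weak_grad_L1(2)[OF u(1)] F'u] by simp
  have "(LINT x:\<Omega>|lebesgue. F (u x) * classical_grad \<phi> x $ i) = - (LINT x:\<Omega>|lebesgue. (F' (u x) *\<^sub>R G x) $ i * \<phi> x)"
    if \<phi>: "\<phi> \<in> test_functions \<Omega>" for \<phi> i
  proof -
    obtain K where K: "compact K" "K \<subseteq> \<Omega>" "\<And>x. x \<in> \<Omega> - K \<Longrightarrow> \<phi> x = 0" "\<And>x. x \<in> \<Omega> - K \<Longrightarrow> classical_grad \<phi> x = 0"
      by (fact test_functions_support[OF \<phi> \<Omega>])
    show ?thesis
    proof (cases "K = {}")
      case True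
      then have "\<And>x. x \<in> \<Omega> \<Longrightarrow> \<phi> x = 0" "\<And>x. x \<in> \<Omega> \<Longrightarrow> classical_grad \<phi> x = 0" using K by auto
      then show ?thesis
        using set_integral_support(1)[of "{}" \<Omega> "\<lambda>x. F (u x) * classical_grad \<phi> x $ i"]
          set_integral_support(1)[of "{}" \<Omega> "\<lambda>x. (F' (u x) *\<^sub>R G x) $ i * \<phi> x"] by simp
    next
      case False
      obtain d K1 where d: "d > 0" and K1: "compact K1" "K1 \<subseteq> \<Omega>" "\<And>x. x \<in> K \<Longrightarrow> cball x d \<subseteq> K1" "K \<subseteq> K1"
        by (fact compact_neighbourhood[OF \<Omega> K(1,2)])
      have K1ne: "K1 \<noteq> {}" using False K1 by blast
      have uK1: "u ` K1 \<subseteq> I" using I(3) K1(2) by blast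
      obtain a b where ab: "{a..b} \<subseteq> I" "\<And>x. x \<in> K1 \<Longrightarrow> a \<le> u x \<and> u x \<le> b"
        by (fact interval_range_bounds[OF K1(1) K1ne continuous_on_subset[OF u(2) K1(2)] uK1 I(2)])
      define U where "U x = indicat_real K1 x * u x" for x
      define g where "g x = indicat_real K1 x * G x $ i" for x
      have Ui: "integrable lebesgue U" unfolding U_def by (rule L1_loc_integrable[OF is_weak_grad_L1(1)[OF u(1)] K1(1,2)])
      have gi: "integrable lebesgue g" unfolding g_def by (rule L1_loc_integrable[OF is_weak_grad_L1(2)[OF u(1)] K1(1,2)])
      define un where "un n = mollify (eps n) U" for n
      define gn where "gn n = mollify (eps n) g" for n
      have unb: "un n x \<in> {a..b}" if "eps n < d" "x \<in> K" for n x
      proof -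
        have "a \<le> U y \<and> U y \<le> b" if "dist y x < eps n" for y
        proof -
          have "y \<in> K1" using K1(3)[OF \<open>x \<in> K\<close>] that \<open>eps n < d\<close> by (auto simp: dist_commute)
          then show ?thesis using ab by (simp add: U_def)
        qed
        then show ?thesis unfolding un_def
          using mollify_local_bounds(1)[OF eps_pos Ui, of x n a b] mollify_local_bounds(2)[OF eps_pos Ui, of x n a b] by simp
      qed
      have ung: "classical_grad (un n) x $ i = gn n x" if "eps n < d" "x \<in> K" for n x
        unfolding un_def gn_def U_def g_def
        using K1(3)[OF that(2)] that(1) by (intro mollify_weak_grad[OF \<Omega> u(1) K1(1,2)]) auto
      have Fd: "((\<lambda>y. F (un n y)) has_derivative (\<lambda>v. (classical_grad (un n) x \<bullet> v) * F' (un n x))) (at x)"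
        if "eps n < d" "x \<in> K" for n x
      proof -
        have "un n x \<in> I" using unb[OF that] ab by blast
        from has_derivative_compose[OF has_derivative_classical_grad[OF mollify_differentiable[OF eps_pos Ui], of n x, folded un_def] F(1)[OF this, unfolded has_field_derivative_def]]
        show ?thesis by (simp add: mult.commute)
      qed
      have Fg: "classical_grad (\<lambda>y. F (un n y)) x $ i = F' (un n x) * gn n x" if "eps n < d" "x \<in> K" for n x
        using classical_grad_eq[OF Fd[OF that], of i] ung[OF that] by (simp add: inner_axis mult.commute)
      have unc: "continuous_on S (un n)" and gnc: "continuous_on S (gn n)" for n S
        unfolding un_def gn_def
        by (rule continuous_on_subset[OF mollify_continuous[OF eps_pos Ui] subset_UNIV],
            rule continuous_on_subset[OF mollify_continuous[OF eps_pos gi] subset_UNIV])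
      have F'n: "continuous_on K (\<lambda>x. F' (un n x))" and Fn: "continuous_on K (\<lambda>x. F (un n x))" if "eps n < d" for n
        using unb[OF that] ab(1) by (auto intro!: continuous_on_compose2[OF F(2) unc] continuous_on_compose2[OF Fc unc])
      have \<phi>c: "continuous_on K \<phi>" "continuous_on K (\<lambda>x. classical_grad \<phi> x $ i)"
        by (rule continuous_on_subset[OF test_functions_D(1)[OF \<phi>] K(2)], rule continuous_on_subset[OF test_functions_D(3)[OF \<phi>] K(2)])
      have ibp: "(\<integral>x. indicat_real K x * (F (un n x) * classical_grad \<phi> x $ i) \<partial>lebesgue)
         = - (\<integral>x. indicat_real K x * (F' (un n x) * gn n x * \<phi> x) \<partial>lebesgue)" if n: "eps n < d" for n
      proof -
        have c: "continuous_on K (\<lambda>x. F' (un n x) * gn n x)" by (intro continuous_intros F'n[OF n] gnc)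
        have "(\<integral>x. indicat_real K x * (F (un n x) * classical_grad \<phi> x $ i) \<partial>lebesgue)
         = - (\<integral>x. indicat_real K x * (classical_grad (\<lambda>y. F (un n y)) x $ i * \<phi> x) \<partial>lebesgue)"
        proof (rule integral_by_parts_test[OF \<Omega> \<phi> K(1-3)])
          show "(\<lambda>y. F (un n y)) differentiable (at x)" if "x \<in> K" for x
            using Fd[OF n that] differentiable_def by blast
          show "continuous_on K (\<lambda>x. classical_grad (\<lambda>y. F (un n y)) x $ i)"
            using c by (rule continuous_on_eq) (simp add: Fg[OF n])
        qed
        also have "(\<integral>x. indicat_real K x * (classical_grad (\<lambda>y. F (un n y)) x $ i * \<phi> x) \<partial>lebesgue)
            = (\<integral>x. indicat_real K x * (F' (un n x) * gn n x * \<phi> x) \<partial>lebesgue)"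
          by (intro Bochner_Integration.integral_cong refl) (auto simp: indicator_def Fg[OF n])
        finally show ?thesis .
      qed
      have cab: "continuous_on {a..b} F" "continuous_on {a..b} F'"
        using continuous_on_subset[OF Fc ab(1)] continuous_on_subset[OF F(2) ab(1)] by auto
      obtain B0 where B0: "B0 > 0" "\<And>s. s \<in> {a..b} \<Longrightarrow> \<bar>F s\<bar> \<le> B0" using continuous_on_compact_bounded[OF compact_Icc cab(1)] by auto
      obtain B1 where B1: "B1 > 0" "\<And>s. s \<in> {a..b} \<Longrightarrow> \<bar>F' s\<bar> \<le> B1" using continuous_on_compact_bounded[OF compact_Icc cab(2)] by auto
      obtain C0 where C0: "C0 > 0" "\<And>x. x \<in> K \<Longrightarrow> \<bar>\<phi> x\<bar> \<le> C0" using continuous_on_compact_bounded[OF K(1) \<phi>c(1)] by auto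
      obtain C1 where C1: "C1 > 0" "\<And>x. x \<in> K \<Longrightarrow> \<bar>classical_grad \<phi> x $ i\<bar> \<le> C1" using continuous_on_compact_bounded[OF K(1) \<phi>c(2)] by auto
      have unl: "(\<lambda>n. un n x) \<longlonglongrightarrow> u x" if x: "x \<in> K" for x
      proof -
        have "isCont u x" using u(2) x K(2) \<Omega> by (auto simp: continuous_on_eq_continuous_at)
        moreover have "\<forall>\<^sub>F y in nhds x. U y = u y"
          unfolding eventually_nhds using K1(3)[OF x] d by (intro exI[of _ "ball x d"]) (auto simp: U_def subset_iff)
        ultimately have "isCont U x" by (simp add: isCont_cong)
        from mollify_tendsto[OF Ui this] show ?thesis using K1(4) x unfolding un_def U_def by auto
      qed
      obtain n0 where n0: "\<And>n. n \<ge> n0 \<Longrightarrow> eps n < d" using eventually_eps_less[OF d] by (auto simp: eventually_sequentially)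
      \<comment> \<open>Shifting the index makes the bounds hold for every \<open>n\<close>, as
        dominated convergence asks.\<close>
      define m where "m n = n + n0" for n :: nat
      have m: "eps (m n) < d" for n by (rule n0) (simp add: m_def)
      have ml: "(\<lambda>n. X (m n)) \<longlonglongrightarrow> l" if "X \<longlonglongrightarrow> l" for X and l :: real
        unfolding m_def using that by (rule LIMSEQ_ignore_initial_segment)
      have uab: "u x \<in> {a..b}" if "x \<in> K" for x using ab(2) K1(4) that by auto
      have meas: "(\<lambda>x. indicat_real K x * k x) \<in> borel_measurable lebesgue" if "continuous_on K k" for k
        by (rule continuous_on_indicator_measurable[OF K(1) that])
      have FuK: "continuous_on K (\<lambda>x. F (u x))" and F'uK: "continuous_on K (\<lambda>x. F' (u x))"
        using continuous_on_subset[OF Fu K(2)] continuous_on_subset[OF F'u K(2)] by auto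
      have indi: "integrable lebesgue (\<lambda>x. indicat_real K x * (c::real))" for c
        using L1_loc_integrable[OF L1_loc_const K(1)] K(2) by blast
      have L1: "(\<lambda>n. \<integral>x. indicat_real K x * (F (un (m n) x) * classical_grad \<phi> x $ i) \<partial>lebesgue)
          \<longlonglongrightarrow> (\<integral>x. indicat_real K x * (F (u x) * classical_grad \<phi> x $ i) \<partial>lebesgue)"
      proof (rule integral_dominated_convergence[where w = "\<lambda>x. indicat_real K x * (B0 * C1)"])
        show "AE x in lebesgue. (\<lambda>n. indicat_real K x * (F (un (m n) x) * classical_grad \<phi> x $ i))
            \<longlonglongrightarrow> indicat_real K x * (F (u x) * classical_grad \<phi> x $ i)"
        proof (rule AE_I2)
          fix x
          show "(\<lambda>n. indicat_real K x * (F (un (m n) x) * classical_grad \<phi> x $ i))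
            \<longlonglongrightarrow> indicat_real K x * (F (u x) * classical_grad \<phi> x $ i)"
          proof (cases "x \<in> K")
            case True
            have "isCont F (u x)" using F(1) I(3) True K(2) by (blast intro: DERIV_isCont)
            from isCont_tendsto_compose[OF this ml[OF unl[OF True]]] show ?thesis by (intro tendsto_intros)
          qed simp
        qed
        show "AE x in lebesgue. norm (indicat_real K x * (F (un (m n) x) * classical_grad \<phi> x $ i)) \<le> indicat_real K x * (B0 * C1)" for n
        proof (rule AE_I2)
          fix x
          show "norm (indicat_real K x * (F (un (m n) x) * classical_grad \<phi> x $ i)) \<le> indicat_real K x * (B0 * C1)"
            using B0(2)[OF unb[OF m]] C1 B0(1) by (cases "x \<in> K") (auto simp: abs_mult intro!: mult_mono)
        qed
      qed (use indi in \<open>auto intro!: meas continuous_intros FuK Fn m \<phi>c\<close>)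
      have L2: "(\<lambda>n. \<integral>x. indicat_real K x * (F' (un (m n) x) * gn (m n) x * \<phi> x) \<partial>lebesgue)
          \<longlonglongrightarrow> (\<integral>x. indicat_real K x * (F' (u x) * g x * \<phi> x) \<partial>lebesgue)"
      proof -
        have i1: "integrable lebesgue (\<lambda>x. (indicat_real K x * (k x * \<phi> x)) * f x)"
          if "continuous_on K k" "integrable lebesgue f" for k f
        proof -
          have c: "continuous_on K (\<lambda>x. k x * \<phi> x)" by (intro continuous_intros that \<phi>c)
          obtain B where "B > 0" "\<And>x. x \<in> K \<Longrightarrow> \<bar>k x * \<phi> x\<bar> \<le> B" using continuous_on_compact_bounded[OF K(1) c] by auto
          then show ?thesis
            by (intro integrable_bounded_mult[OF that(2) meas[OF c], of B]) (auto simp: indicator_def)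
        qed
        have gni: "integrable lebesgue (gn n)" for n unfolding gn_def by (rule integral_mollify[OF eps_pos gi])
        \<comment> \<open>\<open>gn\<close> converges in \<open>L^1\<close> and not pointwise. It is
          split into \<open>gn - g\<close>, against which the coefficients are uniformly bounded,
          and the fixed function \<open>g\<close>, where the coefficients converge
          pointwise.\<close>
        have R1: "(\<lambda>n. \<integral>x. (indicat_real K x * (F' (un (m n) x) * \<phi> x)) * (gn (m n) x - g x) \<partial>lebesgue) \<longlonglongrightarrow> 0"
        proof (rule tendsto_rabs_zero_cancel, rule tendsto_sandwich[where f = "\<lambda>_. 0"])
          show "\<forall>\<^sub>F n in sequentially. \<bar>\<integral>x. (indicat_real K x * (F' (un (m n) x) * \<phi> x)) * (gn (m n) x - g x) \<partial>lebesgue\<bar>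
             \<le> B1 * C0 * (\<integral>x. \<bar>gn (m n) x - g x\<bar> \<partial>lebesgue)"
          proof (intro always_eventually allI)
            fix n
            have "\<bar>\<integral>x. (indicat_real K x * (F' (un (m n) x) * \<phi> x)) * (gn (m n) x - g x) \<partial>lebesgue\<bar>
              \<le> (\<integral>x. B1 * C0 * \<bar>gn (m n) x - g x\<bar> \<partial>lebesgue)"
            proof (rule order_trans[OF integral_abs_bound integral_mono])
              have gd: "integrable lebesgue (\<lambda>x. gn (m n) x - g x)" using gni gi by simp
              show "integrable lebesgue (\<lambda>x. \<bar>(indicat_real K x * (F' (un (m n) x) * \<phi> x)) * (gn (m n) x - g x)\<bar>)"
                by (intro integrable_abs i1 F'n m gd)
              show "integrable lebesgue (\<lambda>x. B1 * C0 * \<bar>gn (m n) x - g x\<bar>)" using gd by simp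
              show "\<bar>(indicat_real K x * (F' (un (m n) x) * \<phi> x)) * (gn (m n) x - g x)\<bar> \<le> B1 * C0 * \<bar>gn (m n) x - g x\<bar>" for x
                unfolding abs_mult[of _ "gn (m n) x - g x"]
                using B1(2)[OF unb[OF m]] C0 B1(1)
                by (intro mult_right_mono) (cases "x \<in> K"; auto simp: abs_mult intro!: mult_mono)+
            qed
            then show "\<bar>\<integral>x. (indicat_real K x * (F' (un (m n) x) * \<phi> x)) * (gn (m n) x - g x) \<partial>lebesgue\<bar>
             \<le> B1 * C0 * (\<integral>x. \<bar>gn (m n) x - g x\<bar> \<partial>lebesgue)" by simp
          qed
          have "(\<lambda>n. \<integral>x. \<bar>gn (m n) x - g x\<bar> \<partial>lebesgue) \<longlonglongrightarrow> 0"
            unfolding gn_def by (rule ml[OF mollify_L1_tendsto[OF gi]])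
          then show "(\<lambda>n. B1 * C0 * (\<integral>x. \<bar>gn (m n) x - g x\<bar> \<partial>lebesgue)) \<longlonglongrightarrow> 0"
            by (rule tendsto_mult_right_zero)
        qed (auto intro!: always_eventually)
        have R2: "(\<lambda>n. \<integral>x. (indicat_real K x * (F' (un (m n) x) * \<phi> x)) * g x \<partial>lebesgue)
            \<longlonglongrightarrow> (\<integral>x. (indicat_real K x * (F' (u x) * \<phi> x)) * g x \<partial>lebesgue)"
        proof (rule integral_dominated_convergence[where w = "\<lambda>x. B1 * C0 * \<bar>g x\<bar>"])
          show "AE x in lebesgue. (\<lambda>n. (indicat_real K x * (F' (un (m n) x) * \<phi> x)) * g x)
              \<longlonglongrightarrow> (indicat_real K x * (F' (u x) * \<phi> x)) * g x"
          proof (rule AE_I2)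
            fix x
            show "(\<lambda>n. (indicat_real K x * (F' (un (m n) x) * \<phi> x)) * g x)
              \<longlonglongrightarrow> (indicat_real K x * (F' (u x) * \<phi> x)) * g x"
            proof (cases "x \<in> K")
              case True
              have "isCont F' (u x)" using F(2) I(1,3) True K(2) by (auto simp: continuous_on_eq_continuous_at)
              from isCont_tendsto_compose[OF this ml[OF unl[OF True]]] show ?thesis by (intro tendsto_intros)
            qed simp
          qed
          show "AE x in lebesgue. norm ((indicat_real K x * (F' (un (m n) x) * \<phi> x)) * g x) \<le> B1 * C0 * \<bar>g x\<bar>" for n
            unfolding norm_mult real_norm_def
            using B1(2)[OF unb[OF m]] C0 B1(1)
            by (intro AE_I2 mult_right_mono) (case_tac "x \<in> K"; auto simp: abs_mult intro!: mult_mono)+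
        qed (use gi borel_measurable_integrable[OF i1[OF F'uK gi]] borel_measurable_integrable[OF i1[OF F'n[OF m] gi]] in auto)
        have s: "(\<integral>x. indicat_real K x * (F' (un (m n) x) * gn (m n) x * \<phi> x) \<partial>lebesgue)
           = (\<integral>x. (indicat_real K x * (F' (un (m n) x) * \<phi> x)) * (gn (m n) x - g x) \<partial>lebesgue)
             + (\<integral>x. (indicat_real K x * (F' (un (m n) x) * \<phi> x)) * g x \<partial>lebesgue)" for n
        proof -
          have gd: "integrable lebesgue (\<lambda>x. gn (m n) x - g x)" using gni gi by simp
          show ?thesis
            by (subst Bochner_Integration.integral_add[OF i1[OF F'n[OF m] gd] i1[OF F'n[OF m] gi], symmetric])
               (intro Bochner_Integration.integral_cong refl, simp add: algebra_simps)
        qed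
        have "(\<lambda>n. \<integral>x. indicat_real K x * (F' (un (m n) x) * gn (m n) x * \<phi> x) \<partial>lebesgue)
          \<longlonglongrightarrow> (\<integral>x. (indicat_real K x * (F' (u x) * \<phi> x)) * g x \<partial>lebesgue)"
          unfolding s using tendsto_add[OF R1 R2] by simp
        then show ?thesis by (simp add: mult_ac)
      qed
      have "(\<integral>x. indicat_real K x * (F (u x) * classical_grad \<phi> x $ i) \<partial>lebesgue)
          = - (\<integral>x. indicat_real K x * (F' (u x) * g x * \<phi> x) \<partial>lebesgue)"
        by (rule LIMSEQ_unique[OF L1]) (use tendsto_minus[OF L2] ibp[OF m] in simp)
      also have "(\<integral>x. indicat_real K x * (F' (u x) * g x * \<phi> x) \<partial>lebesgue) = (\<integral>x. indicat_real K x * ((F' (u x) *\<^sub>R G x) $ i * \<phi> x) \<partial>lebesgue)"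
      proof (intro Bochner_Integration.integral_cong refl)
        fix x show "indicat_real K x * (F' (u x) * g x * \<phi> x) = indicat_real K x * ((F' (u x) *\<^sub>R G x) $ i * \<phi> x)"
          using K1(4) by (cases "x \<in> K") (auto simp: g_def)
      qed
      finally show ?thesis using K by (subst (1 2) set_integral_support(1)[OF K(2)]) auto
    qed
  qed
  then show ?thesis by (intro is_weak_gradI L1_loc_continuous[OF Fu] GL)
qed

lemma is_weak_grad_add:
  assumes \<Omega>: "open \<Omega>" and u: "is_weak_grad \<Omega> u G" and v: "is_weak_grad \<Omega> v H"
  shows "is_weak_grad \<Omega> (\<lambda>x. u x + v x) (\<lambda>x. G x + H x)"
proof -
  have "(LINT x:\<Omega>|lebesgue. (u x + v x) * classical_grad \<phi> x $ i) = - (LINT x:\<Omega>|lebesgue. (G x + H x) $ i * \<phi> x)"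
    if \<phi>: "\<phi> \<in> test_functions \<Omega>" for \<phi> i
  proof -
    obtain K where K: "compact K" "K \<subseteq> \<Omega>" "\<And>x. x \<in> \<Omega> - K \<Longrightarrow> \<phi> x = 0" "\<And>x. x \<in> \<Omega> - K \<Longrightarrow> classical_grad \<phi> x = 0"
      by (fact test_functions_support[OF \<phi> \<Omega>])
    have z: "\<And>x. x \<in> \<Omega> - K \<Longrightarrow> classical_grad \<phi> x $ i = 0" using K(4) by simp
    note S1 = L1_loc_set_integrable[OF is_weak_grad_L1(1)[OF u] test_functions_D(3)[OF \<phi>] K(1,2) z]
      L1_loc_set_integrable[OF is_weak_grad_L1(1)[OF v] test_functions_D(3)[OF \<phi>] K(1,2) z]
    note S2 = L1_loc_set_integrable[OF is_weak_grad_L1(2)[OF u] test_functions_D(1)[OF \<phi>] K(1,2,3), of i]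
      L1_loc_set_integrable[OF is_weak_grad_L1(2)[OF v] test_functions_D(1)[OF \<phi>] K(1,2,3), of i]
    show ?thesis using set_integral_add(2)[OF S1] set_integral_add(2)[OF S2] u v \<phi>
      by (simp add: distrib_right is_weak_grad_def)
  qed
  then show ?thesis
    by (intro is_weak_gradI) (simp_all only: vector_add_component L1_loc_add is_weak_grad_L1[OF u] is_weak_grad_L1[OF v])
qed

lemma is_weak_grad_cmult:
  assumes u: "is_weak_grad \<Omega> u G"
  shows "is_weak_grad \<Omega> (\<lambda>x. c * u x) (\<lambda>x. c *\<^sub>R G x)"
proof -
  have "(LINT x:\<Omega>|lebesgue. (c * u x) * classical_grad \<phi> x $ i) = - (LINT x:\<Omega>|lebesgue. (c *\<^sub>R G x) $ i * \<phi> x)"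
    if \<phi>: "\<phi> \<in> test_functions \<Omega>" for \<phi> i
    using u \<phi> by (simp add: is_weak_grad_def mult.assoc)
  then show ?thesis
    by (intro is_weak_gradI) (simp_all only: vector_scaleR_component real_scaleR_def L1_loc_cmult is_weak_grad_L1[OF u])
qed

text \<open>Polarisation, \<open>4 u v = (u + v)^2 - (u - v)^2\<close>, reduces the product rule to
  the chain rule for the square.\<close>

lemma is_weak_grad_mult:
  assumes \<Omega>: "open \<Omega>" and u: "is_weak_grad \<Omega> u G" "continuous_on \<Omega> u" and v: "is_weak_grad \<Omega> v H" "continuous_on \<Omega> v"
  shows "is_weak_grad \<Omega> (\<lambda>x. u x * v x) (\<lambda>x. u x *\<^sub>R H x + v x *\<^sub>R G x)"
proof -
  have sq: "is_weak_grad \<Omega> (\<lambda>x. (w x)\<^sup>2) (\<lambda>x. (2 * w x) *\<^sub>R W x)" if "is_weak_grad \<Omega> w W" "continuous_on \<Omega> w" for w W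
    by (rule is_weak_grad_chain[OF \<Omega> that, where I = UNIV and F = "\<lambda>s. s\<^sup>2" and F' = "\<lambda>s. 2 * s"])
       (auto intro!: derivative_eq_intros continuous_intros)
  have m: "is_weak_grad \<Omega> (\<lambda>x. u x + (-1) * v x) (\<lambda>x. G x + (-1) *\<^sub>R H x)"
    by (intro is_weak_grad_add \<Omega> u is_weak_grad_cmult v)
  have a: "is_weak_grad \<Omega> (\<lambda>x. u x + v x) (\<lambda>x. G x + H x)"
    by (intro is_weak_grad_add \<Omega> u v)
  have "is_weak_grad \<Omega> (\<lambda>x. (1/4) * (u x + v x)\<^sup>2 + (-1/4) * (u x + (-1) * v x)\<^sup>2)
     (\<lambda>x. (1/4) *\<^sub>R ((2 * (u x + v x)) *\<^sub>R (G x + H x)) + (-1/4) *\<^sub>R ((2 * (u x + (-1) * v x)) *\<^sub>R (G x + (-1) *\<^sub>R H x)))"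
    by (intro is_weak_grad_add \<Omega> is_weak_grad_cmult sq a m continuous_intros u v)
  moreover have "(\<lambda>x. (1/4) * (u x + v x)\<^sup>2 + (-1/4) * (u x + (-1) * v x)\<^sup>2) = (\<lambda>x. u x * v x)"
    by (auto simp: power2_eq_square field_simps)
  moreover have "(\<lambda>x. (1/4) *\<^sub>R ((2 * (u x + v x)) *\<^sub>R (G x + H x)) + (-1/4) *\<^sub>R ((2 * (u x + (-1) * v x)) *\<^sub>R (G x + (-1) *\<^sub>R H x)))
      = (\<lambda>x. u x *\<^sub>R H x + v x *\<^sub>R G x)"
    by (auto simp: vec_eq_iff field_simps)
  ultimately show ?thesis by simp
qed

lemma is_weak_grad_cong:
  fixes \<Omega> :: "(real^'n) set"
  assumes "\<And>x. x \<in> \<Omega> \<Longrightarrow> u x = v x"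
  shows "is_weak_grad \<Omega> u G \<longleftrightarrow> is_weak_grad \<Omega> v G"
proof -
  have "is_weak_grad \<Omega> v G" if "is_weak_grad \<Omega> u G" "\<And>x. x \<in> \<Omega> \<Longrightarrow> u x = v x" for u v :: "real^'n \<Rightarrow> real"
  proof -
    have "set_integrable lebesgue K u \<longleftrightarrow> set_integrable lebesgue K v" if "K \<subseteq> \<Omega>" for K
      unfolding set_integrable_def
      by (rule arg_cong[where f = "integrable lebesgue"]) (use that(1) \<open>\<And>x. x \<in> \<Omega> \<Longrightarrow> u x = v x\<close> in \<open>force simp: indicator_def fun_eq_iff\<close>)
    moreover have "(LINT x:\<Omega>|lebesgue. u x * k x) = (LINT x:\<Omega>|lebesgue. v x * k x)" for k
      unfolding set_lebesgue_integral_def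
      by (rule Bochner_Integration.integral_cong) (use that(2) in \<open>auto simp: indicator_def\<close>)
    ultimately show ?thesis using that(1) unfolding is_weak_grad_def L1_loc_def by simp
  qed
  then show ?thesis using assms by metis
qed

text \<open>The two predicates coincide, so the choice operator returns literally the same
  representative.\<close>

lemma weak_grad_cong:
  assumes "\<And>x. x \<in> \<Omega> \<Longrightarrow> u x = v x"
  shows "weak_grad \<Omega> u = weak_grad \<Omega> v"
proof -
  have "is_weak_grad \<Omega> u = is_weak_grad \<Omega> v" using is_weak_grad_cong[of \<Omega> u v] assms by (intro ext) blast
  then show ?thesis by (simp add: weak_grad_def)
qed

lemma is_weak_grad_weak_grad: "is_weak_grad \<Omega> u G \<Longrightarrow> is_weak_grad \<Omega> u (weak_grad \<Omega> u)"
  unfolding weak_grad_def by (rule someI[of "is_weak_grad \<Omega> u"])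

section \<open>Duality pairings under mollification\<close>

text \<open>\<open>c\<close> solves \<open>c powr p = b * p\<close>; writing \<open>s t\<close> as
  \<open>(s / c) (c t)\<close> then leaves exactly the weight \<open>b\<close> on the second
  summand.\<close>

lemma Young_weighted:
  fixes p b :: real
  assumes p: "1 < p" and b: "0 < b"
  shows "\<exists>a>0. \<forall>s\<ge>0. \<forall>t\<ge>0. s * t \<le> a * s powr (p/(p-1)) + b * t powr p"
proof -
  define c where "c = (b * p) powr (1/p)"
  have c: "c > 0" using p b by (simp add: c_def)
  have cp: "c powr p = b * p" using p b by (simp add: c_def powr_powr)
  define q where "q = p/(p-1)"
  have q: "q > 1" "1/q + 1/p = 1" using p by (auto simp: q_def field_simps)
  have "s * t \<le> ((1/c) powr q / q) * s powr q + b * t powr p" if "s \<ge> 0" "t \<ge> 0" for s t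
  proof -
    have "s * t = ((1/c) * s) * (c * t)" using c by simp
    also have "\<dots> \<le> ((1/c) * s) powr q / q + (c * t) powr p / p"
      using that c p q by (intro Youngs_inequality) auto
    also have "((1/c) * s) powr q = (1/c) powr q * s powr q" using that c by (intro powr_mult)
    also have "(c * t) powr p = b * p * t powr p" using that c cp by (simp add: powr_mult)
    finally show ?thesis using p by simp
  qed
  moreover have "(1/c) powr q / q > 0" using c q by simp
  ultimately show ?thesis unfolding q_def[symmetric] by blast
qed

lemma moll_reflect_integral:
  fixes x :: "real^'n"
  assumes "0 < e"
  shows "(\<integral>y. moll e (x - y) \<partial>lebesgue) = 1" "integrable lebesgue (\<lambda>y. moll e (x - y))"
proof -
  have "(\<integral>y. moll e (x + (-1) *\<^sub>R y) \<partial>lebesgue) = (\<integral>y. moll e (y :: real^'n) \<partial>lebesgue)"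
    by (rule integral_lebesgue_affine_continuous[OF Cc_UNIV_D(1)[OF moll_Cc[OF assms]]]) simp
  then show "(\<integral>y. moll e (x - y) \<partial>lebesgue) = 1" using moll_integral[OF assms, where 'n='n] by simp
  show "integrable lebesgue (\<lambda>y. moll e (x - y))"
    by (rule Cc_UNIV_integrable[OF Cc_reflect[OF moll_Cc[OF assms]]])
qed

text \<open>Young's inequality inside the average replaces an \<open>L^p\<close> bound for
  mollifications: \<open>R\<close> stands for a value of the dual function at \<open>x\<close>, and
  the mollified \<open>p\<close>-th power has the same integral as
  \<open>\<bar>H\<bar> powr p\<close>.\<close>

lemma mollify_Young:
  fixes H :: "real^'n \<Rightarrow> real"
  assumes e: "0 < e" and H: "integrable lebesgue H" "integrable lebesgue (\<lambda>x. \<bar>H x\<bar> powr p)" and R: "0 \<le> R"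
    and Y: "\<And>t. 0 \<le> t \<Longrightarrow> R * t \<le> a + b * t powr p"
  shows "R * \<bar>mollify e H x\<bar> \<le> a + b * mollify e (\<lambda>x. \<bar>H x\<bar> powr p) x"
proof -
  have Ha: "integrable lebesgue (\<lambda>x. \<bar>H x\<bar>)" using H by simp
  note i1 = conv_integrable[OF moll_Cc[OF e] Ha, of x]
  note i2 = conv_integrable[OF moll_Cc[OF e] H(2), of x]
  note i3 = moll_reflect_integral(2)[OF e, of x]
  have "R * \<bar>mollify e H x\<bar> \<le> R * mollify e (\<lambda>x. \<bar>H x\<bar>) x"
    using mollify_abs_le[OF e H(1), of x] R by (intro mult_left_mono) auto
  also have "\<dots> = (\<integral>y. R * (moll e (x - y) * \<bar>H y\<bar>) \<partial>lebesgue)"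
    using i1 by (simp add: mollify_def conv_def)
  also have "\<dots> \<le> (\<integral>y. a * moll e (x - y) + b * (moll e (x - y) * \<bar>H y\<bar> powr p) \<partial>lebesgue)"
  proof (rule integral_mono)
    show "integrable lebesgue (\<lambda>y. R * (moll e (x - y) * \<bar>H y\<bar>))" using i1 by simp
    show "integrable lebesgue (\<lambda>y. a * moll e (x - y) + b * (moll e (x - y) * \<bar>H y\<bar> powr p))" using i2 i3 by simp
    fix y
    have "moll e (x - y) * (R * \<bar>H y\<bar>) \<le> moll e (x - y) * (a + b * \<bar>H y\<bar> powr p)"
      using Y[of "\<bar>H y\<bar>"] moll_nonneg[OF e] by (intro mult_left_mono) auto
    then show "R * (moll e (x - y) * \<bar>H y\<bar>) \<le> a * moll e (x - y) + b * (moll e (x - y) * \<bar>H y\<bar> powr p)"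
      by (simp add: algebra_simps)
  qed
  also have "\<dots> = a + b * mollify e (\<lambda>x. \<bar>H x\<bar> powr p) x"
    using i2 i3 moll_reflect_integral(1)[OF e, of x] by (simp add: mollify_def conv_def)
  finally show ?thesis .
qed

lemma integrable_mult_Young:
  fixes X H :: "real^'n \<Rightarrow> real"
  assumes p: "1 < p" and X: "X \<in> borel_measurable lebesgue" "integrable lebesgue (\<lambda>x. \<bar>X x\<bar> powr (p/(p-1)))"
    and H: "H \<in> borel_measurable lebesgue" "integrable lebesgue (\<lambda>x. \<bar>H x\<bar> powr p)"
  shows "integrable lebesgue (\<lambda>x. X x * H x)"
proof -
  obtain a where a: "a > 0" "\<And>s t. s \<ge> 0 \<Longrightarrow> t \<ge> 0 \<Longrightarrow> s * t \<le> a * s powr (p/(p-1)) + 1 * t powr p"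
    using Young_weighted[OF p, of 1] by auto
  show ?thesis
  proof (rule Bochner_Integration.integrable_bound)
    show "integrable lebesgue (\<lambda>x. a * \<bar>X x\<bar> powr (p/(p-1)) + \<bar>H x\<bar> powr p)" using X H by simp
    show "AE x in lebesgue. norm (X x * H x) \<le> norm (a * \<bar>X x\<bar> powr (p/(p-1)) + \<bar>H x\<bar> powr p)"
    proof (rule AE_I2)
      fix x
      have "\<bar>X x\<bar> * \<bar>H x\<bar> \<le> a * \<bar>X x\<bar> powr (p/(p-1)) + \<bar>H x\<bar> powr p" using a(2)[of "\<bar>X x\<bar>" "\<bar>H x\<bar>"] by simp
      then show "norm (X x * H x) \<le> norm (a * \<bar>X x\<bar> powr (p/(p-1)) + \<bar>H x\<bar> powr p)" by (simp add: abs_mult)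
    qed
  qed (use X H in auto)
qed

text \<open>Mollifications are known to converge in \<open>L^1\<close>, so \<open>X\<close> is
  truncated at height \<open>k\<close>: its bounded part pairs with \<open>L^1\<close> convergence.
  The rest is small in the dual exponent and is absorbed by Young's inequality with a small weight
  on \<open>H\<close>, uniformly in \<open>n\<close>.\<close>

lemma mollify_pairing_tendsto:
  fixes X H :: "real^'n \<Rightarrow> real"
  assumes p: "1 < p" and X: "X \<in> borel_measurable lebesgue" "integrable lebesgue (\<lambda>x. \<bar>X x\<bar> powr (p/(p-1)))"
    and H: "integrable lebesgue H" "integrable lebesgue (\<lambda>x. \<bar>H x\<bar> powr p)"
  shows "integrable lebesgue (\<lambda>x. X x * mollify (eps n) H x)"
    and "(\<lambda>n. \<integral>x. X x * mollify (eps n) H x \<partial>lebesgue) \<longlonglongrightarrow> (\<integral>x. X x * H x \<partial>lebesgue)"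
proof -
  define q where "q = p/(p-1)"
  have q: "q > 1" using p by (auto simp: q_def field_simps)
  define Hp where "Hp x = \<bar>H x\<bar> powr p" for x
  have Hp: "integrable lebesgue Hp" unfolding Hp_def by (rule H(2))
  define I where "I = (\<integral>x. Hp x \<partial>lebesgue)"
  have I0: "I \<ge> 0" by (simp add: I_def Hp_def)
  define Hn where "Hn n = mollify (eps n) H" for n
  have Hni: "integrable lebesgue (Hn n)" for n unfolding Hn_def by (rule integral_mollify[OF eps_pos H(1)])
  have Hnm: "Hn n \<in> borel_measurable lebesgue" for n using Hni[of n] by (rule borel_measurable_integrable)
  have Hpn: "integrable lebesgue (mollify (eps n) Hp)" "(\<integral>x. mollify (eps n) Hp x \<partial>lebesgue) = I" for n
    using integral_mollify[OF eps_pos Hp, of n] by (auto simp: I_def)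
  have XH: "integrable lebesgue (\<lambda>x. X x * H x)"
    by (rule integrable_mult_Young[OF p X borel_measurable_integrable[OF H(1)] H(2)])
  have split: "\<bar>R x\<bar> * \<bar>Hn n x\<bar> \<le> a * \<bar>R x\<bar> powr q + b * mollify (eps n) Hp x"
    if "\<And>s t. s \<ge> 0 \<Longrightarrow> t \<ge> 0 \<Longrightarrow> s * t \<le> a * s powr q + b * t powr p" for R :: "real^'n \<Rightarrow> real" and a b n x
    unfolding Hn_def Hp_def by (rule mollify_Young[OF eps_pos H]) (use that in auto)
  obtain a1 where a1: "a1 > 0" "\<And>s t. s \<ge> 0 \<Longrightarrow> t \<ge> 0 \<Longrightarrow> s * t \<le> a1 * s powr q + 1 * t powr p"
    using Young_weighted[OF p, of 1] unfolding q_def by auto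
  have XHn: "integrable lebesgue (\<lambda>x. X x * Hn n x)" for n
  proof (rule Bochner_Integration.integrable_bound)
    show "integrable lebesgue (\<lambda>x. a1 * \<bar>X x\<bar> powr q + 1 * mollify (eps n) Hp x)" using X(2) Hpn unfolding q_def by simp
    show "AE x in lebesgue. norm (X x * Hn n x) \<le> norm (a1 * \<bar>X x\<bar> powr q + 1 * mollify (eps n) Hp x)"
    proof (rule AE_I2)
      fix x
      show "norm (X x * Hn n x) \<le> norm (a1 * \<bar>X x\<bar> powr q + 1 * mollify (eps n) Hp x)"
        using split[OF a1(2), of X x n] by (simp add: abs_mult)
    qed
  qed (use X(1) Hnm in auto)
  then show "integrable lebesgue (\<lambda>x. X x * mollify (eps n) H x)" unfolding Hn_def .
  have "(\<lambda>n. \<integral>x. X x * Hn n x \<partial>lebesgue) \<longlonglongrightarrow> (\<integral>x. X x * H x \<partial>lebesgue)"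
  proof (rule LIMSEQ_I)
    fix r :: real assume r: "r > 0"
    \<comment> \<open>The rest \<open>R\<close> is paired with \<open>Hn\<close> and with
      \<open>H\<close>; each pairing costs two terms below \<open>r/6\<close>, and the truncated
      part costs one more, five sixths of \<open>r\<close> in all.\<close>
    define b where "b = r / 6 / (I + 1)"
    have b: "b > 0" "b * I < r/6"
    proof -
      show "b > 0" using r I0 by (simp add: b_def)
      have "b * I < b * (I + 1)" using \<open>b > 0\<close> by simp
      also have "b * (I + 1) = r/6" using I0 unfolding b_def by (simp add: nonzero_divide_eq_eq add_nonneg_eq_0_iff)
      finally show "b * I < r/6" .
    qed
    obtain a where a: "a > 0" "\<And>s t. s \<ge> 0 \<Longrightarrow> t \<ge> 0 \<Longrightarrow> s * t \<le> a * s powr q + b * t powr p"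
      using Young_weighted[OF p b(1)] unfolding q_def by auto
    define T where "T k x = max (- real k) (min (real k) (X x))" for k x
    have Tm: "T k \<in> borel_measurable lebesgue" for k
      unfolding T_def using X(1) by (intro borel_measurable_max borel_measurable_min) auto
    have TX: "\<bar>X x - T k x\<bar> \<le> \<bar>X x\<bar>" for k x by (auto simp: T_def)
    have "(\<lambda>k. \<integral>x. \<bar>X x - T k x\<bar> powr q \<partial>lebesgue) \<longlonglongrightarrow> (\<integral>x. 0 \<partial>(lebesgue :: (real^'n) measure))"
    proof (rule integral_dominated_convergence)
      show "integrable lebesgue (\<lambda>x. \<bar>X x\<bar> powr q)" using X(2) by (simp add: q_def)
      show "AE x in lebesgue. (\<lambda>k. \<bar>X x - T k x\<bar> powr q) \<longlonglongrightarrow> 0"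
      proof (rule AE_I2)
        fix x
        obtain N where N: "\<bar>X x\<bar> \<le> real N" using real_arch_simple by blast
        have "\<bar>X x - T k x\<bar> powr q = 0" if "k \<ge> N" for k
        proof -
          have "real N \<le> real k" using that by simp
          then have "T k x = X x" using N by (auto simp: T_def)
          then show ?thesis by simp
        qed
        then show "(\<lambda>k. \<bar>X x - T k x\<bar> powr q) \<longlonglongrightarrow> 0" by (intro tendsto_eventually eventually_sequentiallyI)
      qed
      show "AE x in lebesgue. norm (\<bar>X x - T k x\<bar> powr q) \<le> \<bar>X x\<bar> powr q" for k
        using TX q by (intro AE_I2) (auto intro: powr_mono2)
    qed (use X(1) Tm in auto)
    then have "\<forall>\<^sub>F k in sequentially. (\<integral>x. \<bar>X x - T k x\<bar> powr q \<partial>lebesgue) < r / 6 / a"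
      by (intro order_tendstoD(2)[where y = 0]) (use r a in auto)
    then obtain k where k: "(\<integral>x. \<bar>X x - T k x\<bar> powr q \<partial>lebesgue) < r / 6 / a" by (auto simp: eventually_sequentially)
    define R where "R x = X x - T k x" for x
    have Rm: "R \<in> borel_measurable lebesgue" unfolding R_def using X(1) Tm by auto
    have Rq: "integrable lebesgue (\<lambda>x. \<bar>R x\<bar> powr q)"
    proof (rule Bochner_Integration.integrable_bound)
      show "integrable lebesgue (\<lambda>x. \<bar>X x\<bar> powr q)" using X(2) by (simp add: q_def)
      show "AE x in lebesgue. norm (\<bar>R x\<bar> powr q) \<le> norm (\<bar>X x\<bar> powr q)"
        using TX q unfolding R_def by (intro AE_I2) (auto intro: powr_mono2)
    qed (use Rm in auto)
    have IR: "a * (\<integral>x. \<bar>R x\<bar> powr q \<partial>lebesgue) < r/6" using k a unfolding R_def by (simp add: field_simps)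
    have "(\<lambda>n. real k * (\<integral>x. \<bar>Hn n x - H x\<bar> \<partial>lebesgue)) \<longlonglongrightarrow> 0"
      unfolding Hn_def by (rule tendsto_mult_right_zero[OF mollify_L1_tendsto[OF H(1)]])
    then have "\<forall>\<^sub>F n in sequentially. real k * (\<integral>x. \<bar>Hn n x - H x\<bar> \<partial>lebesgue) < r/6"
      by (rule order_tendstoD(2)) (use r in simp)
    then have "\<forall>\<^sub>F n in sequentially. \<bar>(\<integral>x. X x * Hn n x \<partial>lebesgue) - (\<integral>x. X x * H x \<partial>lebesgue)\<bar> < r"
    proof eventually_elim
      case (elim n)
      have di: "integrable lebesgue (\<lambda>x. Hn n x - H x)" using Hni H by simp
      have e: "(\<integral>x. X x * Hn n x \<partial>lebesgue) - (\<integral>x. X x * H x \<partial>lebesgue) = (\<integral>x. X x * Hn n x - X x * H x \<partial>lebesgue)"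
        by (rule Bochner_Integration.integral_diff[OF XHn XH, symmetric])
      have "\<bar>\<integral>x. X x * Hn n x - X x * H x \<partial>lebesgue\<bar> \<le> (\<integral>x. (a * \<bar>R x\<bar> powr q + b * mollify (eps n) Hp x) + (a * \<bar>R x\<bar> powr q + b * Hp x) + real k * \<bar>Hn n x - H x\<bar> \<partial>lebesgue)"
      proof (rule order_trans[OF integral_abs_bound integral_mono])
        show "integrable lebesgue (\<lambda>x. \<bar>X x * Hn n x - X x * H x\<bar>)" using XHn XH by simp
        show "integrable lebesgue (\<lambda>x. (a * \<bar>R x\<bar> powr q + b * mollify (eps n) Hp x) + (a * \<bar>R x\<bar> powr q + b * Hp x) + real k * \<bar>Hn n x - H x\<bar>)"
          using Rq Hpn Hp di by simp
        fix x
        have "X x * Hn n x - X x * H x = R x * Hn n x - R x * H x + T k x * (Hn n x - H x)" by (simp add: R_def algebra_simps)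
        then have "\<bar>X x * Hn n x - X x * H x\<bar> \<le> \<bar>R x\<bar> * \<bar>Hn n x\<bar> + \<bar>R x\<bar> * \<bar>H x\<bar> + \<bar>T k x\<bar> * \<bar>Hn n x - H x\<bar>"
          by (simp flip: abs_mult)
        moreover have "\<bar>T k x\<bar> * \<bar>Hn n x - H x\<bar> \<le> real k * \<bar>Hn n x - H x\<bar>"
          by (rule mult_right_mono) (auto simp: T_def abs_le_iff)
        moreover have "\<bar>R x\<bar> * \<bar>H x\<bar> \<le> a * \<bar>R x\<bar> powr q + b * Hp x"
          using a(2)[of "\<bar>R x\<bar>" "\<bar>H x\<bar>"] by (simp add: Hp_def)
        ultimately show "\<bar>X x * Hn n x - X x * H x\<bar> \<le> (a * \<bar>R x\<bar> powr q + b * mollify (eps n) Hp x) + (a * \<bar>R x\<bar> powr q + b * Hp x) + real k * \<bar>Hn n x - H x\<bar>"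
          using split[OF a(2), of R x n] by linarith
      qed
      also have "\<dots> = 2 * (a * (\<integral>x. \<bar>R x\<bar> powr q \<partial>lebesgue)) + 2 * (b * I) + real k * (\<integral>x. \<bar>Hn n x - H x\<bar> \<partial>lebesgue)"
        using Rq Hpn Hp di by (simp add: I_def[symmetric])
      also have "\<dots> < r" using IR b(2) elim r by linarith
      finally show ?case unfolding e .
    qed
    then show "\<exists>no. \<forall>n\<ge>no. norm ((\<integral>x. X x * Hn n x \<partial>lebesgue) - (\<integral>x. X x * H x \<partial>lebesgue)) < r"
      by (auto simp: eventually_sequentially)
  qed
  then show "(\<lambda>n. \<integral>x. X x * mollify (eps n) H x \<partial>lebesgue) \<longlonglongrightarrow> (\<integral>x. X x * H x \<partial>lebesgue)" unfolding Hn_def .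
qed

section \<open>Measurability on open sets and Morrey spaces\<close>

lemma measurable_lebesgue_on_iff:
  fixes f :: "real^'n \<Rightarrow> real"
  assumes "open \<Omega>"
  shows "f \<in> borel_measurable (lebesgue_on \<Omega>) \<longleftrightarrow> (\<lambda>x. indicat_real \<Omega> x * f x) \<in> borel_measurable lebesgue"
  using borel_measurable_restrict_space_iff[of \<Omega> lebesgue f] assms by simp

lemma measurable_lebesgue_on_indicator:
  fixes f :: "real^'n \<Rightarrow> real"
  assumes "open \<Omega>" "f \<in> borel_measurable (lebesgue_on \<Omega>)" "K \<in> sets lebesgue" "K \<subseteq> \<Omega>"
  shows "(\<lambda>x. indicat_real K x * f x) \<in> borel_measurable lebesgue"
proof -
  have "(\<lambda>x. indicat_real K x * (indicat_real \<Omega> x * f x)) \<in> borel_measurable lebesgue"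
    by (rule borel_measurable_times[OF borel_measurable_indicator[OF assms(3)] iffD1[OF measurable_lebesgue_on_iff[OF assms(1)] assms(2)]])
  moreover have "(\<lambda>x. indicat_real K x * (indicat_real \<Omega> x * f x)) = (\<lambda>x. indicat_real K x * f x)"
    using assms(4) by (auto simp: fun_eq_iff indicator_def)
  ultimately show ?thesis by simp
qed

text \<open>Measurability on compact subsets passes to \<open>\<Omega>\<close> along an exhaustion
  by compact sets.\<close>

lemma L1_loc_measurable:
  fixes f :: "real^'n \<Rightarrow> real"
  assumes \<Omega>: "open \<Omega>" and f: "f \<in> L1_loc \<Omega>"
  shows "f \<in> borel_measurable (lebesgue_on \<Omega>)"
proof -
  obtain C where C: "\<And>n::nat. compact (C n)" "\<And>n. C n \<subseteq> \<Omega>" "\<And>n. C n \<subseteq> interior (C (Suc n))" "\<Union>(range C) = \<Omega>"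
    "\<And>K. compact K \<Longrightarrow> K \<subseteq> \<Omega> \<Longrightarrow> \<exists>N. \<forall>n\<ge>N. K \<subseteq> C n"
    by (fact open_Union_compact_subsets[OF \<Omega>])
  have "C n \<subseteq> C (Suc n)" for n using order_trans[OF C(3) interior_subset] .
  then have mono: "C m \<subseteq> C n" if "m \<le> n" for m n using lift_Suc_mono_le[of C m n] that by blast
  have "(\<lambda>x. indicat_real \<Omega> x * f x) \<in> borel_measurable lebesgue"
  proof (rule borel_measurable_LIMSEQ_real)
    show "(\<lambda>n. indicat_real (C n) x * f x) \<longlonglongrightarrow> indicat_real \<Omega> x * f x" for x
    proof (cases "x \<in> \<Omega>")
      case True
      then obtain m where m: "x \<in> C m" using C(4) by blast
      show ?thesis
        by (rule tendsto_eventually, rule eventually_sequentiallyI[of m]) (use True m mono in \<open>auto simp: indicator_def\<close>)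
    next
      case False
      then have "x \<notin> C n" for n using C(2) by blast
      then show ?thesis using False by simp
    qed
    show "(\<lambda>x. indicat_real (C n) x * f x) \<in> borel_measurable lebesgue" for n
      using L1_loc_integrable[OF f C(1,2)] by auto
  qed
  then show ?thesis using measurable_lebesgue_on_iff[OF \<Omega>] by blast
qed

lemma integrable_on_compact_bound:
  fixes f g :: "real^'n \<Rightarrow> real"
  assumes \<Omega>: "open \<Omega>" and f: "f \<in> borel_measurable (lebesgue_on \<Omega>)" and K: "compact K" "K \<subseteq> \<Omega>"
    and g: "integrable lebesgue (\<lambda>x. indicat_real K x * g x)" and b: "AE x in lebesgue. x \<in> K \<longrightarrow> \<bar>f x\<bar> \<le> g x"
  shows "integrable lebesgue (\<lambda>x. indicat_real K x * f x)"
proof (rule Bochner_Integration.integrable_bound[OF g])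
  show "(\<lambda>x. indicat_real K x * f x) \<in> borel_measurable lebesgue"
    by (rule measurable_lebesgue_on_indicator[OF \<Omega> f compact_sets_lebesgue[OF K(1)] K(2)])
  show "AE x in lebesgue. norm (indicat_real K x * f x) \<le> norm (indicat_real K x * g x)"
    using b by eventually_elim (auto simp: indicator_def)
qed

text \<open>One radius gives local integrability: at \<open>r = diameter \<omega> / 2\<close> the
  weight is a nonzero constant, so the supremum bounds the integral over each
  \<open>\<omega> \<inter> ball y r\<close>, and finitely many of these cover \<open>K\<close>. An
  abstract weight \<open>c\<close> treats the power and the logarithmic classes together.\<close>

lemma morrey_L1_loc:
  fixes f :: "real^'n \<Rightarrow> real" and c :: "(real^'n) set \<Rightarrow> real \<Rightarrow> ennreal"
  assumes \<Omega>: "open \<Omega>" and f: "f \<in> borel_measurable (lebesgue_on \<Omega>)"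
    and c: "\<And>\<omega> r. 0 < r \<Longrightarrow> r < diameter \<omega> \<Longrightarrow> c \<omega> r \<noteq> 0"
    and s: "\<And>\<omega>. open \<omega> \<Longrightarrow> compactly_inside \<omega> \<Omega> \<Longrightarrow>
       (SUP (y, r) \<in> {(y, r). y \<in> \<omega> \<and> 0 < r \<and> r < diameter \<omega>}.
          c \<omega> r * (\<integral>\<^sup>+x\<in>\<omega> \<inter> ball y r. ennreal \<bar>f x\<bar> \<partial>lebesgue)) < \<infinity>"
  shows "f \<in> L1_loc \<Omega>"
proof -
  have "integrable lebesgue (\<lambda>x. indicat_real K x * f x)" if K: "compact K" "K \<subseteq> \<Omega>" for K
  proof (cases "K = {}")
    case False
    obtain d K1 where d: "d > 0" and K1: "compact K1" "K1 \<subseteq> \<Omega>" "\<And>x. x \<in> K \<Longrightarrow> cball x d \<subseteq> K1" "K \<subseteq> K1"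
      by (fact compact_neighbourhood[OF \<Omega> K])
    \<comment> \<open>Fattening \<open>K\<close> gives an open set of positive diameter, even if
      \<open>K\<close> is a single point.\<close>
    define \<omega> where "\<omega> = (\<Union>x\<in>K. ball x d)"
    have o: "open \<omega>" by (auto simp: \<omega>_def)
    have wK1: "\<omega> \<subseteq> K1" using K1(3) ball_subset_cball unfolding \<omega>_def by blast
    then have cl: "closure \<omega> \<subseteq> K1" using K1(1) by (simp add: closure_minimal compact_imp_closed)
    have ci: "compactly_inside \<omega> \<Omega>" unfolding compactly_inside_def
      using cl K1 wK1 bounded_subset[OF compact_imp_bounded[OF K1(1)] wK1] by (auto simp: compact_closure)
    obtain x0 where x0: "x0 \<in> K" using False by blast
    have "ball x0 d \<subseteq> \<omega>" using x0 by (auto simp: \<omega>_def)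
    then have "diameter (ball x0 d) \<le> diameter \<omega>"
      using bounded_subset[OF compact_imp_bounded[OF K1(1)] wK1] by (intro diameter_subset)
    moreover have "diameter (ball x0 d) > 0" using d by (subst diameter_ball) auto
    ultimately have dm: "diameter \<omega> > 0" by linarith
    define r where "r = diameter \<omega> / 2"
    have r: "0 < r" "r < diameter \<omega>" using dm by (auto simp: r_def)
    have fin: "(\<integral>\<^sup>+x\<in>\<omega> \<inter> ball y r. ennreal \<bar>f x\<bar> \<partial>lebesgue) < \<infinity>" if "y \<in> \<omega>" for y
    proof -
      have "c \<omega> r * (\<integral>\<^sup>+x\<in>\<omega> \<inter> ball y r. ennreal \<bar>f x\<bar> \<partial>lebesgue) < \<infinity>"
        by (rule le_less_trans[OF _ s[OF o ci]]) (rule SUP_upper2[of "(y, r)"], use that r in auto)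
      then show ?thesis using c[OF r] by (auto simp: ennreal_mult_less_top)
    qed
    have "K \<subseteq> (\<Union>y\<in>K. ball y r)" using r by auto
    then obtain Y where Y: "Y \<subseteq> K" "finite Y" "K \<subseteq> (\<Union>y\<in>Y. ball y r)"
      using compactE_image[OF K(1), of K "\<lambda>y. ball y r"] by (metis open_ball)
    have Kw: "K \<subseteq> \<omega>" using d by (auto simp: \<omega>_def)
    have wO: "\<omega> \<subseteq> \<Omega>" using wK1 K1(2) by blast
    have fm: "(\<lambda>x. indicat_real S x * f x) \<in> borel_measurable lebesgue" if "S \<in> sets lebesgue" "S \<subseteq> \<Omega>" for S
      by (rule measurable_lebesgue_on_indicator[OF \<Omega> f that])
    have e: "ennreal \<bar>f x\<bar> * indicator S x = ennreal \<bar>indicat_real S x * f x\<bar>" for S x by (auto simp: indicator_def)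
    have ms: "(\<lambda>x. ennreal \<bar>f x\<bar> * indicator S x) \<in> borel_measurable lebesgue" if "S \<in> sets lebesgue" "S \<subseteq> \<Omega>" for S
      unfolding e using fm[OF that] by auto
    have wb: "\<omega> \<inter> ball y r \<in> sets lebesgue" "\<omega> \<inter> ball y r \<subseteq> \<Omega>" for y using o wO by (auto intro!: sets.Int)
    have "(\<integral>\<^sup>+x. ennreal \<bar>indicat_real K x * f x\<bar> \<partial>lebesgue) \<le> (\<integral>\<^sup>+x. (\<Sum>y\<in>Y. ennreal \<bar>f x\<bar> * indicator (\<omega> \<inter> ball y r) x) \<partial>lebesgue)"
    proof (rule nn_integral_mono)
      fix x
      show "ennreal \<bar>indicat_real K x * f x\<bar> \<le> (\<Sum>y\<in>Y. ennreal \<bar>f x\<bar> * indicator (\<omega> \<inter> ball y r) x)"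
      proof (cases "x \<in> K")
        case True
        then obtain y where y: "y \<in> Y" "x \<in> ball y r" using Y(3) by blast
        have "ennreal \<bar>f x\<bar> * indicator (\<omega> \<inter> ball y r) x \<le> (\<Sum>y\<in>Y. ennreal \<bar>f x\<bar> * indicator (\<omega> \<inter> ball y r) x)"
          using y Y(2) by (intro member_le_sum) auto
        then show ?thesis using True y Kw by (auto simp: subset_iff)
      qed simp
    qed
    also have "\<dots> = (\<Sum>y\<in>Y. \<integral>\<^sup>+x\<in>\<omega> \<inter> ball y r. ennreal \<bar>f x\<bar> \<partial>lebesgue)"
      by (rule nn_integral_sum) (rule ms[OF wb])
    also have "\<dots> < \<infinity>"
    proof -
      have "y \<in> \<omega>" if "y \<in> Y" for y using that Y(1) Kw by blast
      then show ?thesis using fin Y(2) unfolding infinity_ennreal_def ennreal_sum_less_top[OF Y(2)] by blast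
    qed
    finally show ?thesis using fm[OF compact_sets_lebesgue[OF K(1)] K(2)] by (simp add: integrable_iff_bounded)
  qed simp
  then show ?thesis by (auto simp: L1_loc_def set_integrable_def)
qed

lemma morrey_p_loc_L1_loc:
  fixes V :: "real^'n \<Rightarrow> real"
  assumes \<Omega>: "open \<Omega>" and V: "V \<in> morrey_p_loc q p \<Omega>"
  shows "V \<in> L1_loc \<Omega>"
proof -
  consider "V \<in> morrey_loc q \<Omega>" | s where "V \<in> morrey_log_loc s \<Omega>" | "V \<in> L1_loc \<Omega>"
    using V by (auto simp: morrey_p_loc_def split: if_splits)
  then show ?thesis
  proof cases
    case 1
    show ?thesis
      by (rule morrey_L1_loc[OF \<Omega>, where c = "\<lambda>\<omega> r. ennreal (r powr (- real CARD('n) * (1 - real_of_ereal (1 / q))))"])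
         (use 1 in \<open>auto simp: morrey_loc_def\<close>)
  next
    case 2
    show ?thesis
      by (rule morrey_L1_loc[OF \<Omega>, where c = "\<lambda>\<omega> r. ennreal (ln (diameter \<omega> / r) powr (s / (real CARD('n) / (real CARD('n) - 1))))"])
         (use 2 in \<open>auto simp: morrey_log_loc_def\<close>)
  qed
qed

section \<open>Continuous Sobolev functions\<close>

lemma measurable_lebesgue_AE_cong:
  fixes f g :: "real^'n \<Rightarrow> real"
  assumes f: "f \<in> borel_measurable lebesgue" and ae: "AE x in lebesgue. f x = g x"
  shows "g \<in> borel_measurable lebesgue"
proof (rule measurableI)
  fix S :: "real set" assume S: "S \<in> sets borel"
  have f1: "f -` S \<inter> space lebesgue \<in> sets lebesgue" using f S by (rule measurable_sets)
  show "g -` S \<inter> space lebesgue \<in> sets lebesgue"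
  proof (rule completion.in_sets_AE[OF _ f1])
    show "AE x in lebesgue. (x \<in> f -` S \<inter> space lebesgue) = (x \<in> g -` S \<inter> space lebesgue)"
      using ae by eventually_elim auto
  qed auto
qed auto

text \<open>Measurability is not assumed but transferred, the measure being complete. If neither
  side is integrable, both integrals have the default value 0.\<close>

lemma set_integral_AE_cong:
  fixes f g :: "real^'n \<Rightarrow> real"
  assumes ae: "AE x\<in>S in lebesgue. f x = g x"
  shows "set_integrable lebesgue S f \<longleftrightarrow> set_integrable lebesgue S g"
    and "(LINT x:S|lebesgue. f x) = (LINT x:S|lebesgue. g x)"
proof -
  have e: "AE x in lebesgue. indicat_real S x *\<^sub>R f x = indicat_real S x *\<^sub>R g x"
    using ae by eventually_elim (auto simp: indicator_def)
  have e': "AE x in lebesgue. indicat_real S x *\<^sub>R g x = indicat_real S x *\<^sub>R f x"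
    using e by eventually_elim (rule sym)
  have m: "(\<lambda>x. indicat_real S x *\<^sub>R f x) \<in> borel_measurable lebesgue \<longleftrightarrow> (\<lambda>x. indicat_real S x *\<^sub>R g x) \<in> borel_measurable lebesgue"
    using measurable_lebesgue_AE_cong[OF _ e] measurable_lebesgue_AE_cong[OF _ e'] by blast
  show i: "set_integrable lebesgue S f \<longleftrightarrow> set_integrable lebesgue S g"
    unfolding set_integrable_def
  proof
    assume a: "integrable lebesgue (\<lambda>x. indicat_real S x *\<^sub>R f x)"
    show "integrable lebesgue (\<lambda>x. indicat_real S x *\<^sub>R g x)"
      using integrable_cong_AE_imp[OF a _ e] m borel_measurable_integrable[OF a] by blast
  next
    assume a: "integrable lebesgue (\<lambda>x. indicat_real S x *\<^sub>R g x)"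
    show "integrable lebesgue (\<lambda>x. indicat_real S x *\<^sub>R f x)"
      using integrable_cong_AE_imp[OF a _ e'] m borel_measurable_integrable[OF a] by blast
  qed
  show "(LINT x:S|lebesgue. f x) = (LINT x:S|lebesgue. g x)"
  proof (cases "set_integrable lebesgue S f")
    case True
    then show ?thesis using i unfolding set_integrable_def set_lebesgue_integral_def
      by (intro integral_cong_AE e) auto
  next
    case False
    then show ?thesis using i unfolding set_integrable_def set_lebesgue_integral_def
      by (simp add: not_integrable_integral_eq)
  qed
qed

lemma AE_mem_mono: "AE x\<in>S in M. P x \<Longrightarrow> T \<subseteq> S \<Longrightarrow> AE x\<in>T in M. P x"
  by (auto elim: eventually_mono)

lemma L1_loc_AE_cong:
  assumes "AE x\<in>\<Omega> in lebesgue. f x = g x" "f \<in> L1_loc \<Omega>"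
  shows "g \<in> L1_loc \<Omega>"
  unfolding L1_loc_def mem_Collect_eq
proof (intro allI impI, elim conjE)
  fix K assume K: "compact K" "K \<subseteq> \<Omega>"
  have "set_integrable lebesgue K f" using assms(2) K by (simp add: L1_loc_def)
  then show "set_integrable lebesgue K g" using set_integral_AE_cong(1)[OF AE_mem_mono[OF assms(1) K(2)]] by blast
qed

lemma is_weak_grad_AE_cong:
  assumes u: "is_weak_grad \<Omega> u G" and ae: "AE x\<in>\<Omega> in lebesgue. G x = G' x"
  shows "is_weak_grad \<Omega> u G'"
proof (rule is_weak_gradI)
  fix i
  have "AE x\<in>\<Omega> in lebesgue. G x $ i = G' x $ i" using ae by eventually_elim auto
  then show "(\<lambda>x. G' x $ i) \<in> L1_loc \<Omega>" by (rule L1_loc_AE_cong[OF _ is_weak_grad_L1(2)[OF u]])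
next
  fix \<phi> i assume "\<phi> \<in> test_functions \<Omega>"
  then have "(LINT x:\<Omega>|lebesgue. u x * classical_grad \<phi> x $ i) = - (LINT x:\<Omega>|lebesgue. G x $ i * \<phi> x)"
    using u by (simp add: is_weak_grad_def)
  also have "(LINT x:\<Omega>|lebesgue. G x $ i * \<phi> x) = (LINT x:\<Omega>|lebesgue. G' x $ i * \<phi> x)"
  proof (rule set_integral_AE_cong(2))
    show "AE x\<in>\<Omega> in lebesgue. G x $ i * \<phi> x = G' x $ i * \<phi> x" using ae by eventually_elim simp
  qed
  finally show "(LINT x:\<Omega>|lebesgue. u x * classical_grad \<phi> x $ i) = - (LINT x:\<Omega>|lebesgue. G' x $ i * \<phi> x)" .
qed (rule is_weak_grad_L1(1)[OF u])

text \<open>Continuous functions of \<open>W^{1,p}_loc\<close>, with the gradient as an explicit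
  argument: calculus rules then produce formulas for gradients, and the arbitrary representative
  \<open>weak_grad\<close> enters only through uniqueness.\<close>

definition wloc :: "real \<Rightarrow> (real^'n) set \<Rightarrow> (real^'n \<Rightarrow> real) \<Rightarrow> (real^'n \<Rightarrow> real^'n) \<Rightarrow> bool" where
  "wloc p \<Omega> f G \<longleftrightarrow> continuous_on \<Omega> f \<and> is_weak_grad \<Omega> f G \<and> (\<forall>i. (\<lambda>x. \<bar>G x $ i\<bar> powr p) \<in> L1_loc \<Omega>)"

lemma wlocD:
  assumes "wloc p \<Omega> f G"
  shows "continuous_on \<Omega> f" "is_weak_grad \<Omega> f G" "(\<lambda>x. \<bar>G x $ i\<bar> powr p) \<in> L1_loc \<Omega>"
  using assms by (auto simp: wloc_def)

lemma powr_add_le: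
  fixes a b p :: real
  assumes "0 \<le> a" "0 \<le> b" "0 < p"
  shows "(a + b) powr p \<le> 2 powr p * (a powr p + b powr p)"
proof -
  have "(a + b) powr p \<le> (2 * max a b) powr p" using assms by (intro powr_mono2) auto
  also have "\<dots> = 2 powr p * (max a b) powr p" by (rule powr_mult)
  also have "\<dots> \<le> 2 powr p * (a powr p + b powr p)" by (intro mult_left_mono) (auto simp: max_def)
  finally show ?thesis .
qed

lemma Lp_loc_add:
  fixes f g :: "real^'n \<Rightarrow> real"
  assumes \<Omega>: "open \<Omega>" and p: "0 < p" and f: "f \<in> L1_loc \<Omega>" "(\<lambda>x. \<bar>f x\<bar> powr p) \<in> L1_loc \<Omega>"
    and g: "g \<in> L1_loc \<Omega>" "(\<lambda>x. \<bar>g x\<bar> powr p) \<in> L1_loc \<Omega>"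
  shows "(\<lambda>x. \<bar>f x + g x\<bar> powr p) \<in> L1_loc \<Omega>"
proof -
  have b: "(\<lambda>x. 2 powr p * (\<bar>f x\<bar> powr p + \<bar>g x\<bar> powr p)) \<in> L1_loc \<Omega>"
    by (intro L1_loc_cmult L1_loc_add f g)
  have "(\<lambda>x. \<bar>f x + g x\<bar> powr p) \<in> borel_measurable (lebesgue_on \<Omega>)"
    using L1_loc_measurable[OF \<Omega> f(1)] L1_loc_measurable[OF \<Omega> g(1)] by measurable
  moreover have "\<bar>\<bar>f x + g x\<bar> powr p\<bar> \<le> 2 powr p * (\<bar>f x\<bar> powr p + \<bar>g x\<bar> powr p)" for x
  proof -
    have "\<bar>f x + g x\<bar> powr p \<le> (\<bar>f x\<bar> + \<bar>g x\<bar>) powr p" using p by (intro powr_mono2) auto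
    also have "\<dots> \<le> 2 powr p * (\<bar>f x\<bar> powr p + \<bar>g x\<bar> powr p)" using p by (intro powr_add_le) auto
    finally show ?thesis by simp
  qed
  ultimately have "integrable lebesgue (\<lambda>x. indicat_real K x * \<bar>f x + g x\<bar> powr p)" if "compact K" "K \<subseteq> \<Omega>" for K
    by (intro integrable_on_compact_bound[OF \<Omega> _ that L1_loc_integrable[OF b that]]) auto
  then show ?thesis by (simp add: L1_loc_def set_integrable_def)
qed

lemma Lp_loc_mult:
  fixes f c :: "real^'n \<Rightarrow> real"
  assumes "(\<lambda>x. \<bar>f x\<bar> powr p) \<in> L1_loc \<Omega>" "continuous_on \<Omega> c" "0 < p"
  shows "(\<lambda>x. \<bar>c x * f x\<bar> powr p) \<in> L1_loc \<Omega>"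
proof -
  have "continuous_on \<Omega> (\<lambda>x. \<bar>c x\<bar> powr p)" using assms(2,3) by (intro continuous_on_powr' continuous_intros) auto
  from L1_loc_mult[OF assms(1) this] show ?thesis by (simp add: abs_mult powr_mult)
qed

lemma wloc_mult:
  assumes \<Omega>: "open \<Omega>" and p: "0 < p" and f: "wloc p \<Omega> f F" and g: "wloc p \<Omega> g G"
  shows "wloc p \<Omega> (\<lambda>x. f x * g x) (\<lambda>x. f x *\<^sub>R G x + g x *\<^sub>R F x)"
proof -
  note f' = wlocD[OF f] and g' = wlocD[OF g]
  have "(\<lambda>x. \<bar>(f x *\<^sub>R G x + g x *\<^sub>R F x) $ i\<bar> powr p) \<in> L1_loc \<Omega>" for i
    unfolding vector_add_component vector_scaleR_component real_scaleR_def
    by (rule Lp_loc_add[OF \<Omega> p L1_loc_mult[OF is_weak_grad_L1(2)[OF g'(2)] f'(1)] Lp_loc_mult[OF g'(3) f'(1) p]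
      L1_loc_mult[OF is_weak_grad_L1(2)[OF f'(2)] g'(1)] Lp_loc_mult[OF f'(3) g'(1) p]])
  then show ?thesis unfolding wloc_def
    using is_weak_grad_mult[OF \<Omega> f'(2,1) g'(2,1)] continuous_on_mult[OF f'(1) g'(1)] by blast
qed

lemma wloc_chain:
  assumes \<Omega>: "open \<Omega>" and p: "0 < p" and u: "wloc p \<Omega> u G"
    and I: "open I" "convex I" "\<And>x. x \<in> \<Omega> \<Longrightarrow> u x \<in> I"
    and F: "\<And>s. s \<in> I \<Longrightarrow> (F has_real_derivative F' s) (at s)" "continuous_on I F'"
  shows "wloc p \<Omega> (\<lambda>x. F (u x)) (\<lambda>x. F' (u x) *\<^sub>R G x)"
proof -
  note u' = wlocD[OF u]
  have Fc: "continuous_on I F" using F(1) by (intro continuous_at_imp_continuous_on) (auto intro: DERIV_isCont)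
  have Fu: "continuous_on \<Omega> (\<lambda>x. F (u x))" and F'u: "continuous_on \<Omega> (\<lambda>x. F' (u x))"
    using I by (auto intro!: continuous_on_compose2[OF Fc u'(1)] continuous_on_compose2[OF F(2) u'(1)])
  show ?thesis unfolding wloc_def
    using is_weak_grad_chain[OF \<Omega> u'(2,1) I F] Fu Lp_loc_mult[OF u'(3) F'u p] by simp
qed

lemma wloc_classical:
  fixes f :: "real^'n \<Rightarrow> real"
  assumes \<Omega>: "open \<Omega>" and p: "0 < p" and f: "\<And>x. x \<in> \<Omega> \<Longrightarrow> f differentiable (at x)" "\<And>i. continuous_on \<Omega> (\<lambda>x. classical_grad f x $ i)"
  shows "wloc p \<Omega> f (classical_grad f)"
proof -
  have "continuous_on \<Omega> f"
    using f(1) by (intro continuous_at_imp_continuous_on) (auto intro: differentiable_imp_continuous_within)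
  moreover have "(\<lambda>x. \<bar>classical_grad f x $ i\<bar> powr p) \<in> L1_loc \<Omega>" for i
    using p by (intro L1_loc_continuous continuous_on_powr' continuous_intros f(2)) auto
  ultimately show ?thesis unfolding wloc_def using is_weak_grad_classical[OF \<Omega> f] by blast
qed

lemma wloc_weak_grad_AE:
  assumes "open \<Omega>" "wloc p \<Omega> f G"
  shows "AE x\<in>\<Omega> in lebesgue. weak_grad \<Omega> f x = G x"
  using weak_grad_unique[OF assms(1) is_weak_grad_weak_grad[OF wlocD(2)[OF assms(2)]] wlocD(2)[OF assms(2)]] .

lemma continuous_on_open_measurable:
  fixes f :: "real^'n \<Rightarrow> real"
  assumes "open \<Omega>" "continuous_on \<Omega> f"
  shows "f \<in> borel_measurable (lebesgue_on \<Omega>)"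
  by (rule continuous_imp_measurable_on_sets_lebesgue[OF assms(2)]) (use assms(1) in auto)

text \<open>\<open>G\<close> is controlled on compact sets only. It is replaced by its restriction
  to \<open>K\<close>, which remains a weak gradient because \<open>G\<close> vanishes almost
  everywhere off \<open>K\<close>.\<close>

lemma wloc_imp_W1p:
  assumes \<Omega>: "open \<Omega>" and p: "0 < p" and f: "wloc p \<Omega> f G" and K: "compact K" "K \<subseteq> \<Omega>" "\<And>x. x \<in> \<Omega> - K \<Longrightarrow> f x = 0"
  shows "f \<in> W1p p \<Omega> \<inter> Cc \<Omega>"
proof -
  note f' = wlocD[OF f]
  have "f \<in> Cc \<Omega>" using f'(1) K by (auto simp: Cc_def compact_support_in_def)
  have fp: "set_integrable lebesgue \<Omega> (\<lambda>x. \<bar>f x\<bar> powr p)"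
  proof (subst set_integral_support(2)[OF K(2)])
    show "\<bar>f x\<bar> powr p = 0" if "x \<in> \<Omega> - K" for x using K(3)[OF that] by simp
    have "continuous_on \<Omega> (\<lambda>x. \<bar>f x\<bar> powr p)" using f'(1) p by (intro continuous_on_powr' continuous_intros) auto
    then show "integrable lebesgue (\<lambda>x. indicat_real K x * \<bar>f x\<bar> powr p)"
      by (rule L1_loc_integrable[OF L1_loc_continuous K(1,2)])
  qed
  define G' where "G' x = (if x \<in> K then G x else 0)" for x
  have "AE x\<in>\<Omega> - K in lebesgue. G x = 0" by (rule weak_grad_zero_outside[OF \<Omega> f'(2) K(1) K(3)])
  then have ae: "AE x\<in>\<Omega> in lebesgue. G x = G' x" by eventually_elim (auto simp: G'_def)
  have wG: "is_weak_grad \<Omega> f G'" by (rule is_weak_grad_AE_cong[OF f'(2) ae])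
  have "(\<lambda>x. G' x $ i) \<in> Lp_space p \<Omega>" for i
  proof -
    have "set_integrable lebesgue \<Omega> (\<lambda>x. \<bar>G' x $ i\<bar> powr p)"
    proof (subst set_integral_support(2)[OF K(2)])
      show "\<bar>G' x $ i\<bar> powr p = 0" if "x \<in> \<Omega> - K" for x using that by (simp add: G'_def)
      have "(\<lambda>x. indicat_real K x * \<bar>G' x $ i\<bar> powr p) = (\<lambda>x. indicat_real K x * \<bar>G x $ i\<bar> powr p)"
        by (auto simp: G'_def indicator_def)
      then show "integrable lebesgue (\<lambda>x. indicat_real K x * \<bar>G' x $ i\<bar> powr p)"
        using L1_loc_integrable[OF f'(3) K(1,2), of i] by simp
    qed
    then show ?thesis unfolding Lp_space_def using L1_loc_measurable[OF \<Omega> is_weak_grad_L1(2)[OF wG]] by simp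
  qed
  moreover have "f \<in> Lp_space p \<Omega>" unfolding Lp_space_def
    using fp continuous_on_open_measurable[OF \<Omega> f'(1)] by simp
  ultimately show ?thesis unfolding W1p_def using wG \<open>f \<in> Cc \<Omega>\<close> by blast
qed

lemma set_integrable_imp_L1_loc:
  assumes "open \<Omega>" "set_integrable lebesgue \<Omega> f"
  shows "f \<in> L1_loc \<Omega>"
  using assms compact_sets_lebesgue by (auto simp: L1_loc_def intro: set_integrable_subset)

text \<open>\<open>W1p\<close> supplies some gradient; by uniqueness the chosen representative
  agrees with it almost everywhere and inherits its integrability.\<close>

lemma W1p_imp_wloc:
  assumes \<Omega>: "open \<Omega>" and f: "f \<in> W1p p \<Omega> \<inter> Cc \<Omega>"
  obtains K where "compact K" "K \<subseteq> \<Omega>" "\<forall>x\<in>\<Omega> - K. f x = 0" "wloc p \<Omega> f (weak_grad \<Omega> f)"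
proof -
  obtain K where K: "compact K" "K \<subseteq> \<Omega>" "\<forall>x\<in>\<Omega> - K. f x = 0" and c: "continuous_on \<Omega> f"
    using f by (auto simp: Cc_def compact_support_in_def)
  obtain G where G: "is_weak_grad \<Omega> f G" "\<And>i. (\<lambda>x. G x $ i) \<in> Lp_space p \<Omega>" using f by (auto simp: W1p_def)
  have "(\<lambda>x. \<bar>G x $ i\<bar> powr p) \<in> L1_loc \<Omega>" for i
    using G(2)[of i] by (intro set_integrable_imp_L1_loc \<Omega>) (simp add: Lp_space_def)
  then have w: "wloc p \<Omega> f G" using c G by (simp add: wloc_def)
  have ae: "AE x\<in>\<Omega> in lebesgue. \<bar>G x $ i\<bar> powr p = \<bar>weak_grad \<Omega> f x $ i\<bar> powr p" for i
    using wloc_weak_grad_AE[OF \<Omega> w] by eventually_elim auto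
  have "wloc p \<Omega> f (weak_grad \<Omega> f)" unfolding wloc_def
    using c is_weak_grad_weak_grad[OF G(1)] L1_loc_AE_cong[OF ae wlocD(3)[OF w]] by blast
  then show ?thesis using that K by blast
qed

section \<open>Testing an equation with Sobolev functions\<close>

lemma mollify_compact_support_test:
  fixes \<psi> :: "real^'n \<Rightarrow> real"
  assumes U: "integrable lebesgue U" and e: "0 < e" and K1: "compact K1" "K1 \<subseteq> \<Omega>"
    and z: "\<And>x y. x \<notin> K1 \<Longrightarrow> dist y x < e \<Longrightarrow> U y = 0"
  shows "mollify e U \<in> test_functions \<Omega>" "\<And>x. x \<notin> K1 \<Longrightarrow> mollify e U x = 0"
proof -
  show 0: "mollify e U x = 0" if "x \<notin> K1" for x
    using mollify_local[OF e U, of x 0 0] z[OF that] by simp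
  have "Ck_on j \<Omega> (mollify e U)" for j using Ck_on_subset[OF mollify_Ck[OF e U]] by blast
  then show "mollify e U \<in> test_functions \<Omega>"
    using 0 K1 by (auto simp: test_functions_def compact_support_in_def)
qed

text \<open>Mollify \<open>\<psi>\<close>. \<open>K1\<close> contains the supports of the mollified
  functions, and \<open>K2\<close> leaves room around \<open>K1\<close> so that gradient and
  mollification commute there. The flux term converges by the duality pairing. For the other term
  \<open>Z\<close> is merely locally integrable, so it is the bounded pointwise convergence of the
  mollified \<open>\<psi>\<close> that is used.\<close>

lemma equation_tested_with_Sobolev:
  fixes X :: "real^'n \<Rightarrow> real^'n" and Z \<psi> :: "real^'n \<Rightarrow> real"
  assumes \<Omega>: "open \<Omega>" and p: "1 < p"
    and X: "\<And>i. (\<lambda>x. X x $ i) \<in> borel_measurable (lebesgue_on \<Omega>)" "\<And>i. (\<lambda>x. \<bar>X x $ i\<bar> powr (p/(p-1))) \<in> L1_loc \<Omega>"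
    and Z: "Z \<in> L1_loc \<Omega>"
    and eq: "\<And>\<phi>. \<phi> \<in> test_functions \<Omega> \<Longrightarrow> (LINT x:\<Omega>|lebesgue. X x \<bullet> classical_grad \<phi> x + Z x * \<phi> x) = 0"
    and \<psi>: "wloc p \<Omega> \<psi> H" and K: "compact K" "K \<subseteq> \<Omega>" "\<And>x. x \<in> \<Omega> - K \<Longrightarrow> \<psi> x = 0"
  shows "set_integrable lebesgue \<Omega> (\<lambda>x. X x \<bullet> H x + Z x * \<psi> x)"
    and "(LINT x:\<Omega>|lebesgue. X x \<bullet> H x + Z x * \<psi> x) = 0"
proof -
  note \<psi>' = wlocD[OF \<psi>]
  obtain d K1 where d: "d > 0" and K1: "compact K1" "K1 \<subseteq> \<Omega>" "\<And>x. x \<in> K \<Longrightarrow> cball x d \<subseteq> K1" "K \<subseteq> K1"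
    by (fact compact_neighbourhood[OF \<Omega> K(1,2)])
  obtain d2 K2 where d2: "d2 > 0" and K2: "compact K2" "K2 \<subseteq> \<Omega>" "\<And>x. x \<in> K1 \<Longrightarrow> cball x d2 \<subseteq> K2" "K1 \<subseteq> K2"
    by (fact compact_neighbourhood[OF \<Omega> K1(1,2)])
  define U where "U x = indicat_real K2 x * \<psi> x" for x
  have Ui: "integrable lebesgue U" unfolding U_def by (rule L1_loc_integrable[OF is_weak_grad_L1(1)[OF \<psi>'(2)] K2(1,2)])
  have U0: "U x = 0" if "x \<notin> K" for x using that K(3)[of x] K2(2) by (auto simp: U_def indicator_def)
  define h where "h i x = indicat_real K2 x * H x $ i" for i x
  have hi: "integrable lebesgue (h i)" for i unfolding h_def by (rule L1_loc_integrable[OF is_weak_grad_L1(2)[OF \<psi>'(2)] K2(1,2)])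
  have hp: "integrable lebesgue (\<lambda>x. \<bar>h i x\<bar> powr p)" for i
  proof -
    have "(\<lambda>x. \<bar>h i x\<bar> powr p) = (\<lambda>x. indicat_real K2 x * \<bar>H x $ i\<bar> powr p)" by (auto simp: h_def indicator_def)
    then show ?thesis using L1_loc_integrable[OF \<psi>'(3) K2(1,2), of i] by simp
  qed
  define Y where "Y i x = indicat_real K1 x * X x $ i" for i x
  have Ym: "Y i \<in> borel_measurable lebesgue" for i
    unfolding Y_def by (rule measurable_lebesgue_on_indicator[OF \<Omega> X(1) compact_sets_lebesgue[OF K1(1)] K1(2)])
  have Yp: "integrable lebesgue (\<lambda>x. \<bar>Y i x\<bar> powr (p/(p-1)))" for i
  proof -
    have "(\<lambda>x. \<bar>Y i x\<bar> powr (p/(p-1))) = (\<lambda>x. indicat_real K1 x * \<bar>X x $ i\<bar> powr (p/(p-1)))" by (auto simp: Y_def indicator_def)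
    then show ?thesis using L1_loc_integrable[OF X(2) K1(1,2), of i] by simp
  qed
  define \<psi>n where "\<psi>n n = mollify (eps n) U" for n
  have test: "\<psi>n n \<in> test_functions \<Omega>" "\<And>x. x \<notin> K1 \<Longrightarrow> \<psi>n n x = 0" if "eps n < d" for n
  proof -
    have zz: "U y = 0" if "x \<notin> K1" "dist y x < eps n" for x y
    proof (rule U0)
      show "y \<notin> K" using K1(3)[of y] that \<open>eps n < d\<close> by (auto simp: subset_iff)
    qed
    show "\<psi>n n \<in> test_functions \<Omega>" "\<And>x. x \<notin> K1 \<Longrightarrow> \<psi>n n x = 0"
      unfolding \<psi>n_def using mollify_compact_support_test[OF Ui eps_pos K1(1,2) zz] by auto
  qed
  have grad: "classical_grad (\<psi>n n) x $ i = mollify (eps n) (h i) x" if "eps n < d2" "x \<in> K1" for n x i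
    unfolding \<psi>n_def U_def h_def
    using K2(3)[OF that(2)] that(1) by (intro mollify_weak_grad[OF \<Omega> \<psi>'(2) K2(1,2)]) auto
  obtain B where B: "B > 0" "\<And>x. x \<in> K \<Longrightarrow> \<bar>\<psi> x\<bar> \<le> B"
    using continuous_on_compact_bounded[OF K(1) continuous_on_subset[OF \<psi>'(1) K(2)]] by auto
  have Ub: "\<bar>U x\<bar> \<le> B" for x
    using B U0[of x] by (cases "x \<in> K") (auto simp: U_def indicator_def)
  have \<psi>b: "\<bar>\<psi>n n x\<bar> \<le> B" for n x
    unfolding \<psi>n_def using mollify_local[OF eps_pos Ui, of x n 0 B] Ub by simp
  define W where "W x = indicat_real K1 x * Z x" for x
  have Wi: "integrable lebesgue W" unfolding W_def by (rule L1_loc_integrable[OF Z K1(1,2)])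
  have pc: "continuous_on UNIV (\<psi>n n)" for n unfolding \<psi>n_def by (rule mollify_continuous[OF eps_pos Ui])
  have W\<psi>i: "integrable lebesgue (\<lambda>x. \<psi>n n x * W x)" for n
    by (rule integrable_bounded_mult[OF Wi continuous_imp_measurable_lebesgue(1)[OF pc] \<psi>b])
  have WUi: "integrable lebesgue (\<lambda>x. U x * W x)"
    by (rule integrable_bounded_mult[OF Wi borel_measurable_integrable[OF Ui] Ub])
  have Yh: "integrable lebesgue (\<lambda>x. Y i x * h i x)" for i
    by (rule integrable_mult_Young[OF p Ym Yp borel_measurable_integrable[OF hi] hp])
  note Yhn = mollify_pairing_tendsto[OF p Ym Yp hi hp]
  have zero: "(\<Sum>i\<in>UNIV. \<integral>x. Y i x * mollify (eps n) (h i) x \<partial>lebesgue) + (\<integral>x. \<psi>n n x * W x \<partial>lebesgue) = 0" if n: "eps n < d" "eps n < d2" for n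
  proof -
    have "0 = (LINT x:\<Omega>|lebesgue. X x \<bullet> classical_grad (\<psi>n n) x + Z x * \<psi>n n x)" using eq[OF test(1)[OF n(1)]] by simp
    also have "\<dots> = (\<integral>x. indicat_real K1 x * (X x \<bullet> classical_grad (\<psi>n n) x + Z x * \<psi>n n x) \<partial>lebesgue)"
    proof (rule set_integral_support(1)[OF K1(2)])
      fix x assume x: "x \<in> \<Omega> - K1"
      have "classical_grad (\<psi>n n) x = 0"
        by (rule classical_grad_zero_outside[OF \<Omega> K1(1) _ x]) (use test(2)[OF n(1)] in auto)
      then show "X x \<bullet> classical_grad (\<psi>n n) x + Z x * \<psi>n n x = 0" using test(2)[OF n(1)] x by simp
    qed
    also have "\<dots> = (\<integral>x. (\<Sum>i\<in>UNIV. Y i x * mollify (eps n) (h i) x) + \<psi>n n x * W x \<partial>lebesgue)"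
    proof (rule Bochner_Integration.integral_cong[OF refl])
      fix x
      show "indicat_real K1 x * (X x \<bullet> classical_grad (\<psi>n n) x + Z x * \<psi>n n x) = (\<Sum>i\<in>UNIV. Y i x * mollify (eps n) (h i) x) + \<psi>n n x * W x"
        by (cases "x \<in> K1") (auto simp: inner_vec_def grad[OF n(2)] Y_def W_def)
    qed
    also have "\<dots> = (\<integral>x. (\<Sum>i\<in>UNIV. Y i x * mollify (eps n) (h i) x) \<partial>lebesgue) + (\<integral>x. \<psi>n n x * W x \<partial>lebesgue)"
      by (rule Bochner_Integration.integral_add[OF Bochner_Integration.integrable_sum[OF Yhn(1)] W\<psi>i])
    also have "(\<integral>x. (\<Sum>i\<in>UNIV. Y i x * mollify (eps n) (h i) x) \<partial>lebesgue) = (\<Sum>i\<in>UNIV. \<integral>x. Y i x * mollify (eps n) (h i) x \<partial>lebesgue)"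
      by (rule Bochner_Integration.integral_sum[OF Yhn(1)])
    finally show ?thesis by simp
  qed
  have L2: "(\<lambda>n. \<integral>x. \<psi>n n x * W x \<partial>lebesgue) \<longlonglongrightarrow> (\<integral>x. U x * W x \<partial>lebesgue)"
  proof (rule integral_dominated_convergence[where w = "\<lambda>x. B * \<bar>W x\<bar>"])
    show "AE x in lebesgue. (\<lambda>n. \<psi>n n x * W x) \<longlonglongrightarrow> U x * W x"
    proof (rule AE_I2)
      fix x
      show "(\<lambda>n. \<psi>n n x * W x) \<longlonglongrightarrow> U x * W x"
      proof (cases "x \<in> K1")
        case True
        then have xO: "x \<in> \<Omega>" using K1(2) by blast
        have "isCont \<psi> x" using \<psi>'(1) xO \<Omega> by (auto simp: continuous_on_eq_continuous_at)
        moreover have "\<forall>\<^sub>F y in nhds x. U y = \<psi> y"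
          unfolding eventually_nhds using K2(3)[OF True] d2
          by (intro exI[of _ "ball x d2"]) (auto simp: U_def subset_iff)
        ultimately have "isCont U x" by (simp add: isCont_cong)
        from mollify_tendsto[OF Ui this] show ?thesis unfolding \<psi>n_def by (intro tendsto_intros)
      qed (simp add: W_def)
    qed
    show "AE x in lebesgue. norm (\<psi>n n x * W x) \<le> B * \<bar>W x\<bar>" for n
      using \<psi>b by (intro AE_I2) (auto simp: abs_mult intro!: mult_right_mono)
  qed (use Wi borel_measurable_integrable[OF WUi] borel_measurable_integrable[OF W\<psi>i] in auto)
  have L: "(\<lambda>n. (\<Sum>i\<in>UNIV. \<integral>x. Y i x * mollify (eps n) (h i) x \<partial>lebesgue) + (\<integral>x. \<psi>n n x * W x \<partial>lebesgue))
      \<longlonglongrightarrow> (\<Sum>i\<in>UNIV. \<integral>x. Y i x * h i x \<partial>lebesgue) + (\<integral>x. U x * W x \<partial>lebesgue)"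
    by (intro tendsto_add tendsto_sum Yhn(2) L2)
  have ev: "\<forall>\<^sub>F n in sequentially. (\<Sum>i\<in>UNIV. \<integral>x. Y i x * mollify (eps n) (h i) x \<partial>lebesgue) + (\<integral>x. \<psi>n n x * W x \<partial>lebesgue) = 0"
    using eventually_eps_less[OF d] eventually_eps_less[OF d2] by eventually_elim (rule zero)
  have lim0: "(\<Sum>i\<in>UNIV. \<integral>x. Y i x * h i x \<partial>lebesgue) + (\<integral>x. U x * W x \<partial>lebesgue) = 0"
    by (rule LIMSEQ_unique[OF L tendsto_eventually[OF ev]])
  \<comment> \<open>The limit was computed on \<open>K1\<close> with cut-off data; as
    \<open>H\<close> and \<open>\<psi>\<close> vanish off \<open>K\<close>, it agrees almost
    everywhere with the integrand on \<open>\<Omega>\<close>.\<close>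
  have "AE x\<in>\<Omega> - K in lebesgue. H x = 0" by (rule weak_grad_zero_outside[OF \<Omega> \<psi>'(2) K(1) K(3)])
  then have ae0: "AE x in lebesgue. indicat_real \<Omega> x *\<^sub>R (X x \<bullet> H x + Z x * \<psi> x) = (\<Sum>i\<in>UNIV. Y i x * h i x) + U x * W x"
  proof eventually_elim
    case (elim x)
    consider "x \<in> K1" | "x \<in> \<Omega> - K1" | "x \<notin> \<Omega>" by blast
    then show ?case
    proof cases
      case 1
      then have "x \<in> K2" "x \<in> \<Omega>" using K2(4) K1(2) by auto
      then show ?thesis using 1 by (simp add: Y_def h_def U_def W_def inner_vec_def)
    next
      case 2
      then have "x \<notin> K" using K1(4) by blast
      then show ?thesis using 2 elim K(3)[of x] by (simp add: Y_def W_def)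
    next
      case 3
      then have "x \<notin> K1" using K1(2) by blast
      then show ?thesis using 3 by (simp add: Y_def W_def)
    qed
  qed
  have si: "integrable lebesgue (\<lambda>x. (\<Sum>i\<in>UNIV. Y i x * h i x) + U x * W x)"
    by (intro Bochner_Integration.integrable_add Bochner_Integration.integrable_sum Yh WUi)
  have ae1: "AE x in lebesgue. (\<Sum>i\<in>UNIV. Y i x * h i x) + U x * W x = indicat_real \<Omega> x *\<^sub>R (X x \<bullet> H x + Z x * \<psi> x)"
    using ae0 by eventually_elim simp
  have m: "(\<lambda>x. indicat_real \<Omega> x *\<^sub>R (X x \<bullet> H x + Z x * \<psi> x)) \<in> borel_measurable lebesgue"
    by (rule measurable_lebesgue_AE_cong[OF borel_measurable_integrable[OF si] ae1])
  show "set_integrable lebesgue \<Omega> (\<lambda>x. X x \<bullet> H x + Z x * \<psi> x)"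
    unfolding set_integrable_def by (rule integrable_cong_AE_imp[OF si m ae1])
  have "(LINT x:\<Omega>|lebesgue. X x \<bullet> H x + Z x * \<psi> x) = (\<integral>x. (\<Sum>i\<in>UNIV. Y i x * h i x) + U x * W x \<partial>lebesgue)"
    unfolding set_lebesgue_integral_def by (rule integral_cong_AE[OF m borel_measurable_integrable[OF si] ae0])
  also have "\<dots> = (\<integral>x. (\<Sum>i\<in>UNIV. Y i x * h i x) \<partial>lebesgue) + (\<integral>x. U x * W x \<partial>lebesgue)"
    by (rule Bochner_Integration.integral_add[OF Bochner_Integration.integrable_sum[OF Yh] WUi])
  also have "(\<integral>x. (\<Sum>i\<in>UNIV. Y i x * h i x) \<partial>lebesgue) = (\<Sum>i\<in>UNIV. \<integral>x. Y i x * h i x \<partial>lebesgue)"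
    by (rule Bochner_Integration.integral_sum[OF Yh])
  finally show "(LINT x:\<Omega>|lebesgue. X x \<bullet> H x + Z x * \<psi> x) = 0" using lim0 by simp
qed

section \<open>The norms induced by a symmetric positive semidefinite matrix\<close>

definition psd :: "real^'n^'n \<Rightarrow> bool" where
  "psd M \<longleftrightarrow> transpose M = M \<and> (\<forall>\<xi>. 0 \<le> quad_form M \<xi>)"

lemma quad_form_eq: "quad_form M \<xi> = (M *v \<xi>) \<bullet> \<xi>"
  by (simp add: quad_form_def inner_vec_def matrix_vector_mult_def sum_distrib_right sum_distrib_left mult_ac)

lemma symmetric_inner:
  fixes M :: "real^'n^'n"
  assumes "transpose M = M"
  shows "(M *v x) \<bullet> y = (M *v y) \<bullet> x"
proof -
  have "(M *v x) \<bullet> y = (y v* M) \<bullet> x" by (simp only: dot_lmul_matrix inner_commute[of "M *v x"])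
  also have "y v* M = M *v y" using transpose_matrix_vector[of M y] assms by simp
  finally show ?thesis .
qed

lemma quad_form_scale_add:
  fixes M :: "real^'n^'n"
  assumes "transpose M = M"
  shows "quad_form M (s *\<^sub>R x + t *\<^sub>R y) = s\<^sup>2 * quad_form M x + 2 * s * t * ((M *v x) \<bullet> y) + t\<^sup>2 * quad_form M y"
proof -
  have "M *v (s *\<^sub>R x + t *\<^sub>R y) = s *\<^sub>R (M *v x) + t *\<^sub>R (M *v y)"
    by (simp add: matrix_vector_right_distrib matrix_vector_mult_scaleR)
  then show ?thesis using symmetric_inner[OF assms, of y x]
    by (simp add: quad_form_eq inner_add_left inner_add_right power2_eq_square algebra_simps)
qed

lemma psd_Cauchy_Schwarz:
  fixes M :: "real^'n^'n"
  assumes M: "psd M"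
  shows "((M *v x) \<bullet> y)\<^sup>2 \<le> quad_form M x * quad_form M y"
proof -
  define a where "a = quad_form M x"
  define b where "b = quad_form M y"
  define c where "c = (M *v x) \<bullet> y"
  have ab: "0 \<le> a" "0 \<le> b" using M by (auto simp: a_def b_def psd_def)
  have q: "0 \<le> s\<^sup>2 * a + 2 * s * t * c + t\<^sup>2 * b" for s t
    using quad_form_scale_add[of M s x t y] M unfolding a_def b_def c_def psd_def by metis
  have "c\<^sup>2 \<le> a * b"
  proof (cases "b = 0")
    case False
    then have b: "b > 0" using ab by simp
    have "0 \<le> b\<^sup>2 * a + 2 * b * (- c) * c + (- c)\<^sup>2 * b" by (rule q)
    then have "0 \<le> b * (a * b - c\<^sup>2)" by (simp add: power2_eq_square algebra_simps)
    then show ?thesis using b by (simp add: zero_le_mult_iff)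
  next
    \<comment> \<open>Here \<open>t = - (a + 1) / 2\<close> together with \<open>s = c\<close> turns
      the nonnegative form into \<open>- c\<^sup>2\<close>, which forces
      \<open>c = 0\<close>.\<close>
    case True
    have "0 \<le> c\<^sup>2 * a + 2 * c * (- (a + 1) / 2) * c + (- (a+1)/2)\<^sup>2 * b" by (rule q)
    moreover have "c\<^sup>2 * a + 2 * c * (- (a + 1) / 2) * c = - c\<^sup>2" by (simp add: power2_eq_square field_simps)
    ultimately have "c\<^sup>2 \<le> 0" using True by simp
    then show ?thesis using True by simp
  qed
  then show ?thesis by (simp add: a_def b_def c_def)
qed

text \<open>Two vectors span at most a plane, so their Gram matrix is realised by complex numbers.\<close>

lemma psd_realize:
  fixes M :: "real^'n^'n"
  assumes M: "psd M"
  obtains X Y :: complex where "\<forall>s t. norm_mat M (s *\<^sub>R x + t *\<^sub>R y) = norm (s *\<^sub>R X + t *\<^sub>R Y)"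
    "(M *v x) \<bullet> y = X \<bullet> Y"
proof -
  define a where "a = quad_form M x"
  define b where "b = quad_form M y"
  define c where "c = (M *v x) \<bullet> y"
  have ab: "0 \<le> a" "0 \<le> b" using M by (auto simp: a_def b_def psd_def)
  have cs: "c\<^sup>2 \<le> a * b" using psd_Cauchy_Schwarz[OF M, of x y] by (simp add: a_def b_def c_def)
  have "\<exists>X Y :: complex. X \<bullet> X = a \<and> X \<bullet> Y = c \<and> Y \<bullet> Y = b"
  proof (cases "a = 0")
    case True
    then have "c = 0" using cs by simp
    then show ?thesis using True ab
      by (intro exI[of _ 0] exI[of _ "Complex (sqrt b) 0"]) (simp add: inner_complex_def)
  next
    case False
    then have a: "a > 0" using ab by simp
    have "c\<^sup>2 / a \<le> b" using cs a by (simp add: field_simps)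
    \<comment> \<open>Cholesky factorisation of the Gram matrix: \<open>x\<close> is sent to the
      real axis.\<close>
    then show ?thesis using a
      by (intro exI[of _ "Complex (sqrt a) 0"] exI[of _ "Complex (c / sqrt a) (sqrt (b - c\<^sup>2 / a))"])
         (simp add: inner_complex_def power_divide flip: power2_eq_square)
  qed
  then obtain X Y :: complex where XY: "X \<bullet> X = a" "X \<bullet> Y = c" "Y \<bullet> Y = b" by blast
  have "norm_mat M (s *\<^sub>R x + t *\<^sub>R y) = norm (s *\<^sub>R X + t *\<^sub>R Y)" for s t
  proof -
    have "quad_form M (s *\<^sub>R x + t *\<^sub>R y) = s\<^sup>2 * a + 2 * s * t * c + t\<^sup>2 * b"
      using quad_form_scale_add[of M s x t y] M by (simp add: psd_def a_def b_def c_def)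
    also have "\<dots> = (s *\<^sub>R X + t *\<^sub>R Y) \<bullet> (s *\<^sub>R X + t *\<^sub>R Y)"
      using XY by (simp add: inner_add_left inner_add_right inner_commute power2_eq_square algebra_simps)
    finally show ?thesis by (simp add: norm_mat_def norm_eq_sqrt_inner)
  qed
  then show ?thesis using that[of X Y] XY(2) by (simp add: c_def)
qed

lemma norm_mat_nonneg: "psd M \<Longrightarrow> 0 \<le> norm_mat M x"
  by (simp add: norm_mat_def psd_def)

lemma norm_mat_scaleR: "psd M \<Longrightarrow> norm_mat M (s *\<^sub>R x) = \<bar>s\<bar> * norm_mat M x"
proof -
  assume M: "psd M"
  obtain X Y :: complex where "\<forall>s t. norm_mat M (s *\<^sub>R x + t *\<^sub>R x) = norm (s *\<^sub>R X + t *\<^sub>R Y)" "(M *v x) \<bullet> x = X \<bullet> Y"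
    by (fact psd_realize[OF M, of x x])
  then show ?thesis using spec[of "\<lambda>s. \<forall>t. norm_mat M (s *\<^sub>R x + t *\<^sub>R x) = norm (s *\<^sub>R X + t *\<^sub>R Y)" s]
    by (metis add.right_neutral norm_scaleR scaleR_one scaleR_zero_left)
qed

lemma norm_mat_triangle: "psd M \<Longrightarrow> norm_mat M (x + y) \<le> norm_mat M x + norm_mat M y"
proof -
  assume M: "psd M"
  obtain X Y :: complex where *: "\<forall>s t. norm_mat M (s *\<^sub>R x + t *\<^sub>R y) = norm (s *\<^sub>R X + t *\<^sub>R Y)" "(M *v x) \<bullet> y = X \<bullet> Y"
    by (fact psd_realize[OF M, of x y])
  have "norm_mat M (x + y) = norm (X + Y)" using *(1)[rule_format, of 1 1] by simp
  moreover have "norm_mat M x = norm X" using *(1)[rule_format, of 1 0] by simp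
  moreover have "norm_mat M y = norm Y" using *(1)[rule_format, of 0 1] by simp
  ultimately show ?thesis using norm_triangle_ineq[of X Y] by simp
qed

lemma norm_mat_Cauchy_Schwarz: "psd M \<Longrightarrow> \<bar>(M *v x) \<bullet> y\<bar> \<le> norm_mat M x * norm_mat M y"
  unfolding norm_mat_def real_sqrt_mult[symmetric]
  using psd_Cauchy_Schwarz[of M x y] by (intro real_le_rsqrt) simp

lemma norm_mat_sum_le:
  fixes M :: "real^'n^'n"
  assumes M: "psd M"
  shows "finite S \<Longrightarrow> norm_mat M (\<Sum>i\<in>S. f i) \<le> (\<Sum>i\<in>S. norm_mat M (f i))"
proof (induction S rule: finite_induct)
  case empty
  then show ?case by (simp add: norm_mat_def quad_form_def)
next
  case (insert i S)
  then show ?case using norm_mat_triangle[OF M, of "f i" "sum f S"] by simp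
qed

text \<open>Expand in the standard basis, whose vectors have norm at most \<open>sqrt c\<close>
  because the form takes the value \<open>M $ i $ i\<close> on them. The second estimate is
  Cauchy-Schwarz against a basis vector.\<close>

lemma norm_mat_le:
  fixes M :: "real^'n^'n"
  assumes M: "psd M" and c: "\<And>i j. \<bar>M $ i $ j\<bar> \<le> c"
  shows "norm_mat M \<xi> \<le> sqrt c * (\<Sum>i\<in>UNIV. \<bar>\<xi> $ i\<bar>)" and "\<bar>(M *v \<xi>) $ i\<bar> \<le> sqrt c * norm_mat M \<xi>"
proof -
  have q: "quad_form M (axis i 1) = M $ i $ i" for i
    by (simp add: quad_form_eq matrix_vector_mult_basis inner_axis column_def)
  have e: "norm_mat M (axis i 1) \<le> sqrt c" for i
    unfolding norm_mat_def q using c[of i i] by (simp add: abs_le_iff)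
  have "norm_mat M \<xi> = norm_mat M (\<Sum>i\<in>UNIV. (\<xi> $ i) *\<^sub>R axis i 1)"
    by (simp add: basis_expansion flip: scalar_mult_eq_scaleR)
  also have "\<dots> \<le> (\<Sum>i\<in>UNIV. norm_mat M ((\<xi> $ i) *\<^sub>R axis i 1))" by (rule norm_mat_sum_le[OF M]) simp
  also have "\<dots> \<le> (\<Sum>i\<in>UNIV. \<bar>\<xi> $ i\<bar> * sqrt c)"
    using e by (intro sum_mono) (auto simp: norm_mat_scaleR[OF M] intro!: mult_left_mono)
  finally show "norm_mat M \<xi> \<le> sqrt c * (\<Sum>i\<in>UNIV. \<bar>\<xi> $ i\<bar>)" by (simp add: sum_distrib_left mult.commute)
  have "(M *v \<xi>) $ i = (M *v \<xi>) \<bullet> axis i 1" by (simp add: inner_axis)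
  then have "\<bar>(M *v \<xi>) $ i\<bar> \<le> norm_mat M \<xi> * norm_mat M (axis i 1)" using norm_mat_Cauchy_Schwarz[OF M, of \<xi> "axis i 1"] by simp
  also have "\<dots> \<le> norm_mat M \<xi> * sqrt c" using e norm_mat_nonneg[OF M] by (intro mult_left_mono) auto
  finally show "\<bar>(M *v \<xi>) $ i\<bar> \<le> sqrt c * norm_mat M \<xi>" by (simp add: mult.commute)
qed

lemma sum_powr_le:
  fixes f :: "'n::finite \<Rightarrow> real"
  assumes "0 < p" "\<And>i. 0 \<le> f i"
  shows "(\<Sum>i\<in>UNIV. f i) powr p \<le> real CARD('n) powr p * (\<Sum>i\<in>UNIV. f i powr p)"
proof -
  define m where "m = Max (range f)"
  have "m \<in> range f" unfolding m_def by (rule Max_in) auto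
  then obtain j where j: "m = f j" by blast
  have "f i \<le> m" for i by (simp add: m_def)
  then have "(\<Sum>i\<in>UNIV. f i) \<le> real CARD('n) * m" using sum_bounded_above[of UNIV f m] by simp
  then have "(\<Sum>i\<in>UNIV. f i) powr p \<le> (real CARD('n) * m) powr p" using assms by (intro powr_mono2 sum_nonneg) auto
  also have "\<dots> = real CARD('n) powr p * f j powr p" unfolding j by (rule powr_mult)
  also have "\<dots> \<le> real CARD('n) powr p * (\<Sum>i\<in>UNIV. f i powr p)"
    by (intro mult_left_mono member_le_sum) auto
  finally show ?thesis .
qed

lemma norm_mat_powr_le:
  fixes M :: "real^'n^'n"
  assumes M: "psd M" and c: "\<And>i j. \<bar>M $ i $ j\<bar> \<le> c" and p: "0 < p"
  shows "norm_mat M \<xi> powr p \<le> sqrt c powr p * real CARD('n) powr p * (\<Sum>i\<in>UNIV. \<bar>\<xi> $ i\<bar> powr p)"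
proof -
  have c0: "0 \<le> c" using c[of undefined undefined] by linarith
  have "norm_mat M \<xi> powr p \<le> (sqrt c * (\<Sum>i\<in>UNIV. \<bar>\<xi> $ i\<bar>)) powr p"
    using norm_mat_le(1)[OF M c] norm_mat_nonneg[OF M] p by (intro powr_mono2) auto
  also have "\<dots> = sqrt c powr p * (\<Sum>i\<in>UNIV. \<bar>\<xi> $ i\<bar>) powr p" by (rule powr_mult)
  also have "\<dots> \<le> sqrt c powr p * (real CARD('n) powr p * (\<Sum>i\<in>UNIV. \<bar>\<xi> $ i\<bar> powr p))"
    using p by (intro mult_left_mono sum_powr_le) auto
  finally show ?thesis by (simp add: mult.assoc)
qed

text \<open>For \<open>x = w \<nabla>u\<close> and \<open>y = u \<nabla>w\<close> this is the
  Lagrangian of Picone's identity for the pair \<open>u w\<close>, \<open>u\<close>.\<close>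

definition picone :: "real \<Rightarrow> real^'n^'n \<Rightarrow> real^'n \<Rightarrow> real^'n \<Rightarrow> real" where
  "picone p M x y = norm_mat M (x + y) powr p - norm_mat M x powr p - p * norm_mat M x powr (p - 2) * ((M *v x) \<bullet> y)"

text \<open>One pair \<open>X\<close>, \<open>Y\<close> serves all multiples of \<open>x\<close> and
  \<open>y\<close> at once, so inequalities for \<open>bregman\<close> in the complex plane transfer
  with the same constant, whatever the matrix and the dimension.\<close>

lemma picone_realize:
  fixes M :: "real^'n^'n"
  assumes M: "psd M"
  obtains X Y :: complex where "\<forall>s t. picone p M (s *\<^sub>R x) (t *\<^sub>R y) = bregman p (s *\<^sub>R X) (t *\<^sub>R Y)"
    "norm_mat M x = norm X" "norm_mat M y = norm Y"
proof -
  obtain X Y :: complex where *: "\<forall>s t. norm_mat M (s *\<^sub>R x + t *\<^sub>R y) = norm (s *\<^sub>R X + t *\<^sub>R Y)" "(M *v x) \<bullet> y = X \<bullet> Y"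
    by (fact psd_realize[OF M, of x y])
  have x: "norm_mat M (s *\<^sub>R x) = norm (s *\<^sub>R X)" for s using *(1)[rule_format, of s 0] by simp
  have "norm_mat M y = norm Y" using *(1)[rule_format, of 0 1] by simp
  moreover have "norm_mat M x = norm X" using x[of 1] by simp
  moreover have "picone p M (s *\<^sub>R x) (t *\<^sub>R y) = bregman p (s *\<^sub>R X) (t *\<^sub>R Y)" for s t
    using *(1)[rule_format, of s t] *(2) unfolding picone_def bregman_def x
    by (simp add: matrix_vector_mult_scaleR)
  ultimately show ?thesis using that by blast
qed

lemma picone_nonneg:
  assumes "psd M" "1 < p" shows "0 \<le> picone p M x y"
proof -
  obtain X Y :: complex where *: "\<forall>s t. picone p M (s *\<^sub>R x) (t *\<^sub>R y) = bregman p (s *\<^sub>R X) (t *\<^sub>R Y)"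
    "norm_mat M x = norm X" "norm_mat M y = norm Y" by (fact picone_realize[OF assms(1), of p x y])
  show ?thesis using *(1)[rule_format, of 1 1] bregman_nonneg[OF assms(2), of X Y] by simp
qed

lemma picone_zero [simp]: "picone p M x 0 = 0"
  by (simp add: picone_def)

text \<open>Homogeneity extracts the factor \<open>T / s\<close> from both slots and leaves
  \<open>y\<close> dilated by \<open>s * T' / T\<close>, which the hypotheses confine to
  \<open>[0, 2]\<close>. It is applied with \<open>s\<close> a value of \<open>w\<close>,
  \<open>T\<close> its truncation and \<open>T'\<close> the derivative of the truncation.\<close>

lemma picone_compose:
  assumes p: "1 < p"
  shows "\<exists>C>0. \<forall>(M :: real^'n^'n) x y s T T'. psd M \<and> s \<noteq> 0 \<and> 0 \<le> T \<and> 0 \<le> s * T' \<and> s * T' \<le> 2 * T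
     \<longrightarrow> picone p M (T *\<^sub>R x) (T' *\<^sub>R y) \<le> C * (T / \<bar>s\<bar>) powr p * picone p M (s *\<^sub>R x) y"
proof -
  obtain C where C: "C > 0" "\<And>x y :: complex. \<And>t. 0 \<le> t \<Longrightarrow> t \<le> 2 \<Longrightarrow> bregman p x (t *\<^sub>R y) \<le> C * bregman p x y"
    using bregman_dilate[OF p, where 'a = complex] by blast
  have "picone p M (T *\<^sub>R x) (T' *\<^sub>R y) \<le> C * (T / \<bar>s\<bar>) powr p * picone p M (s *\<^sub>R x) y"
    if M: "psd M" and s: "s \<noteq> 0" and T: "0 \<le> T" "0 \<le> s * T'" "s * T' \<le> 2 * T" for M :: "real^'n^'n" and x y s T T'
  proof -
    obtain X Y :: complex where *: "\<forall>s t. picone p M (s *\<^sub>R x) (t *\<^sub>R y) = bregman p (s *\<^sub>R X) (t *\<^sub>R Y)"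
      "norm_mat M x = norm X" "norm_mat M y = norm Y" by (fact picone_realize[OF M, of p x y])
    show ?thesis
    proof (cases "T = 0")
      case True
      then have "T' = 0" using T s by (metis antisym mult_eq_0_iff mult_zero_right)
      then show ?thesis using True by simp
    next
      case False
      define \<theta> where "\<theta> = s * T' / T"
      have th: "0 \<le> \<theta>" "\<theta> \<le> 2" using T False by (auto simp: \<theta>_def field_simps)
      have eX: "T *\<^sub>R X = (T / s) *\<^sub>R (s *\<^sub>R X)" and eY: "T' *\<^sub>R Y = (T / s) *\<^sub>R (\<theta> *\<^sub>R Y)"
        using s False by (auto simp: \<theta>_def)
      have "picone p M (T *\<^sub>R x) (T' *\<^sub>R y) = bregman p (T *\<^sub>R X) (T' *\<^sub>R Y)" by (rule *(1)[rule_format])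
      also have "\<dots> = \<bar>T / s\<bar> powr p * bregman p (s *\<^sub>R X) (\<theta> *\<^sub>R Y)" by (subst eX, subst eY) (rule bregman_scaleR)
      also have "\<dots> \<le> \<bar>T / s\<bar> powr p * (C * bregman p (s *\<^sub>R X) Y)" by (intro mult_left_mono C(2) th) auto
      also have "bregman p (s *\<^sub>R X) Y = picone p M (s *\<^sub>R x) y" using *(1)[rule_format, of s 1] by simp
      finally show ?thesis using T by (simp add: abs_divide mult_ac)
    qed
  qed
  then show ?thesis using C(1) by blast
qed

text \<open>Turns small energy into small \<open>u \<nabla>w\<close> in \<open>L^p\<close>, up to a
  share of \<open>|w \<nabla>u|^p\<close>.\<close>

lemma norm_mat_powr_le_picone:
  assumes p: "1 < p" and d: "0 < d"
  shows "\<exists>C>0. \<forall>(M :: real^'n^'n) x y. psd M \<longrightarrow> norm_mat M y powr p \<le> d * norm_mat M x powr p + C * picone p M x y"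
proof -
  obtain C where C: "C > 0" "\<And>x y :: complex. norm y powr p \<le> d * norm x powr p + C * bregman p x y"
    using norm_powr_le_bregman[OF p d, where 'a = complex] by blast
  have "norm_mat M y powr p \<le> d * norm_mat M x powr p + C * picone p M x y" if M: "psd M" for M :: "real^'n^'n" and x y
  proof -
    obtain X Y :: complex where *: "\<forall>s t. picone p M (s *\<^sub>R x) (t *\<^sub>R y) = bregman p (s *\<^sub>R X) (t *\<^sub>R Y)"
      "norm_mat M x = norm X" "norm_mat M y = norm Y" by (fact picone_realize[OF M, of p x y])
    show ?thesis using *(1)[rule_format, of 1 1] *(2,3) C(2)[of Y X] by simp
  qed
  then show ?thesis using C(1) by blast
qed

text \<open>Bounds the energy of a function about whose gradient nothing but its size is
  known.\<close>

lemma picone_le_norm_mat_powr: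
  assumes p: "1 < p" and d: "0 < d"
  shows "\<exists>C>0. \<forall>(M :: real^'n^'n) x y. psd M \<longrightarrow> picone p M x y \<le> d * norm_mat M x powr p + C * norm_mat M y powr p"
proof -
  obtain C where C: "C > 0" "\<And>x y :: complex. bregman p x y \<le> d * norm x powr p + C * norm y powr p"
    using bregman_le_norm_powr[OF p d, where 'a = complex] by blast
  have "picone p M x y \<le> d * norm_mat M x powr p + C * norm_mat M y powr p" if M: "psd M" for M :: "real^'n^'n" and x y
  proof -
    obtain X Y :: complex where *: "\<forall>s t. picone p M (s *\<^sub>R x) (t *\<^sub>R y) = bregman p (s *\<^sub>R X) (t *\<^sub>R Y)"
      "norm_mat M x = norm X" "norm_mat M y = norm Y" by (fact picone_realize[OF M, of p x y])
    show ?thesis using *(1)[rule_format, of 1 1] *(2,3) C(2)[of X Y] by simp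
  qed
  then show ?thesis using C(1) by blast
qed

section \<open>The simplified energy\<close>

text \<open>Expressions in a weak gradient vanish off the support almost everywhere, not
  everywhere.\<close>

lemma L1_loc_AE_support:
  fixes f :: "real^'n \<Rightarrow> real"
  assumes f: "f \<in> L1_loc \<Omega>" and K: "compact K" "K \<subseteq> \<Omega>" and ae: "AE x\<in>\<Omega> - K in lebesgue. f x = 0"
  shows "set_integrable lebesgue \<Omega> f" "(LINT x:\<Omega>|lebesgue. f x) = (\<integral>x. indicat_real K x * f x \<partial>lebesgue)"
proof -
  define f' where "f' x = indicat_real K x * f x" for x
  have ae': "AE x\<in>\<Omega> in lebesgue. f x = f' x" using ae by eventually_elim (auto simp: f'_def indicator_def)
  have z: "f' x = 0" if "x \<in> \<Omega> - K" for x using that by (simp add: f'_def)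
  have e: "(\<lambda>x. indicat_real K x * f' x) = (\<lambda>x. indicat_real K x * f x)" by (auto simp: f'_def indicator_def)
  have "set_integrable lebesgue \<Omega> f'"
    using set_integral_support(2)[OF K(2) z] L1_loc_integrable[OF f K] e by simp
  then show "set_integrable lebesgue \<Omega> f" using set_integral_AE_cong(1)[OF ae'] by blast
  show "(LINT x:\<Omega>|lebesgue. f x) = (\<integral>x. indicat_real K x * f x \<partial>lebesgue)"
    using set_integral_AE_cong(2)[OF ae'] set_integral_support(1)[OF K(2) z] e by simp
qed

lemma L1_loc_bound:
  fixes f g :: "real^'n \<Rightarrow> real"
  assumes \<Omega>: "open \<Omega>" and f: "f \<in> borel_measurable (lebesgue_on \<Omega>)" and g: "g \<in> L1_loc \<Omega>"
    and b: "\<And>K. compact K \<Longrightarrow> K \<subseteq> \<Omega> \<Longrightarrow> \<exists>C. AE x\<in>K in lebesgue. \<bar>f x\<bar> \<le> C * g x"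
  shows "f \<in> L1_loc \<Omega>"
proof -
  have "integrable lebesgue (\<lambda>x. indicat_real K x * f x)" if K: "compact K" "K \<subseteq> \<Omega>" for K
  proof -
    obtain C where "AE x\<in>K in lebesgue. \<bar>f x\<bar> \<le> C * g x" using b[OF K] by blast
    then show ?thesis
      by (intro integrable_on_compact_bound[OF \<Omega> f K L1_loc_integrable[OF L1_loc_cmult[OF g] K]])
  qed
  then show ?thesis by (simp add: L1_loc_def set_integrable_def)
qed

lemma DERIV_abs_powr:
  fixes p s :: real
  assumes p: "1 < p"
  shows "((\<lambda>s. \<bar>s\<bar> powr p) has_real_derivative (p * \<bar>s\<bar> powr (p - 2) * s)) (at s)"
proof -
  consider "s > 0" | "s < 0" | "s = 0" by linarith
  then show ?thesis
  proof cases
    case 1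
    have "((\<lambda>s. s powr p) has_real_derivative (p * \<bar>s\<bar> powr (p - 2) * s)) (at s)"
      using 1 by (auto intro!: derivative_eq_intros simp: powr_diff power2_eq_square)
    then show ?thesis
      by (rule has_field_derivative_transform_within_open[of _ _ _ "{0<..}"]) (use 1 in auto)
  next
    case 2
    have "((\<lambda>s. (- s) powr p) has_real_derivative (p * \<bar>s\<bar> powr (p - 2) * s)) (at s)"
      using 2 by (auto intro!: derivative_eq_intros simp: powr_diff power2_eq_square field_simps)
    then show ?thesis
      by (rule has_field_derivative_transform_within_open[of _ _ _ "{..<0}"]) (use 2 in auto)
  next
    case 3
    \<comment> \<open>The difference quotient at 0 has absolute value
      \<open>\<bar>h\<bar> powr (p - 1)\<close>, which tends to 0 by \<open>p > 1\<close>.\<close>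
    have "((\<lambda>h. \<bar>h\<bar> powr (p - 1)) \<longlongrightarrow> 0) (at (0::real))"
      using tendsto_powr'[of "\<lambda>h. \<bar>h\<bar>" 0 "at (0::real)" "\<lambda>_. p - 1" "p - 1"] p
      by (auto intro!: tendsto_eq_intros)
    then have "((\<lambda>h. \<bar>(\<bar>0 + h\<bar> powr p - \<bar>0::real\<bar> powr p) / h\<bar>) \<longlongrightarrow> 0) (at 0)"
    proof (rule Lim_transform_eventually)
      have "\<bar>h\<bar> powr (p - 1) = \<bar>(\<bar>0 + h\<bar> powr p - \<bar>0\<bar> powr p) / h\<bar>" if "h \<noteq> 0" for h :: real
        using that by (simp add: powr_diff abs_divide)
      then show "\<forall>\<^sub>F h in at (0::real). \<bar>h\<bar> powr (p - 1) = \<bar>(\<bar>0 + h\<bar> powr p - \<bar>0\<bar> powr p) / h\<bar>"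
        by (auto simp: eventually_at_filter)
    qed
    then have "((\<lambda>h. (\<bar>0 + h\<bar> powr p - \<bar>0::real\<bar> powr p) / h) \<longlongrightarrow> 0) (at 0)"
      by (rule tendsto_rabs_zero_cancel)
    then show ?thesis using 3 by (simp add: DERIV_def)
  qed
qed

text \<open>For \<open>p < 2\<close> the exponent \<open>p - 2\<close> is negative. Positive and
  negative parts with the exponent \<open>p - 1\<close> show the continuity at 0.\<close>

lemma continuous_abs_powr_sgn:
  fixes p :: real
  assumes p: "1 < p"
  shows "continuous_on UNIV (\<lambda>s::real. p * \<bar>s\<bar> powr (p - 2) * s)"
proof -
  have e: "(\<lambda>s::real. p * \<bar>s\<bar> powr (p - 2) * s) = (\<lambda>s. p * (max 0 s powr (p - 1) - max 0 (-s) powr (p - 1)))"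
  proof
    fix s :: real
    consider "s > 0" | "s < 0" | "s = 0" by linarith
    then show "p * \<bar>s\<bar> powr (p - 2) * s = p * (max 0 s powr (p - 1) - max 0 (-s) powr (p - 1))"
    proof cases
      case 1
      then show ?thesis by (simp add: powr_diff power2_eq_square)
    next
      case 2
      then show ?thesis by (simp add: powr_diff power2_eq_square field_simps)
    qed (use p in simp)
  qed
  have "continuous_on UNIV (\<lambda>s::real. max 0 s powr (p - 1))" "continuous_on UNIV (\<lambda>s::real. max 0 (-s) powr (p - 1))"
    using p by (intro continuous_on_powr' continuous_intros; auto)+
  then show ?thesis unfolding e by (intro continuous_on_mult continuous_on_diff continuous_on_const)
qed

text \<open>With \<open>a = \<nabla>u\<close> and \<open>y = u \<nabla>w\<close>, the subtracted
  term is the flux of \<open>u\<close> against the gradient of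
  \<open>\<bar>w\<bar>\<^sup>p u\<close>. The part of this gradient along \<open>a\<close> gives
  \<open>|w a|^p\<close>, the rest gives the linear term of the remainder.\<close>

lemma picone_tested:
  fixes M :: "real^'n^'n"
  assumes M: "psd M" and p: "1 < p"
  shows "norm_mat M (y + w *\<^sub>R a) powr p
    - (norm_mat M a powr (p - 2) *\<^sub>R (M *v a)) \<bullet> ((p * \<bar>w\<bar> powr (p - 2) * w) *\<^sub>R y + \<bar>w\<bar> powr p *\<^sub>R a)
    = picone p M (w *\<^sub>R a) y"
proof -
  define N where "N = norm_mat M a"
  have N: "0 \<le> N" unfolding N_def by (rule norm_mat_nonneg[OF M])
  have "(M *v a) \<bullet> a = N\<^sup>2" using M by (simp add: N_def norm_mat_def quad_form_eq[symmetric] psd_def)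
  then have 1: "N powr (p - 2) * ((M *v a) \<bullet> a) = N powr p" using N by (cases "N = 0") (auto simp: powr_diff)
  have 2: "norm_mat M (w *\<^sub>R a) = \<bar>w\<bar> * N" by (simp add: N_def norm_mat_scaleR[OF M])
  show ?thesis unfolding picone_def 2 N_def[symmetric]
    using 1 by (simp add: inner_add_right matrix_vector_mult_scaleR powr_mult add.commute algebra_simps)
qed

text \<open>The potential enters through its local integrability, since it is paired with continuous
  functions of compact support. As \<open>u\<close> is a parameter, two solutions give two instances
  that share the same \<open>best_constant\<close>.\<close>

locale hardy_setting =
  fixes \<Omega> :: "(real^'n) set" and p :: real and A :: "real^'n \<Rightarrow> real^'n^'n"
    and V :: "real^'n \<Rightarrow> real" and u :: "real^'n \<Rightarrow> real"
  assumes open_\<Omega>: "open \<Omega>" and connected_\<Omega>: "connected \<Omega>" and nonempty_\<Omega>: "\<Omega> \<noteq> {}"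
    and p: "1 < p"
    and A: "Linf_loc_matrix \<Omega> A" "symmetric_matrix_on \<Omega> A" "loc_unif_pos_def \<Omega> A"
    and V: "V \<in> L1_loc \<Omega>"
    and Q_nonneg: "\<And>\<phi>. \<phi> \<in> W1p p \<Omega> \<inter> Cc \<Omega> \<Longrightarrow> 0 \<le> Q_energy p A V \<Omega> \<phi>"
    and sol: "positive_solution p A V \<Omega> u"
begin

abbreviation a where "a \<equiv> weak_grad \<Omega> u"

abbreviation "N x \<xi> \<equiv> norm_mat (A x) \<xi>"

lemma p0: "0 < p" using p by simp

lemma u_pos: "x \<in> \<Omega> \<Longrightarrow> 0 < u x" and u_cont: "continuous_on \<Omega> u"
  using sol by (auto simp: positive_solution_def)

lemma u_wloc: "wloc p \<Omega> u a"
proof -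
  obtain G where G: "is_weak_grad \<Omega> u G" "\<And>i. (\<lambda>x. G x $ i) \<in> Lp_loc p \<Omega>"
    using sol by (auto simp: positive_solution_def W1p_loc_def)
  have "(\<lambda>x. \<bar>G x $ i\<bar> powr p) \<in> L1_loc \<Omega>" for i
    using G(2)[of i] by (auto simp: Lp_loc_def Lp_space_def L1_loc_def)
  then have w: "wloc p \<Omega> u G" using u_cont G by (simp add: wloc_def)
  have ae: "AE x\<in>\<Omega> in lebesgue. \<bar>G x $ i\<bar> powr p = \<bar>a x $ i\<bar> powr p" for i
    using wloc_weak_grad_AE[OF open_\<Omega> w] by eventually_elim auto
  show ?thesis unfolding wloc_def
    using u_cont is_weak_grad_weak_grad[OF G(1)] L1_loc_AE_cong[OF ae wlocD(3)[OF w]] by blast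
qed

lemma A_bound:
  assumes "compact K" "K \<subseteq> \<Omega>"
  obtains c where "AE x\<in>K in lebesgue. \<forall>i j. \<bar>A x $ i $ j\<bar> \<le> c"
  using A(1) assms unfolding Linf_loc_matrix_def by meson

lemma A_lower:
  assumes "compact K" "K \<subseteq> \<Omega>"
  obtains \<theta> where "\<theta> > 0" "AE x\<in>K in lebesgue. \<forall>\<xi>. \<theta> * (norm \<xi>)\<^sup>2 \<le> quad_form (A x) \<xi>"
  using A(3) assms unfolding loc_unif_pos_def_def by meson

lemma A_psd: "AE x\<in>\<Omega> in lebesgue. psd (A x)"
proof (rule AE_local)
  fix x assume "x \<in> \<Omega>"
  then obtain r where r: "r > 0" "cball x r \<subseteq> \<Omega>" using open_\<Omega> open_contains_cball by blast
  obtain \<theta> where \<theta>: "\<theta> > 0" "AE y\<in>cball x r in lebesgue. \<forall>\<xi>. \<theta> * (norm \<xi>)\<^sup>2 \<le> quad_form (A y) \<xi>"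
    by (rule A_lower[OF compact_cball r(2)])
  have "AE y\<in>\<Omega> in lebesgue. transpose (A y) = A y" using A(2) by (simp add: symmetric_matrix_on_def)
  then have "AE y in lebesgue. y \<in> ball x r \<longrightarrow> psd (A y)"
    using \<theta>(2)
  proof eventually_elim
    case (elim y)
    show ?case
    proof
      assume "y \<in> ball x r"
      then have y: "y \<in> cball x r" "y \<in> \<Omega>" using r(2) by auto
      have "0 \<le> quad_form (A y) \<xi>" for \<xi>
      proof -
        have "0 \<le> \<theta> * (norm \<xi>)\<^sup>2" using \<theta>(1) by simp
        then show ?thesis using elim(2) y(1) by (meson order_trans)
      qed
      then show "psd (A y)" using elim(1) y(2) by (simp add: psd_def)
    qed
  qed
  then show "\<exists>r>0. AE y in lebesgue. y \<in> ball x r \<longrightarrow> psd (A y)" using r(1) by blast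
qed

lemma A_meas: "(\<lambda>x. A x $ i $ j) \<in> borel_measurable (lebesgue_on \<Omega>)"
proof -
  have "A \<in> borel_measurable (lebesgue_on \<Omega>)" using A(1) by (simp add: Linf_loc_matrix_def)
  moreover have "(\<lambda>M::real^'n^'n. M $ i $ j) \<in> borel_measurable borel"
    by (intro borel_measurable_continuous_onI continuous_intros)
  ultimately show ?thesis by (rule measurable_compose)
qed

lemma N_meas:
  assumes "\<And>i. (\<lambda>x. G x $ i) \<in> borel_measurable (lebesgue_on \<Omega>)"
  shows "(\<lambda>x. N x (G x)) \<in> borel_measurable (lebesgue_on \<Omega>)"
  unfolding norm_mat_def quad_form_def
  by (rule borel_measurable_continuous_on[of sqrt])
     (intro continuous_intros borel_measurable_sum borel_measurable_times A_meas assms)+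

lemma inner_meas:
  assumes "\<And>i. (\<lambda>x. G x $ i) \<in> borel_measurable (lebesgue_on \<Omega>)" "\<And>i. (\<lambda>x. H x $ i) \<in> borel_measurable (lebesgue_on \<Omega>)"
  shows "(\<lambda>x. (A x *v G x) \<bullet> H x) \<in> borel_measurable (lebesgue_on \<Omega>)" "(\<lambda>x. (A x *v G x) $ i) \<in> borel_measurable (lebesgue_on \<Omega>)"
  unfolding inner_vec_def matrix_vector_mult_def inner_real_def vec_lambda_beta
  by (intro borel_measurable_sum borel_measurable_times A_meas assms)+

lemma wloc_meas: "wloc p \<Omega> f G \<Longrightarrow> (\<lambda>x. G x $ i) \<in> borel_measurable (lebesgue_on \<Omega>)"
  by (rule L1_loc_measurable[OF open_\<Omega> is_weak_grad_L1(2)[OF wlocD(2)]])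

lemma N_powr_L1_loc:
  assumes m: "\<And>i. (\<lambda>x. G x $ i) \<in> borel_measurable (lebesgue_on \<Omega>)" and G: "\<And>i. (\<lambda>x. \<bar>G x $ i\<bar> powr p) \<in> L1_loc \<Omega>"
  shows "(\<lambda>x. N x (G x) powr p) \<in> L1_loc \<Omega>"
proof (rule L1_loc_bound[OF open_\<Omega>])
  show "(\<lambda>x. N x (G x) powr p) \<in> borel_measurable (lebesgue_on \<Omega>)"
    using N_meas[OF m] by measurable
  have "(\<lambda>x. \<Sum>i\<in>S. \<bar>G x $ i\<bar> powr p) \<in> L1_loc \<Omega>" if "finite S" for S
    using that by (induction S rule: finite_induct) (auto intro!: L1_loc_add G L1_loc_const)
  then show "(\<lambda>x. \<Sum>i\<in>UNIV. \<bar>G x $ i\<bar> powr p) \<in> L1_loc \<Omega>" by simp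
  fix K assume K: "compact K" "K \<subseteq> \<Omega>"
  obtain c where c: "AE x\<in>K in lebesgue. \<forall>i j. \<bar>A x $ i $ j\<bar> \<le> c" by (rule A_bound[OF K])
  have "AE x\<in>K in lebesgue. \<bar>N x (G x) powr p\<bar> \<le> (sqrt c powr p * real CARD('n) powr p) * (\<Sum>i\<in>UNIV. \<bar>G x $ i\<bar> powr p)"
    using c A_psd
  proof eventually_elim
    case (elim x)
    show ?case
    proof
      assume "x \<in> K"
      then have "psd (A x)" "\<And>i j. \<bar>A x $ i $ j\<bar> \<le> c" using elim K(2) by auto
      from norm_mat_powr_le[OF this p0, of "G x"]
      show "\<bar>N x (G x) powr p\<bar> \<le> (sqrt c powr p * real CARD('n) powr p) * (\<Sum>i\<in>UNIV. \<bar>G x $ i\<bar> powr p)" by simp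
    qed
  qed
  then show "\<exists>C. AE x\<in>K in lebesgue. \<bar>N x (G x) powr p\<bar> \<le> C * (\<Sum>i\<in>UNIV. \<bar>G x $ i\<bar> powr p)" by blast
qed

lemma wloc_N_L1: "wloc p \<Omega> f G \<Longrightarrow> (\<lambda>x. N x (G x) powr p) \<in> L1_loc \<Omega>"
  by (rule N_powr_L1_loc) (auto intro: wloc_meas wlocD(3))

section \<open>Testing the equation and the ground state representation\<close>

definition flux where "flux x = N x (a x) powr (p - 2) *\<^sub>R (A x *v a x)"

definition Zu where "Zu x = V x * \<bar>u x\<bar> powr (p - 2) * u x"

lemma flux_meas: "(\<lambda>x. flux x $ i) \<in> borel_measurable (lebesgue_on \<Omega>)"
proof -
  have "(\<lambda>x. N x (a x)) \<in> borel_measurable (lebesgue_on \<Omega>)" by (rule N_meas[OF wloc_meas[OF u_wloc]])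
  moreover have "(\<lambda>x. (A x *v a x) $ i) \<in> borel_measurable (lebesgue_on \<Omega>)"
    by (rule inner_meas(2)[OF wloc_meas[OF u_wloc] wloc_meas[OF u_wloc]])
  ultimately show ?thesis unfolding flux_def vector_scaleR_component real_scaleR_def by measurable
qed

text \<open>The flux has the size \<open>N x (a x) powr (p - 1)\<close>, and raising to the dual
  exponent gives the power \<open>p\<close>, which is locally integrable.\<close>

lemma flux_L1: "(\<lambda>x. \<bar>flux x $ i\<bar> powr (p / (p - 1))) \<in> L1_loc \<Omega>"
proof (rule L1_loc_bound[OF open_\<Omega> _ wloc_N_L1[OF u_wloc]])
  show "(\<lambda>x. \<bar>flux x $ i\<bar> powr (p / (p - 1))) \<in> borel_measurable (lebesgue_on \<Omega>)" using flux_meas by measurable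
  fix K assume K: "compact K" "K \<subseteq> \<Omega>"
  obtain c where c: "AE x\<in>K in lebesgue. \<forall>i j. \<bar>A x $ i $ j\<bar> \<le> c" by (rule A_bound[OF K])
  have "AE x\<in>K in lebesgue. \<bar>\<bar>flux x $ i\<bar> powr (p / (p - 1))\<bar> \<le> sqrt c powr (p / (p - 1)) * N x (a x) powr p"
    using c A_psd
  proof eventually_elim
    case (elim x)
    show ?case
    proof
      assume "x \<in> K"
      then have M: "psd (A x)" "\<And>i j. \<bar>A x $ i $ j\<bar> \<le> c" using elim K(2) by auto
      have c0: "0 \<le> c" using M(2)[of undefined undefined] by linarith
      define n where "n = N x (a x)"
      have n: "0 \<le> n" unfolding n_def by (rule norm_mat_nonneg[OF M(1)])
      have "\<bar>flux x $ i\<bar> \<le> n powr (p - 2) * (sqrt c * n)"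
        using norm_mat_le(2)[OF M, of "a x" i] by (simp add: flux_def abs_mult n_def[symmetric] mult_left_mono)
      also have "\<dots> = sqrt c * n powr (p - 1)" using n by (cases "n = 0") (auto simp: powr_diff power2_eq_square)
      finally have "\<bar>flux x $ i\<bar> powr (p / (p - 1)) \<le> (sqrt c * n powr (p - 1)) powr (p / (p - 1))"
        using p by (intro powr_mono2) auto
      also have "\<dots> = sqrt c powr (p / (p - 1)) * n powr p" using p by (simp add: powr_mult powr_powr)
      finally show "\<bar>\<bar>flux x $ i\<bar> powr (p / (p - 1))\<bar> \<le> sqrt c powr (p / (p - 1)) * N x (a x) powr p" by (simp add: n_def)
    qed
  qed
  then show "\<exists>C. AE x\<in>K in lebesgue. \<bar>\<bar>flux x $ i\<bar> powr (p / (p - 1))\<bar> \<le> C * N x (a x) powr p" by blast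
qed

lemma Zu_L1: "Zu \<in> L1_loc \<Omega>"
proof -
  have "continuous_on \<Omega> (\<lambda>x. \<bar>u x\<bar> powr (p - 2) * u x)"
    using u_pos by (intro continuous_intros u_cont) force
  from L1_loc_mult[OF V this] show ?thesis by (simp add: Zu_def[abs_def] mult_ac)
qed

lemma tested:
  assumes "wloc p \<Omega> \<psi> H" "compact K" "K \<subseteq> \<Omega>" "\<And>x. x \<in> \<Omega> - K \<Longrightarrow> \<psi> x = 0"
  shows "set_integrable lebesgue \<Omega> (\<lambda>x. flux x \<bullet> H x + Zu x * \<psi> x)"
    and "(LINT x:\<Omega>|lebesgue. flux x \<bullet> H x + Zu x * \<psi> x) = 0"
proof -
  have eq: "(LINT x:\<Omega>|lebesgue. flux x \<bullet> classical_grad \<phi> x + Zu x * \<phi> x) = 0" if "\<phi> \<in> test_functions \<Omega>" for \<phi>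
    using sol that unfolding positive_solution_def flux_def Zu_def by simp
  show "set_integrable lebesgue \<Omega> (\<lambda>x. flux x \<bullet> H x + Zu x * \<psi> x)"
    "(LINT x:\<Omega>|lebesgue. flux x \<bullet> H x + Zu x * \<psi> x) = 0"
    using equation_tested_with_Sobolev[OF open_\<Omega> p flux_meas flux_L1 Zu_L1 eq assms] by auto
qed

abbreviation "energy_density w H x \<equiv> picone p (A x) (w x *\<^sub>R a x) (u x *\<^sub>R H x)"

text \<open>Ground state representation: test the equation of \<open>u\<close> with \<open>\<bar>w\<bar>\<^sup>p u\<close> and subtract.\<close>

lemma energy_representation:
  assumes w: "wloc p \<Omega> w H" and K: "compact K" "K \<subseteq> \<Omega>" "\<And>x. x \<in> \<Omega> - K \<Longrightarrow> w x = 0"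
  shows "(\<lambda>x. u x * w x) \<in> W1p p \<Omega> \<inter> Cc \<Omega>"
    and "set_integrable lebesgue \<Omega> (energy_density w H)"
    and "Q_energy p A V \<Omega> (\<lambda>x. u x * w x) = (LINT x:\<Omega>|lebesgue. energy_density w H x)"
proof -
  define g where "g x = u x *\<^sub>R H x + w x *\<^sub>R a x" for x
  have uw: "wloc p \<Omega> (\<lambda>x. u x * w x) g" unfolding g_def by (rule wloc_mult[OF open_\<Omega> p0 u_wloc w])
  show "(\<lambda>x. u x * w x) \<in> W1p p \<Omega> \<inter> Cc \<Omega>" by (rule wloc_imp_W1p[OF open_\<Omega> p0 uw K(1,2)]) (use K(3) in simp)
  have H0: "AE x\<in>\<Omega> - K in lebesgue. H x = 0" by (rule weak_grad_zero_outside[OF open_\<Omega> wlocD(2)[OF w] K(1) K(3)])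
  define f1 where "f1 x = N x (g x) powr p + V x * \<bar>u x * w x\<bar> powr p" for x
  have f1L: "f1 \<in> L1_loc \<Omega>"
  proof -
    have "continuous_on \<Omega> (\<lambda>x. \<bar>u x * w x\<bar> powr p)"
      using p by (intro continuous_on_powr' continuous_intros u_cont wlocD(1)[OF w]) auto
    from L1_loc_add[OF wloc_N_L1[OF uw] L1_loc_mult[OF V this]] show ?thesis by (simp add: f1_def[abs_def] mult.commute)
  qed
  have f10: "AE x\<in>\<Omega> - K in lebesgue. f1 x = 0"
    using H0 by eventually_elim (use K(3) in \<open>auto simp: f1_def g_def norm_mat_def quad_form_def\<close>)
  note f1 = L1_loc_AE_support(1)[OF f1L K(1,2) f10]
  have Q: "Q_energy p A V \<Omega> (\<lambda>x. u x * w x) = (LINT x:\<Omega>|lebesgue. f1 x)"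
    unfolding Q_energy_def
  proof (rule set_integral_AE_cong(2))
    show "AE x\<in>\<Omega> in lebesgue. N x (weak_grad \<Omega> (\<lambda>x. u x * w x) x) powr p + V x * \<bar>u x * w x\<bar> powr p = f1 x"
      using wloc_weak_grad_AE[OF open_\<Omega> uw] by eventually_elim (simp add: f1_def)
  qed
  define F' where "F' s = p * \<bar>s\<bar> powr (p - 2) * s" for s :: real
  have "wloc p \<Omega> (\<lambda>x. \<bar>w x\<bar> powr p) (\<lambda>x. F' (w x) *\<^sub>R H x)"
    unfolding F'_def
    by (rule wloc_chain[OF open_\<Omega> p0 w, of UNIV "\<lambda>s. \<bar>s\<bar> powr p"])
       (use p DERIV_abs_powr continuous_abs_powr_sgn in auto)
  then have \<psi>: "wloc p \<Omega> (\<lambda>x. u x * \<bar>w x\<bar> powr p) (\<lambda>x. u x *\<^sub>R (F' (w x) *\<^sub>R H x) + \<bar>w x\<bar> powr p *\<^sub>R a x)"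
    by (rule wloc_mult[OF open_\<Omega> p0 u_wloc])
  define f2 where "f2 x = flux x \<bullet> (u x *\<^sub>R (F' (w x) *\<^sub>R H x) + \<bar>w x\<bar> powr p *\<^sub>R a x) + Zu x * (u x * \<bar>w x\<bar> powr p)" for x
  have f2: "set_integrable lebesgue \<Omega> f2" "(LINT x:\<Omega>|lebesgue. f2 x) = 0"
    unfolding f2_def using tested[OF \<psi> K(1,2)] K(3) by auto
  have ae: "AE x\<in>\<Omega> in lebesgue. f1 x - f2 x = energy_density w H x"
    using A_psd
  proof eventually_elim
    case (elim x)
    show ?case
    proof
      assume x: "x \<in> \<Omega>"
      then have M: "psd (A x)" using elim by blast
      have ux: "u x > 0" by (rule u_pos[OF x])
      \<comment> \<open>The potential part of the energy equals the zeroth order term of the tested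
        equation, so \<open>V\<close> cancels whatever its sign.\<close>
      have "\<bar>u x * w x\<bar> powr p = \<bar>u x\<bar> powr (p - 2) * u x * (u x * \<bar>w x\<bar> powr p)"
        using ux by (simp add: abs_mult powr_mult powr_diff power2_eq_square)
      then have "V x * \<bar>u x * w x\<bar> powr p = Zu x * (u x * \<bar>w x\<bar> powr p)" by (simp add: Zu_def)
      then show "f1 x - f2 x = energy_density w H x"
        using picone_tested[OF M p, of "u x *\<^sub>R H x" "w x" "a x"]
        by (simp add: f1_def f2_def g_def flux_def F'_def mult.commute)
    qed
  qed
  show "set_integrable lebesgue \<Omega> (energy_density w H)"
    using set_integral_AE_cong(1)[OF ae] set_integral_diff(1)[OF f1 f2(1)] by blast
  show "Q_energy p A V \<Omega> (\<lambda>x. u x * w x) = (LINT x:\<Omega>|lebesgue. energy_density w H x)"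
    using set_integral_AE_cong(2)[OF ae] set_integral_diff(2)[OF f1 f2(1)] f2(2) Q by simp
qed

lemma Q_energy_cong: "(\<And>x. x \<in> \<Omega> \<Longrightarrow> \<phi> x = \<psi> x) \<Longrightarrow> Q_energy p A V \<Omega> \<phi> = Q_energy p A V \<Omega> \<psi>"
  using weak_grad_cong[of \<Omega> \<phi> \<psi>] unfolding Q_energy_def
  by (intro set_integral_AE_cong(2) AE_I2) auto

text \<open>\<open>w = \<phi> / u\<close>. Since \<open>u\<close> is continuous and positive,
  \<open>1 / u\<close> comes from the chain rule on \<open>{0<..}\<close>, and the quotient keeps
  the support of \<open>\<phi>\<close>.\<close>

lemma quotient_representation:
  assumes \<phi>: "\<phi> \<in> W1p p \<Omega> \<inter> Cc \<Omega>"
  obtains w H K where "wloc p \<Omega> w H" "compact K" "K \<subseteq> \<Omega>" "\<forall>x\<in>\<Omega> - K. w x = 0" "\<forall>x\<in>\<Omega>. \<phi> x = u x * w x"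
    "Q_energy p A V \<Omega> \<phi> = (LINT x:\<Omega>|lebesgue. energy_density w H x)"
proof -
  obtain K where K: "compact K" "K \<subseteq> \<Omega>" "\<forall>x\<in>\<Omega> - K. \<phi> x = 0" and \<phi>w: "wloc p \<Omega> \<phi> (weak_grad \<Omega> \<phi>)"
    by (rule W1p_imp_wloc[OF open_\<Omega> \<phi>])
  have inv: "wloc p \<Omega> (\<lambda>x. inverse (u x)) (\<lambda>x. (- (inverse (u x) ^ Suc (Suc 0))) *\<^sub>R a x)"
    by (rule wloc_chain[OF open_\<Omega> p0 u_wloc, of "{0<..}" inverse])
       (use u_pos in \<open>auto intro!: DERIV_inverse continuous_intros simp del: power_Suc\<close>)
  define w where "w x = \<phi> x * inverse (u x)" for x
  define H where "H x = \<phi> x *\<^sub>R ((- (inverse (u x) ^ Suc (Suc 0))) *\<^sub>R a x) + inverse (u x) *\<^sub>R weak_grad \<Omega> \<phi> x" for x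
  have w: "wloc p \<Omega> w H" unfolding w_def H_def by (rule wloc_mult[OF open_\<Omega> p0 \<phi>w inv])
  have w0: "\<forall>x\<in>\<Omega> - K. w x = 0" using K(3) by (simp add: w_def)
  have e: "\<phi> x = u x * w x" if "x \<in> \<Omega>" for x using u_pos[OF that] by (simp add: w_def)
  have "Q_energy p A V \<Omega> \<phi> = (LINT x:\<Omega>|lebesgue. energy_density w H x)"
    using energy_representation(3)[OF w K(1,2)] w0 Q_energy_cong[OF e] by auto
  then show ?thesis using that[OF w K(1,2) w0] e by blast
qed

end

section \<open>Smooth truncations\<close>

text \<open>Even, so the sign of \<open>w\<close> does not matter, and continuously differentiable
  with saturation at 1. The bound \<open>T(s) \<le> 2 s^2\<close> has one power of \<open>s\<close>
  to spare, which makes the dyadic sum converge.\<close>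

definition trunc :: "real \<Rightarrow> real" where "trunc s = 1 - (max 0 (1 - s\<^sup>2))\<^sup>2"

definition trunc' :: "real \<Rightarrow> real" where "trunc' s = 4 * s * max 0 (1 - s\<^sup>2)"

lemma DERIV_max_square: "((\<lambda>t. (max 0 t)\<^sup>2) has_real_derivative (2 * max 0 t)) (at (t::real))"
proof -
  consider "t > 0" | "t < 0" | "t = 0" by linarith
  then show ?thesis
  proof cases
    case 1
    have "((\<lambda>t. t\<^sup>2) has_real_derivative (2 * max 0 t)) (at t)" using 1 by (auto intro!: derivative_eq_intros)
    then show ?thesis by (rule has_field_derivative_transform_within_open[of _ _ _ "{0<..}"]) (use 1 in auto)
  next
    case 2
    have "((\<lambda>t. 0) has_real_derivative (2 * max 0 t)) (at t)" using 2 by (auto intro!: derivative_eq_intros)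
    then show ?thesis by (rule has_field_derivative_transform_within_open[of _ _ _ "{..<0}"]) (use 2 in auto)
  next
    case 3
    have "((\<lambda>h::real. max 0 h) \<longlongrightarrow> 0) (at 0)" by (auto intro!: tendsto_eq_intros)
    then have "((\<lambda>h. ((max 0 (0 + h))\<^sup>2 - (max 0 0)\<^sup>2) / h) \<longlongrightarrow> 0) (at (0::real))"
      by (rule Lim_transform_eventually) (auto simp: eventually_at_filter max_def power2_eq_square)
    then show ?thesis using 3 by (simp add: DERIV_def)
  qed
qed

lemma trunc_deriv: "(trunc has_real_derivative trunc' s) (at s)"
proof -
  have "((\<lambda>s. (max 0 (1 - s\<^sup>2))\<^sup>2) has_real_derivative (2 * max 0 (1 - s\<^sup>2)) * (- (2 * s))) (at s)"
    by (rule DERIV_chain2[OF DERIV_max_square]) (auto intro!: derivative_eq_intros)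
  from DERIV_diff[OF DERIV_const[of 1] this] show ?thesis by (simp add: trunc_def[abs_def] trunc'_def algebra_simps)
qed

lemma trunc'_cont: "continuous_on UNIV trunc'"
  unfolding trunc'_def[abs_def] by (intro continuous_intros)

lemma trunc_bounds:
  shows "0 \<le> trunc s" "trunc s \<le> 1" "trunc s \<le> 2 * s\<^sup>2" "0 \<le> s * trunc' s" "s * trunc' s \<le> 2 * trunc s"
proof -
  define m where "m = max 0 (1 - s\<^sup>2)"
  have m: "0 \<le> m" "m \<le> 1" by (auto simp: m_def)
  have m2: "m\<^sup>2 \<le> 1" using m by (simp add: power_le_one)
  have T: "trunc s = 1 - m\<^sup>2" and T': "s * trunc' s = 4 * s\<^sup>2 * m" by (simp_all add: trunc_def trunc'_def m_def power2_eq_square)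
  show "0 \<le> trunc s" "trunc s \<le> 1" unfolding T using m2 by auto
  show "0 \<le> s * trunc' s" unfolding T' using m by simp
  have "1 - m\<^sup>2 \<le> 2 * s\<^sup>2 \<and> 4 * s\<^sup>2 * m \<le> 2 * (1 - m\<^sup>2)"
  proof (cases "m = 0")
    case True
    then have "1 \<le> s\<^sup>2" by (simp add: m_def max_def split: if_splits)
    then show ?thesis using True by simp
  next
    case False
    then have s: "s\<^sup>2 = 1 - m" by (auto simp: m_def max_def split: if_splits)
    \<comment> \<open>Both inequalities are multiples of this square.\<close>
    have "0 \<le> (1 - m)\<^sup>2" by simp
    then show ?thesis unfolding s by (simp add: power2_eq_square algebra_simps)
  qed
  then show "trunc s \<le> 2 * s\<^sup>2" "s * trunc' s \<le> 2 * trunc s" unfolding T T' by auto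
qed

lemma trunc_one: "1 \<le> \<bar>s\<bar> \<Longrightarrow> trunc s = 1" "1 \<le> \<bar>s\<bar> \<Longrightarrow> trunc' s = 0"
proof -
  assume "1 \<le> \<bar>s\<bar>"
  then have "1 \<le> s\<^sup>2" using abs_le_square_iff[of 1 s] by simp
  then show "trunc s = 1" "trunc' s = 0" by (auto simp: trunc_def trunc'_def)
qed

lemma trunc_0 [simp]: "trunc 0 = 0" "trunc' 0 = 0"
  by (auto simp: trunc_def trunc'_def)

text \<open>A geometric series of ratio \<open>q\<close>, stopped where \<open>r 2^k\<close> reaches
  1. The term \<open>- c * r powr p\<close> makes the induction work: the first summand is split off
  and \<open>r\<close> is doubled, and \<open>c (q - 1) = q\<close> is exactly what balances the two
  sides.\<close>

lemma dyadic_sum_bound: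
  fixes p r :: real
  assumes p: "1 < p"
  defines "q \<equiv> 2 powr p" and "c \<equiv> 2 powr p / (2 powr p - 1)"
  assumes r: "0 < r"
  shows "(\<Sum>k<M. if r * 2 ^ k < 1 then (2 * (r * 2 ^ k)) powr p else 0) \<le> (if 1 \<le> r then 0 else q + c - c * r powr p)"
  using r
proof (induction M arbitrary: r)
  case 0
  have "q > 1" unfolding q_def using p by simp
  then have c: "c > 0" by (simp add: c_def q_def)
  have "r powr p \<le> 1" if "r < 1" using 0 p that powr_mono2[of p r 1] by simp
  then have "c * r powr p \<le> c * 1" if "r < 1" using c that by (intro mult_left_mono) auto
  then show ?case using \<open>q > 1\<close> by auto
next
  case (Suc M)
  have q: "q > 1" unfolding q_def using p by simp
  moreover have "c = q / (q - 1)" by (simp add: c_def q_def)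
  ultimately have c: "c > 0" "c * (q - 1) = q" by simp_all
  have sh: "(\<Sum>k<Suc M. if r * 2 ^ k < 1 then (2 * (r * 2 ^ k)) powr p else 0)
    = (if r < 1 then (2 * r) powr p else 0) + (\<Sum>k<M. if (2 * r) * 2 ^ k < 1 then (2 * ((2 * r) * 2 ^ k)) powr p else 0)"
  proof -
    have "r * 2 ^ Suc k = (2 * r) * 2 ^ k" for k by simp
    then show ?thesis unfolding sum.lessThan_Suc_shift by (simp only: power_0 mult_1_right)
  qed
  have IH: "(\<Sum>k<M. if (2 * r) * 2 ^ k < 1 then (2 * ((2 * r) * 2 ^ k)) powr p else 0)
     \<le> (if 1 \<le> 2 * r then 0 else q + c - c * (2 * r) powr p)" using Suc.prems by (intro Suc.IH) simp
  have e: "(2 * r) powr p = q * r powr p" unfolding q_def by (rule powr_mult)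
  show ?case
  proof (cases "1 \<le> r")
    case True
    then show ?thesis unfolding sh using IH by simp
  next
    case False
    have r1: "r powr p \<le> 1" using False Suc.prems p powr_mono2[of p r 1] by simp
    show ?thesis
    proof (cases "1 \<le> 2 * r")
      case True
      have "q * r powr p + c * r powr p \<le> q * 1 + c * 1" using r1 q c by (intro add_mono mult_left_mono) auto
      then show ?thesis unfolding sh using IH True False e by simp
    next
      case F2: False
      have "q * r powr p - c * (q * r powr p) = - (c * r powr p)"
      proof -
        have "q * r powr p - c * (q * r powr p) + c * r powr p = (q - c * (q - 1)) * r powr p" by (simp add: algebra_simps)
        then show ?thesis using c(2) by simp
      qed
      then show ?thesis unfolding sh using IH False F2 e by simp
    qed
  qed
qed

section \<open>From capacities to the Hardy inequality\<close>

text \<open>The first level not above \<open>t\<close> is at least \<open>t/2\<close>, so its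
  summand alone dominates; if \<open>t\<close> is below all the levels, the leading term does.
  Counting down from an upper bound \<open>L\<close> keeps the sum finite.\<close>

lemma dyadic_levels:
  fixes t L p :: real
  assumes p: "0 < p" and L: "0 < L" and t: "0 \<le> t" "t \<le> L"
  shows "t powr p \<le> (L / 2 ^ M) powr p + (\<Sum>k\<le>M. if L / 2 ^ k \<le> t then (2 * (L / 2 ^ k)) powr p else 0)"
proof (cases "\<exists>k\<le>M. L / 2 ^ k \<le> t")
  case False
  then have "t < L / 2 ^ M" by auto
  then have "t powr p \<le> (L / 2 ^ M) powr p" using t p by (intro powr_mono2) auto
  moreover have "0 \<le> (\<Sum>k\<le>M. if L / 2 ^ k \<le> t then (2 * (L / 2 ^ k)) powr p else 0)" by (intro sum_nonneg) auto
  ultimately show ?thesis by linarith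
next
  case True
  define j where "j = (LEAST k. L / 2 ^ k \<le> t)"
  obtain k0 where k0: "k0 \<le> M" "L / 2 ^ k0 \<le> t" using True by blast
  have j: "L / 2 ^ j \<le> t" "j \<le> M" unfolding j_def
    using LeastI[of "\<lambda>k. L / 2 ^ k \<le> t" k0] Least_le[of "\<lambda>k. L / 2 ^ k \<le> t" k0] k0 by auto
  have "t \<le> 2 * (L / 2 ^ j)"
  proof (cases j)
    case 0
    then show ?thesis using t L by simp
  next
    case (Suc i)
    then have "\<not> L / 2 ^ i \<le> t" using not_less_Least[of i "\<lambda>k. L / 2 ^ k \<le> t"] by (simp add: j_def)
    then show ?thesis using Suc by simp
  qed
  then have "t powr p \<le> (2 * (L / 2 ^ j)) powr p" using t p by (intro powr_mono2) auto
  also have "\<dots> = (if L / 2 ^ j \<le> t then (2 * (L / 2 ^ j)) powr p else 0)" using j by simp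
  also have "\<dots> \<le> (\<Sum>k\<le>M. if L / 2 ^ k \<le> t then (2 * (L / 2 ^ k)) powr p else 0)"
    using j(2) by (intro member_le_sum) auto
  moreover have "0 \<le> (L / 2 ^ M) powr p" by simp
  ultimately show ?thesis by linarith
qed

context hardy_setting
begin

abbreviation wt where "wt l w \<equiv> \<lambda>x. trunc (w x / l)"
abbreviation Ht where "Ht l w H \<equiv> \<lambda>x. (trunc' (w x / l) / l) *\<^sub>R H x"

lemma wloc_trunc:
  assumes "wloc p \<Omega> w H" "0 < l"
  shows "wloc p \<Omega> (wt l w) (Ht l w H)"
proof (rule wloc_chain[OF open_\<Omega> p0 assms(1), of UNIV "\<lambda>s. trunc (s / l)" "\<lambda>s. trunc' (s / l) / l"])
  show "((\<lambda>s. trunc (s / l)) has_real_derivative trunc' (s / l) / l) (at s)" for s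
  proof -
    have "((\<lambda>s. s / l) has_real_derivative 1 / l) (at s)" using assms(2) by (auto intro!: derivative_eq_intros)
    from DERIV_chain2[OF trunc_deriv this] show ?thesis by simp
  qed
  show "continuous_on UNIV (\<lambda>s. trunc' (s / l) / l)"
    using assms(2) by (intro continuous_intros continuous_on_compose2[OF trunc'_cont]) auto
qed auto

text \<open>With \<open>s = w / l\<close>, the bound \<open>T(s) \<le> 2 s^2\<close> gives
  \<open>l T(s) / \<bar>w\<bar> \<le> 2 \<bar>s\<bar>\<close>. The factor on the right is thus small
  at levels far above \<open>\<bar>w\<bar>\<close>, and it vanishes at levels
  \<open>l \<le> \<bar>w\<bar>\<close>, where the truncation is saturated.\<close>

lemma trunc_density:
  "\<exists>C>0. \<forall>w H l x. psd (A x) \<and> 0 < l \<longrightarrow>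
     l powr p * energy_density (wt l w) (Ht l w H) x \<le> C * ((if \<bar>w x\<bar> / l < 1 then (2 * (\<bar>w x\<bar> / l)) powr p else 0) * energy_density w H x)"
proof -
  obtain C where C: "C > 0" "\<And>(M :: real^'n^'n) x y s T T'. psd M \<Longrightarrow> s \<noteq> 0 \<Longrightarrow> 0 \<le> T \<Longrightarrow> 0 \<le> s * T' \<Longrightarrow> s * T' \<le> 2 * T
     \<Longrightarrow> picone p M (T *\<^sub>R x) (T' *\<^sub>R y) \<le> C * (T / \<bar>s\<bar>) powr p * picone p M (s *\<^sub>R x) y"
    using picone_compose[OF p, where 'n='n] by blast
  have "l powr p * energy_density (wt l w) (Ht l w H) x \<le> C * ((if \<bar>w x\<bar> / l < 1 then (2 * (\<bar>w x\<bar> / l)) powr p else 0) * energy_density w H x)"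
    if M: "psd (A x)" and l: "0 < l" for w H l x
  proof -
    define s where "s = w x / l"
    have as: "\<bar>s\<bar> = \<bar>w x\<bar> / l" using l by (simp add: s_def abs_divide)
    have pos: "0 \<le> energy_density w H x" by (rule picone_nonneg[OF M p])
    consider "1 \<le> \<bar>s\<bar>" | "w x = 0" | "\<bar>s\<bar> < 1" "w x \<noteq> 0" by linarith
    then show ?thesis
    proof cases
      case 1
      then have "\<not> \<bar>w x\<bar> / l < 1" using as by simp
      then show ?thesis using trunc_one(2)[OF 1] by (simp only: s_def) simp
    next
      case 2
      then show ?thesis by simp
    next
      case 3
      have h: "w x * (trunc' s / l) = s * trunc' s" by (simp add: s_def)
      have "picone p (A x) (trunc s *\<^sub>R a x) ((trunc' s / l) *\<^sub>R (u x *\<^sub>R H x)) \<le> C * (trunc s / \<bar>w x\<bar>) powr p * energy_density w H x"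
        by (rule C(2)[OF M 3(2) trunc_bounds(1)]) (simp_all only: h trunc_bounds)
      moreover have "(trunc' s / l) *\<^sub>R (u x *\<^sub>R H x) = u x *\<^sub>R (trunc' s / l) *\<^sub>R H x"
        by (rule scaleR_left_commute)
      ultimately have 1: "energy_density (wt l w) (Ht l w H) x \<le> C * (trunc s / \<bar>w x\<bar>) powr p * energy_density w H x"
        by (simp only: s_def)
      have "trunc s / \<bar>w x\<bar> \<le> 2 * s\<^sup>2 / \<bar>w x\<bar>" using trunc_bounds(3)[of s] by (intro divide_right_mono) auto
      also have "2 * s\<^sup>2 / \<bar>w x\<bar> = 2 * \<bar>s\<bar> / l"
      proof -
        have "s\<^sup>2 = \<bar>s\<bar> * (\<bar>w x\<bar> / l)" using as by (metis abs_mult_self_eq power2_eq_square)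
        then show ?thesis using 3(2) by simp
      qed
      finally have "(trunc s / \<bar>w x\<bar>) powr p \<le> (2 * \<bar>s\<bar> / l) powr p"
        using p trunc_bounds(1)[of s] by (intro powr_mono2) auto
      then have "l powr p * (trunc s / \<bar>w x\<bar>) powr p \<le> l powr p * (2 * \<bar>s\<bar> / l) powr p" by (intro mult_left_mono) auto
      also have "\<dots> = (l * (2 * \<bar>s\<bar> / l)) powr p" by (rule powr_mult[symmetric])
      also have "\<dots> = (2 * \<bar>s\<bar>) powr p" using l by simp
      finally have 2: "l powr p * (trunc s / \<bar>w x\<bar>) powr p \<le> (2 * \<bar>s\<bar>) powr p" .
      have "l powr p * energy_density (wt l w) (Ht l w H) x \<le> l powr p * (C * (trunc s / \<bar>w x\<bar>) powr p * energy_density w H x)"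
        using 1 by (intro mult_left_mono) auto
      also have "\<dots> = C * ((l powr p * (trunc s / \<bar>w x\<bar>) powr p) * energy_density w H x)" by (simp add: mult_ac)
      also have "\<dots> \<le> C * ((2 * \<bar>s\<bar>) powr p * energy_density w H x)"
        using 2 C(1) pos by (intro mult_left_mono mult_right_mono) auto
      finally show ?thesis using 3 as by simp
    qed
  qed
  then show ?thesis using C(1) by blast
qed

text \<open>The hypothesis speaks of every competitor instead of the capacity; this avoids dividing
  by it and includes the sets of zero capacity. \<open>C\<close> is fixed before \<open>g\<close>
  and \<open>n\<close>, which is the independence required of the final constant.\<close>

lemma hardy_of_capacity_bound:
  "\<exists>C>0. \<forall>g\<in>L1_loc \<Omega>. \<forall>n\<ge>0.
    (\<forall>F \<phi>. compact F \<and> F \<subseteq> \<Omega> \<and> \<phi> \<in> W1p p \<Omega> \<inter> Cc \<Omega> \<and> (\<forall>x\<in>F. u x \<le> \<phi> x) \<longrightarrow>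
       (LINT x:F|lebesgue. \<bar>g x\<bar> * \<bar>u x\<bar> powr p) \<le> n * Q_energy p A V \<Omega> \<phi>) \<longrightarrow>
    hardy_inequality p A V \<Omega> g (C * n)"
proof -
  obtain C where C: "C > 0" "\<And>w H l x. psd (A x) \<Longrightarrow> 0 < l \<Longrightarrow>
     l powr p * energy_density (wt l w) (Ht l w H) x \<le> C * ((if \<bar>w x\<bar> / l < 1 then (2 * (\<bar>w x\<bar> / l)) powr p else 0) * energy_density w H x)"
    using trunc_density by blast
  \<comment> \<open>The two constants of \<open>dyadic_sum_bound\<close>; dropping its negative term
    leaves a bound free of \<open>r\<close> and of the number of summands.\<close>
  define B where "B = 2 powr p + 2 powr p / (2 powr p - 1)"
  have "2 powr p > 1" using p by simp
  then have B: "B > 0" by (simp add: B_def add_pos_pos)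
  have bound: "(\<Sum>k<M. if r * 2 ^ k < 1 then (2 * (r * 2 ^ k)) powr p else 0) \<le> B" if "0 \<le> r" for r M
  proof (cases "r = 0")
    case True
    then show ?thesis using B p by simp
  next
    case False
    then have r: "0 < r" using that by simp
    have "0 \<le> 2 powr p / (2 powr p - 1) * r powr p" using \<open>2 powr p > 1\<close> by simp
    then show ?thesis using dyadic_sum_bound[OF p r, of M] B unfolding B_def by (auto split: if_splits)
  qed
  define CH where "CH = 2 powr p * (C * B)"
  have CH: "CH > 0" using C B by (simp add: CH_def)
  have concl: "hardy_inequality p A V \<Omega> g (CH * n)"
    if g: "g \<in> L1_loc \<Omega>" and n: "0 \<le> n"
      and cap: "\<And>F \<phi>. compact F \<Longrightarrow> F \<subseteq> \<Omega> \<Longrightarrow> \<phi> \<in> W1p p \<Omega> \<inter> Cc \<Omega> \<Longrightarrow> (\<And>x. x \<in> F \<Longrightarrow> u x \<le> \<phi> x) \<Longrightarrow>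
         (LINT x:F|lebesgue. \<bar>g x\<bar> * \<bar>u x\<bar> powr p) \<le> n * Q_energy p A V \<Omega> \<phi>" for g n
    unfolding hardy_inequality_def
  proof
    fix \<phi> assume \<phi>: "\<phi> \<in> W1p p \<Omega> \<inter> Cc \<Omega>"
    obtain w H K where w: "wloc p \<Omega> w H" and K: "compact K" "K \<subseteq> \<Omega>" "\<forall>x\<in>\<Omega> - K. w x = 0"
      and \<phi>w: "\<forall>x\<in>\<Omega>. \<phi> x = u x * w x" and Q: "Q_energy p A V \<Omega> \<phi> = (LINT x:\<Omega>|lebesgue. energy_density w H x)"
      by (rule quotient_representation[OF \<phi>])
    have K3: "\<And>x. x \<in> \<Omega> - K \<Longrightarrow> w x = 0" using K(3) by blast
    have wK: "continuous_on K w" by (rule continuous_on_subset[OF wlocD(1)[OF w] K(2)])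
    obtain L where L: "L > 0" "\<And>x. x \<in> K \<Longrightarrow> \<bar>w x\<bar> \<le> L" using continuous_on_compact_bounded[OF K(1) wK] by auto
    define l where "l k = L / 2 ^ k" for k :: nat
    have l: "l k > 0" for k using L by (simp add: l_def)
    \<comment> \<open>Compact as a relatively closed subset of \<open>K\<close>. The truncation at
      level \<open>l k\<close> equals 1 on it, so \<open>u\<close> times this truncation is a
      competitor for its capacity.\<close>
    define F where "F k = K \<inter> (\<lambda>x. \<bar>w x\<bar>) -` {l k..}" for k
    have F: "compact (F k)" "F k \<subseteq> \<Omega>" "F k \<subseteq> K" for k
    proof -
      have "closed (F k)" unfolding F_def
        using K(1) by (intro continuous_closed_preimage continuous_intros wK) (auto intro: compact_imp_closed)
      then have "compact (K \<inter> F k)" by (rule compact_Int_closed[OF K(1)])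
      moreover have "K \<inter> F k = F k" by (auto simp: F_def)
      ultimately show "compact (F k)" by simp
      show "F k \<subseteq> \<Omega>" "F k \<subseteq> K" using K by (auto simp: F_def)
    qed
    have wk: "wloc p \<Omega> (wt (l k) w) (Ht (l k) w H)" for k by (rule wloc_trunc[OF w l])
    have wk0: "x \<in> \<Omega> - K \<Longrightarrow> wt (l k) w x = 0" for k x using K3 by simp
    note er = energy_representation[OF wk K(1,2) wk0]
    note e0 = energy_representation[OF w K(1,2) K3]
    define g' where "g' x = \<bar>u x\<bar> powr p * \<bar>g x\<bar>" for x
    have gabs: "(\<lambda>x. \<bar>g x\<bar>) \<in> L1_loc \<Omega>"
    proof -
      have "integrable lebesgue (\<lambda>x. \<bar>indicat_real S x * g x\<bar>)" if "compact S" "S \<subseteq> \<Omega>" for S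
        using L1_loc_integrable[OF g that] by simp
      moreover have "(\<lambda>x. \<bar>indicat_real S x * g x\<bar>) = (\<lambda>x. indicat_real S x * \<bar>g x\<bar>)" for S by (auto simp: abs_mult)
      ultimately show ?thesis by (simp add: L1_loc_def set_integrable_def)
    qed
    have g'L: "g' \<in> L1_loc \<Omega>" unfolding g'_def
      using p by (intro L1_loc_mult gabs continuous_on_powr' continuous_intros u_cont) auto
    define I where "I k = (\<integral>x. indicat_real (F k) x * g' x \<partial>lebesgue)" for k
    have Ik: "I k \<le> n * (LINT x:\<Omega>|lebesgue. energy_density (wt (l k) w) (Ht (l k) w H) x)" for k
    proof -
      have "(LINT x:F k|lebesgue. \<bar>g x\<bar> * \<bar>u x\<bar> powr p) \<le> n * Q_energy p A V \<Omega> (\<lambda>x. u x * wt (l k) w x)"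
      proof (rule cap[OF F(1,2) er(1)])
        fix x assume "x \<in> F k"
        then have "l k \<le> \<bar>w x\<bar>" by (simp add: F_def)
        then have "1 \<le> \<bar>w x / l k\<bar>" using l[of k] by (simp add: abs_divide)
        then show "u x \<le> u x * wt (l k) w x" by (simp add: trunc_one)
      qed
      then show ?thesis using er(3)[of k] by (simp add: set_lebesgue_integral_def I_def g'_def mult_ac)
    qed
    define G where "G = (\<integral>x. indicat_real K x * g' x \<partial>lebesgue)"
    have FI: "integrable lebesgue (\<lambda>x. indicat_real (F k) x * g' x)" for k by (rule L1_loc_integrable[OF g'L F(1,2)])
    have KI: "integrable lebesgue (\<lambda>x. indicat_real K x * g' x)" by (rule L1_loc_integrable[OF g'L K(1,2)])
    have main: "(LINT x:\<Omega>|lebesgue. \<bar>g x\<bar> * \<bar>\<phi> x\<bar> powr p) \<le> (l M) powr p * G + CH * n * Q_energy p A V \<Omega> \<phi>" for M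
    proof -
      have "(LINT x:\<Omega>|lebesgue. \<bar>g x\<bar> * \<bar>\<phi> x\<bar> powr p) = (\<integral>x. indicat_real K x * (\<bar>g x\<bar> * \<bar>\<phi> x\<bar> powr p) \<partial>lebesgue)"
        by (rule set_integral_support(1)[OF K(2)]) (use K(3) \<phi>w in auto)
      \<comment> \<open>\<open>dyadic_levels\<close> with \<open>t = \<bar>w x\<bar>\<close>; the
        conditions \<open>l k \<le> \<bar>w x\<bar>\<close> become the indicators of the sets
        \<open>F k\<close>.\<close>
      also have "\<dots> \<le> (\<integral>x. l M powr p * (indicat_real K x * g' x) + (\<Sum>k\<le>M. (2 * l k) powr p * (indicat_real (F k) x * g' x)) \<partial>lebesgue)"
      proof (rule integral_mono)
        have "(\<lambda>x. indicat_real K x * (\<bar>g x\<bar> * \<bar>\<phi> x\<bar> powr p)) = (\<lambda>x. indicat_real K x * (\<bar>w x\<bar> powr p * g' x))"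
          using \<phi>w K(2) by (auto simp: fun_eq_iff g'_def abs_mult powr_mult indicator_def subset_iff)
        moreover have "continuous_on K (\<lambda>x. \<bar>w x\<bar> powr p)" using p by (intro continuous_on_powr' continuous_intros wK) auto
        ultimately show "integrable lebesgue (\<lambda>x. indicat_real K x * (\<bar>g x\<bar> * \<bar>\<phi> x\<bar> powr p))"
          using L1_loc_mult_integrable[OF g'L K(1,2)] by simp
        show "integrable lebesgue (\<lambda>x. l M powr p * (indicat_real K x * g' x) + (\<Sum>k\<le>M. (2 * l k) powr p * (indicat_real (F k) x * g' x)))"
          using KI FI by (intro Bochner_Integration.integrable_add Bochner_Integration.integrable_sum integrable_mult_right) auto
        fix x
        show "indicat_real K x * (\<bar>g x\<bar> * \<bar>\<phi> x\<bar> powr p) \<le> l M powr p * (indicat_real K x * g' x) + (\<Sum>k\<le>M. (2 * l k) powr p * (indicat_real (F k) x * g' x))"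
        proof (cases "x \<in> K")
          case True
          then have xO: "x \<in> \<Omega>" using K by blast
          have "\<bar>w x\<bar> powr p \<le> l M powr p + (\<Sum>k\<le>M. if l k \<le> \<bar>w x\<bar> then (2 * l k) powr p else 0)"
            unfolding l_def by (rule dyadic_levels[OF p0 L(1)]) (use L(2)[OF True] in auto)
          also have "(\<Sum>k\<le>M. if l k \<le> \<bar>w x\<bar> then (2 * l k) powr p else 0) = (\<Sum>k\<le>M. (2 * l k) powr p * indicat_real (F k) x)"
            using True by (intro sum.cong) (auto simp: F_def indicator_def)
          finally have "\<bar>w x\<bar> powr p * g' x \<le> (l M powr p + (\<Sum>k\<le>M. (2 * l k) powr p * indicat_real (F k) x)) * g' x"
            by (rule mult_right_mono) (simp add: g'_def)
          moreover have "\<bar>g x\<bar> * \<bar>\<phi> x\<bar> powr p = \<bar>w x\<bar> powr p * g' x"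
            using \<phi>w xO by (simp add: g'_def abs_mult powr_mult)
          moreover have "(l M powr p + (\<Sum>k\<le>M. (2 * l k) powr p * indicat_real (F k) x)) * g' x
              = l M powr p * g' x + (\<Sum>k\<le>M. (2 * l k) powr p * (indicat_real (F k) x * g' x))"
            by (simp only: distrib_right sum_distrib_right mult.assoc)
          moreover have "indicat_real K x = 1" using True by simp
          ultimately show ?thesis by (simp only: mult_1_left)
        next
          case False
          then have "x \<notin> F k" for k using F(3) by blast
          then show ?thesis using False by simp
        qed
      qed
      also have "\<dots> = l M powr p * G + (\<Sum>k\<le>M. (2 * l k) powr p * I k)"
        using KI FI by (simp add: Bochner_Integration.integral_add Bochner_Integration.integral_sum G_def I_def)
      also have "(\<Sum>k\<le>M. (2 * l k) powr p * I k) \<le> CH * n * Q_energy p A V \<Omega> \<phi>"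
      proof -
        define D where "D k x = indicat_real \<Omega> x * energy_density (wt (l k) w) (Ht (l k) w H) x" for k x
        define D0 where "D0 x = indicat_real \<Omega> x * energy_density w H x" for x
        have Di: "integrable lebesgue (D k)" for k unfolding D_def using er(2)[of k] by (simp add: set_integrable_def)
        have D0i: "integrable lebesgue D0" unfolding D0_def using e0(2) by (simp add: set_integrable_def)
        have "(\<Sum>k\<le>M. (2 * l k) powr p * I k) \<le> (\<Sum>k\<le>M. (2 * l k) powr p * (n * (\<integral>x. D k x \<partial>lebesgue)))"
          using Ik by (intro sum_mono mult_left_mono) (auto simp: D_def set_lebesgue_integral_def)
        also have "\<dots> = 2 powr p * n * (\<integral>x. (\<Sum>k\<le>M. l k powr p * D k x) \<partial>lebesgue)"
          using Di by (simp add: Bochner_Integration.integral_sum sum_distrib_left powr_mult mult_ac)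
        \<comment> \<open>The energies are not compared level by level: all densities are summed at
          each point, where \<open>\<bar>w x\<bar> / l k = r * 2 ^ k\<close> turns the truncation
          factors into the dyadic sum.\<close>
        also have "\<dots> \<le> 2 powr p * n * (\<integral>x. C * (B * D0 x) \<partial>lebesgue)"
        proof (intro mult_left_mono integral_mono_AE)
          show "integrable lebesgue (\<lambda>x. \<Sum>k\<le>M. l k powr p * D k x)"
            using Di by (intro Bochner_Integration.integrable_sum integrable_mult_right) auto
          show "integrable lebesgue (\<lambda>x. C * (B * D0 x))" using D0i by simp
          show "AE x in lebesgue. (\<Sum>k\<le>M. l k powr p * D k x) \<le> C * (B * D0 x)"
            using A_psd
          proof eventually_elim
            case (elim x)
            show ?case
            proof (cases "x \<in> \<Omega>")
              case True
              then have M: "psd (A x)" using elim by blast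
              have pos: "0 \<le> energy_density w H x" by (rule picone_nonneg[OF M p])
              define r where "r = \<bar>w x\<bar> / L"
              have r: "0 \<le> r" using L by (simp add: r_def)
              have rk: "\<bar>w x\<bar> / l k = r * 2 ^ k" for k by (simp add: r_def l_def)
              have "(\<Sum>k\<le>M. l k powr p * D k x) \<le> (\<Sum>k\<le>M. C * ((if r * 2 ^ k < 1 then (2 * (r * 2 ^ k)) powr p else 0) * energy_density w H x))"
                using C(2)[OF M l, of _ w H, unfolded rk] True by (intro sum_mono) (simp add: D_def)
              also have "\<dots> = C * ((\<Sum>k<Suc M. if r * 2 ^ k < 1 then (2 * (r * 2 ^ k)) powr p else 0) * energy_density w H x)"
                by (simp only: sum_distrib_left sum_distrib_right lessThan_Suc_atMost)
              also have "\<dots> \<le> C * (B * energy_density w H x)"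
                using bound[OF r, of "Suc M"] pos C(1) by (intro mult_left_mono mult_right_mono) auto
              finally show ?thesis using True by (simp add: D0_def)
            qed (simp add: D_def D0_def)
          qed
        qed (use n in auto)
        also have "\<dots> = CH * n * (LINT x:\<Omega>|lebesgue. energy_density w H x)"
          using D0i by (simp add: CH_def D0_def set_lebesgue_integral_def mult_ac)
        finally show ?thesis using Q by simp
      qed
      finally show ?thesis by simp
    qed
    \<comment> \<open>As \<open>M\<close> grows, the contribution below the lowest level disappears
      because \<open>G\<close> is fixed.\<close>
    have "(\<lambda>M. L * (1/2) ^ M) \<longlonglongrightarrow> L * 0" by (intro tendsto_mult tendsto_const LIMSEQ_power_zero) simp
    then have "l \<longlonglongrightarrow> 0" unfolding l_def[abs_def] by (simp add: power_divide)
    then have "(\<lambda>M. l M powr p) \<longlonglongrightarrow> 0 powr p"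
      using p l less_imp_le by (intro tendsto_powr' tendsto_const) (auto intro!: always_eventually)
    then have lim: "(\<lambda>M. l M powr p * G + CH * n * Q_energy p A V \<Omega> \<phi>) \<longlonglongrightarrow> 0 * G + CH * n * Q_energy p A V \<Omega> \<phi>"
      using p by (intro tendsto_intros) simp
    have "(LINT x:\<Omega>|lebesgue. \<bar>g x\<bar> * \<bar>\<phi> x\<bar> powr p) \<le> 0 * G + CH * n * Q_energy p A V \<Omega> \<phi>"
      by (rule LIMSEQ_le_const[OF lim]) (intro exI allI impI main)
    then show "(LINT x:\<Omega>|lebesgue. \<bar>g x\<bar> * \<bar>\<phi> x\<bar> powr p) \<le> CH * n * Q_energy p A V \<Omega> \<phi>" by simp
  qed
  show ?thesis
  proof (intro exI[of _ CH] conjI CH ballI allI impI)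
    fix g n assume g: "g \<in> L1_loc \<Omega>" and n: "0 \<le> (n :: real)"
      and h: "\<forall>F \<phi>. compact F \<and> F \<subseteq> \<Omega> \<and> \<phi> \<in> W1p p \<Omega> \<inter> Cc \<Omega> \<and> (\<forall>x\<in>F. u x \<le> \<phi> x) \<longrightarrow>
       (LINT x:F|lebesgue. \<bar>g x\<bar> * \<bar>u x\<bar> powr p) \<le> n * Q_energy p A V \<Omega> \<phi>"
    show "hardy_inequality p A V \<Omega> g (CH * n)"
      by (rule concl[OF g n]) (rule h[rule_format], simp)
  qed
qed

end

section \<open>Compact sets of zero capacity\<close>

text \<open>Applied to the components of a gradient: since the gradient of a mollification is the
  mollified gradient, this is a Lipschitz bound in terms of an \<open>L^1\<close> norm.\<close>

lemma mollify_gradient_bound: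
  fixes h :: "real^'n \<Rightarrow> real"
  assumes e: "0 < e" and h: "integrable lebesgue h" and B: "\<And>z::real^'n. \<bar>moll e z\<bar> \<le> B"
  shows "\<bar>mollify e h x\<bar> \<le> B * (\<integral>y. \<bar>h y\<bar> \<partial>lebesgue)"
proof -
  have "\<bar>mollify e h x\<bar> \<le> (\<integral>y. \<bar>moll e (x - y) * h y\<bar> \<partial>lebesgue)"
    unfolding mollify_def conv_def by (rule integral_abs_bound)
  also have "\<dots> \<le> (\<integral>y. B * \<bar>h y\<bar> \<partial>lebesgue)"
    using conv_integrable[OF moll_Cc[OF e] h, of x] h B
    by (intro integral_mono integrable_abs) (auto simp: abs_mult intro!: mult_right_mono)
  finally show ?thesis by simp
qed

lemma moll_bounded:
  assumes "0 < e" obtains B where "B > 0" "\<forall>z::real^'n. \<bar>moll e z\<bar> \<le> B"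
  using Cc_UNIV_bounded[OF moll_Cc[OF assms]] by blast

text \<open>
  If the weak gradients of \<open>v\<^sub>n\<close> vanish in \<open>L\<^sup>1\<close> locally, then a mollification of \<open>v\<^sub>n\<close> at a fixed scale
  is asymptotically constant on a ball, so smallness at one point spreads to the ball.
\<close>

lemma mollified_smallness_spreads:
  fixes v :: "nat \<Rightarrow> real^'n \<Rightarrow> real"
  assumes \<Omega>: "open \<Omega>" and v: "\<And>n. is_weak_grad \<Omega> (v n) (G n)" and v0: "\<And>n x. x \<in> \<Omega> \<Longrightarrow> 0 \<le> v n x"
    and R: "0 < R" "cball y (3 * R) \<subseteq> \<Omega>"
    and G0: "\<And>i. (\<lambda>n. \<integral>x. \<bar>indicat_real (cball y (3 * R)) x * G n x $ i\<bar> \<partial>lebesgue) \<longlonglongrightarrow> 0"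
    and small: "\<And>d. 0 < d \<Longrightarrow> \<exists>e x. 0 < e \<and> e < R \<and> x \<in> cball y R \<and>
       (\<forall>\<^sub>F n in sequentially. mollify e (\<lambda>z. indicat_real (cball y (3 * R)) z * v n z) x \<le> d)"
  shows "(\<lambda>n. \<integral>x. indicat_real (cball y R) x * v n x \<partial>lebesgue) \<longlonglongrightarrow> 0"
proof (rule LIMSEQ_I)
  fix r :: real assume r: "r > 0"
  define m where "m = measure lebesgue (cball y (2 * R))"
  have m: "m \<ge> 0" by (simp add: m_def)
  define d where "d = r / (4 * (m + 1))"
  have d: "d > 0" using r m by (simp add: d_def)
  have dm: "2 * d * m < r"
  proof -
    have "2 * d * m \<le> 2 * d * (m + 1)" using d by simp
    also have "\<dots> = r / 2" using m unfolding d_def by (simp add: nonzero_divide_eq_eq add_nonneg_eq_0_iff)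
    finally show ?thesis using r by simp
  qed
  obtain e x where e: "0 < e" "e < R" and x: "x \<in> cball y R"
    and ev: "\<forall>\<^sub>F n in sequentially. mollify e (\<lambda>z. indicat_real (cball y (3 * R)) z * v n z) x \<le> d"
    using small[OF d] by blast
  obtain B where B: "B > 0" "\<forall>z::real^'n. \<bar>moll e z\<bar> \<le> B" by (rule moll_bounded[OF e(1)])
  define U where "U n z = indicat_real (cball y (3 * R)) z * v n z" for n z
  have Ui: "integrable lebesgue (U n)" for n unfolding U_def by (rule L1_loc_integrable[OF is_weak_grad_L1(1)[OF v] compact_cball R(2)])
  define h where "h n i z = indicat_real (cball y (3 * R)) z * G n z $ i" for n i z
  have hi: "integrable lebesgue (h n i)" for n i unfolding h_def by (rule L1_loc_integrable[OF is_weak_grad_L1(2)[OF v] compact_cball R(2)])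
  define s where "s n = (\<Sum>i\<in>UNIV. B * (\<integral>z. \<bar>h n i z\<bar> \<partial>lebesgue))" for n
  have s0: "s \<longlonglongrightarrow> 0"
  proof -
    have "(\<lambda>n. \<Sum>i\<in>UNIV. B * (\<integral>z. \<bar>h n i z\<bar> \<partial>lebesgue)) \<longlonglongrightarrow> (\<Sum>i\<in>(UNIV::'n set). B * 0)"
      unfolding h_def by (intro tendsto_sum tendsto_mult tendsto_const G0)
    then show ?thesis by (simp add: s_def[abs_def])
  qed
  \<comment> \<open>On the ball of radius \<open>2 * R\<close> the mollification is Lipschitz with
    constant \<open>s n\<close>, which tends to 0. \<open>B\<close> depends on \<open>e\<close>, so
    the scale has to be fixed before \<open>n\<close> grows.\<close>
  have lip: "mollify e (U n) z \<le> mollify e (U n) x + s n * (4 * R)" if z: "z \<in> cball y (2 * R)" for n z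
  proof -
    have "norm (mollify e (U n) z - mollify e (U n) x) \<le> s n * norm (z - x)"
    proof (rule differentiable_bound[of "cball y (2 * R)" _ "\<lambda>w h. classical_grad (mollify e (U n)) w \<bullet> h"])
      show "convex (cball y (2 * R))" by simp
      show "x \<in> cball y (2 * R)" using x R by auto
      show "z \<in> cball y (2 * R)" by (rule z)
      fix w assume w: "w \<in> cball y (2 * R)"
      show "(mollify e (U n) has_derivative (\<lambda>h. classical_grad (mollify e (U n)) w \<bullet> h)) (at w within cball y (2 * R))"
        using has_derivative_classical_grad[OF mollify_differentiable[OF e(1) Ui[of n], of w]] has_derivative_at_withinI by blast
      have sub: "cball w e \<subseteq> cball y (3 * R)"
      proof
        fix t assume "t \<in> cball w e"
        then show "t \<in> cball y (3 * R)" using w e dist_triangle[of y t w] by (auto simp: dist_commute)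
      qed
      have g: "classical_grad (mollify e (U n)) w $ i = mollify e (h n i) w" for i
        unfolding U_def h_def by (rule mollify_weak_grad[OF \<Omega> v compact_cball R(2) e(1) sub])
      show "onorm (\<lambda>h. classical_grad (mollify e (U n)) w \<bullet> h) \<le> s n"
      proof (rule onorm_bound)
        show "0 \<le> s n" unfolding s_def using B(1) by (intro sum_nonneg) auto
        fix t :: "real^'n"
        have "norm (classical_grad (mollify e (U n)) w) \<le> (\<Sum>i\<in>UNIV. \<bar>classical_grad (mollify e (U n)) w $ i\<bar>)"
          by (rule norm_le_l1_cart)
        also have "\<dots> \<le> s n" unfolding s_def g
          using B(2) by (intro sum_mono mollify_gradient_bound[OF e(1) hi]) blast
        finally have "norm (classical_grad (mollify e (U n)) w) * norm t \<le> s n * norm t" by (rule mult_right_mono) simp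
        then show "norm (classical_grad (mollify e (U n)) w \<bullet> t) \<le> s n * norm t"
          using Cauchy_Schwarz_ineq2[of "classical_grad (mollify e (U n)) w" t] by simp
      qed
    qed
    moreover have "norm (z - x) \<le> 4 * R"
      using z x R dist_triangle[of z x y] by (simp add: dist_norm norm_minus_commute)
    moreover have "0 \<le> s n" unfolding s_def using B(1) by (intro sum_nonneg) auto
    ultimately have "norm (mollify e (U n) z - mollify e (U n) x) \<le> s n * (4 * R)"
      by (meson mult_left_mono order_trans)
    then show ?thesis by simp
  qed
  have "(\<lambda>n. s n * (4 * R)) \<longlonglongrightarrow> 0" by (rule tendsto_mult_left_zero[OF s0])
  then have "\<forall>\<^sub>F n in sequentially. s n * (4 * R) < d" by (rule order_tendstoD(2)) (rule d)
  then have "\<forall>\<^sub>F n in sequentially. \<bar>\<integral>x. indicat_real (cball y R) x * v n x \<partial>lebesgue\<bar> < r"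
    using ev
  proof eventually_elim
    case (elim n)
    define b where "b z = indicat_real (cball y R) z * v n z" for z
    have RO: "cball y R \<subseteq> \<Omega>" using R by (auto intro: order_trans[OF _ R(2)])
    have bi: "integrable lebesgue b" unfolding b_def by (rule L1_loc_integrable[OF is_weak_grad_L1(1)[OF v] compact_cball RO])
    have b0: "0 \<le> b z" for z using v0[of z n] RO by (cases "z \<in> cball y R") (auto simp: b_def)
    have bU: "b z \<le> U n z" for z
    proof (cases "z \<in> cball y (3 * R)")
      case True
      then have "z \<in> \<Omega>" using R(2) by blast
      then show ?thesis using v0[of z n] True by (auto simp: b_def U_def indicator_def)
    next
      case False
      then show ?thesis using R(1) by (auto simp: b_def U_def indicator_def)
    qed
    \<comment> \<open>Mollification preserves the integral. The mollified \<open>b\<close> lives in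
      the ball of radius \<open>2 * R\<close> because \<open>e < R\<close>, and there it is at most
      \<open>2 * d\<close>.\<close>
    have "(\<integral>z. b z \<partial>lebesgue) = (\<integral>z. mollify e b z \<partial>lebesgue)" using integral_mollify(2)[OF e(1) bi] by simp
    also have "\<dots> \<le> (\<integral>z. indicator (cball y (2 * R)) z * (2 * d) \<partial>lebesgue)"
    proof (rule integral_mono)
      show "integrable lebesgue (mollify e b)" by (rule integral_mollify(1)[OF e(1) bi])
      show "integrable lebesgue (\<lambda>z. indicator (cball y (2 * R)) z * (2 * d))" by (rule integrable_indicator_cball)
      fix z
      show "mollify e b z \<le> indicator (cball y (2 * R)) z * (2 * d)"
      proof (cases "z \<in> cball y (2 * R)")
        case True
        have "mollify e b z \<le> mollify e (U n) z" by (rule mollify_mono[OF e(1) bi Ui bU])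
        also have "\<dots> \<le> mollify e (U n) x + s n * (4 * R)" by (rule lip[OF True])
        also have "\<dots> \<le> 2 * d" using elim by (simp add: U_def[abs_def])
        finally show ?thesis using True by simp
      next
        case False
        have "\<bar>mollify e b z - 0\<bar> \<le> 0"
        proof (rule mollify_local[OF e(1) bi])
          fix t assume t: "dist t z < e"
          have "t \<notin> cball y R" using False t e dist_triangle[of y z t] by auto
          then show "\<bar>b t - 0\<bar> \<le> 0" by (simp add: b_def)
        qed
        then show ?thesis using False by simp
      qed
    qed
    also have "\<dots> = m * (2 * d)" by (simp add: m_def)
    also have "\<dots> < r" using dm by (simp add: mult_ac)
    finally have "(\<integral>z. b z \<partial>lebesgue) < r" .
    moreover have "0 \<le> (\<integral>z. b z \<partial>lebesgue)" using b0 by simp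
    ultimately show ?case by (simp add: b_def[symmetric])
  qed
  then show "\<exists>no. \<forall>n\<ge>no. norm ((\<integral>x. indicat_real (cball y R) x * v n x \<partial>lebesgue) - 0) < r"
    by (auto simp: eventually_sequentially)
qed

lemma nonneg_L1_limit_mono:
  fixes v :: "nat \<Rightarrow> real^'n \<Rightarrow> real"
  assumes v: "\<And>n. v n \<in> L1_loc \<Omega>" and v0: "\<And>n x. x \<in> \<Omega> \<Longrightarrow> 0 \<le> v n x"
    and K: "compact K" "K \<subseteq> K'" "compact K'" "K' \<subseteq> \<Omega>"
    and lim: "(\<lambda>n. \<integral>x. indicat_real K' x * v n x \<partial>lebesgue) \<longlonglongrightarrow> 0"
  shows "(\<lambda>n. \<integral>x. indicat_real K x * v n x \<partial>lebesgue) \<longlonglongrightarrow> 0"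
proof (rule tendsto_sandwich[OF _ _ tendsto_const lim])
  have KO: "K \<subseteq> \<Omega>" using K by blast
  show "\<forall>\<^sub>F n in sequentially. 0 \<le> (\<integral>x. indicat_real K x * v n x \<partial>lebesgue)"
  proof (intro always_eventually allI integral_nonneg_AE AE_I2)
    fix n x show "0 \<le> indicat_real K x * v n x" using v0[of x n] KO by (cases "x \<in> K") auto
  qed
  show "\<forall>\<^sub>F n in sequentially. (\<integral>x. indicat_real K x * v n x \<partial>lebesgue) \<le> (\<integral>x. indicat_real K' x * v n x \<partial>lebesgue)"
  proof (intro always_eventually allI integral_mono L1_loc_integrable[OF v] K KO)
    fix n x show "indicat_real K x * v n x \<le> indicat_real K' x * v n x"
      using v0[of x n] K by (cases "x \<in> K'") (auto simp: indicator_def)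
  qed
qed

text \<open>Connectedness: the points with a ball on which \<open>v n\<close> tends to 0 in
  \<open>L^1\<close> form a nonempty open and relatively closed set. It is nonempty since
  \<open>F\<close> has positive measure, and closed since smallness around a nearby point of the set
  makes a mollified value small. Compactness then assembles finitely many balls.\<close>

lemma L1_limit_spreads:
  fixes v :: "nat \<Rightarrow> real^'n \<Rightarrow> real"
  assumes \<Omega>: "open \<Omega>" "connected \<Omega>" and v: "\<And>n. is_weak_grad \<Omega> (v n) (G n)"
    and v01: "\<And>n x. x \<in> \<Omega> \<Longrightarrow> 0 \<le> v n x" "\<And>n x. x \<in> \<Omega> \<Longrightarrow> v n x \<le> 1"
    and G0: "\<And>K i. compact K \<Longrightarrow> K \<subseteq> \<Omega> \<Longrightarrow> (\<lambda>n. \<integral>x. \<bar>indicat_real K x * G n x $ i\<bar> \<partial>lebesgue) \<longlonglongrightarrow> 0"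
    and F: "compact F" "F \<subseteq> \<Omega>" "\<not> negligible F" "\<And>n x. x \<in> F \<Longrightarrow> v n x = 0"
    and K: "compact K" "K \<subseteq> \<Omega>"
  shows "(\<lambda>n. \<integral>x. indicat_real K x * v n x \<partial>lebesgue) \<longlonglongrightarrow> 0"
proof -
  note vL = is_weak_grad_L1(1)[OF v]
  define S where "S = {x\<in>\<Omega>. \<exists>r>0. cball x r \<subseteq> \<Omega> \<and> (\<lambda>n. \<integral>z. indicat_real (cball x r) z * v n z \<partial>lebesgue) \<longlonglongrightarrow> 0}"
  have three: "\<exists>R>0. cball y (3 * R) \<subseteq> \<Omega>" if y: "y \<in> \<Omega>" for y
  proof -
    obtain r where "r > 0" "cball y r \<subseteq> \<Omega>" using \<Omega>(1) y open_contains_cball by blast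
    then show ?thesis by (intro exI[of _ "r/3"]) auto
  qed
  have "S \<noteq> {}"
  proof -
    \<comment> \<open>Otherwise \<open>F\<close> would be locally negligible, hence
      negligible.\<close>
    have "\<exists>y\<in>F. \<forall>U. openin (top_of_set F) U \<and> y \<in> U \<longrightarrow> \<not> negligible U"
      using F(3) by (subst (asm) locally_negligible_alt) blast
    then obtain y where y: "y \<in> F" "\<And>U. openin (top_of_set F) U \<Longrightarrow> y \<in> U \<Longrightarrow> \<not> negligible U" by blast
    have yO: "y \<in> \<Omega>" using y F by blast
    obtain R where R: "R > 0" "cball y (3 * R) \<subseteq> \<Omega>" using three[OF yO] by blast
    have RO: "cball y R \<subseteq> \<Omega>" using R by (auto intro: order_trans[OF _ R(2)])
    define E where "E = F \<inter> cball y R"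
    have E: "compact E" unfolding E_def using F(1) by (intro compact_Int_closed) auto
    have nE: "\<not> negligible E"
    proof
      assume "negligible E"
      then have "negligible (F \<inter> ball y R)" by (rule negligible_subset) (auto simp: E_def)
      moreover have "openin (top_of_set F) (F \<inter> ball y R)" by (rule openin_open_Int[OF open_ball])
      ultimately show False using y R(1) by auto
    qed
    define mE where "mE = measure lebesgue E"
    have mE: "mE > 0"
      using nE negligible_iff_measure0[OF lmeasurable_compact[OF E]] measure_nonneg[of lebesgue E] unfolding mE_def by (metis less_eq_real_def)
    \<comment> \<open>\<open>f\<close> dominates every \<open>v n\<close> at once on the ball, so
      one small mollified value of \<open>f\<close> serves all \<open>n\<close>.\<close>
    define f where "f z = indicat_real (cball y (3 * R)) z * (1 - indicat_real F z)" for z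
    have fm: "f \<in> borel_measurable lebesgue"
      unfolding f_def using compact_sets_lebesgue[OF F(1)]
      by (intro borel_measurable_times borel_measurable_diff borel_measurable_indicator borel_measurable_const) auto
    have fi: "integrable lebesgue f"
      by (rule integrable_lebesgue_bounded_support[OF fm, of 1 "cball y (3 * R)"]) (auto simp: f_def indicator_def)
    have "(\<lambda>n. \<integral>x. indicat_real (cball y R) x * v n x \<partial>lebesgue) \<longlonglongrightarrow> 0"
    proof (rule mollified_smallness_spreads[OF \<Omega>(1) v v01(1) R])
      show "(\<lambda>n. \<integral>x. \<bar>indicat_real (cball y (3 * R)) x * G n x $ i\<bar> \<partial>lebesgue) \<longlonglongrightarrow> 0" for i
        by (rule G0[OF compact_cball R(2)])
      fix d :: real assume d: "0 < d"
      have "\<forall>\<^sub>F k in sequentially. (\<integral>x. \<bar>mollify (eps k) f x - f x\<bar> \<partial>lebesgue) < d * mE"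
        by (rule order_tendstoD(2)[OF mollify_L1_tendsto[OF fi]]) (use d mE in simp)
      moreover have "\<forall>\<^sub>F k in sequentially. eps k < R" by (rule eventually_eps_less[OF R(1)])
      ultimately have "\<forall>\<^sub>F k in sequentially. (\<integral>x. \<bar>mollify (eps k) f x - f x\<bar> \<partial>lebesgue) < d * mE \<and> eps k < R"
        by eventually_elim simp
      then obtain k where k: "(\<integral>x. \<bar>mollify (eps k) f x - f x\<bar> \<partial>lebesgue) < d * mE" "eps k < R"
        by (auto simp: eventually_sequentially)
      \<comment> \<open>\<open>f\<close> vanishes on \<open>E\<close>, so mollified values above
        \<open>d\<close> on all of \<open>E\<close> would contradict \<open>L^1\<close> convergence.
        This takes the place of a Lebesgue density point.\<close>
      have "\<exists>x\<in>E. mollify (eps k) f x \<le> d"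
      proof (rule ccontr)
        assume "\<not> (\<exists>x\<in>E. mollify (eps k) f x \<le> d)"
        then have big: "\<And>x. x \<in> E \<Longrightarrow> d < mollify (eps k) f x" by force
        have "mE * d = (\<integral>x. indicat_real E x * d \<partial>lebesgue)" by (simp add: mE_def)
        also have "\<dots> \<le> (\<integral>x. \<bar>mollify (eps k) f x - f x\<bar> \<partial>lebesgue)"
        proof (rule integral_mono)
          show "integrable lebesgue (\<lambda>x. indicat_real E x * d)"
            using L1_loc_integrable[OF L1_loc_const E, of UNIV d] by simp
          show "integrable lebesgue (\<lambda>x. \<bar>mollify (eps k) f x - f x\<bar>)" using fi integral_mollify(1)[OF eps_pos fi, of k] by simp
          fix x
          show "indicat_real E x * d \<le> \<bar>mollify (eps k) f x - f x\<bar>"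
          proof (cases "x \<in> E")
            case True
            then have "f x = 0" by (simp add: f_def E_def)
            then show ?thesis using big[OF True] True by simp
          qed simp
        qed
        finally show False using k(1) by (simp add: mult.commute)
      qed
      then obtain x where x: "x \<in> E" "mollify (eps k) f x \<le> d" by blast
      have "mollify (eps k) (\<lambda>z. indicat_real (cball y (3 * R)) z * v n z) x \<le> mollify (eps k) f x" for n
      proof (rule mollify_mono[OF eps_pos L1_loc_integrable[OF vL compact_cball R(2)] fi])
        fix z
        show "indicat_real (cball y (3 * R)) z * v n z \<le> f z"
        proof (cases "z \<in> cball y (3 * R)")
          case True
          then have "z \<in> \<Omega>" using R(2) by blast
          then show ?thesis using v01(2)[of z n] F(4)[of z n] True by (auto simp: f_def indicator_def)
        qed (simp add: f_def)
      qed
      then have "\<forall>\<^sub>F n in sequentially. mollify (eps k) (\<lambda>z. indicat_real (cball y (3 * R)) z * v n z) x \<le> d"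
        using x(2) by (intro always_eventually allI) (rule order_trans)
      then show "\<exists>e x. 0 < e \<and> e < R \<and> x \<in> cball y R \<and>
         (\<forall>\<^sub>F n in sequentially. mollify e (\<lambda>z. indicat_real (cball y (3 * R)) z * v n z) x \<le> d)"
        using k(2) x(1) by (intro exI[of _ "eps k"] exI[of _ x]) (simp add: E_def)
    qed
    then have "y \<in> S" unfolding S_def using yO R(1) RO by blast
    then show ?thesis by blast
  qed
  moreover have "openin (top_of_set \<Omega>) S"
  proof -
    have "open S"
      unfolding open_contains_ball
    proof (rule ballI)
      fix x assume "x \<in> S"
      then obtain r where r: "r > 0" "cball x r \<subseteq> \<Omega>" "(\<lambda>n. \<integral>z. indicat_real (cball x r) z * v n z \<partial>lebesgue) \<longlonglongrightarrow> 0"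
        by (auto simp: S_def)
      have "ball x r \<subseteq> S"
      proof
        fix x' assume x': "x' \<in> ball x r"
        define r' where "r' = r - dist x x'"
        have r': "r' > 0" using x' by (simp add: r'_def)
        have sub: "cball x' r' \<subseteq> cball x r"
        proof
          fix t assume "t \<in> cball x' r'"
          then show "t \<in> cball x r" using dist_triangle[of x t x'] by (simp add: r'_def)
        qed
        have "(\<lambda>n. \<integral>z. indicat_real (cball x' r') z * v n z \<partial>lebesgue) \<longlonglongrightarrow> 0"
          by (rule nonneg_L1_limit_mono[OF vL v01(1) compact_cball sub compact_cball r(2,3)])
        then show "x' \<in> S" unfolding S_def using r' sub r(2) x' by (auto intro!: exI[of _ r'] simp: subset_iff)
      qed
      then show "\<exists>r>0. ball x r \<subseteq> S" using r(1) by blast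
    qed
    moreover have "S \<subseteq> \<Omega>" by (auto simp: S_def)
    ultimately show ?thesis using \<Omega>(1) by (simp add: openin_open_eq)
  qed
  moreover have "closedin (top_of_set \<Omega>) S"
    unfolding closedin_limpt
  proof (intro conjI allI impI)
    show "S \<subseteq> \<Omega>" by (auto simp: S_def)
    fix y assume "y islimpt S \<and> y \<in> \<Omega>"
    then have yl: "y islimpt S" and yO: "y \<in> \<Omega>" by auto
    obtain R where R: "R > 0" "cball y (3 * R) \<subseteq> \<Omega>" using three[OF yO] by blast
    have RO: "cball y R \<subseteq> \<Omega>" using R by (auto intro: order_trans[OF _ R(2)])
    obtain x where x: "x \<in> S" "dist x y < R" using yl R(1) by (auto simp: islimpt_approachable)
    then obtain r where r: "r > 0" "cball x r \<subseteq> \<Omega>" "(\<lambda>n. \<integral>z. indicat_real (cball x r) z * v n z \<partial>lebesgue) \<longlonglongrightarrow> 0"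
      by (auto simp: S_def)
    have "(\<lambda>n. \<integral>x. indicat_real (cball y R) x * v n x \<partial>lebesgue) \<longlonglongrightarrow> 0"
    proof (rule mollified_smallness_spreads[OF \<Omega>(1) v v01(1) R])
      show "(\<lambda>n. \<integral>x. \<bar>indicat_real (cball y (3 * R)) x * G n x $ i\<bar> \<partial>lebesgue) \<longlonglongrightarrow> 0" for i
        by (rule G0[OF compact_cball R(2)])
      fix d :: real assume d: "0 < d"
      \<comment> \<open>Below \<open>r\<close>, so that the kernel at \<open>x\<close> only sees the
        ball on which \<open>v n\<close> is known to tend to 0.\<close>
      define e where "e = min r R / 2"
      have e: "0 < e" "e < R" "e < r" using r R by (auto simp: e_def)
      obtain B where B: "B > 0" "\<forall>z::real^'n. \<bar>moll e z\<bar> \<le> B" by (rule moll_bounded[OF e(1)])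
      have "(\<lambda>n. B * (\<integral>z. indicat_real (cball x r) z * v n z \<partial>lebesgue)) \<longlonglongrightarrow> 0" by (rule tendsto_mult_right_zero[OF r(3)])
      then have "\<forall>\<^sub>F n in sequentially. B * (\<integral>z. indicat_real (cball x r) z * v n z \<partial>lebesgue) < d" by (rule order_tendstoD(2)) (rule d)
      then have "\<forall>\<^sub>F n in sequentially. mollify e (\<lambda>z. indicat_real (cball y (3 * R)) z * v n z) x \<le> d"
      proof eventually_elim
        case (elim n)
        have i: "integrable lebesgue (\<lambda>z. indicat_real (cball x r) z * v n z)" by (rule L1_loc_integrable[OF vL compact_cball r(2)])
        have "mollify e (\<lambda>z. indicat_real (cball y (3 * R)) z * v n z) x = mollify e (\<lambda>z. indicat_real (cball x r) z * v n z) x"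
        proof (rule mollify_cong_local[OF e(1)])
          fix t assume t: "dist t x < e"
          have "t \<in> cball x r" using t e by (simp add: dist_commute)
          moreover have "t \<in> cball y (3 * R)" using t e x(2) dist_triangle[of y t x] by (simp add: dist_commute)
          ultimately show "indicat_real (cball y (3 * R)) t * v n t = indicat_real (cball x r) t * v n t" by simp
        qed
        also have "\<dots> \<le> B * (\<integral>z. \<bar>indicat_real (cball x r) z * v n z\<bar> \<partial>lebesgue)"
          using mollify_gradient_bound[OF e(1) i, of B x] B(2) by (simp add: abs_le_iff)
        also have "(\<integral>z. \<bar>indicat_real (cball x r) z * v n z\<bar> \<partial>lebesgue) = (\<integral>z. indicat_real (cball x r) z * v n z \<partial>lebesgue)"
        proof (rule Bochner_Integration.integral_cong[OF refl])
          fix z show "\<bar>indicat_real (cball x r) z * v n z\<bar> = indicat_real (cball x r) z * v n z"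
            using v01(1)[of z n] r(2) by (cases "z \<in> cball x r") auto
        qed
        finally show ?case using elim by simp
      qed
      then show "\<exists>e x. 0 < e \<and> e < R \<and> x \<in> cball y R \<and>
         (\<forall>\<^sub>F n in sequentially. mollify e (\<lambda>z. indicat_real (cball y (3 * R)) z * v n z) x \<le> d)"
        using e x(2) by (intro exI[of _ e] exI[of _ x]) (auto simp: dist_commute)
    qed
    then show "y \<in> S" unfolding S_def using yO R(1) RO by blast
  qed
  ultimately have SO: "S = \<Omega>" using \<Omega>(2) unfolding connected_clopen by blast
  have "\<exists>r. r > 0 \<and> cball x r \<subseteq> \<Omega> \<and> (\<lambda>n. \<integral>z. indicat_real (cball x r) z * v n z \<partial>lebesgue) \<longlonglongrightarrow> 0" if "x \<in> \<Omega>" for x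
    using that SO by (auto simp: S_def)
  then obtain \<rho> where \<rho>: "\<And>x. x \<in> \<Omega> \<Longrightarrow> \<rho> x > 0 \<and> cball x (\<rho> x) \<subseteq> \<Omega> \<and> (\<lambda>n. \<integral>z. indicat_real (cball x (\<rho> x)) z * v n z \<partial>lebesgue) \<longlonglongrightarrow> 0"
    by metis
  have "K \<subseteq> (\<Union>x\<in>K. ball x (\<rho> x))"
  proof
    fix x assume x: "x \<in> K"
    then have "x \<in> ball x (\<rho> x)" using \<rho>[of x] K(2) by auto
    then show "x \<in> (\<Union>x\<in>K. ball x (\<rho> x))" using x by blast
  qed
  then obtain Y where Y: "Y \<subseteq> K" "finite Y" "K \<subseteq> (\<Union>x\<in>Y. ball x (\<rho> x))"
    using compactE_image[OF K(1), of K "\<lambda>x. ball x (\<rho> x)"] by (metis open_ball)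
  have YO: "y \<in> \<Omega>" if "y \<in> Y" for y using that Y(1) K(2) by blast
  have lim: "(\<lambda>n. \<Sum>y\<in>Y. \<integral>z. indicat_real (cball y (\<rho> y)) z * v n z \<partial>lebesgue) \<longlonglongrightarrow> 0"
    using tendsto_sum[of Y "\<lambda>y n. \<integral>z. indicat_real (cball y (\<rho> y)) z * v n z \<partial>lebesgue" "\<lambda>_. 0" sequentially] \<rho> YO by simp
  show ?thesis
  proof (rule tendsto_sandwich[OF _ _ tendsto_const lim])
    show "\<forall>\<^sub>F n in sequentially. 0 \<le> (\<integral>x. indicat_real K x * v n x \<partial>lebesgue)"
    proof (intro always_eventually allI integral_nonneg_AE AE_I2)
      fix n x show "0 \<le> indicat_real K x * v n x" using v01(1)[of x n] K(2) by (cases "x \<in> K") auto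
    qed
    show "\<forall>\<^sub>F n in sequentially. (\<integral>x. indicat_real K x * v n x \<partial>lebesgue) \<le> (\<Sum>y\<in>Y. \<integral>z. indicat_real (cball y (\<rho> y)) z * v n z \<partial>lebesgue)"
    proof (intro always_eventually allI)
      fix n
      have i: "integrable lebesgue (\<lambda>z. indicat_real (cball y (\<rho> y)) z * v n z)" if "y \<in> Y" for y
        using \<rho>[OF YO[OF that]] by (intro L1_loc_integrable[OF vL]) auto
      have "(\<integral>x. indicat_real K x * v n x \<partial>lebesgue) \<le> (\<integral>x. (\<Sum>y\<in>Y. indicat_real (cball y (\<rho> y)) x * v n x) \<partial>lebesgue)"
      proof (rule integral_mono[OF L1_loc_integrable[OF vL K] Bochner_Integration.integrable_sum[OF i]])
        fix x
        have nn: "0 \<le> indicat_real (cball y (\<rho> y)) x * v n x" if "y \<in> Y" for y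
          using v01(1)[of x n] \<rho>[OF YO[OF that]] by (cases "x \<in> cball y (\<rho> y)") auto
        show "indicat_real K x * v n x \<le> (\<Sum>y\<in>Y. indicat_real (cball y (\<rho> y)) x * v n x)"
        proof (cases "x \<in> K")
          case True
          then obtain y where y: "y \<in> Y" "x \<in> ball y (\<rho> y)" using Y(3) by blast
          have "indicat_real (cball y (\<rho> y)) x * v n x \<le> (\<Sum>y\<in>Y. indicat_real (cball y (\<rho> y)) x * v n x)"
            using y(1) Y(2) nn by (intro member_le_sum) auto
          then show ?thesis using True y(2) by simp
        next
          case False
          have "0 \<le> (\<Sum>y\<in>Y. indicat_real (cball y (\<rho> y)) x * v n x)" by (rule sum_nonneg[OF nn])
          then show ?thesis using False by simp
        qed
      qed
      then show "(\<integral>x. indicat_real K x * v n x \<partial>lebesgue) \<le> (\<Sum>y\<in>Y. \<integral>z. indicat_real (cball y (\<rho> y)) z * v n z \<partial>lebesgue)"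
        using Bochner_Integration.integral_sum[of Y lebesgue "\<lambda>y z. indicat_real (cball y (\<rho> y)) z * v n z"] i by simp
    qed
  qed
qed

section \<open>Null sequences, cut-offs and the propagation of zero capacity\<close>

context hardy_setting
begin

lemma wloc_one_minus:
  assumes "wloc p \<Omega> w H"
  shows "wloc p \<Omega> (\<lambda>x. 1 - w x) (\<lambda>x. (-1) *\<^sub>R H x)"
  by (rule wloc_chain[OF open_\<Omega> p0 assms, of UNIV "\<lambda>s. 1 - s" "\<lambda>_. -1"])
     (auto intro!: derivative_eq_intros)

text \<open>\<open>u \<le> \<phi> = u w\<close> means \<open>1 \<le> w\<close> on \<open>F\<close>,
  where the truncation at level 1 is saturated. It confines the values to \<open>[0, 1]\<close> and
  costs only a fixed factor \<open>c\<close> in the energy, so starting below \<open>e / c\<close>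
  is enough.\<close>

lemma truncated_null_sequence:
  assumes F: "F \<subseteq> \<Omega>" and cap: "\<And>e. 0 < e \<Longrightarrow> \<exists>\<phi>\<in>W1p p \<Omega> \<inter> Cc \<Omega>. (\<forall>x\<in>F. u x \<le> \<phi> x) \<and> Q_energy p A V \<Omega> \<phi> < e"
    and e: "0 < e"
  shows "\<exists>w H K. wloc p \<Omega> w H \<and> compact K \<and> K \<subseteq> \<Omega> \<and> (\<forall>x\<in>\<Omega> - K. w x = 0) \<and> (\<forall>x. 0 \<le> w x \<and> w x \<le> 1)
     \<and> (\<forall>x\<in>F. w x = 1) \<and> (LINT x:\<Omega>|lebesgue. energy_density w H x) < e"
proof -
  obtain C where C: "C > 0" "\<And>w H l x. psd (A x) \<Longrightarrow> 0 < l \<Longrightarrow>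
     l powr p * energy_density (wt l w) (Ht l w H) x \<le> C * ((if \<bar>w x\<bar> / l < 1 then (2 * (\<bar>w x\<bar> / l)) powr p else 0) * energy_density w H x)"
    using trunc_density by blast
  define c where "c = C * 2 powr p"
  have c: "c > 0" using C by (simp add: c_def)
  obtain \<phi> where \<phi>: "\<phi> \<in> W1p p \<Omega> \<inter> Cc \<Omega>" "\<forall>x\<in>F. u x \<le> \<phi> x" "Q_energy p A V \<Omega> \<phi> < e / c"
    using cap[of "e/c"] e c by auto
  obtain w H K where w: "wloc p \<Omega> w H" and K: "compact K" "K \<subseteq> \<Omega>" "\<forall>x\<in>\<Omega> - K. w x = 0"
      and \<phi>w: "\<forall>x\<in>\<Omega>. \<phi> x = u x * w x" and Q: "Q_energy p A V \<Omega> \<phi> = (LINT x:\<Omega>|lebesgue. energy_density w H x)"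
    by (rule quotient_representation[OF \<phi>(1)])
  have K3: "\<And>x. x \<in> \<Omega> - K \<Longrightarrow> w x = 0" using K(3) by blast
  have w1: "wloc p \<Omega> (wt 1 w) (Ht 1 w H)" by (rule wloc_trunc[OF w]) simp
  have w10: "\<And>x. x \<in> \<Omega> - K \<Longrightarrow> wt 1 w x = 0" using K3 by simp
  have "(LINT x:\<Omega>|lebesgue. energy_density (wt 1 w) (Ht 1 w H) x) \<le> (LINT x:\<Omega>|lebesgue. c * energy_density w H x)"
    unfolding set_lebesgue_integral_def
  proof (rule integral_mono_AE)
    show "integrable lebesgue (\<lambda>x. indicat_real \<Omega> x *\<^sub>R energy_density (wt 1 w) (Ht 1 w H) x)"
      using energy_representation(2)[OF w1 K(1,2) w10] by (simp add: set_integrable_def)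
    have "integrable lebesgue (\<lambda>x. c * (indicat_real \<Omega> x *\<^sub>R energy_density w H x))"
      using energy_representation(2)[OF w K(1,2) K3] unfolding set_integrable_def by (rule integrable_mult_right)
    then show "integrable lebesgue (\<lambda>x. indicat_real \<Omega> x *\<^sub>R (c * energy_density w H x))" by (simp add: mult_ac)
    show "AE x in lebesgue. indicat_real \<Omega> x *\<^sub>R energy_density (wt 1 w) (Ht 1 w H) x \<le> indicat_real \<Omega> x *\<^sub>R (c * energy_density w H x)"
      using A_psd
    proof eventually_elim
      case (elim x)
      show ?case
      proof (cases "x \<in> \<Omega>")
        case True
        then have M: "psd (A x)" using elim by blast
        have pos: "0 \<le> energy_density w H x" by (rule picone_nonneg[OF M p])
        have "(if \<bar>w x\<bar> / 1 < 1 then (2 * (\<bar>w x\<bar> / 1)) powr p else 0) \<le> 2 powr p"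
          using p by (auto intro!: powr_mono2)
        then have "C * ((if \<bar>w x\<bar> / 1 < 1 then (2 * (\<bar>w x\<bar> / 1)) powr p else 0) * energy_density w H x) \<le> C * (2 powr p * energy_density w H x)"
          using pos C(1) by (intro mult_left_mono mult_right_mono) auto
        with C(2)[OF M zero_less_one, of w H] have "energy_density (wt 1 w) (Ht 1 w H) x \<le> c * energy_density w H x"
          by (simp add: c_def mult.assoc)
        then show ?thesis using True by simp
      qed simp
    qed
  qed
  also have "\<dots> = c * (LINT x:\<Omega>|lebesgue. energy_density w H x)" by (rule set_integral_mult_right)
  also have "\<dots> < e" using \<phi>(3) c unfolding Q by (simp add: field_simps)
  finally have E: "(LINT x:\<Omega>|lebesgue. energy_density (wt 1 w) (Ht 1 w H) x) < e" .
  have "wt 1 w x = 1" if x: "x \<in> F" for x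
  proof -
    have xO: "x \<in> \<Omega>" using x F by blast
    have "u x * 1 \<le> u x * w x" using \<phi>(2) \<phi>w x xO by auto
    then have "1 \<le> w x" using u_pos[OF xO] by (simp only: mult_le_cancel_left_pos)
    then show ?thesis by (simp add: trunc_one)
  qed
  then show ?thesis using w1 K w10 E trunc_bounds(1,2)
    by (intro exI[of _ "wt 1 w"] exI[of _ "Ht 1 w H"] exI[of _ K]) blast
qed

text \<open>The indicator of \<open>K1\<close> is mollified at a scale for which balls around
  \<open>F\<close> stay inside \<open>K1\<close> and balls around points off \<open>K2\<close> miss
  \<open>K1\<close>.\<close>

lemma smooth_cutoff:
  assumes F: "compact F" "F \<subseteq> \<Omega>"
  obtains \<zeta> K where "\<zeta> \<in> test_functions \<Omega>" "compact K" "K \<subseteq> \<Omega>" "\<forall>x. x \<notin> K \<longrightarrow> \<zeta> x = 0"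
    "\<forall>x\<in>F. \<zeta> x = 1" "\<forall>x. 0 \<le> \<zeta> x \<and> \<zeta> x \<le> 1"
proof -
  obtain d K1 where d: "d > 0" and K1: "compact K1" "K1 \<subseteq> \<Omega>" "\<And>x. x \<in> F \<Longrightarrow> cball x d \<subseteq> K1" "F \<subseteq> K1"
    by (fact compact_neighbourhood[OF open_\<Omega> F])
  obtain d2 K2 where d2: "d2 > 0" and K2: "compact K2" "K2 \<subseteq> \<Omega>" "\<And>x. x \<in> K1 \<Longrightarrow> cball x d2 \<subseteq> K2" "K1 \<subseteq> K2"
    by (fact compact_neighbourhood[OF open_\<Omega> K1(1,2)])
  define e where "e = min d d2 / 2"
  have e: "0 < e" "e < d" "e < d2" using d d2 by (auto simp: e_def)
  have i: "integrable lebesgue (\<lambda>x. indicat_real K1 x)" using L1_loc_integrable[OF L1_loc_const K1(1), of UNIV 1] by simp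
  have z: "indicat_real K1 y = 0" if "x \<notin> K2" "dist y x < e" for x y
    using K2(3)[of y] that e by (auto simp: indicator_def subset_iff)
  have t: "mollify e (indicat_real K1) \<in> test_functions \<Omega>"
    by (rule mollify_compact_support_test(1)[OF i e(1) K2(1,2)]) (rule z)
  have t0: "mollify e (indicat_real K1) x = 0" if "x \<notin> K2" for x
    by (rule mollify_compact_support_test(2)[OF i e(1) K2(1,2) _ that]) (rule z)
  have one: "mollify e (indicat_real K1) x = 1" if "x \<in> F" for x
  proof -
    have "1 \<le> indicat_real K1 y \<and> indicat_real K1 y \<le> 1" if "dist y x < e" for y
      using K1(3)[OF \<open>x \<in> F\<close>] that e by (auto simp: subset_iff dist_commute)
    then show ?thesis using mollify_local_bounds[OF e(1) i, of x 1 1] by (intro antisym) blast+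
  qed
  have "0 \<le> mollify e (indicat_real K1) x \<and> mollify e (indicat_real K1) x \<le> 1" for x
  proof -
    have "0 \<le> indicat_real K1 y \<and> indicat_real K1 y \<le> 1" for y by (simp add: indicator_def)
    then show ?thesis using mollify_local_bounds[OF e(1) i, of x 0 1] by blast
  qed
  then have "\<forall>x. 0 \<le> mollify e (indicat_real K1) x \<and> mollify e (indicat_real K1) x \<le> 1" ..
  moreover have "\<forall>x. x \<notin> K2 \<longrightarrow> mollify e (indicat_real K1) x = 0" using t0 by simp
  moreover have "\<forall>x\<in>F. mollify e (indicat_real K1) x = 1" using one by simp
  ultimately show ?thesis using that[OF t K2(1,2)] by simp
qed

text \<open>The glued function equals \<open>w n\<close> off the support of \<open>\<zeta>\<close>,
  where it costs no more than \<open>w n\<close>. On the support its energy is at most a small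
  multiple of \<open>|\<nabla>u|^p\<close> plus powers of \<open>u \<nabla>w\<close> and of
  \<open>(1 - w) u \<nabla>\<zeta>\<close>. The first of these tends to 0 with the energy, the
  second because \<open>1 - w\<close> does in \<open>L^1\<close>.\<close>

lemma zero_capacity_spreads:
  assumes F: "compact F" "F \<subseteq> \<Omega>" "\<not> negligible F"
    and cap: "\<And>e. 0 < e \<Longrightarrow> \<exists>\<phi>\<in>W1p p \<Omega> \<inter> Cc \<Omega>. (\<forall>x\<in>F. u x \<le> \<phi> x) \<and> Q_energy p A V \<Omega> \<phi> < e"
    and F': "compact F'" "F' \<subseteq> \<Omega>" and e: "0 < e"
  shows "\<exists>\<phi>\<in>W1p p \<Omega> \<inter> Cc \<Omega>. (\<forall>x\<in>F'. u x \<le> \<phi> x) \<and> Q_energy p A V \<Omega> \<phi> < e"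
proof -
  have "\<forall>n. \<exists>w H K. wloc p \<Omega> w H \<and> compact K \<and> K \<subseteq> \<Omega> \<and> (\<forall>x\<in>\<Omega> - K. w x = 0) \<and> (\<forall>x. 0 \<le> w x \<and> w x \<le> 1)
     \<and> (\<forall>x\<in>F. w x = 1) \<and> (LINT x:\<Omega>|lebesgue. energy_density w H x) < eps n"
    by (intro allI truncated_null_sequence[OF F(2) cap eps_pos])
  then obtain w H K where wn: "\<forall>n. wloc p \<Omega> (w n) (H n) \<and> compact (K n) \<and> K n \<subseteq> \<Omega> \<and> (\<forall>x\<in>\<Omega> - K n. w n x = 0) \<and> (\<forall>x. 0 \<le> w n x \<and> w n x \<le> 1)
     \<and> (\<forall>x\<in>F. w n x = 1) \<and> (LINT x:\<Omega>|lebesgue. energy_density (w n) (H n) x) < eps n"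
    unfolding choice_iff by (elim exE) (rule that)
  then have w: "\<And>n. wloc p \<Omega> (w n) (H n)" and K: "\<And>n. compact (K n)" "\<And>n. K n \<subseteq> \<Omega>" "\<And>n x. x \<in> \<Omega> - K n \<Longrightarrow> w n x = 0"
    and w01: "\<And>n x. 0 \<le> w n x" "\<And>n x. w n x \<le> 1" and wF: "\<And>n x. x \<in> F \<Longrightarrow> w n x = 1"
    and wE: "\<And>n. (LINT x:\<Omega>|lebesgue. energy_density (w n) (H n) x) < eps n"
    by simp_all
  have er: "(\<lambda>x. u x * w n x) \<in> W1p p \<Omega> \<inter> Cc \<Omega>" "set_integrable lebesgue \<Omega> (energy_density (w n) (H n))"
    "Q_energy p A V \<Omega> (\<lambda>x. u x * w n x) = (LINT x:\<Omega>|lebesgue. energy_density (w n) (H n) x)" for n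
    using energy_representation[OF w[of n] K(1,2)[of n] K(3)[of _ n]] by blast+
  define E where "E n = (LINT x:\<Omega>|lebesgue. energy_density (w n) (H n) x)" for n
  have E0: "0 \<le> E n" for n using Q_nonneg[OF er(1)[of n]] er(3)[of n] by (simp add: E_def)
  have Elim: "E \<longlonglongrightarrow> 0"
    by (rule tendsto_sandwich[OF _ _ tendsto_const eps_tendsto]) (use E0 wE in \<open>auto simp: E_def less_imp_le\<close>)
  define P where "P n x = N x (u x *\<^sub>R H n x) powr p" for n x
  have PL: "P n \<in> L1_loc \<Omega>" for n unfolding P_def
  proof (rule N_powr_L1_loc)
    show "(\<lambda>x. (u x *\<^sub>R H n x) $ i) \<in> borel_measurable (lebesgue_on \<Omega>)" for i
      using L1_loc_measurable[OF open_\<Omega> L1_loc_mult[OF is_weak_grad_L1(2)[OF wlocD(2)[OF w]] u_cont]] by simp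
    show "(\<lambda>x. \<bar>(u x *\<^sub>R H n x) $ i\<bar> powr p) \<in> L1_loc \<Omega>" for i
      using Lp_loc_mult[OF wlocD(3)[OF w] u_cont p0] by simp
  qed
  have P0: "0 \<le> P n x" for n x by (simp add: P_def)
  have aL: "(\<lambda>x. N x (a x) powr p) \<in> L1_loc \<Omega>" by (rule wloc_N_L1[OF u_wloc])
  have wa: "N x (w n x *\<^sub>R a x) powr p \<le> N x (a x) powr p" if "psd (A x)" for n x
  proof -
    have "N x (w n x *\<^sub>R a x) \<le> 1 * N x (a x)"
      unfolding norm_mat_scaleR[OF that] using w01 norm_mat_nonneg[OF that] by (intro mult_right_mono) auto
    then show ?thesis using norm_mat_nonneg[OF that] p by (intro powr_mono2) auto
  qed
  \<comment> \<open>The energy controls \<open>P n\<close> only up to a share \<open>d\<close> of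
    \<open>|\<nabla>u|^p\<close>; \<open>d\<close> is fixed against the integral \<open>J\<close>
    before \<open>n\<close> grows.\<close>
  have P_lim: "(\<lambda>n. \<integral>x. indicat_real S x * P n x \<partial>lebesgue) \<longlonglongrightarrow> 0" if S: "compact S" "S \<subseteq> \<Omega>" for S
  proof (rule LIMSEQ_I)
    fix r :: real assume r: "0 < r"
    define J where "J = (\<integral>x. indicat_real S x * N x (a x) powr p \<partial>lebesgue)"
    have J0: "0 \<le> J" unfolding J_def by (intro integral_nonneg_AE AE_I2) auto
    define d where "d = r / (2 * (J + 1))"
    have d: "0 < d" using r J0 by (simp add: d_def)
    have dJ: "d * J \<le> r / 2"
    proof -
      have "d * J \<le> d * (J + 1)" using d by simp
      also have "\<dots> = r / 2" using J0 unfolding d_def by (simp add: nonzero_divide_eq_eq add_nonneg_eq_0_iff)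
      finally show ?thesis .
    qed
    obtain C where C: "C > 0" "\<And>(M :: real^'n^'n) x y. psd M \<Longrightarrow> norm_mat M y powr p \<le> d * norm_mat M x powr p + C * picone p M x y"
      using norm_mat_powr_le_picone[OF p d, where 'n='n] by blast
    have le: "(\<integral>x. indicat_real S x * P n x \<partial>lebesgue) \<le> d * J + C * E n" for n
    proof -
      have i1: "integrable lebesgue (\<lambda>x. d * (indicat_real S x * N x (a x) powr p))"
        by (intro integrable_mult_right L1_loc_integrable[OF aL S])
      have i2: "integrable lebesgue (\<lambda>x. C * (indicat_real \<Omega> x * energy_density (w n) (H n) x))"
        using er(2)[of n] by (simp add: set_integrable_def)
      have "(\<integral>x. indicat_real S x * P n x \<partial>lebesgue)
         \<le> (\<integral>x. d * (indicat_real S x * N x (a x) powr p) + C * (indicat_real \<Omega> x * energy_density (w n) (H n) x) \<partial>lebesgue)"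
      proof (rule integral_mono_AE[OF L1_loc_integrable[OF PL S] Bochner_Integration.integrable_add[OF i1 i2]])
        show "AE x in lebesgue. indicat_real S x * P n x \<le> d * (indicat_real S x * N x (a x) powr p) + C * (indicat_real \<Omega> x * energy_density (w n) (H n) x)"
          using A_psd
        proof eventually_elim
          case (elim x)
          show ?case
          proof (cases "x \<in> \<Omega>")
            case True
            then have M: "psd (A x)" using elim by blast
            have pos: "0 \<le> energy_density (w n) (H n) x" by (rule picone_nonneg[OF M p])
            have "P n x \<le> d * N x (w n x *\<^sub>R a x) powr p + C * energy_density (w n) (H n) x"
              unfolding P_def by (rule C(2)[OF M])
            also have "\<dots> \<le> d * N x (a x) powr p + C * energy_density (w n) (H n) x"
              using wa[OF M, of n] d by (intro add_right_mono mult_left_mono) auto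
            finally have "P n x \<le> d * N x (a x) powr p + C * energy_density (w n) (H n) x" .
            moreover have "0 \<le> C * energy_density (w n) (H n) x" using C(1) pos by simp
            ultimately show ?thesis using True by (cases "x \<in> S") auto
          next
            case False
            then have "x \<notin> S" using S by blast
            then show ?thesis using False by simp
          qed
        qed
      qed
      also have "\<dots> = d * J + C * E n"
        using Bochner_Integration.integral_add[OF i1 i2] by (simp add: J_def E_def set_lebesgue_integral_def)
      finally show ?thesis .
    qed
    have "(\<lambda>n. C * E n) \<longlonglongrightarrow> 0" by (rule tendsto_mult_right_zero[OF Elim])
    then have "\<forall>\<^sub>F n in sequentially. C * E n < r / 2" by (rule order_tendstoD(2)) (use r in simp)
    then have "\<forall>\<^sub>F n in sequentially. norm ((\<integral>x. indicat_real S x * P n x \<partial>lebesgue) - 0) < r"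
    proof eventually_elim
      case (elim n)
      have "0 \<le> (\<integral>x. indicat_real S x * P n x \<partial>lebesgue)" using P0 by (intro integral_nonneg_AE AE_I2) auto
      then show ?case using le[of n] dJ elim by simp
    qed
    then show "\<exists>no. \<forall>n\<ge>no. norm ((\<integral>x. indicat_real S x * P n x \<partial>lebesgue) - 0) < r" by (simp add: eventually_sequentially)
  qed
  \<comment> \<open>From \<open>u \<nabla>w\<close> in \<open>L^p\<close> for the norm of
    \<open>A\<close> to \<open>\<nabla>w\<close> in \<open>L^1\<close>: ellipticity and the minimum
    of \<open>u\<close> on \<open>S\<close> give the constant \<open>c\<close>, and Young's
    inequality against a constant replaces Hoelder's.\<close>
  have H_lim: "(\<lambda>n. \<integral>x. \<bar>indicat_real S x * ((-1) *\<^sub>R H n x) $ i\<bar> \<partial>lebesgue) \<longlonglongrightarrow> 0" if S: "compact S" "S \<subseteq> \<Omega>" for S i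
  proof (cases "S = {}")
    case False
    obtain \<theta> where \<theta>: "\<theta> > 0" "AE x\<in>S in lebesgue. \<forall>\<xi>. \<theta> * (norm \<xi>)\<^sup>2 \<le> quad_form (A x) \<xi>" by (rule A_lower[OF S])
    obtain x0 where x0: "x0 \<in> S" "\<And>x. x \<in> S \<Longrightarrow> u x0 \<le> u x"
      using continuous_attains_inf[OF S(1) False continuous_on_subset[OF u_cont S(2)]] by blast
    have ux0: "u x0 > 0" using u_pos x0(1) S(2) by blast
    define c where "c = sqrt \<theta> * u x0"
    have c: "c > 0" using \<theta> ux0 by (simp add: c_def)
    have Hle: "AE x\<in>S in lebesgue. (c * \<bar>H n x $ i\<bar>) powr p \<le> P n x" for n
      using \<theta>(2) A_psd
    proof eventually_elim
      case (elim x)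
      show ?case
      proof
        assume xS: "x \<in> S"
        have M: "psd (A x)" using elim(2) xS S by blast
        have q: "\<theta> * (norm (H n x))\<^sup>2 \<le> quad_form (A x) (H n x)" using elim(1) xS by blast
        have "c * \<bar>H n x $ i\<bar> \<le> (sqrt \<theta> * u x) * norm (H n x)"
          unfolding c_def using x0(2)[OF xS] ux0 \<theta>(1) component_le_norm_cart[of "H n x" i]
          by (intro mult_mono mult_left_mono) auto
        also have "\<dots> = u x * sqrt (\<theta> * (norm (H n x))\<^sup>2)" by (simp add: real_sqrt_mult)
        also have "\<dots> \<le> u x * N x (H n x)" unfolding norm_mat_def
          using q x0(2)[OF xS] ux0 by (intro mult_left_mono) auto
        also have "\<dots> = N x (u x *\<^sub>R H n x)" unfolding norm_mat_scaleR[OF M] using x0(2)[OF xS] ux0 by simp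
        finally show "(c * \<bar>H n x $ i\<bar>) powr p \<le> P n x" unfolding P_def using c p by (intro powr_mono2) auto
      qed
    qed
    have mS: "0 \<le> measure lebesgue S" by simp
    show ?thesis
    proof (rule LIMSEQ_I)
      fix r :: real assume r: "0 < r"
      define k where "k = measure lebesgue S + 1"
      have k: "0 < k" "measure lebesgue S \<le> k" using mS unfolding k_def by (rule add_nonneg_pos, simp_all)
      define d where "d = r / (2 * k)"
      have d: "0 < d" using r k by (simp add: d_def)
      have dS: "d * measure lebesgue S \<le> r / 2"
      proof -
        have "d * measure lebesgue S \<le> d * k" using d k by (intro mult_left_mono) auto
        also have "\<dots> = r / 2" using k by (simp add: d_def)
        finally show ?thesis .
      qed
      obtain b where b: "b > 0" "\<And>s t. s \<ge> 0 \<Longrightarrow> t \<ge> 0 \<Longrightarrow> s * t \<le> b * s powr (p/(p-1)) + 1 * t powr p"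
        using Young_weighted[OF p, of 1] by auto
      \<comment> \<open>Chosen so that Young's inequality for
        \<open>\<kappa> * (s / \<kappa>)\<close> leaves exactly the constant
        \<open>d\<close>.\<close>
      define \<kappa> where "\<kappa> = (d / b) powr ((p-1)/p)"
      have \<kappa>: "\<kappa> > 0" "b * \<kappa> powr (p/(p-1)) = d" using d b p by (auto simp: \<kappa>_def powr_powr)
      have y: "s \<le> d + (1/\<kappa> / c) powr p * (c * s) powr p" if "0 \<le> s" for s
      proof -
        have "s = \<kappa> * (s/\<kappa>)" using \<kappa> by simp
        also have "\<dots> \<le> b * \<kappa> powr (p/(p-1)) + 1 * (s/\<kappa>) powr p" using \<kappa> that by (intro b(2)) auto
        also have "(s/\<kappa>) powr p = ((1/\<kappa> / c) * (c * s)) powr p" using c by simp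
        also have "\<dots> = (1/\<kappa> / c) powr p * (c * s) powr p" by (rule powr_mult)
        finally show ?thesis using \<kappa>(2) by simp
      qed
      define C where "C = (1/\<kappa> / c) powr p"
      have le: "(\<integral>x. \<bar>indicat_real S x * ((-1) *\<^sub>R H n x) $ i\<bar> \<partial>lebesgue) \<le> d * measure lebesgue S + C * (\<integral>x. indicat_real S x * P n x \<partial>lebesgue)" for n
      proof -
        have i1: "integrable lebesgue (\<lambda>x. indicat_real S x * d)" using L1_loc_integrable[OF L1_loc_const S] by blast
        have i2: "integrable lebesgue (\<lambda>x. C * (indicat_real S x * P n x))" by (intro integrable_mult_right L1_loc_integrable[OF PL S])
        have i0: "integrable lebesgue (\<lambda>x. \<bar>indicat_real S x * ((-1) *\<^sub>R H n x) $ i\<bar>)"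
          by (rule integrable_abs, rule L1_loc_integrable[OF is_weak_grad_L1(2)[OF wlocD(2)[OF wloc_one_minus[OF w]]] S])
        have "(\<integral>x. \<bar>indicat_real S x * ((-1) *\<^sub>R H n x) $ i\<bar> \<partial>lebesgue) \<le> (\<integral>x. indicat_real S x * d + C * (indicat_real S x * P n x) \<partial>lebesgue)"
        proof (rule integral_mono_AE[OF i0 Bochner_Integration.integrable_add[OF i1 i2]])
          show "AE x in lebesgue. \<bar>indicat_real S x * ((-1) *\<^sub>R H n x) $ i\<bar> \<le> indicat_real S x * d + C * (indicat_real S x * P n x)"
            using Hle[of n]
          proof eventually_elim
            case (elim x)
            show ?case
            proof (cases "x \<in> S")
              case True
              have "\<bar>H n x $ i\<bar> \<le> d + C * (c * \<bar>H n x $ i\<bar>) powr p" unfolding C_def by (rule y) simp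
              also have "\<dots> \<le> d + C * P n x" using elim True by (intro add_left_mono mult_left_mono) (auto simp: C_def)
              finally show ?thesis using True by simp
            qed simp
          qed
        qed
        also have "\<dots> = d * measure lebesgue S + C * (\<integral>x. indicat_real S x * P n x \<partial>lebesgue)"
          using Bochner_Integration.integral_add[OF i1 i2] by simp
        finally show ?thesis .
      qed
      have "(\<lambda>n. C * (\<integral>x. indicat_real S x * P n x \<partial>lebesgue)) \<longlonglongrightarrow> 0" by (rule tendsto_mult_right_zero[OF P_lim[OF S]])
      then have "\<forall>\<^sub>F n in sequentially. C * (\<integral>x. indicat_real S x * P n x \<partial>lebesgue) < r / 2" by (rule order_tendstoD(2)) (use r in simp)
      then have "\<forall>\<^sub>F n in sequentially. norm ((\<integral>x. \<bar>indicat_real S x * ((-1) *\<^sub>R H n x) $ i\<bar> \<partial>lebesgue) - 0) < r"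
      proof eventually_elim
        case (elim n)
        have "0 \<le> (\<integral>x. \<bar>indicat_real S x * ((-1) *\<^sub>R H n x) $ i\<bar> \<partial>lebesgue)" by (intro integral_nonneg_AE AE_I2) simp
        moreover have "(\<integral>x. \<bar>indicat_real S x * ((-1) *\<^sub>R H n x) $ i\<bar> \<partial>lebesgue) < r" using le[of n] dS elim by argo
        ultimately show ?case by (simp only: real_norm_def diff_0_right abs_of_nonneg)
      qed
      then show "\<exists>no. \<forall>n\<ge>no. norm ((\<integral>x. \<bar>indicat_real S x * ((-1) *\<^sub>R H n x) $ i\<bar> \<partial>lebesgue) - 0) < r" by (simp add: eventually_sequentially)
    qed
  qed simp
  define v where "v n x = 1 - w n x" for n x
  have v: "wloc p \<Omega> (v n) (\<lambda>x. (-1) *\<^sub>R H n x)" for n unfolding v_def by (rule wloc_one_minus[OF w])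
  have v01: "0 \<le> v n x" "v n x \<le> 1" for n x using w01 by (auto simp: v_def)
  have v_lim: "(\<lambda>n. \<integral>x. indicat_real S x * v n x \<partial>lebesgue) \<longlonglongrightarrow> 0" if S: "compact S" "S \<subseteq> \<Omega>" for S
    by (rule L1_limit_spreads[OF open_\<Omega> connected_\<Omega> wlocD(2)[OF v] v01 H_lim F _ S]) (use wF in \<open>auto simp: v_def\<close>)
  obtain \<zeta> S where \<zeta>: "\<zeta> \<in> test_functions \<Omega>" and S: "compact S" "S \<subseteq> \<Omega>" "\<forall>x. x \<notin> S \<longrightarrow> \<zeta> x = 0"
    and \<zeta>1: "\<forall>x\<in>F'. \<zeta> x = 1" and \<zeta>01: "\<forall>x. 0 \<le> \<zeta> x \<and> \<zeta> x \<le> 1"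
    by (rule smooth_cutoff[OF F'])
  define Z where "Z = classical_grad \<zeta>"
  have \<zeta>w: "wloc p \<Omega> \<zeta> Z" unfolding Z_def by (rule wloc_classical[OF open_\<Omega> p0 test_functions_D(2,3)[OF \<zeta>]])
  have Z0: "Z x = 0" if "x \<in> \<Omega> - S" for x
    unfolding Z_def by (rule classical_grad_zero_outside[OF open_\<Omega> S(1) _ that]) (use S(3) in auto)
  \<comment> \<open>This is \<open>w n + \<zeta> (1 - w n)\<close>, arranged so that its gradient
    follows from the rules for products and for \<open>1 - f\<close>.\<close>
  define y where "y n x = 1 - (1 - \<zeta> x) * v n x" for n x
  define Y where "Y n x = (-1) *\<^sub>R ((1 - \<zeta> x) *\<^sub>R ((-1) *\<^sub>R H n x) + v n x *\<^sub>R ((-1) *\<^sub>R Z x))" for n x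
  have yw: "wloc p \<Omega> (y n) (Y n)" for n
    unfolding y_def Y_def by (rule wloc_one_minus[OF wloc_mult[OF open_\<Omega> p0 wloc_one_minus[OF \<zeta>w] v]])
  have y0: "y n x = 0" if "x \<in> \<Omega> - (K n \<union> S)" for n x using that K(3)[of x n] S(3) by (simp add: y_def v_def)
  have y01: "0 \<le> y n x" "y n x \<le> 1" for n x
  proof -
    have "(1 - \<zeta> x) * v n x \<le> 1 * 1" using \<zeta>01 v01 by (intro mult_mono) auto
    moreover have "0 \<le> (1 - \<zeta> x) * v n x" using \<zeta>01 v01 by simp
    ultimately show "0 \<le> y n x" "y n x \<le> 1" by (auto simp: y_def)
  qed
  have KS: "compact (K n \<union> S)" "K n \<union> S \<subseteq> \<Omega>" for n using K S by auto
  have yr: "(\<lambda>x. u x * y n x) \<in> W1p p \<Omega> \<inter> Cc \<Omega>" "set_integrable lebesgue \<Omega> (energy_density (y n) (Y n))"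
    "Q_energy p A V \<Omega> (\<lambda>x. u x * y n x) = (LINT x:\<Omega>|lebesgue. energy_density (y n) (Y n) x)" for n
    using energy_representation[OF yw[of n] KS[of n] y0[of _ n]] by blast+
  define B where "B x = N x (u x *\<^sub>R Z x) powr p" for x
  have "\<exists>b. b > 0 \<and> (AE x\<in>S in lebesgue. B x \<le> b)"
  proof -
    obtain c where c: "AE x\<in>S in lebesgue. \<forall>i j. \<bar>A x $ i $ j\<bar> \<le> c" by (rule A_bound[OF S(1,2)])
    have cont: "continuous_on S (\<lambda>x. \<Sum>i\<in>UNIV. \<bar>(u x *\<^sub>R Z x) $ i\<bar> powr p)"
      unfolding vector_scaleR_component real_scaleR_def Z_def using p
      by (intro continuous_on_sum continuous_on_powr' continuous_intros continuous_on_subset[OF u_cont S(2)]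
          continuous_on_subset[OF test_functions_D(3)[OF \<zeta>] S(2)]) auto
    obtain b0 where b0: "b0 > 0" "\<And>x. x \<in> S \<Longrightarrow> \<bar>\<Sum>i\<in>UNIV. \<bar>(u x *\<^sub>R Z x) $ i\<bar> powr p\<bar> \<le> b0"
      using continuous_on_compact_bounded[OF S(1) cont] by auto
    define k where "k = sqrt c powr p * real CARD('n) powr p"
    have "AE x\<in>S in lebesgue. B x \<le> k * b0 + 1"
      using c A_psd
    proof eventually_elim
      case (elim x)
      show ?case
      proof
        assume x: "x \<in> S"
        then have M: "psd (A x)" "\<And>i j. \<bar>A x $ i $ j\<bar> \<le> c" using elim S(2) by auto
        have "B x \<le> k * (\<Sum>i\<in>UNIV. \<bar>(u x *\<^sub>R Z x) $ i\<bar> powr p)" unfolding B_def k_def by (rule norm_mat_powr_le[OF M p0])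
        also have "\<dots> \<le> k * b0" using b0(2)[OF x] by (intro mult_left_mono) (auto simp: k_def abs_le_iff)
        finally show "B x \<le> k * b0 + 1" by simp
      qed
    qed
    moreover have "k * b0 + 1 > 0" using b0(1) by (intro add_nonneg_pos) (auto simp: k_def)
    ultimately show ?thesis by blast
  qed
  then obtain b where b: "b > 0" "AE x\<in>S in lebesgue. B x \<le> b" by blast
  define J where "J = (\<integral>x. indicat_real S x * N x (a x) powr p \<partial>lebesgue)"
  have J0: "0 \<le> J" unfolding J_def by (intro integral_nonneg_AE AE_I2) auto
  define d where "d = e / (2 * (J + 1))"
  have d: "0 < d" using e J0 by (simp add: d_def)
  have dJ: "d * J \<le> e / 2"
  proof -
    have "d * J \<le> d * (J + 1)" using d by simp
    also have "\<dots> = e / 2" using J0 unfolding d_def by (simp add: nonzero_divide_eq_eq add_nonneg_eq_0_iff)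
    finally show ?thesis .
  qed
  obtain C where C: "C > 0" "\<And>(M :: real^'n^'n) x y. psd M \<Longrightarrow> picone p M x y \<le> d * norm_mat M x powr p + C * norm_mat M y powr p"
    using picone_le_norm_mat_powr[OF p d, where 'n='n] by blast
  define D where "D = C * 2 powr p"
  have D: "D > 0" using C by (simp add: D_def)
  have le: "(LINT x:\<Omega>|lebesgue. energy_density (y n) (Y n) x) \<le> E n + d * J + D * (\<integral>x. indicat_real S x * P n x \<partial>lebesgue) + D * b * (\<integral>x. indicat_real S x * v n x \<partial>lebesgue)" for n
  proof -
    have i1: "integrable lebesgue (\<lambda>x. indicat_real \<Omega> x * energy_density (w n) (H n) x)"
      using er(2)[of n] by (simp add: set_integrable_def)
    have i2: "integrable lebesgue (\<lambda>x. d * (indicat_real S x * N x (a x) powr p))"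
      by (intro integrable_mult_right L1_loc_integrable[OF aL S(1,2)])
    have i3: "integrable lebesgue (\<lambda>x. D * (indicat_real S x * P n x))"
      by (intro integrable_mult_right L1_loc_integrable[OF PL S(1,2)])
    have i4: "integrable lebesgue (\<lambda>x. D * b * (indicat_real S x * v n x))"
      by (intro integrable_mult_right L1_loc_integrable[OF is_weak_grad_L1(1)[OF wlocD(2)[OF v]] S(1,2)])
    have i0: "integrable lebesgue (\<lambda>x. indicat_real \<Omega> x * energy_density (y n) (Y n) x)"
      using yr(2)[of n] by (simp add: set_integrable_def)
    note i12 = Bochner_Integration.integrable_add[OF i1 i2]
    note i123 = Bochner_Integration.integrable_add[OF i12 i3]
    note i1234 = Bochner_Integration.integrable_add[OF i123 i4]
    have "(\<integral>x. indicat_real \<Omega> x * energy_density (y n) (Y n) x \<partial>lebesgue)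
       \<le> (\<integral>x. indicat_real \<Omega> x * energy_density (w n) (H n) x + d * (indicat_real S x * N x (a x) powr p)
            + D * (indicat_real S x * P n x) + D * b * (indicat_real S x * v n x) \<partial>lebesgue)"
    proof (rule integral_mono_AE[OF i0 i1234])
      show "AE x in lebesgue. indicat_real \<Omega> x * energy_density (y n) (Y n) x \<le> indicat_real \<Omega> x * energy_density (w n) (H n) x + d * (indicat_real S x * N x (a x) powr p)
            + D * (indicat_real S x * P n x) + D * b * (indicat_real S x * v n x)"
        using A_psd b(2)
      proof eventually_elim
        case (elim x)
        consider "x \<notin> \<Omega>" | "x \<in> \<Omega> - S" | "x \<in> S" by blast
        then show ?case
        proof cases
          case 1
          then have "x \<notin> S" using S(2) by blast
          then show ?thesis using 1 by simp
        next
          \<comment> \<open>Cut-off and gradient of the cut-off vanish here, so the densities of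
            \<open>y n\<close> and \<open>w n\<close> coincide.\<close>
          case 2
          have "y n x = w n x" "Y n x = H n x" using 2 S(3) Z0[OF 2] by (auto simp: y_def v_def Y_def)
          then show ?thesis using 2 by simp
        next
          case 3
          then have xO: "x \<in> \<Omega>" using S(2) by blast
          then have M: "psd (A x)" using elim by blast
          have pos: "0 \<le> energy_density (w n) (H n) x" by (rule picone_nonneg[OF M p])
          have ya: "N x (y n x *\<^sub>R a x) powr p \<le> N x (a x) powr p"
          proof -
            have "N x (y n x *\<^sub>R a x) \<le> 1 * N x (a x)"
              unfolding norm_mat_scaleR[OF M] using y01 norm_mat_nonneg[OF M] by (intro mult_right_mono) auto
            then show ?thesis using norm_mat_nonneg[OF M] p by (intro powr_mono2) auto
          qed
          have Ye: "u x *\<^sub>R Y n x = (1 - \<zeta> x) *\<^sub>R (u x *\<^sub>R H n x) + v n x *\<^sub>R (u x *\<^sub>R Z x)"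
            by (simp add: Y_def vec_eq_iff algebra_simps)
          have "N x (u x *\<^sub>R Y n x) \<le> N x ((1 - \<zeta> x) *\<^sub>R (u x *\<^sub>R H n x)) + N x (v n x *\<^sub>R (u x *\<^sub>R Z x))"
            unfolding Ye by (rule norm_mat_triangle[OF M])
          also have "\<dots> \<le> N x (u x *\<^sub>R H n x) + v n x * N x (u x *\<^sub>R Z x)"
          proof (rule add_mono)
            have "\<bar>1 - \<zeta> x\<bar> * N x (u x *\<^sub>R H n x) \<le> 1 * N x (u x *\<^sub>R H n x)"
              using \<zeta>01 norm_mat_nonneg[OF M] by (intro mult_right_mono) auto
            then show "N x ((1 - \<zeta> x) *\<^sub>R (u x *\<^sub>R H n x)) \<le> N x (u x *\<^sub>R H n x)" by (simp only: norm_mat_scaleR[OF M] mult_1_left)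
            show "N x (v n x *\<^sub>R (u x *\<^sub>R Z x)) \<le> v n x * N x (u x *\<^sub>R Z x)"
              unfolding norm_mat_scaleR[OF M, of "v n x"] using v01(1)[of n x] by simp
          qed
          finally have "N x (u x *\<^sub>R Y n x) powr p \<le> (N x (u x *\<^sub>R H n x) + v n x * N x (u x *\<^sub>R Z x)) powr p"
            using norm_mat_nonneg[OF M] p by (intro powr_mono2) auto
          also have "\<dots> \<le> 2 powr p * (N x (u x *\<^sub>R H n x) powr p + (v n x * N x (u x *\<^sub>R Z x)) powr p)"
            using norm_mat_nonneg[OF M] v01 p by (intro powr_add_le) auto
          also have "(v n x * N x (u x *\<^sub>R Z x)) powr p = v n x powr p * B x" unfolding B_def by (rule powr_mult)
          also have "2 powr p * (N x (u x *\<^sub>R H n x) powr p + v n x powr p * B x) \<le> 2 powr p * (P n x + v n x * b)"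
          proof (intro mult_left_mono add_mono mult_mono)
            \<comment> \<open>Values in \<open>[0, 1]\<close> satisfy this, so the
              \<open>L^1\<close> convergence of \<open>v n\<close> is enough.\<close>
            show "v n x powr p \<le> v n x" using powr_mono'[of 1 p "v n x"] v01[of n x] p by simp
            show "B x \<le> b" using elim(2) 3 by blast
          qed (use v01 in \<open>auto simp: P_def B_def\<close>)
          finally have Yb: "N x (u x *\<^sub>R Y n x) powr p \<le> 2 powr p * (P n x + v n x * b)" .
          have "energy_density (y n) (Y n) x \<le> d * N x (y n x *\<^sub>R a x) powr p + C * N x (u x *\<^sub>R Y n x) powr p"
            by (rule C(2)[OF M])
          also have "\<dots> \<le> d * N x (a x) powr p + C * (2 powr p * (P n x + v n x * b))"
            using ya Yb d C(1) by (intro add_mono mult_left_mono) auto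
          finally have "energy_density (y n) (Y n) x \<le> d * N x (a x) powr p + D * P n x + D * b * v n x"
            by (simp add: D_def algebra_simps)
          then show ?thesis using pos 3 xO by simp
        qed
      qed
    qed
    also have "\<dots> = E n + d * J + D * (\<integral>x. indicat_real S x * P n x \<partial>lebesgue) + D * b * (\<integral>x. indicat_real S x * v n x \<partial>lebesgue)"
      unfolding Bochner_Integration.integral_add[OF i123 i4] Bochner_Integration.integral_add[OF i12 i3] Bochner_Integration.integral_add[OF i1 i2]
        Bochner_Integration.integral_mult_right_zero J_def E_def set_lebesgue_integral_def real_scaleR_def by (rule refl)
    finally show ?thesis unfolding set_lebesgue_integral_def real_scaleR_def .
  qed
  have "(\<lambda>n. E n + d * J + D * (\<integral>x. indicat_real S x * P n x \<partial>lebesgue) + D * b * (\<integral>x. indicat_real S x * v n x \<partial>lebesgue)) \<longlonglongrightarrow> 0 + d * J + D * 0 + D * b * 0"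
    by (intro tendsto_intros Elim P_lim[OF S(1,2)] v_lim[OF S(1,2)])
  moreover have "0 + d * J + D * 0 + D * b * 0 < e" using dJ e by simp
  ultimately have "\<forall>\<^sub>F n in sequentially. E n + d * J + D * (\<integral>x. indicat_real S x * P n x \<partial>lebesgue) + D * b * (\<integral>x. indicat_real S x * v n x \<partial>lebesgue) < e"
    by (rule order_tendstoD(2))
  then obtain n where n: "E n + d * J + D * (\<integral>x. indicat_real S x * P n x \<partial>lebesgue) + D * b * (\<integral>x. indicat_real S x * v n x \<partial>lebesgue) < e"
    by (auto simp: eventually_sequentially)
  have "Q_energy p A V \<Omega> (\<lambda>x. u x * y n x) < e" unfolding yr(3) by (rule le_less_trans[OF le n])
  moreover have "u x \<le> u x * y n x" if "x \<in> F'" for x using \<zeta>1 that by (simp add: y_def)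
  ultimately show ?thesis using yr(1)[of n] by (intro bexI[of _ "\<lambda>x. u x * y n x"] conjI ballI)
qed

end

section \<open>The norms on the space of Hardy-weights\<close>

lemma L1_loc_abs: "g \<in> L1_loc \<Omega> \<Longrightarrow> (\<lambda>x. \<bar>g x\<bar>) \<in> L1_loc \<Omega>"
  by (auto simp: L1_loc_def intro: set_integrable_abs)

text \<open>Infinite capacity is included with \<open>k = 0\<close>; in every case the quotient is
  linear in its numerator, which is what the norm axioms need.\<close>

lemma ereal_divide_pos_real:
  fixes c :: ereal
  assumes "0 < c"
  shows "\<exists>k\<ge>0. \<forall>a. ereal a / c = ereal (a * k)"
proof (cases c)
  case (real r)
  then have "0 < r" using assms by simp
  then show ?thesis using real by (intro exI[of _ "1/r"]) auto
next
  case PInf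
  then show ?thesis by (intro exI[of _ 0]) auto
qed (use assms in simp)

context hardy_setting
begin

abbreviation "cap F \<equiv> capacity p A V \<Omega> u F"
abbreviation "Q \<phi> \<equiv> Q_energy p A V \<Omega> \<phi>"
abbreviation "hn g \<equiv> hardy_norm p A V \<Omega> u g"
abbreviation "best g \<equiv> best_constant p A V \<Omega> g"
abbreviation "hardy g C \<equiv> hardy_inequality p A V \<Omega> g C"
abbreviation "weights \<equiv> hardy_weights p A V \<Omega>"
abbreviation "PC \<equiv> positive_cap_compacts p A V \<Omega> u"

definition mass where "mass g F = (LINT x:F|lebesgue. \<bar>g x\<bar> * \<bar>u x\<bar> powr p)"

lemma cap_nonneg: "0 \<le> cap F"
  unfolding capacity_def using Q_nonneg by (intro INF_greatest) auto

lemma cap_le: "\<phi> \<in> W1p p \<Omega> \<inter> Cc \<Omega> \<Longrightarrow> \<forall>x\<in>F. u x \<le> \<phi> x \<Longrightarrow> cap F \<le> ereal (Q \<phi>)"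
  unfolding capacity_def by (rule INF_lower) simp

lemma mass_integrable:
  assumes "g \<in> L1_loc \<Omega>" "compact F" "F \<subseteq> \<Omega>"
  shows "integrable lebesgue (\<lambda>x. indicat_real F x * (\<bar>g x\<bar> * \<bar>u x\<bar> powr p))"
proof -
  have "continuous_on F (\<lambda>x. \<bar>u x\<bar> powr p)"
    using p by (intro continuous_on_powr' continuous_intros continuous_on_subset[OF u_cont assms(3)]) auto
  from L1_loc_mult_integrable[OF L1_loc_abs[OF assms(1)] assms(2,3) this] show ?thesis by (simp add: mult_ac)
qed

lemma mass_eq: "mass g F = (\<integral>x. indicat_real F x * (\<bar>g x\<bar> * \<bar>u x\<bar> powr p) \<partial>lebesgue)"
  by (simp add: mass_def set_lebesgue_integral_def)

lemma mass_nonneg: "0 \<le> mass g F"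
  unfolding mass_eq by (intro integral_nonneg_AE AE_I2) auto

lemma weighted_integrable:
  assumes g: "g \<in> L1_loc \<Omega>" and \<phi>: "\<phi> \<in> W1p p \<Omega> \<inter> Cc \<Omega>"
  shows "set_integrable lebesgue \<Omega> (\<lambda>x. \<bar>g x\<bar> * \<bar>\<phi> x\<bar> powr p)"
proof -
  obtain K where K: "compact K" "K \<subseteq> \<Omega>" "\<forall>x\<in>\<Omega> - K. \<phi> x = 0" "continuous_on \<Omega> \<phi>"
    using \<phi> by (auto simp: Cc_def compact_support_in_def)
  have "continuous_on \<Omega> (\<lambda>x. \<bar>\<phi> x\<bar> powr p)"
    using p by (intro continuous_on_powr' continuous_intros K(4)) auto
  then show ?thesis
    by (rule L1_loc_set_integrable[OF L1_loc_abs[OF g] _ K(1,2)]) (use K(3) in simp)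
qed

lemma mass_le_hardy:
  assumes g: "g \<in> L1_loc \<Omega>" and h: "hardy g C" and F: "compact F" "F \<subseteq> \<Omega>"
    and \<phi>: "\<phi> \<in> W1p p \<Omega> \<inter> Cc \<Omega>" "\<forall>x\<in>F. u x \<le> \<phi> x"
  shows "mass g F \<le> C * Q \<phi>"
proof -
  have "mass g F \<le> (LINT x:\<Omega>|lebesgue. \<bar>g x\<bar> * \<bar>\<phi> x\<bar> powr p)"
    unfolding mass_def set_lebesgue_integral_def real_scaleR_def
  proof (rule integral_mono)
    show "integrable lebesgue (\<lambda>x. indicat_real F x * (\<bar>g x\<bar> * \<bar>u x\<bar> powr p))" by (rule mass_integrable[OF g F])
    show "integrable lebesgue (\<lambda>x. indicat_real \<Omega> x * (\<bar>g x\<bar> * \<bar>\<phi> x\<bar> powr p))"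
      using weighted_integrable[OF g \<phi>(1)] by (simp add: set_integrable_def)
    fix x
    show "indicat_real F x * (\<bar>g x\<bar> * \<bar>u x\<bar> powr p) \<le> indicat_real \<Omega> x * (\<bar>g x\<bar> * \<bar>\<phi> x\<bar> powr p)"
    proof (cases "x \<in> F")
      case True
      then have xO: "x \<in> \<Omega>" using F by blast
      have "\<bar>u x\<bar> powr p \<le> \<bar>\<phi> x\<bar> powr p" using \<phi>(2) True u_pos[OF xO] p by (intro powr_mono2) auto
      then show ?thesis using True xO by (simp add: mult_left_mono)
    qed simp
  qed
  also have "\<dots> \<le> C * Q \<phi>" using h \<phi>(1) by (simp add: hardy_inequality_def)
  finally show ?thesis .
qed

text \<open>Without a competitor, the constant 0 in the Hardy inequality would say nothing about the
  mass on \<open>F\<close>.\<close>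

lemma admissible_exists:
  assumes "compact F" "F \<subseteq> \<Omega>"
  shows "\<exists>\<phi>\<in>W1p p \<Omega> \<inter> Cc \<Omega>. \<forall>x\<in>F. u x \<le> \<phi> x"
proof -
  obtain \<zeta> K where \<zeta>: "\<zeta> \<in> test_functions \<Omega>" and K: "compact K" "K \<subseteq> \<Omega>" "\<forall>x. x \<notin> K \<longrightarrow> \<zeta> x = 0"
    and one: "\<forall>x\<in>F. \<zeta> x = 1" and "\<forall>x. 0 \<le> \<zeta> x \<and> \<zeta> x \<le> 1" by (rule smooth_cutoff[OF assms])
  have w: "wloc p \<Omega> \<zeta> (classical_grad \<zeta>)" by (rule wloc_classical[OF open_\<Omega> p0 test_functions_D(2,3)[OF \<zeta>]])
  have "(\<lambda>x. u x * \<zeta> x) \<in> W1p p \<Omega> \<inter> Cc \<Omega>" by (rule energy_representation(1)[OF w K(1,2)]) (use K(3) in simp)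
  then show ?thesis by (rule bexI[rotated]) (use one in simp)
qed

lemma AE_zero_of_mass:
  assumes g: "g \<in> L1_loc \<Omega>" and m: "\<And>F. compact F \<Longrightarrow> F \<subseteq> \<Omega> \<Longrightarrow> mass g F \<le> 0"
  shows "AE x\<in>\<Omega> in lebesgue. g x = 0"
proof (rule AE_local)
  fix x assume "x \<in> \<Omega>"
  then obtain r where r: "r > 0" "cball x r \<subseteq> \<Omega>" using open_\<Omega> open_contains_cball by blast
  note i = mass_integrable[OF g compact_cball r(2)]
  have "mass g (cball x r) = 0" using m[OF compact_cball r(2)] mass_nonneg[of g "cball x r"] by linarith
  then have "AE y in lebesgue. indicat_real (cball x r) y * (\<bar>g y\<bar> * \<bar>u y\<bar> powr p) = 0"
    unfolding mass_eq by (subst (asm) integral_nonneg_eq_0_iff_AE[OF i]) auto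
  then have "AE y in lebesgue. y \<in> ball x r \<longrightarrow> g y = 0"
  proof eventually_elim
    case (elim y)
    show ?case
    proof
      assume y: "y \<in> ball x r"
      then have yc: "y \<in> cball x r" by simp
      then have "y \<in> \<Omega>" using r(2) by blast
      then show "g y = 0" using elim yc u_pos[of y] by auto
    qed
  qed
  then show "\<exists>r>0. AE y in lebesgue. y \<in> ball x r \<longrightarrow> g y = 0" using r(1) by blast
qed

lemma mass_AE_cong:
  assumes "AE x\<in>\<Omega> in lebesgue. f x = g x" "F \<subseteq> \<Omega>"
  shows "mass f F = mass g F"
  unfolding mass_def
proof (rule set_integral_AE_cong(2))
  show "AE x\<in>F in lebesgue. \<bar>f x\<bar> * \<bar>u x\<bar> powr p = \<bar>g x\<bar> * \<bar>u x\<bar> powr p"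
    using AE_mem_mono[OF assms] by eventually_elim auto
qed

lemma mass_zero [simp]: "mass (\<lambda>x. 0) F = 0"
  by (simp add: mass_def set_lebesgue_integral_def)

lemma PC_D: "F \<in> PC \<Longrightarrow> compact F \<and> F \<subseteq> \<Omega> \<and> 0 < cap F"
  using cap_nonneg[of F] by (auto simp: positive_cap_compacts_def less_le)

lemma hn_eq:
  "hn g = (if PC = {} then (if AE x\<in>\<Omega> in lebesgue. g x = 0 then 0 else \<infinity>)
     else (SUP F\<in>PC. ereal (mass g F) / cap F))"
  by (simp add: hardy_norm_def mass_def)

lemma ratio_real:
  assumes "F \<in> PC"
  obtains k where "k \<ge> 0" "\<forall>a. ereal a / cap F = ereal (a * k)"
  using ereal_divide_pos_real[of "cap F"] PC_D[OF assms] by blast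

lemma hn_nonneg: "0 \<le> hn g"
proof (cases "PC = {}")
  case False
  then obtain F where F: "F \<in> PC" by blast
  obtain k where k: "k \<ge> 0" "\<forall>a. ereal a / cap F = ereal (a * k)" by (rule ratio_real[OF F])
  have "0 \<le> ereal (mass g F) / cap F" using k mass_nonneg[of g F] by simp
  also have "\<dots> \<le> hn g" unfolding hn_eq using False F by (auto intro: SUP_upper)
  finally show ?thesis .
qed (simp add: hn_eq)

text \<open>Each competitor gives \<open>mass g F \<le> C * Q \<phi>\<close>, so the capacity is at
  least \<open>mass g F / C\<close>. If all capacities vanish, so do all masses; then
  \<open>g = 0\<close> almost everywhere, and the convention for the empty family gives the norm
  0.\<close>

lemma hn_le_hardy:
  assumes g: "g \<in> L1_loc \<Omega>" and C: "0 < C" "hardy g C"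
  shows "hn g \<le> ereal C"
proof -
  have key: "ereal (mass g F / C) \<le> cap F" if F: "compact F" "F \<subseteq> \<Omega>" for F
    unfolding capacity_def
  proof (rule INF_greatest)
    fix \<phi> assume "\<phi> \<in> {\<phi> \<in> W1p p \<Omega> \<inter> Cc \<Omega>. \<forall>x\<in>F. u x \<le> \<phi> x}"
    then have "mass g F \<le> C * Q \<phi>" by (intro mass_le_hardy[OF g C(2) F]) auto
    then show "ereal (mass g F / C) \<le> ereal (Q \<phi>)" using C(1) by (simp add: field_simps)
  qed
  show ?thesis
  proof (cases "PC = {}")
    case True
    have "AE x\<in>\<Omega> in lebesgue. g x = 0"
    proof (rule AE_zero_of_mass[OF g])
      fix F assume F: "compact F" "F \<subseteq> \<Omega>"
      then have "cap F = 0" using True by (auto simp: positive_cap_compacts_def)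
      then have "mass g F / C \<le> 0" using key[OF F] by simp
      then show "mass g F \<le> 0" using C(1) by (simp add: divide_le_0_iff)
    qed
    then show ?thesis using True C(1) by (simp add: hn_eq)
  next
    case False
    have "ereal (mass g F) / cap F \<le> ereal C" if F: "F \<in> PC" for F
    proof -
      have k: "ereal (mass g F / C) \<le> cap F" using key PC_D[OF F] by blast
      show ?thesis
      proof (cases "cap F")
        case (real r)
        then have "0 < r" using PC_D[OF F] by simp
        then show ?thesis using k real C(1) by (simp add: field_simps)
      qed (use PC_D[OF F] C(1) in auto)
    qed
    then show ?thesis unfolding hn_eq using False by (auto intro: SUP_least)
  qed
qed

text \<open>The norm sees sets of positive capacity only. A set of zero capacity must be negligible
  when some set has positive capacity, since otherwise zero capacity would spread to the latter; so
  it carries no mass.\<close>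

lemma mass_le_of_hn:
  assumes g: "g \<in> L1_loc \<Omega>" and n: "0 \<le> n" "hn g \<le> ereal n" and F: "compact F" "F \<subseteq> \<Omega>"
    and \<phi>: "\<phi> \<in> W1p p \<Omega> \<inter> Cc \<Omega>" "\<forall>x\<in>F. u x \<le> \<phi> x"
  shows "mass g F \<le> n * Q \<phi>"
proof -
  have nQ: "0 \<le> n * Q \<phi>" using n(1) Q_nonneg[OF \<phi>(1)] by simp
  show ?thesis
  proof (cases "PC = {}")
    case True
    then have "AE x\<in>\<Omega> in lebesgue. g x = 0" using n(2) by (auto simp: hn_eq split: if_splits)
    then have "mass g F = 0" using mass_AE_cong[of g "\<lambda>x. 0" F] F by simp
    then show ?thesis using nQ by simp
  next
    case False
    show ?thesis
    proof (cases "F \<in> PC")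
      case True
      have "ereal (mass g F) / cap F \<le> hn g" unfolding hn_eq using False True by (auto intro: SUP_upper)
      then have le: "ereal (mass g F) / cap F \<le> ereal n" using n(2) by (rule order_trans)
      have c: "0 < cap F" "cap F \<le> ereal (Q \<phi>)" using PC_D[OF True] cap_le[OF \<phi>] by auto
      then obtain r where r: "cap F = ereal r" "0 < r" "r \<le> Q \<phi>" by (cases "cap F") auto
      have "mass g F \<le> n * r" using le r by (simp add: field_simps)
      also have "\<dots> \<le> n * Q \<phi>" using r n(1) by (intro mult_left_mono) auto
      finally show ?thesis .
    next
      case nP: False
      then have c0: "cap F = 0" using F by (auto simp: positive_cap_compacts_def)
      have "negligible F"
      proof (rule ccontr)
        assume nF: "\<not> negligible F"
        have small: "\<exists>\<phi>\<in>W1p p \<Omega> \<inter> Cc \<Omega>. (\<forall>x\<in>F. u x \<le> \<phi> x) \<and> Q \<phi> < e" if "0 < e" for e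
        proof -
          have "cap F < ereal e" using c0 that by simp
          then show ?thesis unfolding capacity_def INF_less_iff by auto
        qed
        \<comment> \<open>The family of sets of positive capacity is nonempty in this case; its
          member \<open>F'\<close> contradicts the spreading.\<close>
        obtain F' where F': "F' \<in> PC" using False by blast
        have "cap F' \<le> 0"
        proof (rule ereal_le_epsilon2)
            fix e :: real assume "0 < e"
            then obtain \<psi> where \<psi>: "\<psi> \<in> W1p p \<Omega> \<inter> Cc \<Omega>" "\<forall>x\<in>F'. u x \<le> \<psi> x" "Q \<psi> < e"
              using zero_capacity_spreads[OF F nF small, of F' e] PC_D[OF F'] by blast
            have "cap F' \<le> ereal (Q \<psi>)" by (rule cap_le[OF \<psi>(1,2)])
            also have "\<dots> \<le> 0 + ereal e" using \<psi>(3) by simp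
            finally show "cap F' \<le> 0 + ereal e" .
        qed
        then show False using PC_D[OF F'] by (auto simp: not_le[symmetric])
      qed
      then have "F \<in> null_sets lebesgue" by (simp add: negligible_iff_null_sets)
      then have "AE x in lebesgue. indicat_real F x * (\<bar>g x\<bar> * \<bar>u x\<bar> powr p) = 0"
        using AE_not_in by (force elim: eventually_mono)
      then have "mass g F = 0" unfolding mass_eq by (rule integral_eq_zero_AE)
      then show ?thesis using nQ by simp
    qed
  qed
qed

section \<open>The best constant as a norm\<close>

lemma hardy_mono: "hardy g C \<Longrightarrow> C \<le> D \<Longrightarrow> hardy g D"
  unfolding hardy_inequality_def using Q_nonneg by (meson mult_right_mono order_trans)

lemma hn_le_best: "g \<in> L1_loc \<Omega> \<Longrightarrow> hn g \<le> best g"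
  unfolding best_constant_def by (rule INF_greatest) (auto intro: hn_le_hardy)

text \<open>The best constant is an infimum over positive constants, whereas \<open>C\<close> may be
  0; every \<open>C + e\<close> is admissible.\<close>

lemma best_le:
  assumes C: "0 \<le> C" "hardy g C"
  shows "best g \<le> ereal C"
proof (rule ereal_le_epsilon2)
  fix e :: real assume e: "0 < e"
  have "hardy g (C + e)" by (rule hardy_mono[OF C(2)]) (use e in simp)
  then have "best g \<le> ereal (C + e)" unfolding best_constant_def using C(1) e by (intro INF_lower) auto
  then show "best g \<le> ereal C + ereal e" by simp
qed

text \<open>A finite value of the norm is itself an admissible \<open>n\<close> in the capacity
  bound; an infinite value makes the right side infinite.\<close>

lemma best_le_hn: "\<exists>C>0. \<forall>g\<in>L1_loc \<Omega>. best g \<le> ereal C * hn g"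
proof -
  obtain C where C: "C > 0" "\<forall>g\<in>L1_loc \<Omega>. \<forall>n\<ge>0.
    (\<forall>F \<phi>. compact F \<and> F \<subseteq> \<Omega> \<and> \<phi> \<in> W1p p \<Omega> \<inter> Cc \<Omega> \<and> (\<forall>x\<in>F. u x \<le> \<phi> x) \<longrightarrow>
       (LINT x:F|lebesgue. \<bar>g x\<bar> * \<bar>u x\<bar> powr p) \<le> n * Q \<phi>) \<longrightarrow> hardy g (C * n)"
    using hardy_of_capacity_bound by blast
  have "best g \<le> ereal C * hn g" if g: "g \<in> L1_loc \<Omega>" for g
  proof (cases "hn g")
    case (real n)
    then have n: "0 \<le> n" using hn_nonneg[of g] by simp
    have "hardy g (C * n)"
    proof (rule C(2)[rule_format, OF g n])
      fix F \<phi> assume "compact F \<and> F \<subseteq> \<Omega> \<and> \<phi> \<in> W1p p \<Omega> \<inter> Cc \<Omega> \<and> (\<forall>x\<in>F. u x \<le> \<phi> x)"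
      then show "(LINT x:F|lebesgue. \<bar>g x\<bar> * \<bar>u x\<bar> powr p) \<le> n * Q \<phi>"
        using mass_le_of_hn[OF g n, of F \<phi>] real by (simp add: mass_def)
    qed
    then have "best g \<le> ereal (C * n)" using C(1) n by (intro best_le) auto
    then show ?thesis using real by simp
  next
    case PInf
    then show ?thesis using C(1) by simp
  next
    case MInf
    then show ?thesis using hn_nonneg[of g] by simp
  qed
  then show ?thesis using C(1) by blast
qed

lemma best_nonneg: "0 \<le> best g"
  unfolding best_constant_def by (rule INF_greatest) auto

lemma weights_iff: "g \<in> weights \<longleftrightarrow> g \<in> L1_loc \<Omega> \<and> (\<exists>C\<ge>0. hardy g C)"
proof
  assume "g \<in> L1_loc \<Omega> \<and> (\<exists>C\<ge>0. hardy g C)"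
  then obtain C where "g \<in> L1_loc \<Omega>" "C \<ge> 0" "hardy g C" by blast
  then show "g \<in> weights" unfolding hardy_weights_def using hardy_mono[of g C "C + 1"]
    by (auto intro!: exI[of _ "C + 1"])
qed (auto simp: hardy_weights_def intro: less_imp_le)

text \<open>For a fixed \<open>\<phi>\<close> the inequality is closed under limits of the constant,
  so the infimum, possibly 0, is a Hardy constant.\<close>

lemma best_attained:
  assumes g: "g \<in> weights"
  obtains b where "0 \<le> b" "best g = ereal b" "hardy g b"
proof -
  obtain C where C: "C \<ge> 0" "hardy g C" and gL: "g \<in> L1_loc \<Omega>" using g by (auto simp: weights_iff)
  have "best g \<le> ereal C" by (rule best_le[OF C])
  then obtain b where b: "best g = ereal b" "0 \<le> b" using best_nonneg[of g] by (cases "best g") auto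
  have "hardy g b" unfolding hardy_inequality_def
  proof
    fix \<phi> assume \<phi>: "\<phi> \<in> W1p p \<Omega> \<inter> Cc \<Omega>"
    show "(LINT x:\<Omega>|lebesgue. \<bar>g x\<bar> * \<bar>\<phi> x\<bar> powr p) \<le> b * Q \<phi>"
    proof (rule field_le_epsilon)
      fix e :: real assume e: "0 < e"
      define d where "d = e / (Q \<phi> + 1)"
      have q: "0 \<le> Q \<phi>" by (rule Q_nonneg[OF \<phi>])
      have d: "0 < d" "d * Q \<phi> \<le> e" using e q by (auto simp: d_def field_simps)
      have "best g < ereal (b + d)" using b d by simp
      then obtain D where D: "D > 0" "hardy g D" "D < b + d" unfolding best_constant_def INF_less_iff by auto
      have "(LINT x:\<Omega>|lebesgue. \<bar>g x\<bar> * \<bar>\<phi> x\<bar> powr p) \<le> D * Q \<phi>" using D(2) \<phi> by (simp add: hardy_inequality_def)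
      also have "\<dots> \<le> (b + d) * Q \<phi>" using D(3) q by (intro mult_right_mono) auto
      also have "\<dots> \<le> b * Q \<phi> + e" using d(2) by (simp add: distrib_right)
      finally show "(LINT x:\<Omega>|lebesgue. \<bar>g x\<bar> * \<bar>\<phi> x\<bar> powr p) \<le> b * Q \<phi> + e" .
    qed
  qed
  then show ?thesis using that b by blast
qed

lemma hardy_add:
  assumes f: "f \<in> L1_loc \<Omega>" "hardy f C" and g: "g \<in> L1_loc \<Omega>" "hardy g D"
  shows "hardy (\<lambda>x. f x + g x) (C + D)"
  unfolding hardy_inequality_def
proof
  fix \<phi> assume \<phi>: "\<phi> \<in> W1p p \<Omega> \<inter> Cc \<Omega>"
  note i = weighted_integrable[OF f(1) \<phi>] weighted_integrable[OF g(1) \<phi>]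
  have "(LINT x:\<Omega>|lebesgue. \<bar>f x + g x\<bar> * \<bar>\<phi> x\<bar> powr p) \<le> (LINT x:\<Omega>|lebesgue. \<bar>f x\<bar> * \<bar>\<phi> x\<bar> powr p + \<bar>g x\<bar> * \<bar>\<phi> x\<bar> powr p)"
  proof (rule set_integral_mono[OF weighted_integrable[OF L1_loc_add[OF f(1) g(1)] \<phi>] set_integral_add(1)[OF i]])
    fix x
    show "\<bar>f x + g x\<bar> * \<bar>\<phi> x\<bar> powr p \<le> \<bar>f x\<bar> * \<bar>\<phi> x\<bar> powr p + \<bar>g x\<bar> * \<bar>\<phi> x\<bar> powr p"
      unfolding distrib_right[symmetric] by (intro mult_right_mono abs_triangle_ineq) auto
  qed
  also have "\<dots> = (LINT x:\<Omega>|lebesgue. \<bar>f x\<bar> * \<bar>\<phi> x\<bar> powr p) + (LINT x:\<Omega>|lebesgue. \<bar>g x\<bar> * \<bar>\<phi> x\<bar> powr p)"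
    by (rule set_integral_add(2)[OF i])
  also have "\<dots> \<le> C * Q \<phi> + D * Q \<phi>" using f(2) g(2) \<phi> by (intro add_mono) (auto simp: hardy_inequality_def)
  finally show "(LINT x:\<Omega>|lebesgue. \<bar>f x + g x\<bar> * \<bar>\<phi> x\<bar> powr p) \<le> (C + D) * Q \<phi>" by (simp add: distrib_right)
qed

lemma hardy_scale:
  assumes "hardy g C"
  shows "hardy (\<lambda>x. c * g x) (\<bar>c\<bar> * C)"
  unfolding hardy_inequality_def
proof
  fix \<phi> assume \<phi>: "\<phi> \<in> W1p p \<Omega> \<inter> Cc \<Omega>"
  have "(LINT x:\<Omega>|lebesgue. \<bar>c * g x\<bar> * \<bar>\<phi> x\<bar> powr p) = \<bar>c\<bar> * (LINT x:\<Omega>|lebesgue. \<bar>g x\<bar> * \<bar>\<phi> x\<bar> powr p)"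
    by (simp add: abs_mult mult.assoc)
  also have "\<dots> \<le> \<bar>c\<bar> * (C * Q \<phi>)" using assms \<phi> by (intro mult_left_mono) (auto simp: hardy_inequality_def)
  finally show "(LINT x:\<Omega>|lebesgue. \<bar>c * g x\<bar> * \<bar>\<phi> x\<bar> powr p) \<le> \<bar>c\<bar> * C * Q \<phi>" by (simp add: mult.assoc)
qed

lemma hardy_AE_cong:
  assumes "AE x\<in>\<Omega> in lebesgue. f x = g x"
  shows "hardy f C \<longleftrightarrow> hardy g C"
proof -
  have "(LINT x:\<Omega>|lebesgue. \<bar>f x\<bar> * \<bar>\<phi> x\<bar> powr p) = (LINT x:\<Omega>|lebesgue. \<bar>g x\<bar> * \<bar>\<phi> x\<bar> powr p)" for \<phi>
  proof (rule set_integral_AE_cong(2))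
    show "AE x\<in>\<Omega> in lebesgue. \<bar>f x\<bar> * \<bar>\<phi> x\<bar> powr p = \<bar>g x\<bar> * \<bar>\<phi> x\<bar> powr p" using assms by eventually_elim auto
  qed
  then show ?thesis by (simp add: hardy_inequality_def)
qed

lemma hardy_zero: "hardy (\<lambda>x. 0) 0"
  by (simp add: hardy_inequality_def set_lebesgue_integral_def)

lemma best_zero_iff:
  assumes g: "g \<in> weights"
  shows "best g = 0 \<longleftrightarrow> (AE x\<in>\<Omega> in lebesgue. g x = 0)"
proof
  assume 0: "best g = 0"
  have gL: "g \<in> L1_loc \<Omega>" using g by (simp add: weights_iff)
  obtain b where b: "best g = ereal b" "hardy g b" by (rule best_attained[OF g])
  then have h0: "hardy g 0" using 0 by (simp add: zero_ereal_def)
  show "AE x\<in>\<Omega> in lebesgue. g x = 0"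
  proof (rule AE_zero_of_mass[OF gL])
    fix F assume F: "compact F" "F \<subseteq> \<Omega>"
    obtain \<phi> where "\<phi> \<in> W1p p \<Omega> \<inter> Cc \<Omega>" "\<forall>x\<in>F. u x \<le> \<phi> x" using admissible_exists[OF F] by blast
    from mass_le_hardy[OF gL h0 F this] show "mass g F \<le> 0" by simp
  qed
next
  assume "AE x\<in>\<Omega> in lebesgue. g x = 0"
  then have "hardy g 0" using hardy_AE_cong[of g "\<lambda>x. 0" 0] hardy_zero by simp
  from best_le[OF order_refl this] show "best g = 0" using best_nonneg[of g] by (simp add: zero_ereal_def antisym)
qed

text \<open>Definiteness is inherited from the best constant through the two-sided estimate, which
  includes the degenerate case.\<close>

lemma hn_zero_iff:
  assumes g: "g \<in> weights"
  shows "hn g = 0 \<longleftrightarrow> (AE x\<in>\<Omega> in lebesgue. g x = 0)"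
proof -
  have gL: "g \<in> L1_loc \<Omega>" using g by (simp add: weights_iff)
  obtain C where C: "C > 0" "best g \<le> ereal C * hn g" using best_le_hn gL by blast
  have "hn g = 0 \<longleftrightarrow> best g = 0"
  proof
    assume "hn g = 0"
    then show "best g = 0" using C(2) best_nonneg[of g] by simp
  next
    assume "best g = 0"
    then show "hn g = 0" using hn_le_best[OF gL] hn_nonneg[of g] by simp
  qed
  then show ?thesis using best_zero_iff[OF g] by simp
qed

lemma weights_closed:
  shows "(\<lambda>x. 0) \<in> weights" and "f \<in> weights \<Longrightarrow> g \<in> weights \<Longrightarrow> (\<lambda>x. f x + g x) \<in> weights"
    and "g \<in> weights \<Longrightarrow> (\<lambda>x. c * g x) \<in> weights"
    and "f \<in> weights \<Longrightarrow> AE x\<in>\<Omega> in lebesgue. f x = g x \<Longrightarrow> g \<in> weights"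
proof -
  show "(\<lambda>x. 0) \<in> weights" unfolding weights_iff using L1_loc_const[of 0] hardy_zero by blast
  show "(\<lambda>x. f x + g x) \<in> weights" if "f \<in> weights" "g \<in> weights"
  proof -
    obtain C D where "C \<ge> 0" "hardy f C" "D \<ge> 0" "hardy g D" "f \<in> L1_loc \<Omega>" "g \<in> L1_loc \<Omega>"
      using \<open>f \<in> weights\<close> \<open>g \<in> weights\<close> by (auto simp: weights_iff)
    then show ?thesis unfolding weights_iff using hardy_add[of f C g D] L1_loc_add[of f \<Omega> g] add_nonneg_nonneg[of C D] by blast
  qed
  show "(\<lambda>x. c * g x) \<in> weights" if "g \<in> weights"
  proof -
    obtain C where "C \<ge> 0" "hardy g C" "g \<in> L1_loc \<Omega>" using \<open>g \<in> weights\<close> by (auto simp: weights_iff)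
    then show ?thesis unfolding weights_iff using hardy_scale[of g C c] L1_loc_cmult[of g \<Omega> c] mult_nonneg_nonneg[of "\<bar>c\<bar>" C] abs_ge_zero[of c] by blast
  qed
  show "g \<in> weights" if "f \<in> weights" "AE x\<in>\<Omega> in lebesgue. f x = g x"
    using that L1_loc_AE_cong[OF that(2)] hardy_AE_cong[OF that(2)] by (simp add: weights_iff)
qed

text \<open>Scaling by \<open>c\<close> gives one inequality, scaling back by its inverse the
  other.\<close>

lemma best_scale:
  assumes g: "g \<in> weights"
  shows "best (\<lambda>x. c * g x) = ereal \<bar>c\<bar> * best g"
proof (cases "c = 0")
  case True
  then show ?thesis using best_zero_iff[OF weights_closed(1)] by simp
next
  case False
  obtain b where b: "0 \<le> b" "best g = ereal b" "hardy g b" by (rule best_attained[OF g])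
  obtain d where d: "0 \<le> d" "best (\<lambda>x. c * g x) = ereal d" "hardy (\<lambda>x. c * g x) d"
    by (rule best_attained[OF weights_closed(3)[OF g]])
  have "best (\<lambda>x. c * g x) \<le> ereal (\<bar>c\<bar> * b)" by (rule best_le[OF _ hardy_scale[OF b(3)]]) (use b in simp)
  then have 1: "d \<le> \<bar>c\<bar> * b" using d by simp
  have "hardy (\<lambda>x. inverse c * (c * g x)) (\<bar>inverse c\<bar> * d)" by (rule hardy_scale[OF d(3)])
  moreover have "(\<lambda>x. inverse c * (c * g x)) = g" using False by (simp flip: mult.assoc)
  ultimately have "best g \<le> ereal (\<bar>inverse c\<bar> * d)" using d(1) by (intro best_le) auto
  then have "b \<le> \<bar>inverse c\<bar> * d" using b by simp
  then have "\<bar>c\<bar> * b \<le> \<bar>c\<bar> * (\<bar>inverse c\<bar> * d)" by (intro mult_left_mono) auto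
  also have "\<dots> = d" using False by (simp add: abs_inverse)
  finally show ?thesis using 1 b d by simp
qed

lemma best_norm: "ae_norm_on \<Omega> weights (best_constant p A V \<Omega>)"
  unfolding ae_norm_on_def
proof (intro conjI ballI allI impI)
  show "(\<lambda>x. 0) \<in> weights" by (rule weights_closed)
next
  fix f g assume fg: "f \<in> weights" "g \<in> weights"
  then show "(\<lambda>x. f x + g x) \<in> weights" by (rule weights_closed)
  obtain b where b: "0 \<le> b" "best f = ereal b" "hardy f b" by (rule best_attained[OF fg(1)])
  obtain d where d: "0 \<le> d" "best g = ereal d" "hardy g d" by (rule best_attained[OF fg(2)])
  have "best (\<lambda>x. f x + g x) \<le> ereal (b + d)"
    using fg b d by (intro best_le hardy_add) (auto simp: weights_iff)
  then show "best (\<lambda>x. f x + g x) \<le> best f + best g" using b d by simp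
next
  fix c g assume g: "g \<in> weights"
  then show "(\<lambda>x. c * g x) \<in> weights" by (rule weights_closed)
  show "best (\<lambda>x. c * g x) = ereal \<bar>c\<bar> * best g" by (rule best_scale[OF g])
next
  fix f g assume f: "f \<in> weights" "AE x\<in>\<Omega> in lebesgue. f x = g x"
  then show "g \<in> weights" by (rule weights_closed)
  show "best g = best f" unfolding best_constant_def using hardy_AE_cong[OF f(2)] by simp
next
  fix g assume g: "g \<in> weights"
  obtain b where b: "0 \<le> b" "best g = ereal b" by (rule best_attained[OF g])
  then show "0 \<le> best g" "best g < \<infinity>" by auto
  show "(best g = 0) = (AE x\<in>\<Omega> in lebesgue. g x = 0)" by (rule best_zero_iff[OF g])
qed

lemma hn_finite_iff: "g \<in> L1_loc \<Omega> \<Longrightarrow> hn g < \<infinity> \<longleftrightarrow> (\<exists>C>0. hardy g C)"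
proof
  assume g: "g \<in> L1_loc \<Omega>" and f: "hn g < \<infinity>"
  obtain C where C: "C > 0" "best g \<le> ereal C * hn g" using best_le_hn g by blast
  obtain n where "hn g = ereal n" using f hn_nonneg[of g] by (cases "hn g") auto
  then have "best g < \<infinity>" using C by auto
  then show "\<exists>C>0. hardy g C" unfolding best_constant_def INF_less_iff by auto
next
  assume "g \<in> L1_loc \<Omega>" "\<exists>C>0. hardy g C"
  then show "hn g < \<infinity>" using hn_le_hardy le_less_trans by fastforce
qed

section \<open>The capacity quotient as a norm, and equivalence\<close>

lemma mass_add_le:
  assumes "f \<in> L1_loc \<Omega>" "g \<in> L1_loc \<Omega>" "compact F" "F \<subseteq> \<Omega>"
  shows "mass (\<lambda>x. f x + g x) F \<le> mass f F + mass g F"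
proof -
  note i = mass_integrable[OF assms(1,3,4)] mass_integrable[OF assms(2,3,4)]
  have "mass (\<lambda>x. f x + g x) F \<le> (\<integral>x. indicat_real F x * (\<bar>f x\<bar> * \<bar>u x\<bar> powr p) + indicat_real F x * (\<bar>g x\<bar> * \<bar>u x\<bar> powr p) \<partial>lebesgue)"
    unfolding mass_eq
  proof (rule integral_mono[OF mass_integrable[OF L1_loc_add[OF assms(1,2)] assms(3,4)] Bochner_Integration.integrable_add[OF i]])
    fix x
    have "indicat_real F x * (\<bar>f x + g x\<bar> * \<bar>u x\<bar> powr p) \<le> indicat_real F x * ((\<bar>f x\<bar> + \<bar>g x\<bar>) * \<bar>u x\<bar> powr p)"
      by (intro mult_left_mono mult_right_mono abs_triangle_ineq) auto
    then show "indicat_real F x * (\<bar>f x + g x\<bar> * \<bar>u x\<bar> powr p) \<le> indicat_real F x * (\<bar>f x\<bar> * \<bar>u x\<bar> powr p) + indicat_real F x * (\<bar>g x\<bar> * \<bar>u x\<bar> powr p)"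
      by (simp only: distrib_left distrib_right)
  qed
  also have "\<dots> = mass f F + mass g F" unfolding mass_eq by (rule Bochner_Integration.integral_add[OF i])
  finally show ?thesis .
qed

lemma mass_scale: "mass (\<lambda>x. c * g x) F = \<bar>c\<bar> * mass g F"
  by (simp add: mass_def abs_mult mult.assoc)

lemma hn_AE_cong:
  assumes "AE x\<in>\<Omega> in lebesgue. f x = g x"
  shows "hn g = hn f"
proof -
  have "mass f F = mass g F" if "F \<in> PC" for F by (rule mass_AE_cong[OF assms]) (use PC_D[OF that] in blast)
  moreover have "(AE x\<in>\<Omega> in lebesgue. f x = 0) \<longleftrightarrow> (AE x\<in>\<Omega> in lebesgue. g x = 0)"
  proof
    assume "AE x\<in>\<Omega> in lebesgue. f x = 0"
    then show "AE x\<in>\<Omega> in lebesgue. g x = 0" using assms by eventually_elim auto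
  next
    assume "AE x\<in>\<Omega> in lebesgue. g x = 0"
    then show "AE x\<in>\<Omega> in lebesgue. f x = 0" using assms by eventually_elim auto
  qed
  ultimately show ?thesis unfolding hn_eq by simp
qed

text \<open>Finiteness of the norm can only mean \<open>g = 0\<close> here, so the space of
  Hardy-weights is trivial and the norm axioms hold on it.\<close>

lemma weights_AE_zero_if_degenerate:
  assumes "g \<in> weights" "PC = {}"
  shows "AE x\<in>\<Omega> in lebesgue. g x = 0"
proof -
  have "hn g < \<infinity>" using hn_finite_iff[of g] assms(1) by (auto simp: hardy_weights_def)
  then show ?thesis using assms(2) by (auto simp: hn_eq split: if_splits)
qed

text \<open>Each quotient is a seminorm in \<open>g\<close>, and the supremum preserves this.
  Finiteness and definiteness come from the comparison with the best constant.\<close>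

lemma hn_norm: "ae_norm_on \<Omega> weights (hardy_norm p A V \<Omega> u)"
  unfolding ae_norm_on_def
proof (intro conjI ballI allI impI)
  show "(\<lambda>x. 0) \<in> weights" by (rule weights_closed)
next
  fix f g assume fg: "f \<in> weights" "g \<in> weights"
  then show s: "(\<lambda>x. f x + g x) \<in> weights" by (rule weights_closed)
  have L: "f \<in> L1_loc \<Omega>" "g \<in> L1_loc \<Omega>" using fg by (auto simp: weights_iff)
  show "hn (\<lambda>x. f x + g x) \<le> hn f + hn g"
  proof (cases "PC = {}")
    case True
    then have "hn (\<lambda>x. f x + g x) = 0" using hn_zero_iff[OF s] weights_AE_zero_if_degenerate[OF s] by simp
    then show ?thesis using hn_nonneg[of f] hn_nonneg[of g] by simp
  next
    case False
    have "ereal (mass (\<lambda>x. f x + g x) F) / cap F \<le> hn f + hn g" if F: "F \<in> PC" for F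
    proof -
      obtain k where k: "k \<ge> 0" "\<forall>a. ereal a / cap F = ereal (a * k)" by (rule ratio_real[OF F])
      have "mass (\<lambda>x. f x + g x) F * k \<le> mass f F * k + mass g F * k"
        using mass_add_le[OF L, of F] PC_D[OF F] k(1) by (simp flip: distrib_right add: mult_right_mono)
      then have "ereal (mass (\<lambda>x. f x + g x) F) / cap F \<le> ereal (mass f F) / cap F + ereal (mass g F) / cap F" using k(2) by simp
      also have "\<dots> \<le> hn f + hn g"
        unfolding hn_eq using False F by (auto intro!: add_mono SUP_upper)
      finally show ?thesis .
    qed
    then have "(SUP F\<in>PC. ereal (mass (\<lambda>x. f x + g x) F) / cap F) \<le> hn f + hn g" by (rule SUP_least)
    then show ?thesis using False by (simp add: hn_eq[of "\<lambda>x. f x + g x"])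
  qed
next
  fix c g assume g: "g \<in> weights"
  then show s: "(\<lambda>x. c * g x) \<in> weights" by (rule weights_closed)
  show "hn (\<lambda>x. c * g x) = ereal \<bar>c\<bar> * hn g"
  proof (cases "PC = {}")
    case True
    then show ?thesis using hn_zero_iff[OF s] hn_zero_iff[OF g] weights_AE_zero_if_degenerate[OF s] weights_AE_zero_if_degenerate[OF g] by simp
  next
    case False
    have "ereal (mass (\<lambda>x. c * g x) F) / cap F = ereal \<bar>c\<bar> * (ereal (mass g F) / cap F)" "0 \<le> ereal (mass g F) / cap F" if F: "F \<in> PC" for F
    proof -
      obtain k where k: "k \<ge> 0" "\<forall>a. ereal a / cap F = ereal (a * k)" by (rule ratio_real[OF F])
      then show "ereal (mass (\<lambda>x. c * g x) F) / cap F = ereal \<bar>c\<bar> * (ereal (mass g F) / cap F)" "0 \<le> ereal (mass g F) / cap F"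
        using mass_nonneg[of g F] by (simp_all add: mass_scale mult.assoc)
    qed
    then show ?thesis unfolding hn_eq using False by (simp add: SUP_ereal_mult_left)
  qed
next
  fix f g assume f: "f \<in> weights" "AE x\<in>\<Omega> in lebesgue. f x = g x"
  then show "g \<in> weights" by (rule weights_closed)
  show "hn g = hn f" by (rule hn_AE_cong[OF f(2)])
next
  fix g assume g: "g \<in> weights"
  show "0 \<le> hn g" by (rule hn_nonneg)
  show "hn g < \<infinity>" using hn_finite_iff[of g] g by (auto simp: hardy_weights_def)
  show "(hn g = 0) = (AE x\<in>\<Omega> in lebesgue. g x = 0)" by (rule hn_zero_iff[OF g])
qed

lemma hn_best_equivalent: "equivalent_norms_on weights (hardy_norm p A V \<Omega> u) (best_constant p A V \<Omega>)"
proof -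
  obtain C where C: "C > 0" "\<forall>g\<in>L1_loc \<Omega>. best g \<le> ereal C * hn g" using best_le_hn by blast
  have "ereal 1 * hn g \<le> best g \<and> best g \<le> ereal C * hn g" if "g \<in> weights" for g
    using that C(2) hn_le_best[of g] by (auto simp: weights_iff one_ereal_def[symmetric])
  then show ?thesis unfolding equivalent_norms_on_def using C(1) zero_less_one by blast
qed

end

text \<open>The comparison passes through \<open>m\<close>, in the application the best constant,
  which does not involve a solution.\<close>

lemma equivalent_norms_on_common:
  assumes n: "equivalent_norms_on X n m" and n': "equivalent_norms_on X n' m"
  shows "equivalent_norms_on X n n'"
proof -
  obtain c d where cd: "c > 0" "d > 0" "\<forall>g\<in>X. ereal c * n g \<le> m g \<and> m g \<le> ereal d * n g"
    using n unfolding equivalent_norms_on_def by blast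
  obtain c' d' where cd': "c' > 0" "d' > 0" "\<forall>g\<in>X. ereal c' * n' g \<le> m g \<and> m g \<le> ereal d' * n' g"
    using n' unfolding equivalent_norms_on_def by blast
  have cancel: "ereal (1/k) * (ereal k * x) = x" if "k > 0" for k :: real and x :: ereal
    using that by (simp flip: mult.assoc add: one_ereal_def[symmetric])
  have "ereal (c / d') * n g \<le> n' g \<and> n' g \<le> ereal (d / c') * n g" if g: "g \<in> X" for g
  proof
    have "ereal (1/d') * (ereal c * n g) \<le> ereal (1/d') * (ereal d' * n' g)"
      using cd(3) cd'(2,3) g by (intro ereal_mult_left_mono) (auto intro: order_trans)
    then show "ereal (c / d') * n g \<le> n' g" using cancel[OF cd'(2)] by (simp flip: mult.assoc)
    have "ereal (1/c') * (ereal c' * n' g) \<le> ereal (1/c') * (ereal d * n g)"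
      using cd(3) cd'(1,3) g by (intro ereal_mult_left_mono) (auto intro: order_trans)
    then show "n' g \<le> ereal (d / c') * n g" unfolding cancel[OF cd'(1)] by (simp flip: mult.assoc)
  qed
  then show ?thesis unfolding equivalent_norms_on_def
    using cd cd' by (intro exI[of _ "c / d'"] exI[of _ "d / c'"] conjI exI) auto
qed

theorem theorem1p2:
  fixes \<Omega> :: "(real^'n) set" and p :: real and q :: ereal
    and A :: "real^'n \<Rightarrow> real^'n^'n" and V :: "real^'n \<Rightarrow> real" and u :: "real^'n \<Rightarrow> real"
  assumes "open \<Omega>" and "connected \<Omega>" and "\<Omega> \<noteq> {}"
    and "1 < p"
    and "Linf_loc_matrix \<Omega> A" and "symmetric_matrix_on \<Omega> A" and "loc_unif_pos_def \<Omega> A"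
    and "V \<in> morrey_p_loc q p \<Omega>"
    and "\<forall>\<phi>\<in>W1p p \<Omega> \<inter> Cc \<Omega>. 0 \<le> Q_energy p A V \<Omega> \<phi>"
    and "positive_solution p A V \<Omega> u"
  shows "(\<forall>g\<in>L1_loc \<Omega>.
            hardy_norm p A V \<Omega> u g < \<infinity> \<longleftrightarrow> (\<exists>C>0. hardy_inequality p A V \<Omega> g C)) \<and>
         (\<exists>C\<^sub>H>0. \<forall>g\<in>L1_loc \<Omega>.
            hardy_norm p A V \<Omega> u g \<le> best_constant p A V \<Omega> g \<and>
            best_constant p A V \<Omega> g \<le> ereal C\<^sub>H * hardy_norm p A V \<Omega> u g) \<and>
         (ae_norm_on \<Omega> (hardy_weights p A V \<Omega>) (hardy_norm p A V \<Omega> u) \<and>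
          ae_norm_on \<Omega> (hardy_weights p A V \<Omega>) (best_constant p A V \<Omega>) \<and>
          equivalent_norms_on (hardy_weights p A V \<Omega>)
            (hardy_norm p A V \<Omega> u) (best_constant p A V \<Omega>)) \<and>
         (\<forall>v. positive_solution p A V \<Omega> v \<longrightarrow>
            equivalent_norms_on (hardy_weights p A V \<Omega>)
              (hardy_norm p A V \<Omega> u) (hardy_norm p A V \<Omega> v))"
proof -
  \<comment> \<open>Stated for every positive solution, so that the norms of \<open>u\<close> and of
    \<open>v\<close> can both be compared with the one best constant.\<close>
  have setting: "hardy_setting \<Omega> p A V v" if "positive_solution p A V \<Omega> v" for v
    using assms(1-7,9) morrey_p_loc_L1_loc[OF assms(1,8)] that by unfold_locales auto
  interpret hardy_setting \<Omega> p A V u by (rule setting[OF assms(10)])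
  obtain C where C: "C > 0" "\<forall>g\<in>L1_loc \<Omega>. best g \<le> ereal C * hn g" using best_le_hn by blast
  have "equivalent_norms_on weights (hardy_norm p A V \<Omega> u) (hardy_norm p A V \<Omega> v)"
    if "positive_solution p A V \<Omega> v" for v
    by (rule equivalent_norms_on_common[OF hn_best_equivalent hardy_setting.hn_best_equivalent[OF setting[OF that]]])
  moreover have "\<exists>C\<^sub>H>0. \<forall>g\<in>L1_loc \<Omega>. hn g \<le> best g \<and> best g \<le> ereal C\<^sub>H * hn g"
    using C hn_le_best by (intro exI[of _ C]) blast
  ultimately show ?thesis
    using hn_finite_iff hn_norm best_norm hn_best_equivalent by (intro conjI ballI allI impI) simp_all
qed

end
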